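(* Let $\alpha\in(0,3)\setminus\{2\}$, let $X_{11}$ be symmetric with $\mathbb P(|X_{11}|>x)=x^{-\alpha}L(x)$, $x>0$, where $L$ is slowly varying at infinity, and let $\mathbb E[X_{11}^2]=1$ whenever $\mathbb E[X_{11}^2]$ is finite. Assume that, for some constant $c_\delta\in(0,\infty)$, as $n\to\infty$, $$p=p_n\sim c_\delta\, n^{1/2}\ \text{ if }\alpha\in(0,2),\qquad p=p_n\sim c_\delta\,n^{(\alpha-1)/2}\,\frac{1}{L(n^{1/2})}\ \text{ if }\alpha\in(2,3).$$ Then $$\frac{\operatorname{tr}(\mathbf R^2)-\mu_n}{\sigma_n}\ \longrightarrow\ \frac{\sum_{i=1}^\infty\xi_i-c_\delta^2}{\sqrt2\,c_\delta\,c_2(\alpha)}\quad\text{in distribution, as } n\to\infty,$$ where $(\xi_i)_{i\ge1}$ are the atoms of a Poisson point process on $(0,2]$ with intensity measure $\nu_{\alpha,c_\delta}$.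
   Context: For each $n$, $(X_{ij})_{1\le i\le p,1\le j\le n}$ are iid copies of a non-degenerate, symmetric real random variable $X_{11}$. Put $Y_{ij}=X_{ij}/\sqrt{X_{i1}^2+\cdots+X_{in}^2}$, $\mathbf Y=(Y_{ij})\in\mathbb R^{p\times n}$ and $\mathbf R=\mathbf Y\mathbf Y^{\top}$ (sample correlation matrix). Let $\beta_4=\mathbb E[Y_{11}^4]$, $\mu_n=p+p(p-1)/n$, $\sigma_n^2=2p^2n(\beta_4^2+2n^{-3})$, $\sigma_n>0$. The notation $a_n\sim b_n$ means $a_n/b_n\to1$ as $n\to\infty$. $c_2(\alpha)=1-\alpha/2$ for $\alpha\in(0,2)$ and $c_2(\alpha)=\Gamma(1+\alpha/2)\Gamma(2-\alpha/2)$ for $\alpha\in[2,4)$. For $\alpha\in(0,2)$ let $W$ be the product of two independent $\mathrm{Beta}(1-\alpha/2,\alpha/2)$ variables and $\mu$ the law of $2W$; for $\alpha\in[2,3)$ let $W'$ be the product of two independent $\mathrm{Beta}(2-\alpha/2,\alpha/2)$ variables and $\mu'$ the law of $2W'$. The measure $\nu_{\alpha,c_\delta}$ on $(0,2]$ is $$\nu_{\alpha,c_\delta}(dx)=\begin{cases}\dfrac{c_\delta^2}{x}\,\mu(dx),&\alpha\in(0,2),\\[2mm]\dfrac{2c_\delta^2c_2(\alpha)^2}{x^2}\,\mu'(dx),&\alpha\in[2,3).\end{cases}$$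
   Formalization: For α in (2,3) the sum of the ξ_i is almost surely infinite, so the sum minus c_δ² is read as the compensated sum: the limit, as ε→0, of the sum of the atoms above ε minus its mean. For α<2 the expression is taken literally. *)

theory Defs
  imports "HOL-Probability.Probability" "Jordan_Normal_Form.Matrix"
begin

text \<open>Slow variation at infinity in the usual sense: positive and measurable on some half-line
  \<open>[a,\<infinity>)\<close>, with \<open>L(t x) / L(x) \<rightarrow> 1\<close> as \<open>x \<rightarrow> \<infinity>\<close> for each \<open>t > 0\<close>.\<close>

definition slowly_varying :: "(real \<Rightarrow> real) \<Rightarrow> bool" where
  "slowly_varying L \<longleftrightarrow>
     (\<exists>a. (\<forall>x\<ge>a. 0 < L x) \<and> set_borel_measurable borel {a..} L) \<and>
     (\<forall>t>0. ((\<lambda>x. L (t * x) / L x) \<longlongrightarrow> 1) at_top)"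

text \<open>Rows and columns are indexed from 0. A row of zeros is normalized to a row of zeros
  (division by zero yields zero).\<close>

definition normalized_matrix :: "nat \<Rightarrow> nat \<Rightarrow> (nat \<Rightarrow> nat \<Rightarrow> real) \<Rightarrow> real mat" where
  "normalized_matrix p n x =
     Matrix.mat p n (\<lambda>(i, j). x i j / sqrt (\<Sum>k<n. (x i k)\<^sup>2))"

definition sample_correlation :: "nat \<Rightarrow> nat \<Rightarrow> (nat \<Rightarrow> nat \<Rightarrow> real) \<Rightarrow> real mat" where
  "sample_correlation p n x = normalized_matrix p n x * transpose_mat (normalized_matrix p n x)"

definition mat_trace :: "real mat \<Rightarrow> real" where
  "mat_trace A = (\<Sum>i<dim_row A. A $$ (i, i))"

definition beta4 :: "'b measure \<Rightarrow> nat \<Rightarrow> nat \<Rightarrow> (nat \<Rightarrow> nat \<Rightarrow> 'b \<Rightarrow> real) \<Rightarrow> real" where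
  "beta4 M p n X = (\<integral>\<omega>. (normalized_matrix p n (\<lambda>i j. X i j \<omega>) $$ (0, 0)) ^ 4 \<partial>M)"

definition mu_trace :: "nat \<Rightarrow> nat \<Rightarrow> real" where
  "mu_trace p n = real p + real p * (real p - 1) / real n"

definition sigma_trace :: "'b measure \<Rightarrow> nat \<Rightarrow> nat \<Rightarrow> (nat \<Rightarrow> nat \<Rightarrow> 'b \<Rightarrow> real) \<Rightarrow> real" where
  "sigma_trace M p n X =
     sqrt (2 * (real p)\<^sup>2 * real n * ((beta4 M p n X)\<^sup>2 + 2 / real n ^ 3))"

definition c2 :: "real \<Rightarrow> real" where
  "c2 \<alpha> = (if \<alpha> < 2 then 1 - \<alpha> / 2 else Gamma (1 + \<alpha> / 2) * Gamma (2 - \<alpha> / 2))"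

definition beta_distribution :: "real \<Rightarrow> real \<Rightarrow> real measure" where
  "beta_distribution a b = density lborel
     (\<lambda>x. ennreal (if 0 < x \<and> x < 1
                     then x powr (a - 1) * (1 - x) powr (b - 1) / Beta a b else 0))"

text \<open>The law of \<open>2 U V\<close> for independent \<open>U, V\<close> with the same Beta distribution: \<open>\<mu>\<close> if
  \<open>\<alpha> < 2\<close> and \<open>\<mu>'\<close> otherwise.\<close>

definition beta_product_law :: "real \<Rightarrow> real measure" where
  "beta_product_law \<alpha> =
     (let B = beta_distribution (if \<alpha> < 2 then 1 - \<alpha> / 2 else 2 - \<alpha> / 2) (\<alpha> / 2)
      in distr (B \<Otimes>\<^sub>M B) borel (\<lambda>(u, v). 2 * (u * v)))"

definition nu :: "real \<Rightarrow> real \<Rightarrow> real measure" where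
  "nu \<alpha> c = density (restrict_space (beta_product_law \<alpha>) {0<..2})
     (\<lambda>x. ennreal (if \<alpha> < 2 then c\<^sup>2 / x else 2 * c\<^sup>2 * (c2 \<alpha>)\<^sup>2 / x\<^sup>2))"

definition atom_count :: "(nat \<Rightarrow> 'a \<Rightarrow> 'b) \<Rightarrow> 'b set \<Rightarrow> 'a \<Rightarrow> ennreal" where
  "atom_count \<xi> B \<omega> = (\<Sum>i. indicator B (\<xi> i \<omega>))"

text \<open>The random variables \<open>\<xi> i\<close> on the probability space \<open>N\<close>, listed with multiplicity, are the
  atoms of a Poisson point process on \<open>space \<nu>\<close> with intensity \<open>\<nu>\<close>. As the atoms are enumerated
  by all natural numbers, this is meant for infinite \<open>\<nu>\<close>.\<close>

definition poisson_atoms :: "'a measure \<Rightarrow> 'b measure \<Rightarrow> (nat \<Rightarrow> 'a \<Rightarrow> 'b) \<Rightarrow> bool" where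
  "poisson_atoms N \<nu> \<xi> \<longleftrightarrow>
     prob_space N \<and>
     (\<forall>i. \<xi> i \<in> N \<rightarrow>\<^sub>M \<nu>) \<and>
     (\<forall>B\<in>sets \<nu>. emeasure \<nu> B < \<infinity> \<longrightarrow>
        (\<forall>k. measure N {\<omega> \<in> space N. atom_count \<xi> B \<omega> = of_nat k}
               = measure \<nu> B ^ k / fact k * exp (- measure \<nu> B))) \<and>
     (\<forall>B\<in>sets \<nu>. emeasure \<nu> B = \<infinity> \<longrightarrow> (AE \<omega> in N. atom_count \<xi> B \<omega> = \<infinity>)) \<and>
     (\<forall>B :: nat \<Rightarrow> 'b set. range B \<subseteq> sets \<nu> \<longrightarrow> disjoint_family B \<longrightarrow>
        prob_space.indep_vars N (\<lambda>_. borel) (\<lambda>m. atom_count \<xi> (B m)) UNIV)"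

text \<open>The random variable written \<open>\<Sum>\<^sub>i \<xi>\<^sub>i - c\<^sup>2\<close>. If \<open>\<alpha> < 2\<close>, then \<open>\<integral> x d\<nu> = c\<^sup>2\<close> and the series
  converges almost surely, so this expression is taken as it stands. If \<open>\<alpha> \<ge> 2\<close>, then
  \<open>\<integral> x d\<nu> = \<infinity>\<close> and \<open>\<Sum>\<^sub>i \<xi>\<^sub>i = \<infinity>\<close> almost surely; the expression is then understood as the
  compensated sum, i.e. the almost sure limit, as the truncation level tends to 0, of the sum over
  the (finitely many) atoms above the level minus its mean. For \<open>\<alpha> < 2\<close> that limit is
  \<open>\<Sum>\<^sub>i \<xi>\<^sub>i - c\<^sup>2\<close> as well.\<close>

definition centred_atom_sum :: "real \<Rightarrow> real \<Rightarrow> (nat \<Rightarrow> 'a \<Rightarrow> real) \<Rightarrow> 'a \<Rightarrow> real" where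
  "centred_atom_sum \<alpha> c \<xi> \<omega> =
     (if \<alpha> < 2 then (\<Sum>i. \<xi> i \<omega>) - c\<^sup>2
      else lim (\<lambda>m. (\<Sum>i. \<xi> i \<omega> * indicator {1 / real (Suc m)<..2} (\<xi> i \<omega>))
                     - (LINT x:{1 / real (Suc m)<..2}|nu \<alpha> c. x)))"

end

theory Submission
  imports Defs "HOL-Real_Asymp.Real_Asymp"
begin

text \<open>For a row \<open>x\<close> let \<open>y\<^sub>j = x\<^sub>j / |x|\<close> and call \<open>y\<^sub>j\<^sup>2\<close> its shares. Unless some row vanishes, which has
  small probability, \<open>tr(R\<^sup>2) - \<mu>\<^sub>n\<close> is the sum of the degenerate kernel \<open>2 \<langle>y, y'\<rangle>\<^sup>2 - 2 / n\<close> over the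
  pairs of rows. Expanding the square gives the overlaps \<open>2 y\<^sub>j\<^sup>2 y'\<^sub>j\<^sup>2\<close>, centred, and cross terms that
  are negligible in \<open>L\<^sup>2\<close> because the entries are symmetric. Few pairs have an overlap above a level
  \<open>\<epsilon>\<close>, and two such pairs rarely share a row, so the excesses over \<open>\<epsilon>\<close> are asymptotically compound
  Poisson; what they miss is small in \<open>L\<^sup>2\<close>, uniformly in \<open>n\<close>, as \<open>\<epsilon> \<rightarrow> 0\<close>.

  The intensity of the overlaps is found by the method of moments. Regular variation gives
  \<open>p \<surd>n E(y\<^sub>1\<^sup>2\<^sup>k) \<rightarrow> c m\<^sub>k\<close> for \<open>k \<ge> 2\<close> with explicit \<open>m\<^sub>k\<close>, and \<open>\<integral> x\<^sup>k d\<nu> = 2\<^sup>k\<^sup>-\<^sup>1 c\<^sup>2 m\<^sub>k\<^sup>2\<close>. On the other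
  side Campbell's formula and Kolmogorov's theorem on random series show that the compensated sum of
  the atoms has the characteristic function \<open>exp (\<integral> (exp (i t x) - 1 - i t x) \<nu>(dx))\<close>. The theorem
  then follows from Levy's continuity theorem.\<close>

section \<open>Regularly varying tails\<close>

text \<open>The two ranges of \<alpha> need different moment arguments. Below 2 the row sum of
  squares obeys no law of large numbers. But the conditional moments of a share, given the other
  columns, are all asymptotically proportional to the tail at the sum of the other squares;
  comparing order \<open>k\<close> with order 1, whose mean is known, removes that unknown. Above 2
  the sum is close to \<open>n\<close>, and convexity from below and a Chernoff bound from above
  suffice.

  The intensity is infinite near 0 and only moments of order at least 2 converge in general.
  Weierstrass approximation is therefore carried out for the finite measure
  \<open>x\<^sup>2 \<nu>(dx)\<close> on a compact interval. Test functions must be continuous and of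
  order \<open>x\<^sup>2\<close>, which is why large overlaps are extracted by the soft threshold
  \<open>max 0 (w - \<epsilon>)\<close> and why the exponent is compensated.

  The bound \<alpha> < 3 amounts to \<open>p / n\<close> tending to 0: it removes the cross terms
  and the second part of \<open>sigma_trace\<close>. The normalizer then converges to
  \<open>sqrt 2 * c * c2 \<alpha>\<close>, so the work lies in the limit of the numerator.\<close>

locale regular_tail =
  fixes G :: "real \<Rightarrow> real" and a :: real
  assumes a_pos: "0 < a"
    and anti: "x \<le> y \<Longrightarrow> G y \<le> G x"
    and G_le_1: "G x \<le> 1"
    and G_pos: "0 < G x"
    and regular: "0 < t \<Longrightarrow> ((\<lambda>y. G (t * y) / G y) \<longlongrightarrow> t powr - a) at_top"
begin

lemma measurable_G [measurable]: "G \<in> borel_measurable borel"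
proof -
  have "(\<lambda>x. G (- x)) \<in> borel_measurable borel"
    by (rule borel_measurable_mono) (auto intro!: monoI anti)
  from measurable_compose[OF _ this, of uminus borel] show ?thesis by simp
qed

text \<open>Halving the argument costs at most a factor \<open>2 powr b\<close> as long as it starts
  above a threshold, because the limit ratio \<open>2 powr a\<close> is strictly smaller. Below the
  threshold the trivial bound by 1 takes over, and \<open>1 / G x0\<close> pays for it. So the
  estimate holds for all \<open>u\<close> down to 0, with no lower limit on \<open>u * y\<close>;
  this is what permits dominated convergence in \<open>abelian\<close>.\<close>

lemma potter:
  assumes "a < b"
  obtains K x0 where "0 < K" "0 < x0"
    "\<And>y u. x0 \<le> y \<Longrightarrow> 0 < u \<Longrightarrow> u \<le> 1 \<Longrightarrow> G (u * y) \<le> K * u powr - b * G y"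
proof -
  have "(1 / 2 :: real) powr - a < (1 / 2) powr - b"
    using assms by (simp add: powr_minus_divide powr_divide)
  then have "eventually (\<lambda>y. G (1 / 2 * y) / G y < (1 / 2) powr - b) at_top"
    using order_tendstoD(2)[OF regular[of "1/2"]] by simp
  then obtain x1 where x1: "\<And>y. x1 \<le> y \<Longrightarrow> G (1 / 2 * y) / G y < (1 / 2) powr - b"
    by (auto simp: eventually_at_top_linorder)
  define x0 where "x0 = max 1 x1"
  have half: "G (y / 2) \<le> 2 powr b * G y" if "x0 \<le> y" for y
    using x1[of y] that G_pos[of y]
    by (simp add: x0_def field_simps powr_minus_divide powr_divide)
  have b: "0 < b" using a_pos assms by simp
  have step: "x0 \<le> y \<Longrightarrow> G (y / 2 ^ m) \<le> 1 / G x0 * 2 powr (m * b) * G y" for m y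
  proof (induction m arbitrary: y)
    case 0
    have "1 \<le> 1 / G x0" using G_le_1[of x0] G_pos[of x0] by simp
    then have "1 * G y \<le> 1 / G x0 * G y" using G_pos[of y] by (intro mult_right_mono) auto
    then show ?case by simp
  next
    case (Suc m)
    have e: "2 powr (Suc m * b) = 2 powr (m * b) * (2 powr b)"
      by (simp add: powr_add[symmetric] algebra_simps)
    show ?case
    proof (cases "x0 \<le> y / 2")
      case True
      have "G (y / 2 ^ Suc m) = G (y / 2 / 2 ^ m)" by simp
      also have "\<dots> \<le> 1 / G x0 * 2 powr (m * b) * G (y / 2)" using Suc.IH[OF True] .
      also have "\<dots> \<le> 1 / G x0 * 2 powr (m * b) * (2 powr b * G y)"
        using G_pos[of x0] by (intro mult_left_mono half Suc.prems) auto
      finally show ?thesis by (simp only: e mult.assoc)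
    next
      case False
      have "G (y / 2 ^ Suc m) \<le> 1" by (rule G_le_1)
      also have "\<dots> \<le> 1 / G x0 * G (y / 2)"
        using anti[of "y / 2" x0] False G_pos[of x0] by simp
      also have "\<dots> \<le> 1 / G x0 * (2 powr b * G y)"
        using G_pos[of x0] by (intro mult_left_mono half Suc.prems) auto
      also have "\<dots> \<le> 1 / G x0 * (2 powr (Suc m * b) * G y)"
        using G_pos[of x0] G_pos[of y] b
        by (intro mult_left_mono mult_right_mono powr_mono) (auto simp: algebra_simps)
      finally show ?thesis by (simp add: mult.assoc)
    qed
  qed
  show ?thesis
  proof (rule that)
    show "0 < 1 / G x0 * 2 powr b" "0 < x0" using G_pos[of x0] by (auto simp: x0_def)
    fix y u :: real assume y: "x0 \<le> y" and u: "0 < u" "u \<le> 1"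
    \<comment> \<open>Enough halvings to pass below \<open>u\<close>, with an overshoot of less than
      one halving; the overshoot accounts for the extra factor \<open>2 powr b\<close> in the
      constant.\<close>
    define m where "m = nat \<lceil>- log 2 u\<rceil>"
    have l: "- log 2 u \<le> m" "real m \<le> 1 - log 2 u"
      using u by (auto simp: m_def of_nat_nat) linarith+
    have y0: "0 \<le> y" using y by (simp add: x0_def)
    have "1 / u = 2 powr (- log 2 u)" using u by (simp add: powr_minus_divide)
    also have "\<dots> \<le> 2 powr m" using l by (intro powr_mono) auto
    finally have "1 / 2 ^ m \<le> u" using u by (simp add: field_simps powr_realpow)
    then have "y / 2 ^ m \<le> u * y" using y0 mult_right_mono[of "1 / 2 ^ m" u y] by simp
    then have "G (u * y) \<le> G (y / 2 ^ m)" by (rule anti)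
    also have "\<dots> \<le> 1 / G x0 * 2 powr (m * b) * G y" by (rule step[OF y])
    also have "\<dots> \<le> 1 / G x0 * 2 powr ((1 - log 2 u) * b) * G y"
      using G_pos[of x0] G_pos[of y] b l
      by (intro mult_left_mono mult_right_mono powr_mono) auto
    also have "2 powr ((1 - log 2 u) * b) = 2 powr b * u powr - b"
    proof -
      have "2 powr ((1 - log 2 u) * b) = 2 powr b * (2 powr (log 2 u)) powr (- b)"
        by (simp add: powr_powr powr_add[symmetric] algebra_simps)
      then show ?thesis using u by simp
    qed
    finally show "G (u * y) \<le> 1 / G x0 * 2 powr b * u powr - b * G y" by simp
  qed
qed

text \<open>Potter's bound read backwards with \<open>u = x0 / y\<close>: it compares
  \<open>G x0\<close> with \<open>G y\<close>. The polynomial lower bound makes exponentially small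
  errors negligible against the tail.\<close>

lemma lower_bound:
  assumes "a < b"
  obtains K x0 where "0 < K" "0 < x0" "\<And>y. x0 \<le> y \<Longrightarrow> K * y powr - b \<le> G y"
proof -
  obtain K x0 where K: "0 < K" "0 < x0"
    "\<And>y u. x0 \<le> y \<Longrightarrow> 0 < u \<Longrightarrow> u \<le> 1 \<Longrightarrow> G (u * y) \<le> K * u powr - b * G y"
    using potter[OF assms] by metis
  show ?thesis
  proof (rule that)
    show "0 < G x0 * x0 powr b / K" using K G_pos by simp
    show "0 < x0" by fact
    fix y assume y: "x0 \<le> y"
    have "G x0 \<le> K * (x0 / y) powr - b * G y"
      using K(3)[OF y, of "x0 / y"] y K by simp
    also have "(x0 / y) powr - b = y powr b / x0 powr b"
      using y K by (simp add: powr_minus_divide powr_divide)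
    finally have "G x0 * x0 powr b / K \<le> y powr b * G y"
      using K by (simp add: field_simps)
    then show "G x0 * x0 powr b / K * y powr - b \<le> G y"
      using y K by (simp add: powr_minus_divide field_simps)
  qed
qed

text \<open>The mirror image of the halving argument: doubling the argument gains a factor
  \<open>2 powr - b\<close>, starting from \<open>G x0 \<le> 1\<close>. It serves to prove a finite
  second moment when \<open>1 < a\<close>.\<close>

lemma upper_bound:
  assumes "0 < b" "b < a"
  obtains K x0 where "0 < K" "0 < x0" "\<And>y. x0 \<le> y \<Longrightarrow> G y \<le> K * y powr - b"
proof -
  have "2 powr - a < (2::real) powr - b" using assms by simp
  then have "eventually (\<lambda>y. G (2 * y) / G y < 2 powr - b) at_top"
    using order_tendstoD(2)[OF regular[of 2]] by simp
  then obtain x1 where x1: "\<And>y. x1 \<le> y \<Longrightarrow> G (2 * y) / G y < 2 powr - b"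
    by (auto simp: eventually_at_top_linorder)
  define x0 where "x0 = max 1 x1"
  have dbl: "G (2 * y) \<le> 2 powr - b * G y" if "x0 \<le> y" for y
    using x1[of y] that G_pos[of y] by (simp add: x0_def field_simps)
  have step: "G (2 ^ m * x0) \<le> 2 powr (- (m * b))" for m
  proof (induction m)
    case 0 show ?case using G_le_1 by simp
  next
    case (Suc m)
    have "1 * x0 \<le> 2 ^ m * x0" by (intro mult_right_mono) (auto simp: x0_def)
    then have "x0 \<le> 2 ^ m * x0" by simp
    then have "G (2 * (2 ^ m * x0)) \<le> 2 powr - b * G (2 ^ m * x0)" by (rule dbl)
    also have "\<dots> \<le> 2 powr - b * 2 powr (- (m * b))" by (intro mult_left_mono Suc) auto
    also have "\<dots> = 2 powr (- (Suc m * b))" by (simp add: powr_add[symmetric] algebra_simps)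
    finally show ?case by (simp add: mult.assoc)
  qed
  show ?thesis
  proof (rule that)
    show "0 < (2 * x0) powr b" "0 < x0" by (auto simp: x0_def)
    fix y assume y: "x0 \<le> y"
    have x0: "1 \<le> x0" by (simp add: x0_def)
    define m where "m = nat \<lfloor>log 2 (y / x0)\<rfloor>"
    have "0 \<le> log 2 (y / x0)" using y x0 by simp
    then have l: "real m \<le> log 2 (y / x0)" "log 2 (y / x0) - 1 \<le> m"
      by (auto simp: m_def of_nat_nat)
    have "2 ^ m = 2 powr m" by (simp add: powr_realpow)
    also have "\<dots> \<le> 2 powr (log 2 (y / x0))" using l by (intro powr_mono) auto
    also have "\<dots> = y / x0" using y x0 by simp
    finally have "2 ^ m * x0 \<le> y" using x0 by (simp add: field_simps)
    then have "G y \<le> G (2 ^ m * x0)" by (rule anti)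
    also have "\<dots> \<le> 2 powr (- (m * b))" by (rule step)
    also have "\<dots> \<le> 2 powr (- ((log 2 (y / x0) - 1) * b))"
      using l assms by (intro powr_mono) auto
    also have "\<dots> = 2 powr b * (2 powr (log 2 (y / x0))) powr - b"
      by (simp add: powr_powr powr_add[symmetric] algebra_simps)
    also have "\<dots> = 2 powr b * (y / x0) powr - b" using y x0 by simp
    also have "\<dots> = (2 * x0) powr b * y powr - b"
      using y x0 by (simp add: powr_minus_divide powr_divide powr_mult)
    finally show "G y \<le> (2 * x0) powr b * y powr - b" .
  qed
qed

text \<open>The integrand is the layer-cake form of \<open>H k y\<close> defined later, so this is
  an Abelian theorem for the conditional moments of a share. After division by \<open>G y\<close>,
  regular variation gives the pointwise limit \<open>(x / (1 - x)) powr - a\<close>, Potter's bound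
  gives a majorant, and the limit is a Beta integral.\<close>

lemma abelian:
  assumes k: "a < real k"
  shows "((\<lambda>y. (LBINT x:{0<..<1}. real k * x ^ (k - 1) * G (y * (x / (1 - x)))) / G y)
    \<longlongrightarrow> real k * Beta (real k - a) (1 + a)) at_top"
proof -
  \<comment> \<open>Room on both sides: Potter's bound asks for an exponent above \<open>a\<close>,
    and the majorant \<open>x powr (real k - b - 1)\<close> is integrable at 0 only for an exponent
    below \<open>k\<close>.\<close>
  define b where "b = (a + real k) / 2"
  have b: "a < b" "b < k" "0 < b" using k a_pos by (auto simp: b_def)
  have k1: "1 \<le> real k" using k a_pos by (cases k) auto
  obtain K x0 where K: "0 < K" "0 < x0"
    "\<And>y u. x0 \<le> y \<Longrightarrow> 0 < u \<Longrightarrow> u \<le> 1 \<Longrightarrow> G (u * y) \<le> K * u powr - b * G y"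
    using potter[OF b(1)] by metis
  define s where "s = (\<lambda>y x. indicator {0<..<1} (x::real) *\<^sub>R (real k * x ^ (k - 1) * (G (y * (x / (1 - x))) / G y))) "
  define f where "f = (\<lambda>x. indicator {0<..<1} (x::real) *\<^sub>R (real k * x ^ (k - 1) * (x / (1 - x)) powr - a))"
  define w where "w = (\<lambda>x. indicator {0<..<1} (x::real) *\<^sub>R (real k * K * x powr (real k - b - 1) + real k))"
  have pw: "x ^ (k - 1) = x powr (real k - 1)" if "0 < x" for x :: real
    using that k1 by (simp add: powr_realpow[symmetric])
  have "((\<lambda>y. integral\<^sup>L lborel (s y)) \<longlongrightarrow> integral\<^sup>L lborel f) at_top"
  proof (rule integral_dominated_convergence_at_top)
    show "f \<in> borel_measurable lborel" "s y \<in> borel_measurable lborel" for y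
      by (auto simp: f_def s_def)
    show "AE x in lborel. ((\<lambda>y. s y x) \<longlongrightarrow> f x) at_top"
    proof (rule AE_I2)
      fix x :: real
      show "((\<lambda>y. s y x) \<longlongrightarrow> f x) at_top"
      proof (cases "x \<in> {0<..<1}")
        case True
        then have "0 < x / (1 - x)" by simp
        from regular[OF this] True show ?thesis
          unfolding s_def f_def by (intro tendsto_intros) (simp add: mult.commute)
      qed (simp add: s_def f_def)
    qed
    show "\<forall>\<^sub>F y in at_top. AE x in lborel. norm (s y x) \<le> w x"
      using eventually_ge_at_top[of x0]
    proof eventually_elim
      case (elim y)
      show ?case
      proof (rule AE_I2)
        fix x :: real
        show "norm (s y x) \<le> w x"
        proof (cases "x \<in> {0<..<1}")
          case x: True
          define u where "u = x / (1 - x)"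
          have u: "0 < u" "x \<le> u" using x by (auto simp: u_def field_simps)
          \<comment> \<open>Potter's bound covers \<open>u \<le> 1\<close>, where
            \<open>x \<le> u\<close> allows \<open>u\<close> to be replaced by \<open>x\<close>; for
            larger \<open>u\<close> monotonicity of \<open>G\<close> already gives 1.\<close>
          have "G (y * u) / G y \<le> K * x powr - b + 1"
          proof (cases "u \<le> 1")
            case True
            have "G (u * y) \<le> K * u powr - b * G y" using K(3)[OF elim] u True by simp
            then have "G (y * u) / G y \<le> K * u powr - b"
              using G_pos[of y] by (simp add: field_simps)
            also have "\<dots> \<le> K * x powr - b" using u x K b by (intro mult_left_mono powr_mono2') auto
            finally show ?thesis by simp
          next
            case False
            then have "G (y * u) \<le> G y" using K elim by (intro anti) auto
            then have "G (y * u) / G y \<le> 1" using G_pos[of y] by simp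
            also have "\<dots> \<le> K * x powr - b + 1" using K by simp
            finally show ?thesis .
          qed
          then have "real k * x ^ (k - 1) * (G (y * u) / G y) \<le> real k * x ^ (k - 1) * (K * x powr - b + 1)"
            using x by (intro mult_left_mono) auto
          also have "\<dots> = real k * K * (x powr (real k - 1) * x powr - b) + real k * x ^ (k - 1)"
            using x pw[of x] by (simp add: algebra_simps)
          also have "x powr (real k - 1) * x powr - b = x powr (real k - b - 1)"
            using k1 by (simp add: powr_add[symmetric] of_nat_diff algebra_simps)
          also have "real k * x ^ (k - 1) \<le> real k" using x power_le_one[of x "k - 1"] mult_left_le[of "x ^ (k - 1)" "real k"] by simp
          finally show ?thesis using x
            by (simp add: s_def w_def u_def abs_mult abs_of_pos[OF G_pos])
        qed (simp add: s_def w_def)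
      qed
    qed
    have "set_integrable lborel {0<..<1} (\<lambda>x. x powr (real k - b - 1) * (1 - x) powr (1 - 1) :: real)"
    proof -
      have "(\<lambda>t. t powr ((real k - b) - 1) * (1 - t) powr (1 - 1) :: real) integrable_on {0<..<1}"
        using has_integral_Beta_real[of "real k - b" 1] b
        by (auto simp: has_integral_Icc_iff_Ioo integrable_on_def simp del: diff_self)
      then have "(\<lambda>t. t powr ((real k - b) - 1) * (1 - t) powr (1 - 1) :: real)
          absolutely_integrable_on {0<..<1}"
        by (intro nonnegative_absolutely_integrable_1) auto
      then show ?thesis
        unfolding set_integrable_def by (subst (asm) integrable_completion) auto
    qed
    then have "set_integrable lborel {0<..<1} (\<lambda>x. x powr (real k - b - 1) :: real)"
      by (rule set_integrable_cong[THEN iffD1, rotated -1]) auto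
    moreover have "set_integrable lborel {0<..<1} (\<lambda>x::real. real k)"
      unfolding set_integrable_def by (rule integrable_scaleR_left, rule integrable_real_indicator) simp_all
    ultimately have "set_integrable lborel {0<..<1} (\<lambda>x. real k * K * x powr (real k - b - 1) + real k)"
      by (intro set_integral_add set_integrable_mult_right)
    then show "integrable lborel w" by (simp add: w_def set_integrable_def)
  qed
  also have "integral\<^sup>L lborel f = real k * Beta (real k - a) (1 + a)"
  proof -
    have "((\<lambda>t. t powr ((real k - a) - 1) * (1 - t) powr ((1 + a) - 1)) has_integral Beta (real k - a) (1 + a)) {0<..<1}"
      using has_integral_Beta_real[of "real k - a" "1 + a"] k a_pos
      by (simp add: has_integral_Icc_iff_Ioo)
    moreover from this have "(\<lambda>t. t powr ((real k - a) - 1) * (1 - t) powr ((1 + a) - 1))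
          absolutely_integrable_on {0<..<1}"
      by (intro nonnegative_absolutely_integrable_1) (auto simp: integrable_on_def)
    then have si: "set_integrable lborel {0<..<1} (\<lambda>t. t powr ((real k - a) - 1) * (1 - t) powr ((1 + a) - 1))"
      unfolding set_integrable_def by (subst (asm) integrable_completion) auto
    ultimately have "(LBINT t:{0<..<1}. t powr ((real k - a) - 1) * (1 - t) powr ((1 + a) - 1)) = Beta (real k - a) (1 + a)"
      using set_borel_integral_eq_integral(2)[OF si] by (metis integral_unique)
    then have "(LBINT t:{0<..<1}. real k * (t powr ((real k - a) - 1) * (1 - t) powr ((1 + a) - 1))) = real k * Beta (real k - a) (1 + a)"
      by simp
    moreover have "integral\<^sup>L lborel f = (LBINT t:{0<..<1}. real k * (t powr ((real k - a) - 1) * (1 - t) powr ((1 + a) - 1)))"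
      unfolding set_lebesgue_integral_def f_def
    proof (rule Bochner_Integration.integral_cong[OF refl])
      fix x :: real
      show "indicator {0<..<1} x *\<^sub>R (real k * x ^ (k - 1) * (x / (1 - x)) powr - a) =
        indicator {0<..<1} x *\<^sub>R (real k * (x powr ((real k - a) - 1) * (1 - x) powr ((1 + a) - 1)))"
      proof (cases "x \<in> {0<..<1}")
        case True
        have "x ^ (k - 1) * (x / (1 - x)) powr - a = (x powr (real k - 1) * x powr - a) * (1 - x) powr a"
          using True pw[of x] by (simp add: powr_divide powr_minus_divide)
        also have "x powr (real k - 1) * x powr - a = x powr ((real k - a) - 1)"
          using k1 by (simp add: powr_add[symmetric] of_nat_diff algebra_simps)
        finally show ?thesis using True by (simp add: mult.assoc)
      qed simp
    qed
    ultimately show ?thesis by simp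
  qed
  also have "(\<lambda>y. integral\<^sup>L lborel (s y)) =
      (\<lambda>y. (LBINT x:{0<..<1}. real k * x ^ (k - 1) * G (y * (x / (1 - x)))) / G y)"
    by (simp add: s_def set_lebesgue_integral_def fun_eq_iff flip: Bochner_Integration.integral_divide_zero)

  finally show ?thesis .
qed

end

section \<open>Random series\<close>

text \<open>Partial sums frozen once they reach \<open>e\<close> in absolute value. The terminal
  value then carries the information about the maximum, and each increment is a term of the series
  times an indicator of the past. This replaces the usual decomposition by the first passage
  time.\<close>

fun stopped_sum :: "real \<Rightarrow> (nat \<Rightarrow> real) \<Rightarrow> nat \<Rightarrow> real" where
  "stopped_sum e x 0 = 0"
| "stopped_sum e x (Suc k) = stopped_sum e x k + (if \<bar>stopped_sum e x k\<bar> < e then x k else 0)"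

lemma stopped_sum_cong: "(\<And>l. l < k \<Longrightarrow> x l = y l) \<Longrightarrow> stopped_sum e x k = stopped_sum e y k"
  by (induction k) auto

lemma stopped_sum_measurable [measurable]:
  "(\<And>l. l < k \<Longrightarrow> (\<lambda>\<omega>. x \<omega> l) \<in> borel_measurable M) \<Longrightarrow> (\<lambda>\<omega>. stopped_sum e (x \<omega>) k) \<in> borel_measurable M"
  by (induction k) auto

text \<open>A frozen sum keeps a value of size at least \<open>e\<close> for ever, so a terminal
  value below \<open>e\<close> shows that no freezing has occurred. The contrapositive is what the
  maximal inequality uses.\<close>

lemma stopped_sum_eq:
  assumes "\<bar>stopped_sum e x n\<bar> < e" "k \<le> n"
  shows "\<bar>stopped_sum e x k\<bar> < e \<and> stopped_sum e x k = (\<Sum>l<k. x l)"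
proof -
  have lt: "\<bar>stopped_sum e x k\<bar> < e" if "k \<le> n" for k
    using that
  proof (induction rule: inc_induct)
    case (step j) then show ?case by (auto split: if_splits)
  qed (use assms in simp)
  have "k \<le> n \<Longrightarrow> stopped_sum e x k = (\<Sum>l<k. x l)" for k
  proof (induction k)
    case (Suc k) then show ?case using lt[of k] by simp
  qed simp
  with lt assms show ?thesis by blast
qed

context prob_space
begin

text \<open>The increments of the stopped sum are uncorrelated with its past, so its second moment
  is at most the sum of the variances; what remains is Markov's inequality for the square of the
  terminal value. The offset \<open>m\<close> is there because the convergence theorem applies the
  bound to tails of a series.\<close>

lemma kolmogorov_maximal_inequality:
  fixes X :: "nat \<Rightarrow> 'a \<Rightarrow> real"
  assumes ind: "indep_vars (\<lambda>_. borel) X UNIV" and e: "0 < e"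
    and sq: "\<And>l. integrable M (\<lambda>\<omega>. (X l \<omega>)\<^sup>2)"
    and mean: "\<And>l. expectation (X l) = 0"
  shows "prob {\<omega> \<in> space M. \<exists>k\<le>n. e \<le> \<bar>\<Sum>l<k. X (l + m) \<omega>\<bar>}
    \<le> (\<Sum>l<n. expectation (\<lambda>\<omega>. (X (l + m) \<omega>)\<^sup>2)) / e\<^sup>2"
proof -
  define Z where "Z k \<omega> = stopped_sum e (\<lambda>l. X (l + m) \<omega>) k" for k \<omega>
  have X [measurable]: "X l \<in> borel_measurable M" for l
    using ind by (auto simp: indep_vars_def)
  have Zm: "k \<le> n \<Longrightarrow> Z k \<in> borel_measurable M" for k
    unfolding Z_def[abs_def] by (rule stopped_sum_measurable) auto
  have "integrable M (\<lambda>\<omega>. (Z k \<omega>)\<^sup>2) \<and>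
      expectation (\<lambda>\<omega>. (Z k \<omega>)\<^sup>2) \<le> (\<Sum>l<k. expectation (\<lambda>\<omega>. (X (l + m) \<omega>)\<^sup>2))" if "k \<le> n" for k
    using that
  proof (induction k)
    case (Suc k)
    then have k: "k < n" and ZZ: "integrable M (\<lambda>\<omega>. (Z k \<omega>)\<^sup>2)"
      and IH: "expectation (\<lambda>\<omega>. (Z k \<omega>)\<^sup>2) \<le> (\<Sum>l<k. expectation (\<lambda>\<omega>. (X (l + m) \<omega>)\<^sup>2))" by auto
    note Zm[measurable]
    have [measurable]: "Z k \<in> borel_measurable M" "X (k + m) \<in> borel_measurable M" using k Zm by auto
    define H where "H \<omega> = (if \<bar>Z k \<omega>\<bar> < e then 1 else 0 :: real)" for \<omega>
    have [measurable]: "H \<in> borel_measurable M" unfolding H_def[abs_def] by measurable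
    have step: "Z (Suc k) \<omega> = Z k \<omega> + H \<omega> * X (k + m) \<omega>" for \<omega> by (simp add: Z_def H_def)
    let ?RA = "\<lambda>\<omega>. restrict (\<lambda>i. X i \<omega>) {m..<m + k}" and ?RB = "\<lambda>\<omega>. restrict (\<lambda>i. X i \<omega>) {k + m}"
    let ?f = "\<lambda>x. stopped_sum e (\<lambda>l. x (l + m)) k * (if \<bar>stopped_sum e (\<lambda>l. x (l + m)) k\<bar> < e then 1 else 0 :: real)"
    have fm: "(\<lambda>x. stopped_sum e (\<lambda>l. x (l + m)) k) \<in> borel_measurable (PiM {m..<m + k} (\<lambda>_. borel))"
      by (rule stopped_sum_measurable) auto
    \<comment> \<open>The stopped sum and its freezing indicator depend on the indices in
      \<open>{m..<m + k}\<close> only, the next term on the index \<open>k + m\<close>; the two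
      blocks are disjoint.\<close>
    have "indep_var borel (?f \<circ> ?RA) borel ((\<lambda>x. x (k + m)) \<circ> ?RB)"
      using fm by (intro indep_var_compose[OF indep_var_restrict[OF ind]]) auto
    also have "(\<lambda>x. x (k + m)) \<circ> ?RB = X (k + m)" by (auto simp: fun_eq_iff)
    also have "?f \<circ> ?RA = (\<lambda>\<omega>. Z k \<omega> * H \<omega>)"
    proof
      fix \<omega>
      have "stopped_sum e (\<lambda>l. ?RA \<omega> (l + m)) k = Z k \<omega>" unfolding Z_def by (rule stopped_sum_cong) simp
      then show "(?f \<circ> ?RA) \<omega> = Z k \<omega> * H \<omega>" by (simp add: H_def)
    qed
    finally have ind': "indep_var borel (\<lambda>\<omega>. Z k \<omega> * H \<omega>) borel (X (k + m))" .
    have iX: "integrable M (X (k + m))" by (rule square_integrable_imp_integrable[OF _ sq]) measurable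
    have iZH: "integrable M (\<lambda>\<omega>. Z k \<omega> * H \<omega>)"
      by (rule integrable_const_bound[where B=e]) (use e in \<open>auto simp: H_def\<close>)
    note cross = indep_var_lebesgue_integral[OF ind' iZH iX]
    note icross = indep_var_integrable[OF ind' iZH iX]
    have cross0: "expectation (\<lambda>\<omega>. Z k \<omega> * H \<omega> * X (k + m) \<omega>) = 0"
      unfolding cross mean by (rule mult_zero_right)
    have iHX: "integrable M (\<lambda>\<omega>. H \<omega> * (X (k + m) \<omega>)\<^sup>2)"
      by (rule Bochner_Integration.integrable_bound[OF sq]) (auto simp: H_def)
    have e1: "(Z (Suc k) \<omega>)\<^sup>2 = (Z k \<omega>)\<^sup>2 + 2 * (Z k \<omega> * H \<omega> * X (k + m) \<omega>) + H \<omega> * (X (k + m) \<omega>)\<^sup>2" for \<omega>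
      unfolding step by (auto simp: H_def power2_eq_square algebra_simps)
    have "integrable M (\<lambda>\<omega>. (Z (Suc k) \<omega>)\<^sup>2)" unfolding e1
      by (intro Bochner_Integration.integrable_add integrable_mult_right ZZ icross iHX)
    moreover have "expectation (\<lambda>\<omega>. (Z (Suc k) \<omega>)\<^sup>2) =
        expectation (\<lambda>\<omega>. (Z k \<omega>)\<^sup>2) + expectation (\<lambda>\<omega>. H \<omega> * (X (k + m) \<omega>)\<^sup>2)"
      unfolding e1 using ZZ icross iHX cross0 by simp
    moreover have "expectation (\<lambda>\<omega>. H \<omega> * (X (k + m) \<omega>)\<^sup>2) \<le> expectation (\<lambda>\<omega>. (X (k + m) \<omega>)\<^sup>2)"
      by (rule integral_mono[OF iHX sq]) (auto simp: H_def)
    ultimately show ?case using IH by simp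
  qed (simp add: Z_def)
  then have Z: "integrable M (\<lambda>\<omega>. (Z n \<omega>)\<^sup>2)"
    "expectation (\<lambda>\<omega>. (Z n \<omega>)\<^sup>2) \<le> (\<Sum>l<n. expectation (\<lambda>\<omega>. (X (l + m) \<omega>)\<^sup>2))" by auto
  have [measurable]: "Z n \<in> borel_measurable M" using Zm by simp
  have "{\<omega> \<in> space M. \<exists>k\<le>n. e \<le> \<bar>\<Sum>l<k. X (l + m) \<omega>\<bar>} \<subseteq> {\<omega> \<in> space M. e\<^sup>2 \<le> (Z n \<omega>)\<^sup>2}"
  proof safe
    fix \<omega> k assume k: "k \<le> n" "e \<le> \<bar>\<Sum>l<k. X (l + m) \<omega>\<bar>"
    have "e \<le> \<bar>Z n \<omega>\<bar>"
      using stopped_sum_eq[of e "\<lambda>l. X (l + m) \<omega>" n k] k unfolding Z_def by force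
    then show "e\<^sup>2 \<le> (Z n \<omega>)\<^sup>2" using e by (simp add: abs_le_square_iff[symmetric])
  qed
  then have "prob {\<omega> \<in> space M. \<exists>k\<le>n. e \<le> \<bar>\<Sum>l<k. X (l + m) \<omega>\<bar>} \<le> prob {\<omega> \<in> space M. e\<^sup>2 \<le> (Z n \<omega>)\<^sup>2}"
    by (intro finite_measure_mono) auto
  also have "\<dots> \<le> expectation (\<lambda>\<omega>. (Z n \<omega>)\<^sup>2) / e\<^sup>2"
    using e by (intro integral_Markov_inequality_measure[OF Z(1), of "{}"]) auto
  also have "\<dots> \<le> (\<Sum>l<n. expectation (\<lambda>\<omega>. (X (l + m) \<omega>)\<^sup>2)) / e\<^sup>2"
    using Z(2) e by (intro divide_right_mono) auto
  finally show ?thesis .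
qed

text \<open>By the maximal inequality the probability of ever deviating by \<open>e\<close> after
  time \<open>m\<close> is at most the tail of the variance series divided by
  \<open>e\<^sup>2\<close>, which tends to 0 with \<open>m\<close>. The countably many levels
  \<open>1 / (j + 1)\<close> give the Cauchy property almost surely.\<close>

lemma AE_convergent_random_series:
  assumes ind: "indep_vars (\<lambda>_. borel) X UNIV"
    and sq: "\<And>l. integrable M (\<lambda>\<omega>. (X l \<omega>)\<^sup>2)"
    and mean: "\<And>l. expectation (X l) = (0::real)"
    and sm: "summable (\<lambda>l. expectation (\<lambda>\<omega>. (X l \<omega>)\<^sup>2))"
  shows "AE \<omega> in M. convergent (\<lambda>n. \<Sum>l<n. X l \<omega>)"
proof -
  define V where "V l = expectation (\<lambda>\<omega>. (X l \<omega>)\<^sup>2)" for l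
  have V0: "0 \<le> V l" for l by (simp add: V_def)
  have sV: "summable V" using sm by (simp add: V_def[abs_def])
  have X [measurable]: "X l \<in> borel_measurable M" for l using ind by (auto simp: indep_vars_def)
  define A where "A e m n = {\<omega> \<in> space M. \<exists>k\<le>n. e \<le> \<bar>\<Sum>l<k. X (l + m) \<omega>\<bar>}" for e :: real and m n :: nat
  have Am [measurable]: "A e m n \<in> sets M" for e m n unfolding A_def by measurable
  have fin: "prob (A e m n) \<le> (\<Sum>l. V (l + m)) / e\<^sup>2" if "0 < e" for e m n
  proof -
    have "prob (A e m n) \<le> (\<Sum>l<n. V (l + m)) / e\<^sup>2"
      unfolding A_def V_def by (rule kolmogorov_maximal_inequality[OF ind that sq mean])
    also have "\<dots> \<le> (\<Sum>l. V (l + m)) / e\<^sup>2"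
      using V0 sV by (intro divide_right_mono sum_le_suminf) (auto simp: summable_iff_shift)
    finally show ?thesis .
  qed
  have UN: "prob (\<Union>n. A e m n) \<le> (\<Sum>l. V (l + m)) / e\<^sup>2" if "0 < e" for e m
  proof (rule LIMSEQ_le_const2)
    show "(\<lambda>n. prob (A e m n)) \<longlonglongrightarrow> prob (\<Union>n. A e m n)"
      by (rule finite_Lim_measure_incseq) (auto simp: A_def incseq_def intro: order_trans)
    show "\<exists>N. \<forall>n\<ge>N. prob (A e m n) \<le> (\<Sum>l. V (l + m)) / e\<^sup>2" using fin that by auto
  qed
  have null: "AE \<omega> in M. \<exists>m. \<omega> \<notin> (\<Union>n. A e m n)" if e: "0 < e" for e
  proof -
    let ?I = "\<Inter>m. \<Union>n. A e m n"
    have "prob ?I \<le> 0"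
    proof (rule LIMSEQ_le_const)
      have "(\<lambda>m. (\<Sum>l. V (l + m)) / e\<^sup>2) \<longlonglongrightarrow> 0 / e\<^sup>2"
        using suminf_exist_split2[OF sV] e by (intro tendsto_divide tendsto_const) auto
      then show "(\<lambda>m. (\<Sum>l. V (l + m)) / e\<^sup>2) \<longlonglongrightarrow> 0" by simp
      show "\<exists>N. \<forall>m\<ge>N. prob ?I \<le> (\<Sum>l. V (l + m)) / e\<^sup>2"
        by (intro exI allI impI order_trans[OF _ UN[OF e]] finite_measure_mono) auto
    qed
    then have "prob ?I = 0" using measure_nonneg[of M ?I] by linarith
    then have "emeasure M ?I = 0" by (simp add: emeasure_eq_measure)
    then have "AE \<omega> in M. \<omega> \<notin> ?I" by (intro AE_not_in null_setsI) auto
    then show ?thesis by auto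
  qed
  have "AE \<omega> in M. \<forall>j. \<exists>m. \<omega> \<notin> (\<Union>n. A (1 / real (Suc j)) m n)"
    unfolding AE_all_countable by (intro allI null) simp
  with AE_space show ?thesis
  proof eventually_elim
    case (elim \<omega>)
    have "Cauchy (\<lambda>n. \<Sum>l<n. X l \<omega>)"
    proof (rule metric_CauchyI)
      fix e :: real assume "0 < e"
      then obtain j where j: "1 / real (Suc j) < e / 2" using nat_approx_posE[of "e / 2"] by auto
      obtain m where m: "\<And>n. \<omega> \<notin> A (1 / real (Suc j)) m n" using elim by auto
      have near: "\<bar>(\<Sum>l<n. X l \<omega>) - (\<Sum>l<m. X l \<omega>)\<bar> < e / 2" if "m \<le> n" for n
      proof -
        have "(\<Sum>l<n. X l \<omega>) = (\<Sum>l<m. X l \<omega>) + (\<Sum>l<n - m. X (l + m) \<omega>)"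
        proof -
          have "(\<Sum>l<m + d. X l \<omega>) = (\<Sum>l<m. X l \<omega>) + (\<Sum>l<d. X (l + m) \<omega>)" for d
            by (induction d) (simp_all add: add.commute)
          from this[of "n - m"] show ?thesis using that by simp
        qed
        moreover have "\<bar>\<Sum>l<n - m. X (l + m) \<omega>\<bar> < 1 / real (Suc j)"
          using m[of "n - m"] elim by (auto simp: A_def not_le)
        ultimately show ?thesis using j by simp
      qed
      show "\<exists>N. \<forall>m\<ge>N. \<forall>n\<ge>N. dist (\<Sum>l<m. X l \<omega>) (\<Sum>l<n. X l \<omega>) < e"
      proof (intro exI allI impI)
        fix a b assume "m \<le> a" "m \<le> b"
        from near[OF this(1)] near[OF this(2)] show "dist (\<Sum>l<a. X l \<omega>) (\<Sum>l<b. X l \<omega>) < e"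
          unfolding dist_real_def by linarith
      qed
    qed
    then show ?case by (rule Cauchy_convergent)
  qed
qed

end

section \<open>Moments of the intensity measure\<close>

lemma sets_beta_distribution [simp, measurable_cong]: "sets (beta_distribution p q) = sets borel"
  by (simp add: beta_distribution_def)

lemma space_beta_distribution [simp]: "space (beta_distribution p q) = UNIV"
  by (simp add: beta_distribution_def)

lemma AE_beta_distribution: "AE u in beta_distribution p q. 0 < u \<and> u < 1"
  unfolding beta_distribution_def by (subst AE_density) auto

lemma Beta_pos: "0 < p \<Longrightarrow> 0 < q \<Longrightarrow> 0 < Beta p (q :: real)"
  by (simp add: Beta_def)

text \<open>The power is absorbed into the first parameter, so moments are quotients of Beta values;
  \<open>j = 0\<close> doubles as the normalization of the density.\<close>

lemma nn_integral_beta_distribution: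
  assumes p: "0 < p" and q: "0 < q"
  shows "(\<integral>\<^sup>+u. ennreal (u ^ j) \<partial>beta_distribution p q) = ennreal (Beta (p + j) q / Beta p q)"
proof -
  have B: "0 < Beta p q" using p q by (rule Beta_pos)
  have hi: "((\<lambda>t. t powr (p + j - 1) * (1 - t) powr (q - 1) / Beta p q) has_integral Beta (p + j) q / Beta p q) {0<..<1}"
    using has_integral_Beta_real[of "p + j" q] p q
    by (intro has_integral_divide) (simp add: has_integral_Icc_iff_Ioo)
  have "(\<integral>\<^sup>+u. ennreal (u ^ j) \<partial>beta_distribution p q) =
    (\<integral>\<^sup>+x. ennreal (indicator {0<..<1} x * (x powr (p + j - 1) * (1 - x) powr (q - 1) / Beta p q)) \<partial>lborel)"
    unfolding beta_distribution_def
  proof (subst nn_integral_density, simp, simp, rule nn_integral_cong)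
    fix x :: real
    show "ennreal (if 0 < x \<and> x < 1 then x powr (p - 1) * (1 - x) powr (q - 1) / Beta p q else 0) * ennreal (x ^ j)
      = ennreal (indicator {0<..<1} x * (x powr (p + j - 1) * (1 - x) powr (q - 1) / Beta p q))"
    proof (cases "0 < x \<and> x < 1")
      case True
      then have "x powr (p + j - 1) = x powr (p - 1) * x ^ j"
        by (simp add: powr_realpow[symmetric] powr_add[symmetric] algebra_simps)
      then show ?thesis using True B by (subst ennreal_mult[symmetric]) (auto simp: mult_ac)
    qed auto
  qed
  also have "\<dots> = ennreal (Beta (p + j) q / Beta p q)"
    using B by (intro nn_integral_has_integral_lebesgue hi) auto
  finally show ?thesis .
qed

lemma prob_space_beta_distribution:
  assumes "0 < p" "0 < q"
  shows "prob_space (beta_distribution p q)"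
proof
  have "emeasure (beta_distribution p q) (space (beta_distribution p q)) =
    (\<integral>\<^sup>+u. ennreal (u ^ 0) \<partial>beta_distribution p q)" by simp
  also have "\<dots> = ennreal (Beta (p + 0) q / Beta p q)"
    using nn_integral_beta_distribution[OF assms, of 0] by simp
  also have "\<dots> = 1" using Beta_pos[OF assms] by simp
  finally show "emeasure (beta_distribution p q) (space (beta_distribution p q)) = 1" .
qed

lemma sets_beta_product_law [simp, measurable_cong]: "sets (beta_product_law \<alpha>) = sets borel"
  by (simp add: beta_product_law_def Let_def)

lemma space_nu: "space (nu \<alpha> c) = {0<..2}"
  using sets_eq_imp_space_eq[OF sets_beta_product_law, of \<alpha>] by (simp add: nu_def space_restrict_space)

lemma sets_nu: "sets (nu \<alpha> c) = sets (restrict_space borel {0<..2})"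
  by (simp add: nu_def cong: sets_restrict_space_cong)

lemma measurable_nu [measurable (raw)]:
  "f \<in> borel_measurable borel \<Longrightarrow> f \<in> borel_measurable (nu \<alpha> c)"
  by (subst measurable_cong_sets[OF sets_nu refl]) (rule measurable_restrict_space1)

text \<open>The exponent \<open>s\<close> of \<open>1 / x ^ s\<close> in the density of
  \<open>nu\<close> is also the integer in the first Beta parameter \<open>s - \<alpha> / 2\<close>.
  The moment of order \<open>k\<close> is therefore a multiple of the moment of order
  \<open>k - s\<close> of \<open>2 * (u * v)\<close>, which independence turns into a power of 2
  times a squared Beta moment.\<close>

lemma nn_integral_nu_power:
  fixes \<alpha> c :: real
  defines "s \<equiv> (if \<alpha> < 2 then 1 else 2 :: nat)"
    and "K \<equiv> (if \<alpha> < 2 then c\<^sup>2 else 2 * c\<^sup>2 * (c2 \<alpha>)\<^sup>2)"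
  assumes \<alpha>: "\<alpha> \<in> {0<..<3} - {2}" and k: "s \<le> k"
  shows "(\<integral>\<^sup>+x. ennreal (x ^ k) \<partial>nu \<alpha> c) =
    ennreal (K * 2 ^ (k - s) * (Beta (k - \<alpha> / 2) (\<alpha> / 2) / Beta (s - \<alpha> / 2) (\<alpha> / 2))\<^sup>2)"
proof -
  define B where "B = beta_distribution (s - \<alpha> / 2) (\<alpha> / 2)"
  have sa: "0 < s - \<alpha> / 2" "0 < \<alpha> / 2" using \<alpha> by (auto simp: s_def)
  have K: "0 \<le> K" by (simp add: K_def)
  define b where "b = Beta (k - \<alpha> / 2) (\<alpha> / 2) / Beta (s - \<alpha> / 2) (\<alpha> / 2)"
  have b0: "0 \<le> b"
    using Beta_pos[of "s - \<alpha> / 2" "\<alpha> / 2"] Beta_pos[of "k - \<alpha> / 2" "\<alpha> / 2"] sa k by (simp add: b_def)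
  interpret B: prob_space B unfolding B_def by (rule prob_space_beta_distribution[OF sa])
  have setsB [measurable_cong]: "sets B = sets borel" by (simp add: B_def)
  have law: "beta_product_law \<alpha> = distr (B \<Otimes>\<^sub>M B) borel (\<lambda>(u, v). 2 * (u * v))"
    by (simp add: beta_product_law_def B_def s_def Let_def)
  have dens: "(if \<alpha> < 2 then c\<^sup>2 / x else 2 * c\<^sup>2 * (c2 \<alpha>)\<^sup>2 / x\<^sup>2) = K / x ^ s" for x :: real
    by (simp add: K_def s_def)
  define f where "f x = indicator {0<..2} x * (K * x ^ (k - s))" for x :: real
  have AEB: "AE u in B. 0 < u \<and> u < 1" unfolding B_def by (rule AE_beta_distribution)
  have "(\<integral>\<^sup>+x. ennreal (x ^ k) \<partial>nu \<alpha> c) =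
    (\<integral>\<^sup>+x. ennreal (K / x ^ s) * ennreal (x ^ k) \<partial>restrict_space (beta_product_law \<alpha>) {0<..2})"
    unfolding nu_def dens
    by (rule nn_integral_density) (auto intro!: measurable_restrict_space1)
  also have "\<dots> = (\<integral>\<^sup>+x. ennreal (K / x ^ s) * ennreal (x ^ k) * indicator {0<..2} x \<partial>beta_product_law \<alpha>)"
    by (rule nn_integral_restrict_space) auto
  also have "\<dots> = (\<integral>\<^sup>+x. ennreal (f x) \<partial>beta_product_law \<alpha>)"
  proof (rule nn_integral_cong)
    fix x :: real
    show "ennreal (K / x ^ s) * ennreal (x ^ k) * indicator {0<..2} x = ennreal (f x)"
    proof (cases "x \<in> {0<..2}")
      case True
      then have "K / x ^ s * x ^ k = K * x ^ (k - s)"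
        using k by (simp add: power_diff)
      then show ?thesis using True K by (simp add: f_def ennreal_mult[symmetric])
    qed (simp add: f_def)
  qed
  also have "\<dots> = (\<integral>\<^sup>+z. ennreal (f (case z of (u, v) \<Rightarrow> 2 * (u * v))) \<partial>(B \<Otimes>\<^sub>M B))"
    unfolding law by (rule nn_integral_distr) (auto simp: f_def)
  also have "\<dots> = (\<integral>\<^sup>+u. (\<integral>\<^sup>+v. ennreal (f (2 * (u * v))) \<partial>B) \<partial>B)"
    by (subst B.nn_integral_fst[symmetric]) (auto simp: f_def)
  also have "\<dots> = (\<integral>\<^sup>+u. (\<integral>\<^sup>+v. ennreal (K * 2 ^ (k - s)) * ennreal (u ^ (k - s)) * ennreal (v ^ (k - s)) \<partial>B) \<partial>B)"
  proof (rule nn_integral_cong_AE)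
    show "AE u in B. (\<integral>\<^sup>+v. ennreal (f (2 * (u * v))) \<partial>B) =
      (\<integral>\<^sup>+v. ennreal (K * 2 ^ (k - s)) * ennreal (u ^ (k - s)) * ennreal (v ^ (k - s)) \<partial>B)"
      using AEB
    proof eventually_elim
      case (elim u)
      show ?case
      proof (rule nn_integral_cong_AE)
        show "AE v in B. ennreal (f (2 * (u * v))) =
          ennreal (K * 2 ^ (k - s)) * ennreal (u ^ (k - s)) * ennreal (v ^ (k - s))"
          using AEB
        proof eventually_elim
          case v: (elim v)
          \<comment> \<open>Almost surely \<open>2 * (u * v)\<close> lies in \<open>{0<..2}\<close>,
            so restricting the space loses no mass.\<close>
          have "u * v \<le> 1 * 1" using elim v by (intro mult_mono) auto
          then have "f (2 * (u * v)) = K * 2 ^ (k - s) * u ^ (k - s) * v ^ (k - s)"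
            using elim v by (simp add: f_def power_mult_distrib)
          then show ?case using elim v K by (simp add: ennreal_mult)
        qed
      qed
    qed
  qed
  also have "\<dots> = ennreal (K * 2 ^ (k - s)) * (\<integral>\<^sup>+u. ennreal (u ^ (k - s)) \<partial>B) * (\<integral>\<^sup>+v. ennreal (v ^ (k - s)) \<partial>B)"
    by (simp add: nn_integral_cmult nn_integral_multc mult.assoc)
  also have "(\<integral>\<^sup>+v. ennreal (v ^ (k - s)) \<partial>B) = ennreal b"
    unfolding B_def nn_integral_beta_distribution[OF sa] b_def using k by (simp add: of_nat_diff)
  also have "ennreal (K * 2 ^ (k - s)) * ennreal b * ennreal b = ennreal (K * 2 ^ (k - s) * b\<^sup>2)"
    using K b0 by (simp add: ennreal_mult[symmetric] power2_eq_square mult.assoc)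
  finally show ?thesis unfolding b_def .
qed

text \<open>Below 2 this is the moment of order \<open>k - 1\<close> of the Beta law with parameters
  \<open>1 - \<alpha> / 2\<close> and \<open>\<alpha> / 2\<close>, equivalently the quotient of
  \<open>hlim k\<close> by \<open>hlim 1\<close> for the tail exponent \<open>\<alpha> / 2\<close>;
  above 2 it is \<open>hlim k\<close> itself.\<close>

definition limit_moment :: "real \<Rightarrow> nat \<Rightarrow> real" where
  "limit_moment \<alpha> k = (if \<alpha> < 2 then Gamma (k - \<alpha> / 2) / (Gamma k * Gamma (1 - \<alpha> / 2))
    else Gamma (1 + \<alpha> / 2) * Gamma (k - \<alpha> / 2) / Gamma k)"

text \<open>This is how \<open>c2\<close> enters the theorem: \<open>beta4\<close> is the second
  moment of a share, so the normalizer tends to \<open>sqrt 2 * c * c2 \<alpha>\<close>.\<close>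

lemma limit_moment_2: "\<alpha> \<in> {0<..<3} - {2} \<Longrightarrow> limit_moment \<alpha> 2 = c2 \<alpha>"
proof (cases "\<alpha> < 2")
  case True
  then have "1 - \<alpha> / 2 \<notin> \<int>\<^sub>\<le>\<^sub>0" "0 < Gamma (1 - \<alpha> / 2)"
    by (auto elim!: nonpos_Ints_cases intro!: Gamma_real_pos)
  then have "Gamma (2 - \<alpha> / 2) = (1 - \<alpha> / 2) * Gamma (1 - \<alpha> / 2)" "Gamma (1 - \<alpha> / 2) \<noteq> 0"
    using Gamma_plus1[of "1 - \<alpha> / 2"] by auto
  with True show ?thesis by (simp add: limit_moment_def c2_def Gamma_numeral)
qed (auto simp: limit_moment_def c2_def Gamma_numeral)

text \<open>Matches the Beta quotients of the intensity with the constants that the shares produce,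
  so that both sides of the method of moments agree. The square reflects that an overlap is a
  product of two independent shares, one from each row.\<close>

lemma nu_power:
  assumes \<alpha>: "\<alpha> \<in> {0<..<3} - {2}" and k: "2 \<le> k \<or> (\<alpha> < 2 \<and> 1 \<le> k)"
  shows "integrable (nu \<alpha> c) (\<lambda>x. x ^ k)"
    and "(\<integral>x. x ^ k \<partial>nu \<alpha> c) = 2 ^ (k - 1) * c\<^sup>2 * (limit_moment \<alpha> k)\<^sup>2"
proof -
  define s where "s = (if \<alpha> < 2 then 1 else 2 :: nat)"
  define K where "K = (if \<alpha> < 2 then c\<^sup>2 else 2 * c\<^sup>2 * (c2 \<alpha>)\<^sup>2)"
  define v where "v = K * 2 ^ (k - s) * (Beta (k - \<alpha> / 2) (\<alpha> / 2) / Beta (s - \<alpha> / 2) (\<alpha> / 2))\<^sup>2"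
  have sk: "s \<le> k" using k by (auto simp: s_def)
  have v0: "0 \<le> v" by (simp add: v_def K_def)
  have nn: "(\<integral>\<^sup>+x. ennreal (x ^ k) \<partial>nu \<alpha> c) = ennreal v"
    unfolding v_def s_def K_def using nn_integral_nu_power[OF \<alpha>] sk by (simp add: s_def)
  have AE0: "AE x in nu \<alpha> c. 0 \<le> x ^ k" by (rule AE_I2) (auto simp: space_nu)
  show "integrable (nu \<alpha> c) (\<lambda>x. x ^ k)"
    by (rule integrableI_nn_integral_finite[OF _ AE0 nn]) measurable
  have "(\<integral>x. x ^ k \<partial>nu \<alpha> c) = v"
    by (rule integral_eq_nn_integral[OF _ AE0, THEN trans]) (auto simp: nn v0)
  also have "v = 2 ^ (k - 1) * c\<^sup>2 * (limit_moment \<alpha> k)\<^sup>2"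
  proof -
    have G: "Gamma (\<alpha> / 2) \<noteq> 0" "Gamma (s - \<alpha> / 2) \<noteq> 0" "Gamma (real k) \<noteq> 0"
      using \<alpha> sk by (auto simp: s_def Gamma_eq_zero_iff elim!: nonpos_Ints_cases split: if_splits)
    have "Beta (k - \<alpha> / 2) (\<alpha> / 2) / Beta (s - \<alpha> / 2) (\<alpha> / 2) =
        Gamma (k - \<alpha> / 2) / (Gamma k * Gamma (s - \<alpha> / 2)) * Gamma s"
      using G by (simp add: Beta_def field_simps)
    also have "Gamma (real s) = 1" by (simp add: s_def Gamma_numeral)
    finally have e: "Beta (k - \<alpha> / 2) (\<alpha> / 2) / Beta (s - \<alpha> / 2) (\<alpha> / 2) =
        Gamma (k - \<alpha> / 2) / (Gamma k * Gamma (s - \<alpha> / 2))" by simp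
    show ?thesis
    proof (cases "\<alpha> < 2")
      case True
      then show ?thesis unfolding v_def e by (simp add: s_def K_def limit_moment_def)
    next
      case False
      \<comment> \<open>The factor 2 in the density of \<open>nu\<close> makes up for the fact that
        only \<open>k - 2\<close> powers of the doubled product remain; the factor
        \<open>Gamma (2 - \<alpha> / 2)\<close> of \<open>c2\<close> cancels the denominator of the
        Beta quotient.\<close>
      then have "(2::real) ^ (k - 1) = 2 * 2 ^ (k - 2)" using sk
        by (cases k; cases "k - 1") (auto simp: s_def)
      then show ?thesis using False G unfolding v_def e
        by (simp add: s_def K_def limit_moment_def c2_def power_mult_distrib power_divide)
    qed
  qed
  finally show "(\<integral>x. x ^ k \<partial>nu \<alpha> c) = 2 ^ (k - 1) * c\<^sup>2 * (limit_moment \<alpha> k)\<^sup>2" .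
qed

section \<open>Poisson processes\<close>

text \<open>Splitting over the level sets of a variable with countably many values turns
  expectations into series. The vector-valued form covers characteristic functions as well as real
  moments.\<close>

lemma (in prob_space) expectation_nat_valued:
  fixes K :: "'a \<Rightarrow> nat" and f :: "nat \<Rightarrow> 'b::{banach, second_countable_topology}"
  assumes [measurable]: "K \<in> M \<rightarrow>\<^sub>M count_space UNIV"
    and P: "\<And>k. prob {\<omega> \<in> space M. K \<omega> = k} = w k"
    and sm: "summable (\<lambda>k. w k * norm (f k))"
  shows "integrable M (\<lambda>\<omega>. f (K \<omega>))"
    and "(\<lambda>k. w k *\<^sub>R f k) sums expectation (\<lambda>\<omega>. f (K \<omega>))"
proof -
  define A where "A k = {\<omega> \<in> space M. K \<omega> = k}" for k
  have [measurable]: "A k \<in> sets M" for k unfolding A_def by measurable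
  define F where "F k \<omega> = indicator (A k) \<omega> *\<^sub>R f k" for k \<omega>
  have int: "integrable M (F k)" for k
    unfolding F_def by (intro integrable_scaleR_left integrable_real_indicator) (auto simp: emeasure_eq_measure)
  have sn: "AE \<omega> in M. summable (\<lambda>k. norm (F k \<omega>))"
  proof (rule AE_I2)
    fix \<omega> show "summable (\<lambda>k. norm (F k \<omega>))"
      by (rule summable_finite[of "{K \<omega>}"]) (auto simp: F_def A_def)
  qed
  have "(\<integral>\<omega>. norm (F k \<omega>) \<partial>M) = w k * norm (f k)" for k
    using P[of k] by (simp add: F_def A_def[symmetric])
  then have sI: "summable (\<lambda>k. \<integral>\<omega>. norm (F k \<omega>) \<partial>M)" using sm by simp
  have S: "(\<Sum>k. F k \<omega>) = f (K \<omega>)" if "\<omega> \<in> space M" for \<omega>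
    using suminf_finite[of "{K \<omega>}" "\<lambda>k. F k \<omega>"] that by (auto simp: F_def A_def)
  have "integrable M (\<lambda>\<omega>. \<Sum>k. F k \<omega>)" by (rule integrable_suminf[OF int sn sI])
  then show "integrable M (\<lambda>\<omega>. f (K \<omega>))"
    by (rule Bochner_Integration.integrable_cong[THEN iffD1, rotated -1]) (auto simp: S)
  have "(\<lambda>k. \<integral>\<omega>. F k \<omega> \<partial>M) sums (\<integral>\<omega>. (\<Sum>k. F k \<omega>) \<partial>M)" by (rule sums_integral[OF int sn sI])
  moreover have "(\<integral>\<omega>. F k \<omega> \<partial>M) = w k *\<^sub>R f k" for k
    using P[of k] unfolding F_def
    by (subst integral_scaleR_left) (auto simp: A_def[symmetric] emeasure_eq_measure intro!: integrable_real_indicator)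
  moreover have "(\<integral>\<omega>. (\<Sum>k. F k \<omega>) \<partial>M) = expectation (\<lambda>\<omega>. f (K \<omega>))"
    by (rule Bochner_Integration.integral_cong) (auto simp: S)
  ultimately show "(\<lambda>k. w k *\<^sub>R f k) sums expectation (\<lambda>\<omega>. f (K \<omega>))" by simp
qed

definition poisson_weight :: "real \<Rightarrow> nat \<Rightarrow> real" where
  "poisson_weight r k = r ^ k / fact k * exp (- r)"

lemma poisson_weight_sums_complex:
  "(\<lambda>k. poisson_weight r k *\<^sub>R z ^ k) sums exp (of_real r * (z - 1 :: complex))"
proof -
  have "(\<lambda>k. exp (- of_real r) * ((of_real r * z) ^ k /\<^sub>R fact k)) sums (exp (- of_real r) * exp (of_real r * z))"
    by (intro sums_mult exp_converges)
  also have "exp (- of_real r) * exp (of_real r * z) = exp (of_real r * (z - 1 :: complex))"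
    by (simp add: exp_add[symmetric] algebra_simps)
  also have "(\<lambda>k. exp (- of_real r) * ((of_real r * z) ^ k /\<^sub>R fact k)) = (\<lambda>k. poisson_weight r k *\<^sub>R z ^ k)"
    by (auto simp: fun_eq_iff poisson_weight_def scaleR_conv_of_real power_mult_distrib exp_of_real[symmetric] field_simps)
  finally show ?thesis .
qed

lemma poisson_weight_sums: "poisson_weight r sums 1"
proof -
  have "(\<lambda>k. exp (- r) * (r ^ k /\<^sub>R fact k)) sums (exp (- r) * exp r)"
    by (intro sums_mult exp_converges)
  then show ?thesis
    by (simp add: poisson_weight_def[abs_def] exp_add[symmetric] field_simps)
qed

text \<open>Size biasing: weighting by the value shifts the Poisson weights by one. Mean and second
  moment then follow from the total mass, the term of index 0 contributing nothing.\<close>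

lemma poisson_weight_Suc: "poisson_weight r (Suc k) * real (Suc k) = r * poisson_weight r k"
  by (simp add: poisson_weight_def field_simps del: of_nat_Suc)

lemma poisson_weight_sums_mean: "(\<lambda>k. poisson_weight r k * real k) sums r"
proof -
  have "(\<lambda>k. poisson_weight r (Suc k) * real (Suc k)) sums (r * 1)"
    unfolding poisson_weight_Suc by (intro sums_mult poisson_weight_sums)
  from sums_Suc[OF this] show ?thesis by simp
qed

lemma poisson_weight_sums_square: "(\<lambda>k. poisson_weight r k * (real k)\<^sup>2) sums (r\<^sup>2 + r)"
proof -
  have "(\<lambda>k. poisson_weight r (Suc k) * (real (Suc k))\<^sup>2) =
      (\<lambda>k. r * (poisson_weight r k * real k) + r * poisson_weight r k)"
  proof
    fix k
    have "poisson_weight r (Suc k) * (real (Suc k))\<^sup>2 = (poisson_weight r (Suc k) * real (Suc k)) * real (Suc k)"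
      by (simp only: power2_eq_square mult.assoc)
    also have "\<dots> = r * (poisson_weight r k * real k) + r * poisson_weight r k"
      unfolding poisson_weight_Suc by (simp add: algebra_simps)
    finally show "poisson_weight r (Suc k) * (real (Suc k))\<^sup>2 = r * (poisson_weight r k * real k) + r * poisson_weight r k" .
  qed
  moreover have "(\<lambda>k. r * (poisson_weight r k * real k) + r * poisson_weight r k) sums (r * r + r * 1)"
    by (intro sums_add sums_mult poisson_weight_sums poisson_weight_sums_mean)
  ultimately have "(\<lambda>k. poisson_weight r (Suc k) * (real (Suc k))\<^sup>2) sums (r * r + r * 1)" by simp
  from sums_Suc[OF this] show ?thesis by (simp add: power2_eq_square)
qed

section \<open>Counting variables of a Poisson process and Campbell's formula\<close>

lemma atom_count_finite:
  assumes "finite {i. \<xi> i \<omega> \<in> B}"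
  shows "atom_count \<xi> B \<omega> = of_nat (card {i. \<xi> i \<omega> \<in> B})"
proof -
  have "atom_count \<xi> B \<omega> = (\<Sum>i | \<xi> i \<omega> \<in> B. indicator B (\<xi> i \<omega>))"
    unfolding atom_count_def by (rule suminf_finite[OF assms]) auto
  also have "\<dots> = (\<Sum>i | \<xi> i \<omega> \<in> B. 1)" by (rule sum.cong) auto
  finally show ?thesis by simp
qed

lemma atom_count_infinite:
  assumes "infinite {i. \<xi> i \<omega> \<in> B}"
  shows "atom_count \<xi> B \<omega> = \<infinity>"
proof -
  have "of_nat n \<le> atom_count \<xi> B \<omega>" for n
  proof -
    obtain F where F: "F \<subseteq> {i. \<xi> i \<omega> \<in> B}" "finite F" "card F = n"
      using infinite_arbitrarily_large[OF assms] by blast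
    have "of_nat n = (\<Sum>i\<in>F. indicator B (\<xi> i \<omega>) :: ennreal)"
      using F by (subst sum.cong[OF refl, of F _ "\<lambda>_. 1"]) auto
    also have "\<dots> \<le> atom_count \<xi> B \<omega>"
      unfolding atom_count_def by (rule sum_le_suminf) (auto simp: F)
    finally show ?thesis .
  qed
  then show ?thesis
    by (metis ennreal_Ex_less_of_nat infinity_ennreal_def not_le top.not_eq_extremum)
qed

locale poisson_process = prob_space N for N :: "'c measure" +
  fixes \<nu> :: "'b measure" and \<xi> :: "nat \<Rightarrow> 'c \<Rightarrow> 'b"
  assumes poisson: "poisson_atoms N \<nu> \<xi>"
begin

lemma measurable_atom [measurable]: "\<xi> i \<in> N \<rightarrow>\<^sub>M \<nu>"
  using poisson by (simp add: poisson_atoms_def)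

lemma measurable_atom_count [measurable]:
  assumes [measurable]: "B \<in> sets \<nu>" shows "atom_count \<xi> B \<in> borel_measurable N"
  unfolding atom_count_def[abs_def] by measurable

text \<open>A natural-valued version of \<open>atom_count\<close>. It differs only when infinitely
  many atoms fall into \<open>B\<close>, where \<open>card\<close> gives 0; for finite intensity
  this is a null event.\<close>

definition count :: "'b set \<Rightarrow> 'c \<Rightarrow> nat" where
  "count B \<omega> = card {i. \<xi> i \<omega> \<in> B}"

text \<open>Holds for infinitely many atoms too, since \<open>enn2real\<close> sends infinity to 0.
  Thus \<open>count\<close> is a fixed measurable function of \<open>atom_count\<close> and inherits
  measurability and independence from it.\<close>

lemma count_eq: "count B \<omega> = nat \<lfloor>enn2real (atom_count \<xi> B \<omega>)\<rfloor>"
  by (cases "finite {i. \<xi> i \<omega> \<in> B}") (simp_all add: count_def atom_count_finite atom_count_infinite)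

lemma measurable_count [measurable]:
  assumes [measurable]: "B \<in> sets \<nu>" shows "count B \<in> N \<rightarrow>\<^sub>M count_space UNIV"
  unfolding count_eq[abs_def] by measurable

lemma indep_count:
  fixes f :: "nat \<Rightarrow> nat \<Rightarrow> 'e::topological_space"
  assumes "range B \<subseteq> sets \<nu>" "disjoint_family B"
  shows "indep_vars (\<lambda>_. borel) (\<lambda>m \<omega>. f m (count (B m) \<omega>)) UNIV"
proof -
  have "indep_vars (\<lambda>_. borel) (\<lambda>m. atom_count \<xi> (B m)) UNIV"
    using poisson assms by (simp add: poisson_atoms_def)
  then have "indep_vars (\<lambda>_. borel) (\<lambda>m. (\<lambda>x. f m (nat \<lfloor>enn2real x\<rfloor>)) \<circ> atom_count \<xi> (B m)) UNIV"
    by (rule indep_vars_compose) measurable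
  then show ?thesis by (simp add: comp_def count_eq)
qed

text \<open>The finite values of the count already have total probability 1, because the Poisson
  weights sum to 1.\<close>

lemma AE_finite_atoms:
  assumes [measurable]: "B \<in> sets \<nu>" and fin: "emeasure \<nu> B < \<infinity>"
  shows "AE \<omega> in N. finite {i. \<xi> i \<omega> \<in> B}"
proof -
  let ?A = "\<lambda>k. {\<omega> \<in> space N. atom_count \<xi> B \<omega> = of_nat k}"
  have P: "prob (?A k) = poisson_weight (measure \<nu> B) k" for k
    using poisson assms by (simp add: poisson_atoms_def poisson_weight_def)
  have "(\<lambda>k. prob (?A k)) sums prob (\<Union>k. ?A k)"
    by (rule finite_measure_UNION) (auto simp: disjoint_family_on_def)
  then have "prob (\<Union>k. ?A k) = 1"
    unfolding P using poisson_weight_sums sums_unique2 by blast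
  then have "AE \<omega> in N. \<omega> \<in> (\<Union>k. ?A k)" by (subst AE_in_set_eq_1) auto
  then show ?thesis
  proof eventually_elim
    case (elim \<omega>)
    then obtain k where "atom_count \<xi> B \<omega> = of_nat k" by auto
    then have "atom_count \<xi> B \<omega> \<noteq> \<infinity>" by (simp add: ennreal_of_nat_eq_real_of_nat)
    then show ?case using atom_count_infinite[of \<xi> \<omega> B] by blast
  qed
qed

lemma prob_count:
  assumes [measurable]: "B \<in> sets \<nu>" and fin: "emeasure \<nu> B < \<infinity>"
  shows "prob {\<omega> \<in> space N. count B \<omega> = k} = poisson_weight (measure \<nu> B) k"
proof -
  have "prob {\<omega> \<in> space N. count B \<omega> = k} = prob {\<omega> \<in> space N. atom_count \<xi> B \<omega> = of_nat k}"
  proof (rule finite_measure_eq_AE)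
    show "AE \<omega> in N. (\<omega> \<in> {\<omega> \<in> space N. count B \<omega> = k}) = (\<omega> \<in> {\<omega> \<in> space N. atom_count \<xi> B \<omega> = of_nat k})"
      using AE_finite_atoms[OF assms] by eventually_elim (auto simp: atom_count_finite count_def)
  qed measurable
  then show ?thesis using poisson assms by (simp add: poisson_atoms_def poisson_weight_def)
qed

context
  fixes B assumes B [measurable]: "B \<in> sets \<nu>" and fin: "emeasure \<nu> B < \<infinity>"
begin

lemma char_count: "(CLINT \<omega>|N. iexp (s * real (count B \<omega>))) = exp (of_real (measure \<nu> B) * (iexp s - 1))"
proof -
  have "(\<lambda>k. poisson_weight (measure \<nu> B) k *\<^sub>R iexp (s * real k)) sums (CLINT \<omega>|N. iexp (s * real (count B \<omega>)))"
    using poisson_weight_sums[of "measure \<nu> B"]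
    by (intro expectation_nat_valued prob_count B fin measurable_count) (simp add: sums_iff)
  moreover have "iexp (s * real k) = iexp s ^ k" for k
    by (simp add: exp_of_nat_mult[symmetric] algebra_simps)
  ultimately show ?thesis
    using poisson_weight_sums_complex[of "measure \<nu> B" "iexp s"] sums_unique2 by fastforce
qed

lemma mean_count: "integrable N (\<lambda>\<omega>. real (count B \<omega>))" "expectation (\<lambda>\<omega>. real (count B \<omega>)) = measure \<nu> B"
proof -
  have s: "summable (\<lambda>k. poisson_weight (measure \<nu> B) k * norm (real k))"
    using poisson_weight_sums_mean[of "measure \<nu> B"] by (simp add: sums_iff)
  note * = expectation_nat_valued[OF measurable_count[OF B] prob_count[OF B fin] s]
  show "integrable N (\<lambda>\<omega>. real (count B \<omega>))" by (rule *(1))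
  show "expectation (\<lambda>\<omega>. real (count B \<omega>)) = measure \<nu> B"
    using *(2) poisson_weight_sums_mean[of "measure \<nu> B"] sums_unique2 by fastforce
qed

lemma square_count: "integrable N (\<lambda>\<omega>. (real (count B \<omega>))\<^sup>2)"
    "expectation (\<lambda>\<omega>. (real (count B \<omega>))\<^sup>2) = (measure \<nu> B)\<^sup>2 + measure \<nu> B"
proof -
  have s: "summable (\<lambda>k. poisson_weight (measure \<nu> B) k * norm ((real k)\<^sup>2))"
    using poisson_weight_sums_square[of "measure \<nu> B"] by (simp add: sums_iff)
  note * = expectation_nat_valued[OF measurable_count[OF B] prob_count[OF B fin] s]
  show "integrable N (\<lambda>\<omega>. (real (count B \<omega>))\<^sup>2)" by (rule *(1))
  show "expectation (\<lambda>\<omega>. (real (count B \<omega>))\<^sup>2) = (measure \<nu> B)\<^sup>2 + measure \<nu> B"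
    using *(2) poisson_weight_sums_square[of "measure \<nu> B"] sums_unique2 by fastforce
qed

end

text \<open>Stated in \<open>ennreal\<close> and for infinite intensity as well, so that Campbell's
  formula can be lifted from indicators without a finiteness condition.\<close>

lemma nn_integral_atom_count:
  assumes B [measurable]: "B \<in> sets \<nu>"
  shows "(\<integral>\<^sup>+\<omega>. atom_count \<xi> B \<omega> \<partial>N) = emeasure \<nu> B"
proof (cases "emeasure \<nu> B = \<infinity>")
  case True
  then have "AE \<omega> in N. atom_count \<xi> B \<omega> = \<infinity>"
    using poisson assms by (simp add: poisson_atoms_def)
  then have "(\<integral>\<^sup>+\<omega>. atom_count \<xi> B \<omega> \<partial>N) = (\<integral>\<^sup>+\<omega>. \<infinity> \<partial>N)" by (rule nn_integral_cong_AE)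
  then show ?thesis using True by (simp add: emeasure_space_1)
next
  case False
  then have fin: "emeasure \<nu> B < \<infinity>" by (simp add: less_top)
  have "(\<integral>\<^sup>+\<omega>. atom_count \<xi> B \<omega> \<partial>N) = (\<integral>\<^sup>+\<omega>. ennreal (real (count B \<omega>)) \<partial>N)"
    using AE_finite_atoms[OF B fin]
    by (intro nn_integral_cong_AE, eventually_elim) (simp add: atom_count_finite count_def ennreal_of_nat_eq_real_of_nat)
  also have "\<dots> = ennreal (measure \<nu> B)"
    using mean_count[OF B fin] by (subst nn_integral_eq_integral) auto
  also have "\<dots> = emeasure \<nu> B" using False by (simp add: emeasure_eq_ennreal_measure)
  finally show ?thesis .
qed

text \<open>The laws of all atoms add up to \<open>\<nu>\<close> as measures; the formula extends
  this identity from indicators to nonnegative measurable functions.\<close>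

lemma campbell:
  assumes "f \<in> borel_measurable \<nu>"
  shows "(\<integral>\<^sup>+\<omega>. (\<Sum>i. f (\<xi> i \<omega>)) \<partial>N) = (\<integral>\<^sup>+x. f x \<partial>\<nu>)"
proof -
  have eq: "(\<Sum>i. distr N \<nu> (\<xi> i) B) = \<nu> B" if [measurable]: "B \<in> sets \<nu>" for B
  proof -
    have "distr N \<nu> (\<xi> i) B = (\<integral>\<^sup>+\<omega>. indicator B (\<xi> i \<omega>) \<partial>N)" for i
    proof -
      have "distr N \<nu> (\<xi> i) B = (\<integral>\<^sup>+x. indicator B x \<partial>distr N \<nu> (\<xi> i))" by simp
      also have "\<dots> = (\<integral>\<^sup>+\<omega>. indicator B (\<xi> i \<omega>) \<partial>N)" by (rule nn_integral_distr) simp_all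
      finally show ?thesis .
    qed
    then have "(\<Sum>i. distr N \<nu> (\<xi> i) B) = (\<Sum>i. \<integral>\<^sup>+\<omega>. indicator B (\<xi> i \<omega>) \<partial>N)" by simp
    also have "\<dots> = (\<integral>\<^sup>+\<omega>. (\<Sum>i. indicator B (\<xi> i \<omega>)) \<partial>N)" by (rule nn_integral_suminf[symmetric]) simp
    finally show ?thesis using nn_integral_atom_count[OF that] by (simp add: atom_count_def)
  qed
  have "(\<Sum>i. \<integral>\<^sup>+x. f x \<partial>distr N \<nu> (\<xi> i)) = (\<integral>\<^sup>+x. f x \<partial>\<nu>)"
    using assms
  proof (induction rule: borel_measurable_induct)
    case (cong f g)
    have "(\<integral>\<^sup>+x. f x \<partial>distr N \<nu> (\<xi> i)) = (\<integral>\<^sup>+x. g x \<partial>distr N \<nu> (\<xi> i))" for i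
      by (rule nn_integral_cong) (simp add: cong)
    moreover have "(\<integral>\<^sup>+x. f x \<partial>\<nu>) = (\<integral>\<^sup>+x. g x \<partial>\<nu>)" by (rule nn_integral_cong) (simp add: cong)
    ultimately show ?case using cong by simp
  next
    case (set A) then show ?case using eq by simp
  next
    case (mult u c) then show ?case by (simp add: nn_integral_cmult ennreal_suminf_cmult)
  next
    case (add u v) then show ?case by (simp add: nn_integral_add suminf_add[symmetric])
  next
    case (seq U)
    have "(\<Sum>i. \<integral>\<^sup>+x. (SUP n. U n) x \<partial>distr N \<nu> (\<xi> i)) = (\<Sum>i. SUP n. \<integral>\<^sup>+x. U n x \<partial>distr N \<nu> (\<xi> i))"
      using seq by (simp add: image_comp nn_integral_monotone_convergence_SUP)
    also have "\<dots> = (SUP n. \<Sum>i. \<integral>\<^sup>+x. U n x \<partial>distr N \<nu> (\<xi> i))"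
      using seq by (intro ennreal_suminf_SUP_eq) (auto simp: incseq_def le_fun_def intro!: nn_integral_mono)
    also have "\<dots> = (SUP n. \<integral>\<^sup>+x. U n x \<partial>\<nu>)" using seq by simp
    also have "\<dots> = (\<integral>\<^sup>+x. (SUP n. U n) x \<partial>\<nu>)"
      using seq by (simp add: image_comp nn_integral_monotone_convergence_SUP)
    finally show ?case .
  qed
  moreover have "(\<integral>\<^sup>+\<omega>. (\<Sum>i. f (\<xi> i \<omega>)) \<partial>N) = (\<Sum>i. \<integral>\<^sup>+\<omega>. f (\<xi> i \<omega>) \<partial>N)"
    by (intro nn_integral_suminf measurable_compose[OF measurable_atom assms])
  ultimately show ?thesis using assms by (simp add: nn_integral_distr)
qed

lemma AE_summable:
  assumes [measurable]: "f \<in> borel_measurable \<nu>" and f: "integrable \<nu> f" "\<And>x. x \<in> space \<nu> \<Longrightarrow> 0 \<le> f x"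
  shows "AE \<omega> in N. summable (\<lambda>i. f (\<xi> i \<omega>) :: real)"
proof -
  have "(\<integral>\<^sup>+\<omega>. (\<Sum>i. ennreal (f (\<xi> i \<omega>))) \<partial>N) = (\<integral>\<^sup>+x. ennreal (f x) \<partial>\<nu>)"
    by (rule campbell) simp
  also have "\<dots> = ennreal (integral\<^sup>L \<nu> f)"
    using f by (intro nn_integral_eq_integral AE_I2) auto
  finally have "AE \<omega> in N. (\<Sum>i. ennreal (f (\<xi> i \<omega>))) \<noteq> \<infinity>"
    by (intro nn_integral_PInf_AE) auto
  with AE_space show ?thesis
  proof eventually_elim
    case (elim \<omega>)
    then show ?case using f(2) measurable_space[OF measurable_atom]
      by (intro summable_suminf_not_top) auto
  qed
qed

end

section \<open>Characteristic functions of sums over finitely many atoms\<close>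

lemma nat_floor_le: "y \<le> real n \<Longrightarrow> nat \<lfloor>y\<rfloor> \<le> n"
  by linarith

lemma grid_approx:
  assumes "0 \<le> y" "0 < k" shows "\<bar>real (nat \<lfloor>k * y\<rfloor>) / k - y\<bar> \<le> 1 / (k :: real)"
proof -
  have "0 \<le> k * y" using assms by simp
  then have "\<bar>real (nat \<lfloor>k * y\<rfloor>) - k * y\<bar> \<le> 1" by linarith
  then have "\<bar>real (nat \<lfloor>k * y\<rfloor>) - k * y\<bar> / k \<le> 1 / k"
    using assms by (intro divide_right_mono) auto
  moreover have "real (nat \<lfloor>k * y\<rfloor>) / k - y = (real (nat \<lfloor>k * y\<rfloor>) - k * y) / k"
    using assms by (simp add: diff_divide_distrib)
  ultimately show ?thesis using assms by (simp add: abs_divide)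
qed

lemma indicator_sum_finite:
  assumes "finite {i :: nat. y i \<in> B}"
  shows "(\<Sum>i. h (y i) * indicator B (y i) :: real) = (\<Sum>i | y i \<in> B. h (y i))"
proof -
  have "(\<Sum>i. h (y i) * indicator B (y i) :: real) = (\<Sum>i | y i \<in> B. h (y i) * indicator B (y i))"
    by (rule suminf_finite[OF assms]) auto
  also have "\<dots> = (\<Sum>i | y i \<in> B. h (y i))" by (rule sum.cong) auto
  finally show ?thesis .
qed

text \<open>Labelling the points by finitely many values turns a sum over atoms into a linear
  combination of cell counts, and it is for counts of disjoint cells that independence is
  available.\<close>

lemma sum_by_cells:
  fixes F :: "nat \<Rightarrow> real" and y :: "nat \<Rightarrow> 'b"
  assumes fin: "finite {i. y i \<in> D}" and n: "\<And>x. x \<in> D \<Longrightarrow> n x \<le> J"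
  shows "(\<Sum>i | y i \<in> D. F (n (y i))) = (\<Sum>j\<le>J. F j * real (card {i. y i \<in> {x \<in> D. n x = j}}))"
proof -
  have "(\<Sum>i | y i \<in> D. F (n (y i))) = (\<Sum>j\<le>J. \<Sum>i | i \<in> {i. y i \<in> D} \<and> n (y i) = j. F (n (y i)))"
    using n by (intro sum.group[symmetric] fin) auto
  also have "\<dots> = (\<Sum>j\<le>J. F j * real (card {i. y i \<in> {x \<in> D. n x = j}}))"
  proof (rule sum.cong[OF refl])
    fix j
    have "(\<Sum>i | i \<in> {i. y i \<in> D} \<and> n (y i) = j. F (n (y i))) = (\<Sum>i\<in>{i. y i \<in> {x \<in> D. n x = j}}. F j)"
      by (rule sum.cong) auto
    then show "(\<Sum>i | i \<in> {i. y i \<in> D} \<and> n (y i) = j. F (n (y i))) = F j * real (card {i. y i \<in> {x \<in> D. n x = j}})"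
      by simp
  qed
  finally show ?thesis .
qed

context poisson_process
begin

text \<open>Rounding \<open>g\<close> down to a grid of mesh \<open>1 / (K + 1)\<close> makes the
  sum a combination of finitely many independent Poisson counts, whose characteristic functions
  multiply to the exponential of an integral. Then the mesh tends to 0 on both sides by dominated
  convergence; finite intensity of \<open>D\<close> supplies the majorant and makes the sum over
  atoms finite almost surely.\<close>

lemma char_atom_sum:
  fixes g :: "'b \<Rightarrow> real"
  assumes D [measurable]: "D \<in> sets \<nu>" and fin: "emeasure \<nu> D < \<infinity>"
    and g [measurable]: "g \<in> borel_measurable \<nu>" and g0: "\<And>x. x \<in> D \<Longrightarrow> 0 \<le> g x"
    and gC: "\<And>x. x \<in> D \<Longrightarrow> g x \<le> real C"
  shows "(CLINT \<omega>|N. iexp (t * (\<Sum>i. g (\<xi> i \<omega>) * indicator D (\<xi> i \<omega>)))) =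
    exp (CLINT x|\<nu>. indicator D x *\<^sub>R (iexp (t * g x) - 1))"
proof -
  define n where "n K x = nat \<lfloor>real (Suc K) * g x\<rfloor>" for K x
  define J where "J K = Suc K * C" for K
  define c where "c K j = real j / real (Suc K)" for K j
  define B where "B K j = {x \<in> D. n K x = j}" for K j
  define S where "S K \<omega> = (\<Sum>j\<le>J K. c K j * real (count (B K j) \<omega>))" for K \<omega>
  define SI where "SI \<omega> = (\<Sum>i. g (\<xi> i \<omega>) * indicator D (\<xi> i \<omega>))" for \<omega>
  have DS: "D \<subseteq> space \<nu>" using sets.sets_into_space[OF D] .
  have Bs [measurable]: "B K j \<in> sets \<nu>" for K j
  proof -
    have "B K j = D \<inter> {x \<in> space \<nu>. n K x = j}" using DS by (auto simp: B_def)
    moreover have [measurable]: "n K \<in> \<nu> \<rightarrow>\<^sub>M count_space UNIV" unfolding n_def[abs_def] by measurable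
    have "{x \<in> space \<nu>. n K x = j} \<in> sets \<nu>" by measurable
    ultimately show ?thesis using D by auto
  qed
  have BD: "B K j \<subseteq> D" for K j by (auto simp: B_def)
  have finB: "emeasure \<nu> (B K j) < \<infinity>" for K j
    using emeasure_mono[OF BD D] fin by (meson le_less_trans)
  have nJ: "n K x \<le> J K" if "x \<in> D" for K x
  proof -
    have "real (Suc K) * g x \<le> real (Suc K * C)"
      unfolding of_nat_mult using gC[OF that] by (intro mult_left_mono) auto
    then show ?thesis unfolding n_def J_def by (rule nat_floor_le)
  qed
  have approx: "\<bar>c K (n K x) - g x\<bar> \<le> 1 / real (Suc K)" if "x \<in> D" for K x
    unfolding c_def n_def by (rule grid_approx[OF g0[OF that]]) simp
  have gridlim: "(\<lambda>K. c K (n K x)) \<longlonglongrightarrow> g x" if "x \<in> D" for x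
  proof (rule LIM_zero_cancel, rule Lim_null_comparison)
    show "eventually (\<lambda>K. norm (c K (n K x) - g x) \<le> 1 / real (Suc K)) sequentially"
      using approx[OF that] by simp
    show "(\<lambda>K. 1 / real (Suc K)) \<longlonglongrightarrow> 0" by (rule lim_1_over_n[THEN LIMSEQ_Suc])
  qed
  have disj: "disjoint_family (B K)" for K by (auto simp: disjoint_family_on_def B_def)
  have charS: "(CLINT \<omega>|N. iexp (t * S K \<omega>)) =
      exp (CLINT x|\<nu>. indicator D x *\<^sub>R (iexp (t * c K (n K x)) - 1))" for K
  proof -
    have rg: "range (B K) \<subseteq> sets \<nu>" using Bs by blast
    have ind: "indep_vars (\<lambda>_. borel) (\<lambda>j \<omega>. iexp (t * c K j * real (count (B K j) \<omega>))) {..J K}"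
      by (rule indep_vars_subset[OF indep_count[OF rg disj, of "\<lambda>j k. iexp (t * c K j * real k)"]]) auto
    have "\<i> * of_real (t * S K \<omega>) = (\<Sum>j\<le>J K. \<i> * of_real (t * c K j * real (count (B K j) \<omega>)))" for \<omega>
      unfolding S_def sum_distrib_left of_real_sum by (intro sum.cong refl) (simp only: mult.assoc)
    then have "(CLINT \<omega>|N. iexp (t * S K \<omega>)) = (CLINT \<omega>|N. (\<Prod>j\<le>J K. iexp (t * c K j * real (count (B K j) \<omega>))))"
      by (simp only: exp_sum finite_atMost)
    also have "\<dots> = (\<Prod>j\<le>J K. CLINT \<omega>|N. iexp (t * c K j * real (count (B K j) \<omega>)))"
      by (intro indep_vars_lebesgue_integral ind integrable_const_bound[where B=1]) auto
    also have "\<dots> = (\<Prod>j\<le>J K. exp (of_real (measure \<nu> (B K j)) * (iexp (t * c K j) - 1)))"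
      by (intro prod.cong refl char_count finB Bs)
    also have "\<dots> = exp (\<Sum>j\<le>J K. of_real (measure \<nu> (B K j)) * (iexp (t * c K j) - 1))"
      by (simp only: exp_sum finite_atMost)
    also have "(\<Sum>j\<le>J K. of_real (measure \<nu> (B K j)) * (iexp (t * c K j) - 1)) =
        (\<Sum>j\<le>J K. CLINT x|\<nu>. indicator (B K j) x *\<^sub>R (iexp (t * c K j) - 1))"
    proof (intro sum.cong refl)
      fix j
      have "(CLINT x|\<nu>. indicator (B K j) x *\<^sub>R (iexp (t * c K j) - 1)) = measure \<nu> (B K j) *\<^sub>R (iexp (t * c K j) - 1)"
        using finB[of K j] BD[of K j] DS
        by (subst integral_scaleR_left) (auto intro!: integrable_real_indicator arg_cong2[where f=scaleR] arg_cong[where f="measure \<nu>"])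
      then show "of_real (measure \<nu> (B K j)) * (iexp (t * c K j) - 1) = (CLINT x|\<nu>. indicator (B K j) x *\<^sub>R (iexp (t * c K j) - 1))"
        by (simp only: scaleR_conv_of_real)
    qed
    also have "\<dots> = (CLINT x|\<nu>. (\<Sum>j\<le>J K. indicator (B K j) x *\<^sub>R (iexp (t * c K j) - 1)))"
      using finB by (intro Bochner_Integration.integral_sum[symmetric] integrable_scaleR_left integrable_real_indicator) auto
    also have "\<dots> = (CLINT x|\<nu>. indicator D x *\<^sub>R (iexp (t * c K (n K x)) - 1))"
    proof (rule Bochner_Integration.integral_cong[OF refl])
      fix x
      show "(\<Sum>j\<le>J K. indicator (B K j) x *\<^sub>R (iexp (t * c K j) - 1)) =
        indicator D x *\<^sub>R (iexp (t * c K (n K x)) - 1)"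
      proof (cases "x \<in> D")
        case True
        then have "(\<Sum>j\<le>J K. indicator (B K j) x *\<^sub>R (iexp (t * c K j) - 1)) =
          (\<Sum>j\<le>J K. if j = n K x then iexp (t * c K j) - 1 else 0)"
          by (intro sum.cong refl) (auto simp: B_def)
        also have "\<dots> = iexp (t * c K (n K x)) - 1" using nJ[OF True] by (subst sum.delta) auto
        finally show ?thesis using True by simp
      qed (auto simp: B_def)
    qed
    finally show ?thesis .
  qed
  have [measurable]: "SI \<in> borel_measurable N" unfolding SI_def[abs_def] by measurable
  have [measurable]: "S K \<in> borel_measurable N" for K unfolding S_def[abs_def] by measurable
  have lim1: "(\<lambda>K. CLINT \<omega>|N. iexp (t * S K \<omega>)) \<longlonglongrightarrow> (CLINT \<omega>|N. iexp (t * SI \<omega>))"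
  proof (rule integral_dominated_convergence[where w="\<lambda>_. 1"])
    show "AE \<omega> in N. (\<lambda>K. iexp (t * S K \<omega>)) \<longlonglongrightarrow> iexp (t * SI \<omega>)"
      using AE_finite_atoms[OF D fin]
    proof eventually_elim
      case (elim \<omega>)
      have "S K \<omega> = (\<Sum>i | \<xi> i \<omega> \<in> D. c K (n K (\<xi> i \<omega>)))" for K
        unfolding S_def count_def B_def by (rule sum_by_cells[symmetric, OF elim nJ])
      moreover have "(\<lambda>K. \<Sum>i | \<xi> i \<omega> \<in> D. c K (n K (\<xi> i \<omega>))) \<longlonglongrightarrow> (\<Sum>i | \<xi> i \<omega> \<in> D. g (\<xi> i \<omega>))"
        by (intro tendsto_sum gridlim) auto
      ultimately have "(\<lambda>K. S K \<omega>) \<longlonglongrightarrow> SI \<omega>"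
        unfolding SI_def indicator_sum_finite[OF elim] by simp
      then show ?case by (intro tendsto_intros)
    qed
  qed auto
  have intD: "integrable \<nu> (\<lambda>x. indicator D x * 2 :: real)"
    using fin by (intro integrable_mult_left integrable_real_indicator) auto
  have "(\<lambda>K. CLINT x|\<nu>. indicator D x *\<^sub>R (iexp (t * c K (n K x)) - 1)) \<longlonglongrightarrow>
      (CLINT x|\<nu>. indicator D x *\<^sub>R (iexp (t * g x) - 1))"
  proof (rule integral_dominated_convergence[OF _ _ intD])
    show "AE x in \<nu>. (\<lambda>K. indicator D x *\<^sub>R (iexp (t * c K (n K x)) - 1)) \<longlonglongrightarrow> indicator D x *\<^sub>R (iexp (t * g x) - 1)"
    proof (rule AE_I2)
      fix x show "(\<lambda>K. indicator D x *\<^sub>R (iexp (t * c K (n K x)) - 1)) \<longlonglongrightarrow> indicator D x *\<^sub>R (iexp (t * g x) - 1)"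
        by (cases "x \<in> D") (auto intro!: tendsto_intros gridlim)
    qed
    show "AE x in \<nu>. norm (indicator D x *\<^sub>R (iexp (t * c K (n K x)) - 1)) \<le> indicator D x * 2" for K
    proof (rule AE_I2)
      fix x show "norm (indicator D x *\<^sub>R (iexp (t * c K (n K x)) - 1)) \<le> indicator D x * 2"
        using norm_triangle_ineq4[of "iexp (t * c K (n K x))" 1] by (auto simp: indicator_def)
    qed
  qed (auto simp: n_def c_def)
  then have lim2: "(\<lambda>K. CLINT \<omega>|N. iexp (t * S K \<omega>)) \<longlonglongrightarrow>
      exp (CLINT x|\<nu>. indicator D x *\<^sub>R (iexp (t * g x) - 1))"
    unfolding charS by (rule tendsto_exp)
  show ?thesis using LIMSEQ_unique[OF lim1 lim2] unfolding SI_def .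
qed

end

text \<open>Integrand of the Levy-Khintchine formula with full compensation. Subtracting the linear
  term leaves an expression of order \<open>x\<^sup>2\<close>, integrable against \<open>nu\<close>
  even above 2, where the first moment is infinite.\<close>

definition levy_exponent :: "real \<Rightarrow> real \<Rightarrow> complex" where
  "levy_exponent t x = iexp (t * x) - 1 - \<i> * of_real (t * x)"

lemma levy_exponent_bound: "norm (levy_exponent t x) \<le> t\<^sup>2 / 2 * x\<^sup>2"
  using iexp_approx1[of "t * x" 1] by (simp add: levy_exponent_def power2_eq_square algebra_simps)

lemma levy_exponent_measurable [measurable]: "levy_exponent t \<in> borel_measurable borel"
  unfolding levy_exponent_def[abs_def] by measurable

section \<open>Compensated sums of the atoms of the intensity measure\<close>

locale nu_process = poisson_process N "nu \<alpha> c" \<xi>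
  for N :: "'c measure" and \<alpha> c :: real and \<xi> :: "nat \<Rightarrow> 'c \<Rightarrow> real" +
  assumes alpha: "\<alpha> \<in> {0<..<3} - {2}"
begin

abbreviation "\<nu> \<equiv> nu \<alpha> c"

lemma sets_nuI: "A \<in> sets borel \<Longrightarrow> A \<subseteq> {0<..2} \<Longrightarrow> A \<in> sets \<nu>"
  unfolding sets_nu by (subst sets_restrict_space_iff) auto

lemma atom_range: "\<omega> \<in> space N \<Longrightarrow> 0 < \<xi> i \<omega> \<and> \<xi> i \<omega> \<le> 2"
  using measurable_space[OF measurable_atom, of \<omega> i] by (simp add: space_nu)

lemma square_integrable: "integrable \<nu> (\<lambda>x. x\<^sup>2)"
  using nu_power(1)[OF alpha, of 2] by simp

text \<open>Chebyshev's inequality with the second moment of \<open>nu\<close>, which is finite in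
  both ranges of \<alpha>.\<close>

lemma finite_above:
  assumes "0 < \<delta>" shows "emeasure \<nu> {\<delta><..2} < \<infinity>"
proof -
  have [measurable]: "{\<delta><..2} \<in> sets \<nu>" using assms by (intro sets_nuI) auto
  have "emeasure \<nu> {\<delta><..2} = (\<integral>\<^sup>+x. indicator {\<delta><..2} x \<partial>\<nu>)" by simp
  also have "\<dots> \<le> (\<integral>\<^sup>+x. ennreal (x\<^sup>2 / \<delta>\<^sup>2) \<partial>\<nu>)"
  proof (rule nn_integral_mono)
    fix x
    show "indicator {\<delta><..2} x \<le> ennreal (x\<^sup>2 / \<delta>\<^sup>2)"
    proof (cases "x \<in> {\<delta><..2}")
      case True
      then have "1 \<le> x\<^sup>2 / \<delta>\<^sup>2" using assms by (simp add: power_mono)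
      then have "ennreal 1 \<le> ennreal (x\<^sup>2 / \<delta>\<^sup>2)" by (rule ennreal_leI)
      then show ?thesis using True by simp
    qed simp
  qed
  also have "\<dots> = ennreal (\<integral>x. x\<^sup>2 / \<delta>\<^sup>2 \<partial>\<nu>)"
    using square_integrable by (intro nn_integral_eq_integral) auto
  finally have le: "emeasure \<nu> {\<delta><..2} \<le> ennreal (\<integral>x. x\<^sup>2 / \<delta>\<^sup>2 \<partial>\<nu>)" .
  show ?thesis by (rule le_less_trans[OF le]) simp
qed

definition upper :: "nat \<Rightarrow> real set" where "upper m = {1 / real (Suc m)<..2}"

lemma upper_subset: "upper m \<subseteq> {0<..2}"
proof
  fix x assume "x \<in> upper m"
  moreover have "0 < 1 / real (Suc m)" by simp
  ultimately show "x \<in> {0<..2}" unfolding upper_def greaterThanAtMost_iff by linarith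
qed

lemma upper_sets [measurable]: "upper m \<in> sets \<nu>" "upper m \<in> sets borel"
  using upper_subset by (auto intro!: sets_nuI) (simp_all add: upper_def)

lemma upper_finite: "emeasure \<nu> (upper m) < \<infinity>"
  unfolding upper_def by (rule finite_above) simp

definition compensated_sum :: "nat \<Rightarrow> 'c \<Rightarrow> real" where
  "compensated_sum m \<omega> = (\<Sum>i. \<xi> i \<omega> * indicator (upper m) (\<xi> i \<omega>)) - (LINT x:upper m|\<nu>. x)"

lemma measurable_compensated_sum [measurable]: "compensated_sum m \<in> borel_measurable N"
proof -
  have [measurable]: "\<xi> i \<in> borel_measurable N" for i
    by (rule measurable_compose[OF measurable_atom]) measurable
  show ?thesis unfolding compensated_sum_def[abs_def] by measurable
qed

text \<open>Subtracting the mean multiplies the characteristic function by a deterministic phase,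
  and the phase supplies exactly the linear term of \<open>levy_exponent\<close>.\<close>

lemma char_compensated_sum: "(CLINT \<omega>|N. iexp (t * compensated_sum m \<omega>)) = exp (CLINT x|\<nu>. indicator (upper m) x *\<^sub>R levy_exponent t x)"
proof -
  define I where "I = (LINT x:upper m|\<nu>. x)"
  have "(CLINT \<omega>|N. iexp (t * compensated_sum m \<omega>)) =
      (CLINT \<omega>|N. iexp (t * (\<Sum>i. \<xi> i \<omega> * indicator (upper m) (\<xi> i \<omega>))) * exp (- (\<i> * of_real (t * I))))"
  proof (rule Bochner_Integration.integral_cong[OF refl])
    fix \<omega>
    have "\<i> * of_real (t * (s - I)) = \<i> * of_real (t * s) + - (\<i> * of_real (t * I))" for s
      by (simp add: algebra_simps)
    then show "iexp (t * compensated_sum m \<omega>) = iexp (t * (\<Sum>i. \<xi> i \<omega> * indicator (upper m) (\<xi> i \<omega>))) * exp (- (\<i> * of_real (t * I)))"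
      unfolding compensated_sum_def I_def[symmetric] by (simp only: exp_add)
  qed
  also have "\<dots> = (CLINT \<omega>|N. iexp (t * (\<Sum>i. \<xi> i \<omega> * indicator (upper m) (\<xi> i \<omega>)))) * exp (- (\<i> * of_real (t * I)))"
    by (rule integral_mult_left_zero)
  also have "(CLINT \<omega>|N. iexp (t * (\<Sum>i. \<xi> i \<omega> * indicator (upper m) (\<xi> i \<omega>)))) =
      exp (CLINT x|\<nu>. indicator (upper m) x *\<^sub>R (iexp (t * x) - 1))"
  proof (rule char_atom_sum[where g="\<lambda>x. x" and C=2, OF upper_sets(1) upper_finite])
    fix x assume "x \<in> upper m"
    then have "x \<in> {0<..2}" using upper_subset by blast
    then show "0 \<le> x" "x \<le> real 2" by auto
  qed simp
  also have "\<dots> * exp (- (\<i> * of_real (t * I))) =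
      exp ((CLINT x|\<nu>. indicator (upper m) x *\<^sub>R (iexp (t * x) - 1)) - \<i> * of_real (t * I))"
    by (simp add: exp_diff exp_minus divide_inverse)
  also have "\<i> * of_real (t * I) = (CLINT x|\<nu>. indicator (upper m) x *\<^sub>R (\<i> * of_real (t * x)))"
  proof -
    have "(CLINT x|\<nu>. indicator (upper m) x *\<^sub>R (\<i> * of_real (t * x))) =
      (CLINT x|\<nu>. \<i> * of_real t * of_real (indicator (upper m) x *\<^sub>R x))"
      by (intro Bochner_Integration.integral_cong) (auto simp: indicator_def)
    also have "\<dots> = \<i> * of_real t * of_real I"
      unfolding I_def set_lebesgue_integral_def by (simp only: integral_mult_right_zero integral_complex_of_real)
    finally show ?thesis by simp
  qed
  also have "(CLINT x|\<nu>. indicator (upper m) x *\<^sub>R (iexp (t * x) - 1)) - (CLINT x|\<nu>. indicator (upper m) x *\<^sub>R (\<i> * of_real (t * x))) =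
      (CLINT x|\<nu>. indicator (upper m) x *\<^sub>R levy_exponent t x)"
  proof (subst Bochner_Integration.integral_diff[symmetric])
    have ii: "integrable \<nu> (\<lambda>x. indicator (upper m) x * (2 + 2 * \<bar>t\<bar>) :: real)"
      using upper_finite by (intro integrable_mult_left integrable_real_indicator) auto
    show "integrable \<nu> (\<lambda>x. indicator (upper m) x *\<^sub>R (iexp (t * x) - 1))"
    proof (rule Bochner_Integration.integrable_bound[OF ii])
      show "AE x in \<nu>. norm (indicator (upper m) x *\<^sub>R (iexp (t * x) - 1)) \<le> norm (indicator (upper m) x * (2 + 2 * \<bar>t\<bar>) :: real)"
      proof (rule AE_I2)
        fix x show "norm (indicator (upper m) x *\<^sub>R (iexp (t * x) - 1)) \<le> norm (indicator (upper m) x * (2 + 2 * \<bar>t\<bar>) :: real)"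
          using norm_triangle_ineq4[of "iexp (t * x)" 1] by (auto simp: indicator_def)
      qed
    qed measurable
    show "integrable \<nu> (\<lambda>x. indicator (upper m) x *\<^sub>R (\<i> * of_real (t * x)))"
    proof (rule Bochner_Integration.integrable_bound[OF ii])
      show "AE x in \<nu>. norm (indicator (upper m) x *\<^sub>R (\<i> * of_real (t * x))) \<le> norm (indicator (upper m) x * (2 + 2 * \<bar>t\<bar>) :: real)"
      proof (rule AE_I2)
        fix x assume "x \<in> space \<nu>"
        then have "\<bar>t\<bar> * \<bar>x\<bar> \<le> \<bar>t\<bar> * 2" by (intro mult_left_mono) (auto simp: space_nu)
        then show "norm (indicator (upper m) x *\<^sub>R (\<i> * of_real (t * x))) \<le> norm (indicator (upper m) x * (2 + 2 * \<bar>t\<bar>) :: real)"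
          by (auto simp: indicator_def norm_mult abs_mult)
      qed
    qed measurable
  qed (auto intro!: Bochner_Integration.integral_cong simp: levy_exponent_def indicator_def)
  finally show ?thesis .
qed

lemma upper_eventually:
  assumes "0 < x" "x \<le> 2"
  shows "eventually (\<lambda>m. x \<in> upper m) sequentially"
proof -
  obtain j where j: "1 / real (Suc j) < x" using nat_approx_posE[OF assms(1)] by blast
  show ?thesis unfolding eventually_sequentially
  proof (intro exI allI impI)
    fix m assume "j \<le> m"
    then have "1 / real (Suc m) \<le> 1 / real (Suc j)" by (simp add: frac_le)
    then show "x \<in> upper m" using j assms by (simp add: upper_def)
  qed
qed

lemma levy_integrable: "integrable \<nu> (levy_exponent t)"
proof (rule Bochner_Integration.integrable_bound)
  show "integrable \<nu> (\<lambda>x. t\<^sup>2 / 2 * x\<^sup>2)" by (intro integrable_mult_right square_integrable)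
  show "AE x in \<nu>. norm (levy_exponent t x) \<le> norm (t\<^sup>2 / 2 * x\<^sup>2)"
    using levy_exponent_bound by (intro AE_I2) (simp add: abs_mult)
qed measurable

text \<open>Stated for an arbitrary almost sure limit \<open>Y\<close>, so that both readings of
  \<open>centred_atom_sum\<close> are covered at once.\<close>

lemma char_limit:
  assumes [measurable]: "Y \<in> borel_measurable N" and lim: "AE \<omega> in N. (\<lambda>m. compensated_sum m \<omega>) \<longlonglongrightarrow> Y \<omega>"
  shows "(CLINT \<omega>|N. iexp (t * Y \<omega>)) = exp (CLINT x|\<nu>. levy_exponent t x)"
proof -
  have 1: "(\<lambda>m. CLINT \<omega>|N. iexp (t * compensated_sum m \<omega>)) \<longlonglongrightarrow> (CLINT \<omega>|N. iexp (t * Y \<omega>))"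
  proof (rule integral_dominated_convergence[where w="\<lambda>_. 1"])
    show "AE \<omega> in N. (\<lambda>m. iexp (t * compensated_sum m \<omega>)) \<longlonglongrightarrow> iexp (t * Y \<omega>)"
      using lim by eventually_elim (intro tendsto_intros)
  qed auto
  have "(\<lambda>m. CLINT x|\<nu>. indicator (upper m) x *\<^sub>R levy_exponent t x) \<longlonglongrightarrow> (CLINT x|\<nu>. levy_exponent t x)"
  proof (rule integral_dominated_convergence)
    show "integrable \<nu> (\<lambda>x. norm (levy_exponent t x))" by (intro integrable_norm levy_integrable)
    show "AE x in \<nu>. (\<lambda>m. indicator (upper m) x *\<^sub>R levy_exponent t x) \<longlonglongrightarrow> levy_exponent t x"
    proof (rule AE_I2)
      fix x assume "x \<in> space \<nu>"
      then have "eventually (\<lambda>m. indicator (upper m) x *\<^sub>R levy_exponent t x = levy_exponent t x) sequentially"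
        using upper_eventually[of x] by (auto simp: space_nu elim!: eventually_mono)
      then show "(\<lambda>m. indicator (upper m) x *\<^sub>R levy_exponent t x) \<longlonglongrightarrow> levy_exponent t x"
        by (rule tendsto_eventually)
    qed
    show "AE x in \<nu>. norm (indicator (upper m) x *\<^sub>R levy_exponent t x) \<le> norm (levy_exponent t x)" for m
      by (rule AE_I2) (auto simp: indicator_def)
  qed measurable
  then have 2: "(\<lambda>m. CLINT \<omega>|N. iexp (t * compensated_sum m \<omega>)) \<longlonglongrightarrow> exp (CLINT x|\<nu>. levy_exponent t x)"
    unfolding char_compensated_sum by (rule tendsto_exp)
  show ?thesis by (rule LIMSEQ_unique[OF 1 2])
qed

text \<open>All atoms in the cell \<open>1 / (l + 1) < x \<le> 1 / l\<close> have size \<open>1 / (l + 1)\<close> up to \<open>x\<^sup>2\<close>. Hence the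
  compensated sum is a series of independent centred Poisson variables, to which Kolmogorov's
  theorem applies, plus an absolutely convergent rest.\<close>
definition cell :: "real \<Rightarrow> nat" where "cell x = nat \<lfloor>1 / x\<rfloor>"
definition cell_value :: "nat \<Rightarrow> real" where "cell_value l = 1 / real (Suc l)"
definition rest :: "real \<Rightarrow> real" where "rest x = x - cell_value (cell x)"

text \<open>With \<open>y = 1 / x\<close> and \<open>l\<close> its integer part, the rest is
  \<open>(l + 1 - y) / (y * (l + 1))\<close>: the numerator lies between 0 and 1 and the denominator
  is at least \<open>y * y\<close>. So the rests are integrable against \<open>nu\<close> although
  \<open>x\<close> itself need not be.\<close>

lemma rest_bounds:
  assumes "0 < x" shows "0 \<le> rest x" "rest x \<le> x\<^sup>2"
proof -
  define y where "y = 1 / x"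
  define l where "l = real (cell x)"
  have y: "0 < y" "x = 1 / y" using assms by (auto simp: y_def)
  have l: "l \<le> y" "y < l + 1" "0 \<le> l"
    using y by (auto simp: l_def cell_def y_def[symmetric])
  have eq: "rest x = (l + 1 - y) / (y * (l + 1))"
  proof -
    have "rest x = 1 / y - 1 / (l + 1)" unfolding rest_def cell_value_def l_def using y(2) by (simp add: add.commute)
    also have "\<dots> = (l + 1 - y) / (y * (l + 1))" using y(1) l(3) by (simp add: diff_frac_eq mult.commute)
    finally show ?thesis .
  qed
  show "0 \<le> rest x" unfolding eq using l y by simp
  have "(l + 1 - y) / (y * (l + 1)) \<le> 1 / (y * y)"
    using l y by (intro frac_le mult_left_mono) auto
  then show "rest x \<le> x\<^sup>2" unfolding eq using y by (simp add: power2_eq_square)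
qed

text \<open>Cutting the cells at reciprocals of integers makes every truncation level
  \<open>1 / (m + 1)\<close> a cell boundary: truncation keeps exactly the cells up to index
  \<open>m\<close>.\<close>

lemma in_upper_iff: "0 < x \<Longrightarrow> x \<le> 2 \<Longrightarrow> x \<in> upper m \<longleftrightarrow> cell x \<le> m"
proof -
  assume x: "0 < x" "x \<le> 2"
  have "x \<in> upper m \<longleftrightarrow> 1 / x < real (Suc m)" using x by (simp add: upper_def field_simps)
  also have "\<dots> \<longleftrightarrow> cell x \<le> m"
  proof -
    have "0 < 1 / x" using x by simp
    then show ?thesis unfolding cell_def by linarith
  qed
  finally show ?thesis .
qed

lemma cell_le: "x \<in> upper m \<Longrightarrow> cell x \<le> m"
  using upper_subset[of m] in_upper_iff[of x m] by auto

lemma cell_measurable [measurable]: "cell \<in> borel \<rightarrow>\<^sub>M count_space UNIV"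
  unfolding cell_def[abs_def] by measurable

lemma rest_measurable [measurable]: "rest \<in> borel_measurable borel"
  unfolding rest_def[abs_def] cell_value_def[abs_def] by measurable

lemma rest_integrable: "integrable \<nu> rest"
proof (rule Bochner_Integration.integrable_bound[OF square_integrable])
  show "AE x in \<nu>. norm (rest x) \<le> norm (x\<^sup>2)"
    using rest_bounds by (intro AE_I2) (auto simp: space_nu)
qed measurable

definition cells :: "nat \<Rightarrow> real set" where "cells l = {x \<in> {0<..2}. cell x = l}"

lemma cells_sets [measurable]: "cells l \<in> sets \<nu>"
proof -
  have "cells l = {x \<in> space borel. x \<in> {0<..2} \<and> cell x = l}" by (auto simp: cells_def)
  also have "\<dots> \<in> sets borel" by measurable
  finally show ?thesis by (intro sets_nuI) (auto simp: cells_def)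
qed

lemma cells_subset: "cells l \<subseteq> upper l"
  by (auto simp: cells_def in_upper_iff)

lemma cells_finite: "emeasure \<nu> (cells l) < \<infinity>"
  using emeasure_mono[OF cells_subset upper_sets(1)] upper_finite by (rule le_less_trans)

lemma upper_cells: "{x \<in> upper m. cell x = j} = (if j \<le> m then cells j else {})"
  using upper_subset[of m] by (auto simp: cells_def in_upper_iff)

text \<open>The terms are the variances of the centred cell contributions. The cell value is a lower
  bound for every point of its cell, so the sum is dominated by the second moment of
  \<open>nu\<close>.\<close>

lemma cells_summable: "summable (\<lambda>l. (cell_value l)\<^sup>2 * measure \<nu> (cells l))"
proof (rule summableI_nonneg_bounded)
  fix n
  show "0 \<le> (cell_value n)\<^sup>2 * measure \<nu> (cells n)" by simp
  have i: "integrable \<nu> (\<lambda>x. (cell_value l)\<^sup>2 * indicator (cells l) x)" for l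
    using cells_finite[of l] by (intro integrable_mult_right integrable_real_indicator) auto
  have "(\<Sum>l<n. (cell_value l)\<^sup>2 * measure \<nu> (cells l)) = (\<Sum>l<n. (\<integral>x. (cell_value l)\<^sup>2 * indicator (cells l) x \<partial>\<nu>))"
    using cells_finite sets.sets_into_space[OF cells_sets] by (intro sum.cong refl) (simp add: Int_absorb1)
  also have "\<dots> = (\<integral>x. (\<Sum>l<n. (cell_value l)\<^sup>2 * indicator (cells l) x) \<partial>\<nu>)"
    by (intro Bochner_Integration.integral_sum[symmetric] i)
  also have "\<dots> \<le> (\<integral>x. x\<^sup>2 \<partial>\<nu>)"
  proof (rule integral_mono[OF _ square_integrable])
    show "integrable \<nu> (\<lambda>x. \<Sum>l<n. (cell_value l)\<^sup>2 * indicator (cells l) x)"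
      by (intro Bochner_Integration.integrable_sum i)
    fix x assume "x \<in> space \<nu>"
    then have x: "0 < x" by (simp add: space_nu)
    have "(\<Sum>l<n. (cell_value l)\<^sup>2 * indicator (cells l) x) \<le> (\<Sum>l<n. if l = cell x then (cell_value l)\<^sup>2 else 0)"
      by (intro sum_mono) (auto simp: cells_def indicator_def)
    also have "\<dots> \<le> (cell_value (cell x))\<^sup>2" by (subst sum.delta) auto
    also have "\<dots> \<le> x\<^sup>2"
      using rest_bounds(1)[OF x] by (intro power_mono) (auto simp: rest_def cell_value_def)
    finally show "(\<Sum>l<n. (cell_value l)\<^sup>2 * indicator (cells l) x) \<le> x\<^sup>2" .
  qed
  finally show "(\<Sum>l<n. (cell_value l)\<^sup>2 * measure \<nu> (cells l)) \<le> (\<integral>x. x\<^sup>2 \<partial>\<nu>)" .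
qed

definition fluctuation :: "nat \<Rightarrow> 'c \<Rightarrow> real" where
  "fluctuation l \<omega> = cell_value l * (real (count (cells l) \<omega>) - measure \<nu> (cells l))"

lemma AE_fluctuation_series: "AE \<omega> in N. convergent (\<lambda>n. \<Sum>l<n. fluctuation l \<omega>)"
proof (rule AE_convergent_random_series)
  have "disjoint_family cells" by (auto simp: disjoint_family_on_def cells_def)
  moreover have "range cells \<subseteq> sets \<nu>" using cells_sets by blast
  ultimately show "indep_vars (\<lambda>_. borel) fluctuation UNIV"
    unfolding fluctuation_def[abs_def] by (intro indep_count)
  fix l
  note c = mean_count[OF cells_sets cells_finite, of l] square_count[OF cells_sets cells_finite, of l]
  have square: "(fluctuation l \<omega>)\<^sup>2 = (cell_value l)\<^sup>2 * ((real (count (cells l) \<omega>))\<^sup>2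
      - 2 * measure \<nu> (cells l) * real (count (cells l) \<omega>) + (measure \<nu> (cells l))\<^sup>2)" for \<omega>
    unfolding fluctuation_def by (simp add: power2_eq_square algebra_simps)
  show "integrable N (\<lambda>\<omega>. (fluctuation l \<omega>)\<^sup>2)" unfolding square using c
    by (intro integrable_mult_right Bochner_Integration.integrable_add Bochner_Integration.integrable_diff) auto
  show "expectation (fluctuation l) = 0" unfolding fluctuation_def[abs_def] using c by (simp add: prob_space)
  have "expectation (\<lambda>\<omega>. (fluctuation l \<omega>)\<^sup>2) = (cell_value l)\<^sup>2 * measure \<nu> (cells l)" for l
  proof -
    note c = mean_count[OF cells_sets cells_finite, of l] square_count[OF cells_sets cells_finite, of l]
    have square: "(fluctuation l \<omega>)\<^sup>2 = (cell_value l)\<^sup>2 * ((real (count (cells l) \<omega>))\<^sup>2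
        - 2 * measure \<nu> (cells l) * real (count (cells l) \<omega>) + (measure \<nu> (cells l))\<^sup>2)" for \<omega>
      unfolding fluctuation_def by (simp add: power2_eq_square algebra_simps)
    \<comment> \<open>The terms with the squared mean cancel: variance and mean of a Poisson count
      coincide.\<close>
    have "expectation (\<lambda>\<omega>. (fluctuation l \<omega>)\<^sup>2) = (cell_value l)\<^sup>2 * (((measure \<nu> (cells l))\<^sup>2 + measure \<nu> (cells l))
        - 2 * measure \<nu> (cells l) * measure \<nu> (cells l) + (measure \<nu> (cells l))\<^sup>2)"
      unfolding square using c by (simp add: prob_space)
    then show ?thesis by (simp add: power2_eq_square)
  qed
  then show "summable (\<lambda>l. expectation (\<lambda>\<omega>. (fluctuation l \<omega>)\<^sup>2))" using cells_summable by simp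
qed

lemma convergent_bounded_mono:
  fixes f :: "nat \<Rightarrow> real"
  assumes "incseq f" "\<And>n. f n \<le> b" shows "convergent f"
proof -
  obtain L where "f \<longlonglongrightarrow> L" using incseq_convergent[OF assms(1), of b] assms(2) by blast
  then show ?thesis by (rule convergentI)
qed

text \<open>The compensator decomposes along the same cells as the sum, so that the mean of each
  count can be subtracted cell by cell.\<close>

lemma compensator_split:
  "(LINT x:upper m|\<nu>. x) = (\<Sum>l<Suc m. cell_value l * measure \<nu> (cells l)) + (\<integral>x. indicator (upper m) x * rest x \<partial>\<nu>)"
proof -
  have i: "integrable \<nu> (\<lambda>x. cell_value l * indicator (cells l) x)" for l
    using cells_finite[of l] by (intro integrable_mult_right integrable_real_indicator) auto
  have ir: "integrable \<nu> (\<lambda>x. indicator (upper m) x * rest x)"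
    using integrable_real_mult_indicator[OF upper_sets(1) rest_integrable] by (simp add: mult.commute)
  have "(LINT x:upper m|\<nu>. x) = (\<integral>x. (\<Sum>l<Suc m. cell_value l * indicator (cells l) x) + indicator (upper m) x * rest x \<partial>\<nu>)"
    unfolding set_lebesgue_integral_def
  proof (rule Bochner_Integration.integral_cong[OF refl])
    fix x assume "x \<in> space \<nu>"
    then have x: "0 < x" "x \<le> 2" by (auto simp: space_nu)
    have "(\<Sum>l<Suc m. cell_value l * indicator (cells l) x) = (\<Sum>l<Suc m. if l = cell x then cell_value l else 0)"
      using x by (intro sum.cong refl) (auto simp: cells_def indicator_def)
    also have "\<dots> = (if cell x < Suc m then cell_value (cell x) else 0)" by (subst sum.delta) auto
    also have "\<dots> = indicator (upper m) x * cell_value (cell x)"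
      using in_upper_iff[OF x, of m] by (auto simp: indicator_def)
    finally have e: "(\<Sum>l<Suc m. cell_value l * indicator (cells l) x) = indicator (upper m) x * cell_value (cell x)" .
    show "indicator (upper m) x *\<^sub>R x = (\<Sum>l<Suc m. cell_value l * indicator (cells l) x) + indicator (upper m) x * rest x"
      unfolding e by (simp add: rest_def algebra_simps)
  qed
  also have "\<dots> = (\<Sum>l<Suc m. (\<integral>x. cell_value l * indicator (cells l) x \<partial>\<nu>)) + (\<integral>x. indicator (upper m) x * rest x \<partial>\<nu>)"
    by (simp only: Bochner_Integration.integral_add[OF Bochner_Integration.integrable_sum[OF i] ir] Bochner_Integration.integral_sum[OF i])
  also have "(\<Sum>l<Suc m. (\<integral>x. cell_value l * indicator (cells l) x \<partial>\<nu>)) = (\<Sum>l<Suc m. cell_value l * measure \<nu> (cells l))"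
    using sets.sets_into_space[OF cells_sets] by (intro sum.cong refl) (simp add: Int_absorb1)
  finally show ?thesis .
qed

lemma upper_mono: "m \<le> m' \<Longrightarrow> upper m \<subseteq> upper m'"
proof
  fix x assume m: "m \<le> m'" and x: "x \<in> upper m"
  then have "0 < x" "x \<le> 2" using upper_subset[of m] by auto
  then show "x \<in> upper m'" using in_upper_iff[of x] x m by auto
qed

text \<open>Truncated at a cell boundary, the compensated sum is a partial sum of the fluctuation
  series, plus the sum of the rests, minus the integral of the rest. The first converges by
  Kolmogorov's theorem, the other two because they are monotone and bounded.\<close>

lemma AE_compensated_sum_converges: "AE \<omega> in N. convergent (\<lambda>m. compensated_sum m \<omega>)"
proof -
  have fin: "AE \<omega> in N. \<forall>m. finite {i. \<xi> i \<omega> \<in> upper m}"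
    unfolding AE_all_countable by (intro allI AE_finite_atoms upper_sets upper_finite)
  have sm: "AE \<omega> in N. summable (\<lambda>i. rest (\<xi> i \<omega>))"
    using rest_bounds by (intro AE_summable rest_integrable) (auto simp: space_nu)
  have comp: "convergent (\<lambda>m. \<integral>x. indicator (upper m) x * rest x \<partial>\<nu>)"
  proof (rule convergent_bounded_mono)
    have i: "integrable \<nu> (\<lambda>x. indicator (upper m) x * rest x)" for m
      using integrable_real_mult_indicator[OF upper_sets(1) rest_integrable] by (simp add: mult.commute)
    show "incseq (\<lambda>m. \<integral>x. indicator (upper m) x * rest x \<partial>\<nu>)"
      unfolding incseq_def
    proof (intro allI impI integral_mono i)
      fix m m' :: nat and x assume "m \<le> m'" "x \<in> space \<nu>"
      then show "indicator (upper m) x * rest x \<le> indicator (upper m') x * rest x"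
        using upper_mono[of m m'] rest_bounds(1)[of x] by (auto simp: indicator_def space_nu)
    qed
    show "(\<integral>x. indicator (upper m) x * rest x \<partial>\<nu>) \<le> (\<integral>x. rest x \<partial>\<nu>)" for m
      using rest_bounds(1) by (intro integral_mono i rest_integrable) (auto simp: indicator_def space_nu)
  qed
  show ?thesis using fin sm AE_fluctuation_series AE_space
  proof eventually_elim
    case (elim \<omega>)
    then have fin: "\<And>m. finite {i. \<xi> i \<omega> \<in> upper m}" and \<omega>: "\<omega> \<in> space N" by auto
    have r0: "0 \<le> rest (\<xi> i \<omega>)" for i using rest_bounds(1) atom_range[OF \<omega>] by auto
    define \<rho> where "\<rho> m = (\<Sum>i | \<xi> i \<omega> \<in> upper m. rest (\<xi> i \<omega>))" for m
    have "convergent \<rho>"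
    proof (rule convergent_bounded_mono)
      show "incseq \<rho>" unfolding incseq_def \<rho>_def
        using upper_mono r0 fin by (intro allI impI sum_mono2) auto
      show "\<rho> m \<le> (\<Sum>i. rest (\<xi> i \<omega>))" for m
        unfolding \<rho>_def using elim r0 fin by (intro sum_le_suminf) auto
    qed
    moreover have "convergent (\<lambda>m. \<Sum>l<Suc m. fluctuation l \<omega>)"
      using elim by (simp only: convergent_Suc_iff[of "\<lambda>n. \<Sum>l<n. fluctuation l \<omega>"])
    ultimately have "convergent (\<lambda>m. (\<Sum>l<Suc m. fluctuation l \<omega>) + \<rho> m - (\<integral>x. indicator (upper m) x * rest x \<partial>\<nu>))"
      using comp by (intro convergent_add convergent_diff)
    moreover have "compensated_sum m \<omega> = (\<Sum>l<Suc m. fluctuation l \<omega>) + \<rho> m - (\<integral>x. indicator (upper m) x * rest x \<partial>\<nu>)" for m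
    proof -
      have "(\<Sum>i. \<xi> i \<omega> * indicator (upper m) (\<xi> i \<omega>)) = (\<Sum>i | \<xi> i \<omega> \<in> upper m. \<xi> i \<omega>)"
        by (rule indicator_sum_finite[OF fin, where h="\<lambda>x. x"])
      also have "\<dots> = (\<Sum>i | \<xi> i \<omega> \<in> upper m. cell_value (cell (\<xi> i \<omega>))) + \<rho> m"
        unfolding \<rho>_def by (simp add: rest_def sum_subtractf)
      also have "(\<Sum>i | \<xi> i \<omega> \<in> upper m. cell_value (cell (\<xi> i \<omega>))) =
          (\<Sum>j\<le>m. cell_value j * real (card {i. \<xi> i \<omega> \<in> {x \<in> upper m. cell x = j}}))"
        by (rule sum_by_cells[OF fin cell_le])
      also have "\<dots> = (\<Sum>j\<le>m. cell_value j * real (count (cells j) \<omega>))"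
        unfolding upper_cells by (intro sum.cong refl) (auto simp: count_def)
      also have "\<dots> = (\<Sum>j<Suc m. cell_value j * real (count (cells j) \<omega>))"
        by (simp only: lessThan_Suc_atMost)
      finally show ?thesis
        unfolding compensated_sum_def compensator_split fluctuation_def
        by (simp only: right_diff_distrib sum_subtractf)
    qed
    ultimately show ?case by simp
  qed
qed

text \<open>Above 2 the centred sum is by definition the limit in question. Below 2 the sum and the
  compensator converge separately, the latter to the first moment of \<open>nu\<close>.\<close>

lemma AE_centred_atom_sum: "AE \<omega> in N. (\<lambda>m. compensated_sum m \<omega>) \<longlonglongrightarrow> centred_atom_sum \<alpha> c \<xi> \<omega>"
proof (cases "\<alpha> < 2")
  case False
  then have "centred_atom_sum \<alpha> c \<xi> \<omega> = lim (\<lambda>m. compensated_sum m \<omega>)" for \<omega>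
    unfolding centred_atom_sum_def compensated_sum_def upper_def by simp
  then show ?thesis using AE_compensated_sum_converges by (simp add: convergent_LIMSEQ_iff)
next
  case True
  \<comment> \<open>Since this value does not vanish, \<open>limit_moment \<alpha> 1 = 1\<close>,
    and the first moment of \<open>nu\<close> is exactly \<open>c\<^sup>2\<close>.\<close>
  have "0 < Gamma (1 - \<alpha> / 2)" using True by (intro Gamma_real_pos) auto
  then have "Gamma (1 - \<alpha> / 2) \<noteq> 0" by linarith
  then have int: "integrable \<nu> (\<lambda>x. x)" "(\<integral>x. x \<partial>\<nu>) = c\<^sup>2"
    using nu_power[OF alpha, of 1 c] True by (auto simp: limit_moment_def)
  have fin: "AE \<omega> in N. \<forall>m. finite {i. \<xi> i \<omega> \<in> upper m}"
    unfolding AE_all_countable by (intro allI AE_finite_atoms upper_sets upper_finite)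
  have sm: "AE \<omega> in N. summable (\<lambda>i. \<xi> i \<omega>)"
    by (intro AE_summable[where f="\<lambda>x. x"] int) (auto simp: space_nu)
  have comp: "(\<lambda>m. LINT x:upper m|\<nu>. x) \<longlonglongrightarrow> c\<^sup>2"
    unfolding int(2)[symmetric] set_lebesgue_integral_def
  proof (rule integral_dominated_convergence[OF _ _ int(1)])
    show "AE x in \<nu>. (\<lambda>m. indicator (upper m) x *\<^sub>R x) \<longlonglongrightarrow> x"
    proof (rule AE_I2)
      fix x assume "x \<in> space \<nu>"
      then have "eventually (\<lambda>m. indicator (upper m) x *\<^sub>R x = x) sequentially"
        using upper_eventually[of x] by (auto simp: space_nu elim!: eventually_mono)
      then show "(\<lambda>m. indicator (upper m) x *\<^sub>R x) \<longlonglongrightarrow> x" by (rule tendsto_eventually)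
    qed
    show "AE x in \<nu>. norm (indicator (upper m) x *\<^sub>R x) \<le> x" for m
      by (rule AE_I2) (auto simp: indicator_def space_nu)
  qed measurable
  show ?thesis using sm AE_space
  proof eventually_elim
    case (elim \<omega>)
    have r: "0 < \<xi> i \<omega>" "\<xi> i \<omega> \<le> 2" for i using atom_range[OF elim(2)] by auto
    have "(\<lambda>m. \<Sum>i. \<xi> i \<omega> * indicator (upper m) (\<xi> i \<omega>)) \<longlonglongrightarrow> (\<Sum>i. \<xi> i \<omega>)"
    proof (rule conjunct2[OF conjunct2[OF tannerys_theorem[where M="\<lambda>i. \<xi> i \<omega>"]]])
      show "(\<lambda>m. \<xi> i \<omega> * indicator (upper m) (\<xi> i \<omega>)) \<longlonglongrightarrow> \<xi> i \<omega>" for i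
        by (intro tendsto_eventually eventually_mono[OF upper_eventually[OF r(1)[of i] r(2)[of i]]]) simp
      show "eventually (\<lambda>(i, m). norm (\<xi> i \<omega> * indicator (upper m) (\<xi> i \<omega>)) \<le> \<xi> i \<omega>) (at_top \<times>\<^sub>F sequentially)"
        using r by (intro always_eventually) (auto simp: indicator_def less_imp_le abs_of_pos)
    qed (use elim in auto)
    from tendsto_diff[OF this comp] show ?case
      unfolding compensated_sum_def centred_atom_sum_def using True by simp
  qed
qed

lemma measurable_centred_atom_sum [measurable]: "centred_atom_sum \<alpha> c \<xi> \<in> borel_measurable N"
proof -
  have [measurable]: "\<xi> i \<in> borel_measurable N" for i
    by (rule measurable_compose[OF measurable_atom]) measurable
  show ?thesis
  proof (cases "\<alpha> < 2")
    case True
    then show ?thesis unfolding centred_atom_sum_def[abs_def] by simp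
  next
    case False
    then have "centred_atom_sum \<alpha> c \<xi> = (\<lambda>\<omega>. lim (\<lambda>m. compensated_sum m \<omega>))"
      unfolding centred_atom_sum_def[abs_def] compensated_sum_def upper_def by simp
    then show ?thesis by simp
  qed
qed

theorem char_centred_atom_sum:
  "(CLINT \<omega>|N. iexp (t * centred_atom_sum \<alpha> c \<xi> \<omega>)) = exp (CLINT x|\<nu>. levy_exponent t x)"
  by (rule char_limit[OF measurable_centred_atom_sum AE_centred_atom_sum])

end

section \<open>Sums over pairs of independent variables\<close>

text \<open>The Taylor remainder is at most \<open>C\<^sup>2 * (s - t)\<^sup>2\<close> uniformly
  over the outcomes, because \<open>U\<close> is bounded by \<open>C\<close>.\<close>

lemma (in prob_space) char_has_vector_derivative:
  assumes [measurable]: "U \<in> borel_measurable M" and bd: "\<And>\<omega>. \<omega> \<in> space M \<Longrightarrow> \<bar>U \<omega>\<bar> \<le> C"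
  shows "((\<lambda>t. CLINT \<omega>|M. iexp (t * U \<omega>)) has_vector_derivative
    (CLINT \<omega>|M. \<i> * U \<omega> * iexp (t * U \<omega>))) (at t)"
proof -
  let ?f = "\<lambda>t. CLINT \<omega>|M. iexp (t * U \<omega>)"
  let ?f' = "CLINT \<omega>|M. \<i> * U \<omega> * iexp (t * U \<omega>)"
  have C: "0 \<le> C" using bd not_empty by (meson abs_ge_zero all_not_in_conv order_trans)
  have int1: "integrable M (\<lambda>\<omega>. iexp (s * U \<omega>))" for s
    by (rule integrable_const_bound[where B=1]) auto
  have int2: "integrable M (\<lambda>\<omega>. \<i> * U \<omega> * iexp (s * U \<omega>))" for s
    by (rule integrable_const_bound[where B=C]) (auto simp: norm_mult bd)
  have *: "norm (?f s - ?f t - (s - t) *\<^sub>R ?f') \<le> C\<^sup>2 * (s - t)\<^sup>2" for s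
  proof -
    have "?f s - ?f t - (s - t) *\<^sub>R ?f' =
      (CLINT \<omega>|M. iexp (s * U \<omega>) - iexp (t * U \<omega>) - (s - t) *\<^sub>R (\<i> * U \<omega> * iexp (t * U \<omega>)))"
      using int1 int2 by simp
    also have "norm \<dots> \<le> (LINT \<omega>|M. C\<^sup>2 * (s - t)\<^sup>2)"
    proof (rule order_trans[OF integral_norm_bound integral_mono])
      show "integrable M (\<lambda>\<omega>. norm (iexp (s * U \<omega>) - iexp (t * U \<omega>) - (s - t) *\<^sub>R (\<i> * U \<omega> * iexp (t * U \<omega>))))"
        using int1 int2 by (intro integrable_norm) simp
      show "integrable M (\<lambda>_. C\<^sup>2 * (s - t)\<^sup>2)" by simp
      fix \<omega> assume "\<omega> \<in> space M"
      let ?u = "(s - t) * U \<omega>"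
      have "iexp (s * U \<omega>) = iexp (t * U \<omega>) * iexp ?u"
        by (simp add: exp_add[symmetric] algebra_simps)
      then have "iexp (s * U \<omega>) - iexp (t * U \<omega>) - (s - t) *\<^sub>R (\<i> * U \<omega> * iexp (t * U \<omega>)) =
        iexp (t * U \<omega>) * (iexp ?u - (1 + \<i> * ?u))"
        by (simp add: algebra_simps scaleR_conv_of_real)
      also have "norm \<dots> \<le> ?u\<^sup>2 / 2"
        using iexp_approx1[of ?u 1] by (simp add: norm_mult power2_eq_square)
      also have "\<dots> \<le> (s - t)\<^sup>2 * (U \<omega>)\<^sup>2" by (simp add: power_mult_distrib)
      also have "\<dots> \<le> (s - t)\<^sup>2 * C\<^sup>2"
        using bd[OF \<open>\<omega> \<in> space M\<close>] C by (intro mult_left_mono) (auto simp: abs_le_square_iff[symmetric])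
      finally show "norm (iexp (s * U \<omega>) - iexp (t * U \<omega>) - (s - t) *\<^sub>R (\<i> * U \<omega> * iexp (t * U \<omega>)))
        \<le> C\<^sup>2 * (s - t)\<^sup>2" by (simp add: mult.commute)
    qed
    also have "\<dots> = C\<^sup>2 * (s - t)\<^sup>2" by (simp add: prob_space)
    finally show ?thesis .
  qed
  show ?thesis unfolding has_vector_derivative_def
  proof (rule has_derivativeI_sandwich[where e=1 and H="\<lambda>s. C\<^sup>2 * norm (s - t)"])
    show "bounded_linear (\<lambda>x. x *\<^sub>R ?f')" by (rule bounded_linear_scaleR_left)
    show "((\<lambda>s. C\<^sup>2 * norm (s - t)) \<longlongrightarrow> 0) (at t)"
      by (auto intro!: tendsto_eq_intros)
    fix s assume "s \<noteq> t"
    show "norm (?f s - ?f t - (s - t) *\<^sub>R ?f') / norm (s - t) \<le> C\<^sup>2 * norm (s - t)"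
    proof -
      have "norm (?f s - ?f t - (s - t) *\<^sub>R ?f') \<le> C\<^sup>2 * norm (s - t) * norm (s - t)"
        using *[of s] by (simp add: power2_eq_square abs_mult[symmetric] mult.assoc)
      then show ?thesis using \<open>s \<noteq> t\<close> by (simp add: pos_divide_le_eq)
    qed
  qed simp
qed

section \<open>Index pairs and pairs that share an index\<close>

definition pairs :: "nat \<Rightarrow> (nat \<times> nat) set" where
  "pairs p = {(i, j). i < j \<and> j < p}"

lemma pairs_Suc: "pairs (Suc p) = pairs p \<union> (\<lambda>i. (i, p)) ` {..<p}"
  by (auto simp: pairs_def image_iff less_Suc_eq)

lemma finite_pairs [simp]: "finite (pairs p)"
  by (rule finite_subset[of _ "{..<p} \<times> {..<p}"]) (auto simp: pairs_def)

lemma card_pairs: "real (card (pairs p)) = real p * (real p - 1) / 2"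
proof (induction p)
  case (Suc p)
  have "card (pairs (Suc p)) = card (pairs p) + p"
    unfolding pairs_Suc by (subst card_Un_disjoint) (simp_all add: card_image inj_on_def, auto simp: pairs_def)
  with Suc show ?case by (simp add: field_simps)
qed (simp add: pairs_def)

lemma card_pairs_le: "real (card (pairs p)) \<le> (real p)\<^sup>2 / 2"
  unfolding card_pairs by (simp add: power2_eq_square algebra_simps)

definition nbrs :: "nat \<Rightarrow> nat \<times> nat \<Rightarrow> (nat \<times> nat) set" where
  "nbrs p P = {Q \<in> pairs p. Q \<noteq> P \<and> {fst P, snd P} \<inter> {fst Q, snd Q} \<noteq> {}}"

lemma finite_nbrs [simp]: "finite (nbrs p P)"
  by (rule finite_subset[OF _ finite_pairs[of p]]) (auto simp: nbrs_def)

text \<open>A neighbour is determined by the index that it shares with \<open>P\<close> and by its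
  other index, after sorting.\<close>

lemma card_nbrs: "card (nbrs p P) \<le> 2 * p"
proof -
  let ?f = "\<lambda>(r, u). (min r u, max r u)"
  have "nbrs p P \<subseteq> ?f ` ({fst P, snd P} \<times> {..<p})"
  proof (rule subsetI)
    fix Q assume Q: "Q \<in> nbrs p P"
    obtain i j where ij: "Q = (i, j)" by (cases Q)
    with Q have "i < j" "j < p" by (auto simp: nbrs_def pairs_def)
    moreover have "i \<in> {fst P, snd P} \<or> j \<in> {fst P, snd P}" using Q ij by (auto simp: nbrs_def)
    ultimately show "Q \<in> ?f ` ({fst P, snd P} \<times> {..<p})"
    proof (elim disjE)
      assume "i \<in> {fst P, snd P}" with \<open>i < j\<close> \<open>j < p\<close> ij show ?thesis
        by (intro image_eqI[of _ _ "(i, j)"]) auto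
    next
      assume "j \<in> {fst P, snd P}" with \<open>i < j\<close> \<open>j < p\<close> ij show ?thesis
        by (intro image_eqI[of _ _ "(j, i)"]) auto
    qed
  qed
  then have "card (nbrs p P) \<le> card (?f ` ({fst P, snd P} \<times> {..<p}))"
    by (intro card_mono) auto
  also have "\<dots> \<le> card ({fst P, snd P} \<times> {..<p})" by (intro card_image_le) auto
  also have "\<dots> \<le> 2 * p" by (simp add: card_cartesian_product card_insert_if)
  finally show ?thesis .
qed

text \<open>The ways in which two distinct increasing pairs can meet all reduce to one common index
  \<open>r\<close> and two further distinct ones. For a symmetric kernel the order within a pair is
  then irrelevant.\<close>

lemma nbrs_cases:
  assumes "P \<in> pairs p" "Q \<in> nbrs p P"
  obtains r s u where "r < p" "s < p" "u < p" "r \<noteq> s" "r \<noteq> u" "s \<noteq> u"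
    "P = (r, s) \<or> P = (s, r)" "Q = (r, u) \<or> Q = (u, r)"
proof -
  obtain i j k l where P: "P = (i, j)" "Q = (k, l)" by (metis surj_pair)
  then have *: "i < j" "j < p" "k < l" "l < p" "i \<noteq> k \<or> j \<noteq> l" "i = k \<or> i = l \<or> j = k \<or> j = l"
    using assms by (auto simp: nbrs_def pairs_def)
  then consider "i = k" "j \<noteq> l" | "i = l" | "j = k" | "j = l" "i \<noteq> k" by auto
  then show ?thesis
  proof cases
    case 1 with * P that[of i j l] show ?thesis by auto
  next
    case 2 with * P that[of i j k] show ?thesis by auto
  next
    case 3 with * P that[of j i l] show ?thesis by auto
  next
    case 4 with * P that[of j i k] show ?thesis by auto
  qed
qed

section \<open>Symmetric kernels summed over pairs of independent rows\<close>

locale iid_family = prob_space M + D: prob_space D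
  for M :: "'a measure" and D :: "'s measure" +
  fixes \<zeta> :: "nat \<Rightarrow> 'a \<Rightarrow> 's" and p :: nat
  assumes indep: "indep_vars (\<lambda>_. D) \<zeta> {..<p}"
    and law: "i < p \<Longrightarrow> distr M D (\<zeta> i) = D"
begin

lemma measurable_row [measurable (raw)]: "i < p \<Longrightarrow> \<zeta> i \<in> M \<rightarrow>\<^sub>M D"
  using indep by (auto simp: indep_vars_def)

lemma indep_rows2:
  assumes "i < p" "j < p" "i \<noteq> j"
  shows "indep_var D (\<zeta> i) D (\<zeta> j)"
proof -
  have "indep_var D ((\<lambda>x. x i) \<circ> (\<lambda>\<omega>. restrict (\<lambda>i. \<zeta> i \<omega>) {i})) D ((\<lambda>x. x j) \<circ> (\<lambda>\<omega>. restrict (\<lambda>i. \<zeta> i \<omega>) {j}))"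
    using assms by (intro indep_var_compose[OF indep_var_restrict[OF indep]]) auto
  then show ?thesis by (simp add: comp_def)
qed

lemma pair_law:
  assumes "i < p" "j < p" "i \<noteq> j"
  shows "distr M (D \<Otimes>\<^sub>M D) (\<lambda>\<omega>. (\<zeta> i \<omega>, \<zeta> j \<omega>)) = D \<Otimes>\<^sub>M D"
  using indep_rows2[OF assms] law assms by (auto simp: indep_var_distribution_eq)

lemma triple_law:
  assumes "i < p" "j < p" "l < p" "i \<noteq> j" "i \<noteq> l" "j \<noteq> l"
  shows "distr M (D \<Otimes>\<^sub>M (D \<Otimes>\<^sub>M D)) (\<lambda>\<omega>. (\<zeta> i \<omega>, (\<zeta> j \<omega>, \<zeta> l \<omega>))) = D \<Otimes>\<^sub>M (D \<Otimes>\<^sub>M D)"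
proof -
  let ?RA = "\<lambda>\<omega>. restrict (\<lambda>i. \<zeta> i \<omega>) {i}" and ?RB = "\<lambda>\<omega>. restrict (\<lambda>i. \<zeta> i \<omega>) {j, l}"
  let ?A = "PiM {i} (\<lambda>_. D)" and ?B = "PiM {j, l} (\<lambda>_. D)"
  let ?f = "\<lambda>x. x i" and ?g = "\<lambda>x. (x j, x l)"
  have [measurable]: "?RA \<in> M \<rightarrow>\<^sub>M ?A" "?RB \<in> M \<rightarrow>\<^sub>M ?B"
    using assms by (auto intro!: measurable_restrict measurable_row)
  have [measurable]: "?f \<in> ?A \<rightarrow>\<^sub>M D" "?g \<in> ?B \<rightarrow>\<^sub>M D \<Otimes>\<^sub>M D" by measurable
  have [measurable]: "\<zeta> i \<in> M \<rightarrow>\<^sub>M D" "\<zeta> j \<in> M \<rightarrow>\<^sub>M D" "\<zeta> l \<in> M \<rightarrow>\<^sub>M D" using assms by auto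
  have ind: "indep_var ?A ?RA ?B ?RB" using assms by (intro indep_var_restrict[OF indep]) auto
  interpret RB: prob_space "distr M ?B ?RB" by (rule prob_space_distr) simp
  have sf: "sigma_finite_measure (distr (distr M ?B ?RB) (D \<Otimes>\<^sub>M D) ?g)"
    by (intro prob_space_imp_sigma_finite RB.prob_space_distr) simp
  have "distr M (D \<Otimes>\<^sub>M (D \<Otimes>\<^sub>M D)) (\<lambda>\<omega>. (\<zeta> i \<omega>, (\<zeta> j \<omega>, \<zeta> l \<omega>))) =
    distr (distr M (?A \<Otimes>\<^sub>M ?B) (\<lambda>\<omega>. (?RA \<omega>, ?RB \<omega>))) (D \<Otimes>\<^sub>M (D \<Otimes>\<^sub>M D)) (\<lambda>(x, y). (?f x, ?g y))"
    by (subst distr_distr) (auto simp: comp_def)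
  also have "distr M (?A \<Otimes>\<^sub>M ?B) (\<lambda>\<omega>. (?RA \<omega>, ?RB \<omega>)) = distr M ?A ?RA \<Otimes>\<^sub>M distr M ?B ?RB"
    using ind by (simp add: indep_var_distribution_eq)
  also have "distr (distr M ?A ?RA \<Otimes>\<^sub>M distr M ?B ?RB) (D \<Otimes>\<^sub>M (D \<Otimes>\<^sub>M D)) (\<lambda>(x, y). (?f x, ?g y)) =
      distr (distr M ?A ?RA) D ?f \<Otimes>\<^sub>M distr (distr M ?B ?RB) (D \<Otimes>\<^sub>M D) ?g"
    by (intro pair_measure_distr[symmetric] sf) simp_all
  also have "distr (distr M ?A ?RA) D ?f = D"
    using law assms by (subst distr_distr) (auto simp: comp_def)
  also have "distr (distr M ?B ?RB) (D \<Otimes>\<^sub>M D) ?g = D \<Otimes>\<^sub>M D"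
    using pair_law[of j l] assms by (subst distr_distr) (auto simp: comp_def)
  finally show ?thesis .
qed

definition at_pair :: "('s \<Rightarrow> 's \<Rightarrow> real) \<Rightarrow> nat \<times> nat \<Rightarrow> 'a \<Rightarrow> real" where
  "at_pair h P \<omega> = h (\<zeta> (fst P) \<omega>) (\<zeta> (snd P) \<omega>)"

lemma at_pair_measurable [measurable (raw)]:
  assumes "case_prod h \<in> borel_measurable (D \<Otimes>\<^sub>M D)" "P \<in> pairs p"
  shows "at_pair h P \<in> borel_measurable M"
proof -
  have "(\<lambda>\<omega>. case_prod h (\<zeta> (fst P) \<omega>, \<zeta> (snd P) \<omega>)) \<in> borel_measurable M"
    using assms by (intro measurable_compose[OF _ assms(1)] measurable_Pair measurable_row) (auto simp: pairs_def)
  then show ?thesis by (simp add: at_pair_def[abs_def])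
qed

lemma integral_at_pair:
  fixes f :: "real \<Rightarrow> 'e::{banach, second_countable_topology}"
  assumes [measurable]: "case_prod h \<in> borel_measurable (D \<Otimes>\<^sub>M D)" "f \<in> borel_measurable borel"
    and P: "P \<in> pairs p"
  shows "(\<integral>\<omega>. f (at_pair h P \<omega>) \<partial>M) = (\<integral>z. f (case_prod h z) \<partial>(D \<Otimes>\<^sub>M D))"
proof -
  have P': "fst P < p" "snd P < p" "fst P \<noteq> snd P" using P by (auto simp: pairs_def)
  have [measurable]: "\<zeta> (fst P) \<in> M \<rightarrow>\<^sub>M D" "\<zeta> (snd P) \<in> M \<rightarrow>\<^sub>M D" using P' by auto
  have "(\<integral>z. f (case_prod h z) \<partial>(distr M (D \<Otimes>\<^sub>M D) (\<lambda>\<omega>. (\<zeta> (fst P) \<omega>, \<zeta> (snd P) \<omega>)))) =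
    (\<integral>\<omega>. f (at_pair h P \<omega>) \<partial>M)"
    unfolding at_pair_def by (subst integral_distr) simp_all
  with pair_law[OF P'] show ?thesis by simp
qed

text \<open>Neighbouring pairs involve exactly three distinct rows; symmetry of \<open>h\<close>
  allows the shared row to be written as the first argument of both kernels.\<close>

lemma integral_at_nbrs:
  fixes f :: "real \<Rightarrow> real \<Rightarrow> real"
  assumes [measurable]: "case_prod h \<in> borel_measurable (D \<Otimes>\<^sub>M D)"
    "case_prod f \<in> borel_measurable (borel \<Otimes>\<^sub>M borel)"
    and sym: "\<And>x y. h x y = h y x"
    and P: "P \<in> pairs p" "Q \<in> nbrs p P"
  shows "(\<integral>\<omega>. f (at_pair h P \<omega>) (at_pair h Q \<omega>) \<partial>M) =
    (\<integral>(x, y, z). f (h x y) (h x z) \<partial>(D \<Otimes>\<^sub>M (D \<Otimes>\<^sub>M D)))"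
proof -
  obtain r s u where *: "r < p" "s < p" "u < p" "r \<noteq> s" "r \<noteq> u" "s \<noteq> u"
    "P = (r, s) \<or> P = (s, r)" "Q = (r, u) \<or> Q = (u, r)" using nbrs_cases[OF P] .
  have [measurable]: "\<zeta> r \<in> M \<rightarrow>\<^sub>M D" "\<zeta> s \<in> M \<rightarrow>\<^sub>M D" "\<zeta> u \<in> M \<rightarrow>\<^sub>M D" using * by auto
  have "(\<integral>(x, y, z). f (h x y) (h x z) \<partial>(distr M (D \<Otimes>\<^sub>M (D \<Otimes>\<^sub>M D)) (\<lambda>\<omega>. (\<zeta> r \<omega>, (\<zeta> s \<omega>, \<zeta> u \<omega>))))) =
    (\<integral>\<omega>. f (h (\<zeta> r \<omega>) (\<zeta> s \<omega>)) (h (\<zeta> r \<omega>) (\<zeta> u \<omega>)) \<partial>M)"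
    by (subst integral_distr) simp_all
  also have "\<dots> = (\<integral>\<omega>. f (at_pair h P \<omega>) (at_pair h Q \<omega>) \<partial>M)"
    using *(7,8) sym by (auto simp: at_pair_def)
  finally show ?thesis using triple_law[OF *(1-6)] by simp
qed

lemma indep_at_disjoint:
  assumes [measurable]: "case_prod h \<in> borel_measurable (D \<Otimes>\<^sub>M D)"
    and P: "P \<in> pairs p" and R: "R \<subseteq> pairs p"
    and dj: "\<And>Q. Q \<in> R \<Longrightarrow> {fst P, snd P} \<inter> {fst Q, snd Q} = {}"
  shows "indep_var borel (at_pair h P) borel (\<lambda>\<omega>. \<Sum>Q\<in>R. at_pair h Q \<omega>)"
proof -
  let ?A = "{fst P, snd P}"
  have P': "fst P < p" "snd P < p" using P by (auto simp: pairs_def)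
  have R': "\<And>Q. Q \<in> R \<Longrightarrow> fst Q < p \<and> snd Q < p \<and> fst Q \<notin> ?A \<and> snd Q \<notin> ?A"
    using R dj by (fastforce simp: pairs_def)
  have "indep_var borel ((\<lambda>x. h (x (fst P)) (x (snd P))) \<circ> (\<lambda>\<omega>. restrict (\<lambda>i. \<zeta> i \<omega>) ?A))
      borel ((\<lambda>x. \<Sum>Q\<in>R. h (x (fst Q)) (x (snd Q))) \<circ> (\<lambda>\<omega>. restrict (\<lambda>i. \<zeta> i \<omega>) ({..<p} - ?A)))"
    using P' R' by (intro indep_var_compose[OF indep_var_restrict[OF indep]])
      (auto intro!: borel_measurable_sum)
  also have "(\<lambda>x. h (x (fst P)) (x (snd P))) \<circ> (\<lambda>\<omega>. restrict (\<lambda>i. \<zeta> i \<omega>) ?A) = at_pair h P"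
    by (simp add: fun_eq_iff at_pair_def)
  also have "(\<lambda>x. \<Sum>Q\<in>R. h (x (fst Q)) (x (snd Q))) \<circ> (\<lambda>\<omega>. restrict (\<lambda>i. \<zeta> i \<omega>) ({..<p} - ?A)) =
      (\<lambda>\<omega>. \<Sum>Q\<in>R. at_pair h Q \<omega>)"
    using R' by (auto simp: fun_eq_iff at_pair_def intro!: sum.cong)
  finally show ?thesis .
qed

text \<open>When the square is expanded, disjoint pairs contribute 0 by independence and centring,
  equal pairs the variance, and each of the at most \<open>2 * p\<close> neighbours of a pair the
  triple integral. With at most \<open>(real p)\<^sup>2 / 2\<close> pairs this gives the factor
  \<open>real p ^ 3\<close>.\<close>

lemma second_moment_pair_sum:
  assumes [measurable]: "case_prod h \<in> borel_measurable (D \<Otimes>\<^sub>M D)"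
    and sym: "\<And>x y. h x y = h y x"
    and bd: "\<And>x y. x \<in> space D \<Longrightarrow> y \<in> space D \<Longrightarrow> \<bar>h x y\<bar> \<le> B"
    and mean0: "(\<integral>z. case_prod h z \<partial>(D \<Otimes>\<^sub>M D)) = 0"
  shows "(\<integral>\<omega>. (\<Sum>P\<in>pairs p. at_pair h P \<omega>)\<^sup>2 \<partial>M) \<le>
    (real p)\<^sup>2 / 2 * (\<integral>(x, y). (h x y)\<^sup>2 \<partial>(D \<Otimes>\<^sub>M D)) +
    real p ^ 3 * \<bar>\<integral>(x, y, z). h x y * h x z \<partial>(D \<Otimes>\<^sub>M (D \<Otimes>\<^sub>M D))\<bar>"
proof -
  define v where "v = (\<integral>(x, y). (h x y)\<^sup>2 \<partial>(D \<Otimes>\<^sub>M D))"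
  define g where "g = (\<integral>(x, y, z). h x y * h x z \<partial>(D \<Otimes>\<^sub>M (D \<Otimes>\<^sub>M D)))"
  have v0: "0 \<le> v" unfolding v_def by (intro integral_nonneg_AE) auto
  have space: "P \<in> pairs p \<Longrightarrow> \<omega> \<in> space M \<Longrightarrow> \<zeta> (fst P) \<omega> \<in> space D \<and> \<zeta> (snd P) \<omega> \<in> space D" for P \<omega>
    by (auto simp: pairs_def intro!: measurable_space[OF measurable_row])
  have bdP: "P \<in> pairs p \<Longrightarrow> \<omega> \<in> space M \<Longrightarrow> \<bar>at_pair h P \<omega>\<bar> \<le> B" for P \<omega>
    using space bd by (auto simp: at_pair_def)
  have intP: "P \<in> pairs p \<Longrightarrow> integrable M (at_pair h P)" for P
    by (rule integrable_const_bound[where B=B]) (auto simp: bdP)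
  have intPQ: "integrable M (\<lambda>\<omega>. at_pair h P \<omega> * at_pair h Q \<omega>)" if "P \<in> pairs p" "Q \<in> pairs p" for P Q
  proof (rule integrable_const_bound[where B="B * B"])
    show "AE \<omega> in M. norm (at_pair h P \<omega> * at_pair h Q \<omega>) \<le> B * B"
    proof (rule AE_I2)
      fix \<omega> assume "\<omega> \<in> space M"
      then have "\<bar>at_pair h P \<omega>\<bar> \<le> B" "\<bar>at_pair h Q \<omega>\<bar> \<le> B" using bdP that by auto
      then show "norm (at_pair h P \<omega> * at_pair h Q \<omega>) \<le> B * B"
        unfolding real_norm_def abs_mult by (intro mult_mono) linarith+
    qed
  qed (use that in measurable)
  have "(\<integral>\<omega>. (\<Sum>P\<in>pairs p. at_pair h P \<omega>)\<^sup>2 \<partial>M) =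
    (\<Sum>P\<in>pairs p. \<Sum>Q\<in>pairs p. \<integral>\<omega>. at_pair h P \<omega> * at_pair h Q \<omega> \<partial>M)"
    unfolding power2_eq_square sum_product using intPQ by simp
  also have "\<dots> \<le> (\<Sum>P\<in>pairs p. v + 2 * real p * \<bar>g\<bar>)"
  proof (rule sum_mono)
    fix P assume P: "P \<in> pairs p"
    let ?e = "\<lambda>Q. \<integral>\<omega>. at_pair h P \<omega> * at_pair h Q \<omega> \<partial>M"
    let ?d = "pairs p - insert P (nbrs p P)"
    have split: "pairs p = insert P (nbrs p P) \<union> ?d" using P by (auto simp: nbrs_def)
    have "(\<Sum>Q\<in>pairs p. ?e Q) = (\<Sum>Q\<in>insert P (nbrs p P). ?e Q) + (\<Sum>Q\<in>?d. ?e Q)"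
      by (subst split, rule sum.union_disjoint) auto
    also have "(\<Sum>Q\<in>?d. ?e Q) = 0"
    proof (rule sum.neutral, rule ballI)
      fix Q assume Q: "Q \<in> ?d"
      then have Q': "Q \<in> pairs p" "{fst P, snd P} \<inter> {fst Q, snd Q} = {}" by (auto simp: nbrs_def)
      have "indep_var borel (at_pair h P) borel (\<lambda>\<omega>. \<Sum>Q\<in>{Q}. at_pair h Q \<omega>)"
        by (rule indep_at_disjoint) (use P Q' in auto)
      then have ind: "indep_var borel (at_pair h P) borel (at_pair h Q)" by simp
      note e = indep_var_lebesgue_integral[OF ind intP[OF P] intP[OF Q'(1)]]
      have m: "(\<integral>\<omega>. at_pair h P \<omega> \<partial>M) = 0"
        by (rule trans[OF integral_at_pair[OF assms(1) measurable_ident P, unfolded id_def] mean0])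
      show "?e Q = 0" unfolding e m by (rule mult_zero_left)
    qed
    also have "(\<Sum>Q\<in>insert P (nbrs p P). ?e Q) = ?e P + (\<Sum>Q\<in>nbrs p P. ?e Q)"
      by (rule sum.insert) (auto simp: nbrs_def)
    also have "?e P = v"
      using integral_at_pair[OF assms(1) _ P, of "\<lambda>x. x * x"]
      by (simp only: v_def power2_eq_square split_beta') simp
    also have "(\<Sum>Q\<in>nbrs p P. ?e Q) = card (nbrs p P) * g"
      by (subst sum.cong[OF refl integral_at_nbrs[OF assms(1) _ sym P, of "\<lambda>x y. x * y"]]) (auto simp: g_def)
    also have "card (nbrs p P) * g \<le> 2 * real p * \<bar>g\<bar>"
    proof -
      have "card (nbrs p P) * g \<le> card (nbrs p P) * \<bar>g\<bar>" by (intro mult_left_mono) auto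
      also have "\<dots> \<le> 2 * real p * \<bar>g\<bar>"
        using card_nbrs[of p P] by (intro mult_right_mono) auto
      finally show ?thesis .
    qed
    finally show "(\<Sum>Q\<in>pairs p. ?e Q) \<le> v + 2 * real p * \<bar>g\<bar>" by simp
  qed
  also have "\<dots> = card (pairs p) * (v + 2 * real p * \<bar>g\<bar>)" by simp
  also have "\<dots> \<le> (real p)\<^sup>2 / 2 * (v + 2 * real p * \<bar>g\<bar>)"
    by (intro mult_right_mono card_pairs_le add_nonneg_nonneg v0) auto
  also have "\<dots> = (real p)\<^sup>2 / 2 * v + real p ^ 3 * \<bar>g\<bar>"
    by (simp add: algebra_simps power2_eq_square power3_eq_cube)
  finally show ?thesis unfolding v_def g_def .
qed

text \<open>Leaving out the pairs that meet a given pair makes the remaining sum independent of it, so the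
  characteristic function \<open>\<phi>\<close> of the whole sum nearly solves \<open>\<phi>' = N \<psi>' \<phi>\<close>, where \<open>\<psi>\<close> belongs to a
  single summand. The solution of this equation is the compound Poisson \<open>exp (N (\<psi> - 1))\<close>.\<close>
lemma char_pair_sum:
  assumes h [measurable]: "case_prod h \<in> borel_measurable (D \<Otimes>\<^sub>M D)"
    and sym: "\<And>x y. h x y = h y x"
    and bd: "\<And>x y. x \<in> space D \<Longrightarrow> y \<in> space D \<Longrightarrow> \<bar>h x y\<bar> \<le> B" and B: "0 \<le> B"
    and q: "(\<integral>(x, y). of_bool (h x y \<noteq> 0) \<partial>(D \<Otimes>\<^sub>M D)) = q"
    and \<gamma>: "(\<integral>(x, y, z). of_bool (h x y \<noteq> 0 \<and> h x z \<noteq> 0) \<partial>(D \<Otimes>\<^sub>M (D \<Otimes>\<^sub>M D))) = \<gamma>"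
  shows "norm ((CLINT \<omega>|M. iexp (t * (\<Sum>P\<in>pairs p. at_pair h P \<omega>))) -
      exp (of_nat (card (pairs p)) * ((CLINT z|(D \<Otimes>\<^sub>M D). iexp (t * case_prod h z)) - 1)))
    \<le> \<bar>t\<bar> * (B * real p ^ 3 * (2 * \<gamma> + 3 * q\<^sup>2) * exp ((real p)\<^sup>2 * q))"
proof -
  interpret DD: pair_prob_space D D ..
  define N where "N = card (pairs p)"
  define U where "U \<omega> = (\<Sum>P\<in>pairs p. at_pair h P \<omega>)" for \<omega>
  define \<phi> where "\<phi> t = (CLINT \<omega>|M. iexp (t * U \<omega>))" for t
  define \<phi>' where "\<phi>' t = (CLINT \<omega>|M. \<i> * U \<omega> * iexp (t * U \<omega>))" for t
  define \<psi> where "\<psi> t = (CLINT z|(D \<Otimes>\<^sub>M D). iexp (t * case_prod h z))" for t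
  define m where "m t = (CLINT z|(D \<Otimes>\<^sub>M D). \<i> * case_prod h z * iexp (t * case_prod h z))" for t
  have hm: "P \<in> pairs p \<Longrightarrow> at_pair h P \<in> borel_measurable M" for P by (rule at_pair_measurable[OF h])
  have [measurable]: "U \<in> borel_measurable M" unfolding U_def[abs_def] by (intro borel_measurable_sum hm)
  have bdP: "\<bar>at_pair h P \<omega>\<bar> \<le> B" if "P \<in> pairs p" "\<omega> \<in> space M" for P \<omega>
    using that bd[of "\<zeta> (fst P) \<omega>" "\<zeta> (snd P) \<omega>"] measurable_space[OF measurable_row, of _ \<omega>]
    by (auto simp: at_pair_def pairs_def)
  have bdU: "\<bar>U \<omega>\<bar> \<le> N * B" if "\<omega> \<in> space M" for \<omega>
    unfolding U_def N_def using bdP that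
    by (intro order_trans[OF sum_abs] sum_bounded_above) auto
  have bdh: "\<bar>case_prod h z\<bar> \<le> B" if "z \<in> space (D \<Otimes>\<^sub>M D)" for z
    using that bd by (auto simp: space_pair_measure)
  have d\<phi>: "(\<phi> has_vector_derivative \<phi>' t) (at t)" for t
    unfolding \<phi>_def[abs_def] \<phi>'_def by (rule char_has_vector_derivative[where C="N * B"]) (use bdU in auto)
  have d\<psi>: "(\<psi> has_vector_derivative m t) (at t)" for t
    unfolding \<psi>_def[abs_def] m_def by (rule DD.char_has_vector_derivative[where C=B]) (use bdh in auto)
  \<comment> \<open>All errors are measured by the events that summands are nonzero:
    \<open>q\<close> is the probability for one pair, \<open>\<gamma>\<close> for two pairs with a
    common row.\<close>
  define c where "c P \<omega> = (of_bool (at_pair h P \<omega> \<noteq> 0) :: real)" for P \<omega>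
  have c01: "0 \<le> c P \<omega>" "c P \<omega> \<le> 1" for P \<omega> by (auto simp: c_def)
  have cm: "P \<in> pairs p \<Longrightarrow> c P \<in> borel_measurable M" for P
    using hm[of P] unfolding c_def[abs_def] by measurable
  have cint: "P \<in> pairs p \<Longrightarrow> integrable M (c P)" for P
    by (rule integrable_const_bound[where B=1]) (auto simp: cm c01)
  have ccint: "P \<in> pairs p \<Longrightarrow> Q \<in> pairs p \<Longrightarrow> integrable M (\<lambda>\<omega>. c P \<omega> * c Q \<omega>)" for P Q
    by (rule integrable_const_bound[where B=1]) (auto intro!: borel_measurable_times cm mult_le_one simp: c01)
  have Ec: "(\<integral>\<omega>. c P \<omega> \<partial>M) = q" if P: "P \<in> pairs p" for P
  proof -
    have "(\<integral>\<omega>. c P \<omega> \<partial>M) = (\<integral>z. of_bool (case_prod h z \<noteq> 0) \<partial>(D \<Otimes>\<^sub>M D))"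
      unfolding c_def by (rule integral_at_pair[OF h _ P]) measurable
    also have "\<dots> = q" unfolding q[symmetric] by (simp only: split_beta')
    finally show ?thesis .
  qed
  have Ecc: "(\<integral>\<omega>. c P \<omega> * c Q \<omega> \<partial>M) = \<gamma>" if P: "P \<in> pairs p" "Q \<in> nbrs p P" for P Q
  proof -
    have "(\<integral>\<omega>. c P \<omega> * c Q \<omega> \<partial>M) =
        (\<integral>(x, y, z). of_bool (h x y \<noteq> 0) * of_bool (h x z \<noteq> 0) \<partial>(D \<Otimes>\<^sub>M (D \<Otimes>\<^sub>M D)))"
      unfolding c_def by (rule integral_at_nbrs[OF h _ sym P]) measurable
    then show ?thesis unfolding \<gamma>[symmetric] by (simp only: of_bool_conj)
  qed
  have q0: "0 \<le> q" unfolding q[symmetric] by (intro integral_nonneg_AE) auto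
  have \<gamma>0: "0 \<le> \<gamma>" unfolding \<gamma>[symmetric] by (intro integral_nonneg_AE) auto
  have hz: "integrable (D \<Otimes>\<^sub>M D) (\<lambda>z. of_bool (case_prod h z \<noteq> 0) :: real)"
    by (rule DD.integrable_const_bound[where B=1]) auto
  have q': "(\<integral>z. of_bool (case_prod h z \<noteq> 0) \<partial>(D \<Otimes>\<^sub>M D)) = q"
    unfolding q[symmetric] by (simp only: split_beta')
  have inth: "integrable (D \<Otimes>\<^sub>M D) (\<lambda>z. iexp (t * case_prod h z))" for t
    by (rule DD.integrable_const_bound[where B=1]) auto
  have m_le: "norm (m t) \<le> B * q" for t
  proof -
    have "norm (m t) \<le> (\<integral>z. norm (\<i> * case_prod h z * iexp (t * case_prod h z)) \<partial>(D \<Otimes>\<^sub>M D))"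
      unfolding m_def by (rule integral_norm_bound)
    also have "\<dots> \<le> (\<integral>z. B * of_bool (case_prod h z \<noteq> 0) \<partial>(D \<Otimes>\<^sub>M D))"
    proof (rule integral_mono)
      show "integrable (D \<Otimes>\<^sub>M D) (\<lambda>z. norm (\<i> * case_prod h z * iexp (t * case_prod h z)))"
        by (rule DD.integrable_const_bound[where B=B]) (auto simp: norm_mult bdh)
      show "integrable (D \<Otimes>\<^sub>M D) (\<lambda>z. B * of_bool (case_prod h z \<noteq> 0))" using hz by simp
      fix z assume "z \<in> space (D \<Otimes>\<^sub>M D)"
      then show "norm (\<i> * case_prod h z * iexp (t * case_prod h z)) \<le> B * of_bool (case_prod h z \<noteq> 0)"
        using bdh[of z] by (auto simp: norm_mult)
    qed
    also have "\<dots> = B * q" unfolding q'[symmetric] by simp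
    finally show ?thesis .
  qed
  have \<psi>_le: "norm (\<psi> t - 1) \<le> 2 * q" for t
  proof -
    have "\<psi> t - 1 = (CLINT z|(D \<Otimes>\<^sub>M D). iexp (t * case_prod h z) - 1)"
      unfolding \<psi>_def using inth[of t] by (simp add: DD.prob_space)
    also have "norm \<dots> \<le> (\<integral>z. norm (iexp (t * case_prod h z) - 1) \<partial>(D \<Otimes>\<^sub>M D))"
      by (rule integral_norm_bound)
    also have "\<dots> \<le> (\<integral>z. 2 * of_bool (case_prod h z \<noteq> 0) \<partial>(D \<Otimes>\<^sub>M D))"
    proof (rule integral_mono)
      show "integrable (D \<Otimes>\<^sub>M D) (\<lambda>z. norm (iexp (t * case_prod h z) - 1))"
        using inth[of t] by (intro integrable_norm) simp
      show "integrable (D \<Otimes>\<^sub>M D) (\<lambda>z. 2 * of_bool (case_prod h z \<noteq> 0) :: real)" using hz by simp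
      fix z
      show "norm (iexp (t * case_prod h z) - 1) \<le> 2 * of_bool (case_prod h z \<noteq> 0)"
        using norm_triangle_ineq4[of "iexp (t * case_prod h z)" 1] by (cases "case_prod h z = 0") auto
    qed
    also have "\<dots> = 2 * q" unfolding q'[symmetric] by simp
    finally show ?thesis .
  qed
  have intU: "integrable M (\<lambda>\<omega>. iexp (t * U \<omega>))" for t
    by (rule integrable_const_bound[where B=1]) auto
  have \<phi>_le: "norm (\<phi> t) \<le> 1" for t
    unfolding \<phi>_def by (intro order_trans[OF integral_norm_bound]) (simp add: prob_space)
  \<comment> \<open>Two replacements. Dropping the neighbours from the exponent costs at most
    \<open>2 * B\<close> for every neighbour that is nonzero together with \<open>P\<close>, which
    gives the term in \<open>\<gamma>\<close>. Restoring the full sum in the independent factor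
    costs at most 2 when \<open>P\<close> or a neighbour is nonzero, and the prefactor
    \<open>m t\<close>, of size at most \<open>B * q\<close>, makes this quadratic in
    \<open>q\<close>.\<close>
  have loc_est: "norm ((CLINT \<omega>|M. \<i> * at_pair h P \<omega> * iexp (t * U \<omega>)) - m t * \<phi> t)
      \<le> B * (4 * p * \<gamma> + 6 * p * q\<^sup>2)" if P: "P \<in> pairs p" for t P
  proof -
    let ?d = "pairs p - insert P (nbrs p P)"
    define H where "H \<omega> = at_pair h P \<omega>" for \<omega>
    define R where "R \<omega> = (\<Sum>Q\<in>nbrs p P. at_pair h Q \<omega>)" for \<omega>
    define U' where "U' \<omega> = (\<Sum>Q\<in>?d. at_pair h Q \<omega>)" for \<omega>
    have nb: "Q \<in> nbrs p P \<Longrightarrow> Q \<in> pairs p" for Q by (simp add: nbrs_def)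
    have [measurable]: "H \<in> borel_measurable M" "R \<in> borel_measurable M" "U' \<in> borel_measurable M"
      unfolding H_def[abs_def] R_def[abs_def] U'_def[abs_def]
      using P nb by (auto intro!: borel_measurable_sum hm)
    have bH: "\<bar>H \<omega>\<bar> \<le> B" if "\<omega> \<in> space M" for \<omega> unfolding H_def by (rule bdP[OF P that])
    have U: "U \<omega> = H \<omega> + R \<omega> + U' \<omega>" for \<omega>
    proof -
      have "pairs p = insert P (nbrs p P) \<union> ?d" using P by (auto simp: nbrs_def)
      then have "U \<omega> = (\<Sum>Q\<in>insert P (nbrs p P). at_pair h Q \<omega>) + U' \<omega>"
        unfolding U_def U'_def by (metis (no_types, lifting) Diff_disjoint finite_Diff finite_insert finite_nbrs finite_pairs sum.union_disjoint)
      also have "(\<Sum>Q\<in>insert P (nbrs p P). at_pair h Q \<omega>) = H \<omega> + R \<omega>"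
        unfolding H_def R_def by (rule sum.insert) (auto simp: nbrs_def)
      finally show ?thesis .
    qed
    have ind: "indep_var borel H borel U'"
      unfolding H_def[abs_def] U'_def[abs_def]
      using indep_at_disjoint[OF h P, of ?d] by (auto simp: nbrs_def)
    have iU': "integrable M (\<lambda>\<omega>. iexp (t * U' \<omega>))"
      by (rule integrable_const_bound[where B=1]) auto
    have iH: "integrable M (\<lambda>\<omega>. \<i> * H \<omega> * iexp (t * H \<omega>))"
      by (rule integrable_const_bound[where B=B]) (auto simp: norm_mult bH)
    have iHU: "integrable M (\<lambda>\<omega>. \<i> * H \<omega> * iexp (t * U \<omega>))"
      by (rule integrable_const_bound[where B=B]) (auto simp: norm_mult bH)
    have iHU': "integrable M (\<lambda>\<omega>. (\<i> * H \<omega> * iexp (t * H \<omega>)) * iexp (t * U' \<omega>))"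
      by (rule integrable_const_bound[where B=B]) (auto simp: norm_mult bH)
    have "(CLINT \<omega>|M. (\<i> * H \<omega> * iexp (t * H \<omega>)) * iexp (t * U' \<omega>)) =
        (CLINT \<omega>|M. \<i> * H \<omega> * iexp (t * H \<omega>)) * (CLINT \<omega>|M. iexp (t * U' \<omega>))"
      using iH iU'
      by (intro indep_var_lebesgue_integral
        indep_var_compose[OF ind, of "\<lambda>x. \<i> * x * iexp (t * x)" borel "\<lambda>x. iexp (t * x)" borel, unfolded comp_def]) auto
    also have "(CLINT \<omega>|M. \<i> * H \<omega> * iexp (t * H \<omega>)) = m t"
      unfolding m_def H_def by (rule integral_at_pair[OF h _ P]) measurable
    finally have prod: "(CLINT \<omega>|M. (\<i> * H \<omega> * iexp (t * H \<omega>)) * iexp (t * U' \<omega>)) = m t * (CLINT \<omega>|M. iexp (t * U' \<omega>))" .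
    have "norm ((CLINT \<omega>|M. \<i> * H \<omega> * iexp (t * U \<omega>)) - (CLINT \<omega>|M. (\<i> * H \<omega> * iexp (t * H \<omega>)) * iexp (t * U' \<omega>)))
      = norm (CLINT \<omega>|M. \<i> * H \<omega> * iexp (t * U \<omega>) - (\<i> * H \<omega> * iexp (t * H \<omega>)) * iexp (t * U' \<omega>))"
      using iHU iHU' by simp
    also have "\<dots> \<le> (\<integral>\<omega>. norm (\<i> * H \<omega> * iexp (t * U \<omega>) - (\<i> * H \<omega> * iexp (t * H \<omega>)) * iexp (t * U' \<omega>)) \<partial>M)"
      by (rule integral_norm_bound)
    also have "\<dots> \<le> (\<integral>\<omega>. (\<Sum>Q\<in>nbrs p P. 2 * B * (c P \<omega> * c Q \<omega>)) \<partial>M)"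
    proof (rule integral_mono)
      show "integrable M (\<lambda>\<omega>. norm (\<i> * H \<omega> * iexp (t * U \<omega>) - (\<i> * H \<omega> * iexp (t * H \<omega>)) * iexp (t * U' \<omega>)))"
        by (intro integrable_norm Bochner_Integration.integrable_diff iHU iHU')
      show "integrable M (\<lambda>\<omega>. \<Sum>Q\<in>nbrs p P. 2 * B * (c P \<omega> * c Q \<omega>))"
        by (intro Bochner_Integration.integrable_sum integrable_mult_right ccint P nb)
      fix \<omega> assume w: "\<omega> \<in> space M"
      have e: "\<i> * H \<omega> * iexp (t * U \<omega>) - (\<i> * H \<omega> * iexp (t * H \<omega>)) * iexp (t * U' \<omega>) =
        \<i> * H \<omega> * iexp (t * H \<omega>) * iexp (t * U' \<omega>) * (iexp (t * R \<omega>) - 1)"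
        unfolding U by (simp add: algebra_simps exp_add)
      have n: "norm (\<i> * H \<omega> * iexp (t * U \<omega>) - (\<i> * H \<omega> * iexp (t * H \<omega>)) * iexp (t * U' \<omega>)) =
        \<bar>H \<omega>\<bar> * norm (iexp (t * R \<omega>) - 1)"
        unfolding e by (simp add: norm_mult)
      have s0: "0 \<le> (\<Sum>Q\<in>nbrs p P. 2 * B * (c P \<omega> * c Q \<omega>))"
        using B c01 by (intro sum_nonneg mult_nonneg_nonneg) auto
      show "norm (\<i> * H \<omega> * iexp (t * U \<omega>) - (\<i> * H \<omega> * iexp (t * H \<omega>)) * iexp (t * U' \<omega>))
          \<le> (\<Sum>Q\<in>nbrs p P. 2 * B * (c P \<omega> * c Q \<omega>))"
      proof (cases "H \<omega> = 0 \<or> R \<omega> = 0")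
        case True then show ?thesis unfolding n using s0 by auto
      next
        case False
        then obtain Q where Q: "Q \<in> nbrs p P" "at_pair h Q \<omega> \<noteq> 0"
          unfolding R_def by (meson sum.neutral)
        have "\<bar>H \<omega>\<bar> * norm (iexp (t * R \<omega>) - 1) \<le> B * 2"
          using norm_triangle_ineq4[of "iexp (t * R \<omega>)" 1] B by (intro mult_mono bH w) auto
        also have "\<dots> = 2 * B * (c P \<omega> * c Q \<omega>)" using False Q by (simp add: c_def H_def)
        also have "\<dots> \<le> (\<Sum>Q\<in>nbrs p P. 2 * B * (c P \<omega> * c Q \<omega>))"
          using B c01 by (intro member_le_sum[OF Q(1)]) auto
        finally show ?thesis unfolding n .
      qed
    qed
    also have "\<dots> = (\<Sum>Q\<in>nbrs p P. 2 * B * \<gamma>)"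
      using ccint P nb Ecc[OF P] by simp
    also have "\<dots> \<le> 2 * p * (2 * B * \<gamma>)"
      using card_nbrs[of p P] B \<gamma>0 by (simp only: sum_constant) (intro mult_right_mono, auto)
    finally have d1: "norm ((CLINT \<omega>|M. \<i> * H \<omega> * iexp (t * U \<omega>)) - m t * (CLINT \<omega>|M. iexp (t * U' \<omega>))) \<le> 2 * p * (2 * B * \<gamma>)"
      unfolding prod .
    have "norm ((CLINT \<omega>|M. iexp (t * U' \<omega>)) - \<phi> t) = norm (CLINT \<omega>|M. iexp (t * U' \<omega>) - iexp (t * U \<omega>))"
      unfolding \<phi>_def using iU' intU by simp
    also have "\<dots> \<le> (\<integral>\<omega>. norm (iexp (t * U' \<omega>) - iexp (t * U \<omega>)) \<partial>M)"
      by (rule integral_norm_bound)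
    also have "\<dots> \<le> (\<integral>\<omega>. (\<Sum>Q\<in>insert P (nbrs p P). 2 * c Q \<omega>) \<partial>M)"
    proof (rule integral_mono)
      show "integrable M (\<lambda>\<omega>. norm (iexp (t * U' \<omega>) - iexp (t * U \<omega>)))"
        by (intro integrable_norm Bochner_Integration.integrable_diff iU' intU)
      show "integrable M (\<lambda>\<omega>. \<Sum>Q\<in>insert P (nbrs p P). 2 * c Q \<omega>)"
        using P nb by (intro Bochner_Integration.integrable_sum integrable_mult_right cint) auto
      fix \<omega> assume w: "\<omega> \<in> space M"
      show "norm (iexp (t * U' \<omega>) - iexp (t * U \<omega>)) \<le> (\<Sum>Q\<in>insert P (nbrs p P). 2 * c Q \<omega>)"
      proof (cases "H \<omega> = 0 \<and> R \<omega> = 0")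
        case True then show ?thesis unfolding U using c01 by (auto intro!: sum_nonneg)
      next
        case False
        then obtain Q where Q: "Q \<in> insert P (nbrs p P)" "at_pair h Q \<omega> \<noteq> 0"
          unfolding R_def H_def by (metis (mono_tags, lifting) insertI1 insertI2 sum.neutral)
        have "norm (iexp (t * U' \<omega>) - iexp (t * U \<omega>)) \<le> 2"
          using norm_triangle_ineq4[of "iexp (t * U' \<omega>)" "iexp (t * U \<omega>)"] by auto
        also have "\<dots> = 2 * c Q \<omega>" using Q by (simp add: c_def)
        also have "\<dots> \<le> (\<Sum>Q\<in>insert P (nbrs p P). 2 * c Q \<omega>)"
          using c01 by (intro member_le_sum[OF Q(1)]) auto
        finally show ?thesis .
      qed
    qed
    also have "\<dots> = (\<Sum>Q\<in>insert P (nbrs p P). (\<integral>\<omega>. 2 * c Q \<omega> \<partial>M))"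
      using P nb by (intro Bochner_Integration.integral_sum integrable_mult_right cint) auto
    also have "\<dots> = (\<Sum>Q\<in>insert P (nbrs p P). 2 * q)"
      using P nb Ec by (intro sum.cong) auto
    also have "\<dots> = (card (nbrs p P) + 1) * (2 * q)"
      by (simp add: nbrs_def)
    also have "\<dots> \<le> 3 * p * (2 * q)"
    proof (intro mult_right_mono)
      have "1 \<le> p" using P by (auto simp: pairs_def)
      then have "card (nbrs p P) + 1 \<le> 3 * p" using card_nbrs[of p P] by linarith
      then show "real (card (nbrs p P) + 1) \<le> real (3 * p)" by (rule of_nat_mono)
    qed (use q0 in auto)
    finally have d2: "norm ((CLINT \<omega>|M. iexp (t * U' \<omega>)) - \<phi> t) \<le> 3 * p * (2 * q)" by simp
    define I where "I = (CLINT \<omega>|M. iexp (t * U' \<omega>))"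
    define J where "J = (CLINT \<omega>|M. \<i> * H \<omega> * iexp (t * U \<omega>))"
    have "norm (J - m t * \<phi> t) = norm ((J - m t * I) + m t * (I - \<phi> t))" by (simp add: algebra_simps)
    also have "\<dots> \<le> norm (J - m t * I) + norm (m t) * norm (I - \<phi> t)"
      by (metis norm_mult norm_triangle_ineq)
    also have "\<dots> \<le> 2 * p * (2 * B * \<gamma>) + (B * q) * (3 * p * (2 * q))"
      using d1 d2 m_le[of t] B q0 unfolding I_def[symmetric] J_def[symmetric]
      by (intro add_mono mult_mono) auto
    also have "\<dots> = B * (4 * p * \<gamma> + 6 * p * q\<^sup>2)" by (simp add: algebra_simps power2_eq_square)
    finally show ?thesis unfolding J_def H_def .
  qed
  \<comment> \<open>The local error summed over at most \<open>(real p)\<^sup>2 / 2\<close>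
    pairs.\<close>
  define E where "E = B * real p ^ 3 * (2 * \<gamma> + 3 * q\<^sup>2)"
  have E0: "0 \<le> E" unfolding E_def using B \<gamma>0 by auto
  have key: "norm (\<phi>' t - N * m t * \<phi> t) \<le> E" for t
  proof -
    have "\<phi>' t = (CLINT \<omega>|M. \<Sum>P\<in>pairs p. \<i> * at_pair h P \<omega> * iexp (t * U \<omega>))"
      unfolding \<phi>'_def by (subst (1) U_def) (simp add: sum_distrib_left sum_distrib_right)
    also have "\<dots> = (\<Sum>P\<in>pairs p. CLINT \<omega>|M. \<i> * at_pair h P \<omega> * iexp (t * U \<omega>))"
      using hm by (intro Bochner_Integration.integral_sum integrable_const_bound[where B=B]) (auto simp: norm_mult bdP)
    finally have "\<phi>' t - N * m t * \<phi> t = (\<Sum>P\<in>pairs p. (CLINT \<omega>|M. \<i> * at_pair h P \<omega> * iexp (t * U \<omega>)) - m t * \<phi> t)"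
      by (simp add: sum_subtractf N_def algebra_simps)
    also have "norm \<dots> \<le> (\<Sum>P\<in>pairs p. B * (4 * p * \<gamma> + 6 * p * q\<^sup>2))"
      by (intro order_trans[OF norm_sum] sum_mono loc_est)
    also have "\<dots> = card (pairs p) * (B * (4 * p * \<gamma> + 6 * p * q\<^sup>2))" by simp
    also have "\<dots> \<le> (real p)\<^sup>2 / 2 * (B * (4 * p * \<gamma> + 6 * p * q\<^sup>2))"
      using B \<gamma>0 by (intro mult_right_mono card_pairs_le) auto
    also have "\<dots> = E" unfolding E_def by (simp add: algebra_simps power2_eq_square power3_eq_cube)
    finally show ?thesis .
  qed
  define \<Lambda> where "\<Lambda> t = of_nat N * (\<psi> t - 1)" for t
  have d\<Lambda>: "(\<Lambda> has_vector_derivative (of_nat N * m t)) (at t)" for t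
    unfolding \<Lambda>_def[abs_def] using has_vector_derivative_diff[OF d\<psi> has_vector_derivative_const, of 1 t]
    by (intro has_vector_derivative_mult_right) simp
  \<comment> \<open>Integrating factor of the linear equation: if the equation held exactly,
    \<open>g\<close> would be constantly 1.\<close>
  define g where "g t = \<phi> t * exp (- \<Lambda> t)" for t
  have dg: "(g has_vector_derivative ((\<phi>' t - N * m t * \<phi> t) * exp (- \<Lambda> t))) (at t)" for t
  proof -
    have "((\<lambda>t. exp (- \<Lambda> t)) has_vector_derivative ((- (of_nat N * m t)) * exp (- \<Lambda> t))) (at t)"
      using field_vector_diff_chain_at[OF has_vector_derivative_minus[OF d\<Lambda>] DERIV_exp, of t]
      by (simp add: comp_def)
    from has_vector_derivative_mult[OF d\<phi> this] show ?thesis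
      unfolding g_def[abs_def] by (simp add: algebra_simps)
  qed
  have exp_le: "norm (exp (- \<Lambda> t)) \<le> exp ((real p)\<^sup>2 * q)" for t
  proof -
    have "norm (exp (- \<Lambda> t)) \<le> exp (norm (- \<Lambda> t))" by (rule norm_exp)
    also have "norm (- \<Lambda> t) \<le> (real p)\<^sup>2 / 2 * (2 * q)"
      unfolding \<Lambda>_def norm_minus_cancel norm_mult N_def
      using \<psi>_le q0 card_pairs_le[of p] by (intro mult_mono) auto
    finally show ?thesis by simp
  qed
  have "norm (g t - g 0) \<le> (E * exp ((real p)\<^sup>2 * q)) * norm (t - 0)"
  proof (rule differentiable_bound[where S=UNIV])
    show "(g has_derivative (\<lambda>h. h *\<^sub>R ((\<phi>' x - N * m x * \<phi> x) * exp (- \<Lambda> x)))) (at x within UNIV)" for x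
      using dg[of x] by (simp add: has_vector_derivative_def)
    show "onorm (\<lambda>h. h *\<^sub>R ((\<phi>' x - N * m x * \<phi> x) * exp (- \<Lambda> x))) \<le> E * exp ((real p)\<^sup>2 * q)" for x
    proof (rule onorm_le)
      fix h :: real
      have "norm ((\<phi>' x - N * m x * \<phi> x) * exp (- \<Lambda> x)) \<le> E * exp ((real p)\<^sup>2 * q)"
        unfolding norm_mult using key exp_le E0 by (intro mult_mono) auto
      then have "\<bar>h\<bar> * norm ((\<phi>' x - N * m x * \<phi> x) * exp (- \<Lambda> x)) \<le> \<bar>h\<bar> * (E * exp ((real p)\<^sup>2 * q))"
        by (intro mult_left_mono) auto
      then show "norm (h *\<^sub>R ((\<phi>' x - N * m x * \<phi> x) * exp (- \<Lambda> x))) \<le> E * exp ((real p)\<^sup>2 * q) * norm h"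
        by (simp add: mult.commute)
    qed
  qed auto
  moreover have "g 0 = 1"
    unfolding g_def \<Lambda>_def \<phi>_def \<psi>_def by (simp add: prob_space DD.prob_space)
  ultimately have g: "norm (g t - 1) \<le> E * exp ((real p)\<^sup>2 * q) * \<bar>t\<bar>" by simp
  \<comment> \<open>Multiplying back by \<open>exp (\<Lambda> t)\<close> does not enlarge the error:
    a characteristic function \<open>\<psi>\<close> has real part at most 1.\<close>
  have e1: "norm (exp (\<Lambda> t)) \<le> 1"
  proof -
    have "norm (\<psi> t) \<le> 1"
      unfolding \<psi>_def by (intro order_trans[OF integral_norm_bound]) (simp add: DD.prob_space)
    then have "Re (\<psi> t) \<le> 1" using complex_Re_le_cmod[of "\<psi> t"] by linarith
    then have "Re (\<Lambda> t) \<le> 0" unfolding \<Lambda>_def by (simp add: mult_nonneg_nonpos)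
    then show ?thesis by (simp add: norm_exp_eq_Re)
  qed
  have e2: "\<phi> t - exp (\<Lambda> t) = exp (\<Lambda> t) * (g t - 1)"
    unfolding g_def by (simp add: algebra_simps exp_minus)
  have "norm (\<phi> t - exp (\<Lambda> t)) \<le> 1 * (E * exp ((real p)\<^sup>2 * q) * \<bar>t\<bar>)"
    unfolding e2 norm_mult by (intro mult_mono e1 g) auto
  then show ?thesis unfolding \<phi>_def \<Lambda>_def \<psi>_def U_def E_def N_def by (simp add: mult_ac)
qed

end

section \<open>Self-normalized rows\<close>

definition sqsum :: "nat \<Rightarrow> (nat \<Rightarrow> real) \<Rightarrow> real" where
  "sqsum n x = (\<Sum>k<n. (x k)\<^sup>2)"

definition unit :: "nat \<Rightarrow> (nat \<Rightarrow> real) \<Rightarrow> nat \<Rightarrow> real" where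
  "unit n x j = x j / sqrt (sqsum n x)"

definition share :: "nat \<Rightarrow> (nat \<Rightarrow> real) \<Rightarrow> nat \<Rightarrow> real" where
  "share n x j = (x j)\<^sup>2 / sqsum n x"

lemma sqsum_nonneg: "0 \<le> sqsum n x"
  by (simp add: sqsum_def sum_nonneg)

lemma sqsum_Suc: "sqsum (Suc n) x = sqsum n x + (x n)\<^sup>2"
  by (simp add: sqsum_def)

lemma unit_square: "(unit n x j)\<^sup>2 = share n x j"
  by (simp add: unit_def share_def power_divide sqsum_nonneg)

lemma share_nonneg: "0 \<le> share n x j"
  by (simp add: share_def sqsum_nonneg)

text \<open>Division by zero makes every share of a zero row 0, so such a row sums to 0 instead of
  1. Keeping the exact value lets \<open>kap\<close> be degenerate without excluding zero
  rows.\<close>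

lemma sum_share: "(\<Sum>j<n. share n x j) = (if sqsum n x = 0 then 0 else 1)"
  by (simp add: share_def sum_divide_distrib[symmetric] sqsum_def[symmetric])

lemma sum_share_le_1: "(\<Sum>j<n. share n x j) \<le> 1"
  by (simp add: sum_share)

lemma share_le_1: "j < n \<Longrightarrow> share n x j \<le> 1"
  using member_le_sum[of j "{..<n}" "share n x"] share_nonneg sum_share_le_1[of n x]
  by (meson finite_lessThan lessThan_iff order_trans)

lemma abs_unit_le_1: "j < n \<Longrightarrow> \<bar>unit n x j\<bar> \<le> 1"
  using share_le_1[of j n x] by (simp add: unit_square[symmetric] abs_square_le_1)

locale row_law = prob_space \<rho> for \<rho> :: "real measure" +
  assumes sets_rho [measurable_cong]: "sets \<rho> = sets borel"
    and symmetric: "distr \<rho> borel uminus = \<rho>"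
begin

abbreviation Row :: "nat \<Rightarrow> (nat \<Rightarrow> real) measure" where
  "Row n \<equiv> PiM {..<n} (\<lambda>_. \<rho>)"

lemma prob_space_Row: "prob_space (Row n)"
  by (intro prob_space_PiM) (rule prob_space_axioms)

sublocale Row: prob_space "Row n" for n by (rule prob_space_Row)

sublocale rows: product_prob_space "\<lambda>_. \<rho>" UNIV
  by standard

lemma sqsum_measurable [measurable]: "sqsum n \<in> borel_measurable (Row n)"
  unfolding sqsum_def[abs_def] by measurable

lemma unit_measurable [measurable]: "j < n \<Longrightarrow> (\<lambda>x. unit n x j) \<in> borel_measurable (Row n)"
  unfolding unit_def[abs_def] by measurable

lemma share_measurable [measurable]: "j < n \<Longrightarrow> (\<lambda>x. share n x j) \<in> borel_measurable (Row n)"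
  unfolding share_def[abs_def] by measurable

section \<open>Exchangeability of the columns and sign symmetry\<close>

lemma distr_Row_permute:
  assumes "inj_on \<pi> {..<n}" "\<pi> \<in> {..<n} \<rightarrow> {..<n}"
  shows "distr (Row n) (Row n) (\<lambda>x. \<lambda>i\<in>{..<n}. x (\<pi> i)) = Row n"
  using distr_PiM_reindex[of "{..<n}" "\<lambda>_. \<rho>" \<pi> "{..<n}"] assms prob_space_axioms by simp

lemma distr_Row_swap:
  assumes "i < n" "j < n" "f \<in> borel_measurable (Row n)"
  shows "distr (Row n) borel (\<lambda>x. f (\<lambda>k\<in>{..<n}. x (Transposition.transpose i j k))) = distr (Row n) borel f"
proof -
  have p: "inj_on (Transposition.transpose i j) {..<n}" "Transposition.transpose i j \<in> {..<n} \<rightarrow> {..<n}"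
    using assms by (auto simp: Transposition.transpose_def inj_on_def split: if_splits)
  have m: "(\<lambda>x. \<lambda>k\<in>{..<n}. x (Transposition.transpose i j k)) \<in> Row n \<rightarrow>\<^sub>M Row n"
    using p(2) by (intro measurable_restrict measurable_component_singleton) auto
  have "distr (distr (Row n) (Row n) (\<lambda>x. \<lambda>i'\<in>{..<n}. x (Transposition.transpose i j i'))) borel f =
      distr (Row n) borel (f \<circ> (\<lambda>x. \<lambda>k\<in>{..<n}. x (Transposition.transpose i j k)))"
    by (rule distr_distr[OF assms(3) m])
  then show ?thesis unfolding distr_Row_permute[OF p] by (simp add: comp_def)
qed

lemma sqsum_swap:
  assumes "i < n" "j < n"
  shows "sqsum n (\<lambda>k\<in>{..<n}. x (Transposition.transpose i j k)) = sqsum n x"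
proof -
  have "bij_betw (Transposition.transpose i j) {..<n} {..<n}"
    using assms by (intro bij_betwI[where g="Transposition.transpose i j"]) (auto simp: Transposition.transpose_def)
  then have "(\<Sum>k<n. (x (Transposition.transpose i j k))\<^sup>2) = (\<Sum>k<n. (x k)\<^sup>2)"
    by (rule sum.reindex_bij_betw)
  then show ?thesis by (simp add: sqsum_def)
qed

lemma share_swap:
  assumes "i < n" "j < n" "k < n"
  shows "share n (\<lambda>k\<in>{..<n}. x (Transposition.transpose i j k)) k = share n x (Transposition.transpose i j k)"
  using assms by (simp add: share_def sqsum_swap)

text \<open>By exchangeability any other column gives the same law.\<close>
definition share_law :: "nat \<Rightarrow> real measure" where
  "share_law n = distr (Row n) borel (\<lambda>x. share n x (n - 1))"

lemma distr_share:
  assumes "j < n" shows "distr (Row n) borel (\<lambda>x. share n x j) = share_law n"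
proof -
  have "distr (Row n) borel (\<lambda>x. share n (\<lambda>k\<in>{..<n}. x (Transposition.transpose j (n - 1) k)) (n - 1)) = share_law n"
    unfolding share_law_def using assms by (intro distr_Row_swap) auto
  then show ?thesis using assms by (simp add: share_swap)
qed

definition share_moment :: "nat \<Rightarrow> nat \<Rightarrow> real" where
  "share_moment n k = (\<integral>u. u ^ k \<partial>share_law n)"

lemma integral_share:
  assumes "j < n" and [measurable]: "f \<in> borel_measurable borel"
  shows "(\<integral>x. f (share n x j) \<partial>Row n) = (\<integral>u. f u \<partial>share_law n :: real)"
  using assms(1) by (subst distr_share[OF assms(1), symmetric]) (subst integral_distr, auto)

lemma share_moment_eq: "j < n \<Longrightarrow> share_moment n k = (\<integral>x. (share n x j) ^ k \<partial>Row n)"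
  unfolding share_moment_def by (rule integral_share[symmetric]) auto

lemma integrable_share_prod:
  assumes "j < n" "l < n" shows "integrable (Row n) (\<lambda>x. share n x j * share n x l)"
proof (rule Row.integrable_const_bound[where B=1])
  show "AE x in Row n. norm (share n x j * share n x l) \<le> 1"
    using assms by (intro AE_I2) (auto simp: share_nonneg abs_mult intro!: mult_le_one share_le_1)
qed (use assms in measurable)

lemma integrable_share_power:
  assumes "j < n" shows "integrable (Row n) (\<lambda>x. share n x j ^ k)"
proof (rule Row.integrable_const_bound[where B=1])
  show "AE x in Row n. norm (share n x j ^ k) \<le> 1"
    using assms by (intro AE_I2) (auto simp: share_nonneg intro!: power_le_one share_le_1)
qed (use assms in measurable)

lemma share_moment_nonneg: "0 \<le> share_moment n k"
proof (cases "n = 0")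
  case False
  then have "share_moment n k = (\<integral>x. (share n x (n - 1)) ^ k \<partial>Row n)" by (intro share_moment_eq) auto
  then show ?thesis by (auto intro!: integral_nonneg_AE simp: share_nonneg)
next
  case True
  have "(\<lambda>x. share 0 x (0 - 1)) = (\<lambda>x. 0)" by (simp add: share_def sqsum_def fun_eq_iff)
  then show ?thesis using True
    by (simp add: share_moment_def share_law_def integral_distr)
qed

text \<open>The shares of a nonzero row add up to 1, so by exchangeability each has mean
  \<open>1 / n\<close> up to the probability of a zero row. This exact normalization is the anchor
  of the case of infinite variance.\<close>

lemma share_moment_1: "n * share_moment n 1 = 1 - Row.prob n {x \<in> space (Row n). sqsum n x = 0}"
proof -
  have "n * share_moment n 1 = (\<Sum>j<n. share_moment n 1)" by simp
  also have "\<dots> = (\<Sum>j<n. \<integral>x. share n x j \<partial>Row n)"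
    using share_moment_eq[of _ n 1] by (intro sum.cong) auto
  also have "\<dots> = (\<integral>x. (\<Sum>j<n. share n x j) \<partial>Row n)"
    using integrable_share_power[of _ n 1] by (intro Bochner_Integration.integral_sum[symmetric]) auto
  also have "\<dots> = (\<integral>x. 1 - indicator {x \<in> space (Row n). sqsum n x = 0} x \<partial>Row n)"
    by (intro Bochner_Integration.integral_cong) (auto simp: sum_share)
  also have "\<dots> = 1 - Row.prob n {x \<in> space (Row n). sqsum n x = 0}"
    by (subst Bochner_Integration.integral_diff) (auto simp: Row.prob_space intro!: integrable_real_indicator simp: Row.emeasure_eq_measure)
  finally show ?thesis .
qed

lemma share_moment_1_le: "1 \<le> n \<Longrightarrow> share_moment n 1 \<le> 1 / n"
proof -
  assume n: "1 \<le> n"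
  have "n * share_moment n 1 \<le> 1"
    unfolding share_moment_1 using measure_nonneg[of "Row n" "{x \<in> space (Row n). sqsum n x = 0}"] by linarith
  then show ?thesis using n by (simp add: field_simps)
qed

lemma mean_share_prod_eq:
  assumes "i < n" "j < n" "l < n" "i \<noteq> j" "i \<noteq> l"
  shows "(\<integral>x. share n x i * share n x j \<partial>Row n) = (\<integral>x. share n x i * share n x l \<partial>Row n)"
proof -
  have "distr (Row n) borel (\<lambda>x. share n (\<lambda>k\<in>{..<n}. x (Transposition.transpose j l k)) i * share n (\<lambda>k\<in>{..<n}. x (Transposition.transpose j l k)) j)
      = distr (Row n) borel (\<lambda>x. share n x i * share n x j)"
    using assms by (intro distr_Row_swap[where f="\<lambda>x. share n x i * share n x j"]) auto
  then have d: "distr (Row n) borel (\<lambda>x. share n x i * share n x l) = distr (Row n) borel (\<lambda>x. share n x i * share n x j)"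
    using assms by (simp add: share_swap)
  have e: "(\<integral>u. u \<partial>distr (Row n) borel (\<lambda>x. share n x i * share n x k)) = (\<integral>x. share n x i * share n x k \<partial>Row n)" if "k < n" for k
    using that assms by (intro integral_distr) auto
  show ?thesis unfolding e[OF assms(2), symmetric] e[OF assms(3), symmetric] d ..
qed

text \<open>By exchangeability \<open>real n - 1\<close> such products have the same mean, and
  together they are at most one share, whose mean is at most \<open>1 / n\<close>.\<close>

lemma mean_share_prod_le:
  assumes "j < n" "l < n" "j \<noteq> l"
  shows "(\<integral>x. share n x j * share n x l \<partial>Row n) \<le> 1 / (real n * (real n - 1))"
proof -
  let ?e = "\<lambda>j l. (\<integral>x. share n x j * share n x l \<partial>Row n)"
  have n: "2 \<le> n" using assms by auto
  have "(real n - 1) * ?e j l = (\<Sum>k\<in>{..<n} - {j}. ?e j l)"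
    using assms n by (simp add: of_nat_diff)
  also have "\<dots> = (\<Sum>k\<in>{..<n} - {j}. ?e j k)"
    using assms by (intro sum.cong refl mean_share_prod_eq) auto
  also have "\<dots> \<le> (\<Sum>k<n. ?e j k)"
    by (intro sum_mono2 integral_nonneg_AE) (auto simp: share_nonneg)
  also have "\<dots> = (\<integral>x. (\<Sum>k<n. share n x j * share n x k) \<partial>Row n)"
    using assms by (intro Bochner_Integration.integral_sum[symmetric] integrable_share_prod) auto
  also have "\<dots> \<le> (\<integral>x. share n x j \<partial>Row n)"
  proof (rule integral_mono)
    show "integrable (Row n) (\<lambda>x. \<Sum>k<n. share n x j * share n x k)"
      using assms by (intro Bochner_Integration.integrable_sum integrable_share_prod) auto
    show "integrable (Row n) (\<lambda>x. share n x j)" using integrable_share_power[OF assms(1), of 1] by simp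
    show "(\<Sum>k<n. share n x j * share n x k) \<le> share n x j" for x
      using mult_left_mono[OF sum_share_le_1[of n x] share_nonneg[of n x j]] by (simp add: sum_distrib_left)
  qed
  also have "\<dots> \<le> 1 / n" using share_moment_1_le[of n] share_moment_eq[OF assms(1), of 1] n by simp
  finally show ?thesis using n by (simp add: field_simps)
qed

text \<open>Fubini's theorem isolates the coordinate \<open>j\<close>, to which the symmetry of
  \<open>\<rho>\<close> applies.\<close>

lemma distr_Row_flip:
  assumes "j < n" and g: "integrable (Row n) g"
    and g': "integrable (Row n) (\<lambda>x. g (x(j := - x j)))"
  shows "(\<integral>x. g (x(j := - x j)) \<partial>Row n) = (\<integral>x. g x \<partial>Row n :: real)"
proof -
  let ?I = "{..<n} - {j}"
  have I: "insert j ?I = {..<n}" "finite ?I" "j \<notin> ?I" using assms by auto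
  have "(\<integral>x. g (x(j := - x j)) \<partial>Row n) = (\<integral>x. (\<integral>t. g ((x(j := t))(j := - (x(j := t)) j)) \<partial>\<rho>) \<partial>PiM ?I (\<lambda>_. \<rho>))"
    using rows.product_integral_insert[OF I(2,3), of "\<lambda>x. g (x(j := - x j))"] g' I(1) by simp
  also have "\<dots> = (\<integral>x. (\<integral>t. g (x(j := t)) \<partial>\<rho>) \<partial>PiM ?I (\<lambda>_. \<rho>))"
  proof (rule Bochner_Integration.integral_cong[OF refl])
    fix x assume x: "x \<in> space (PiM ?I (\<lambda>_. \<rho>))"
    have gm: "g \<in> borel_measurable (PiM (insert j ?I) (\<lambda>_. \<rho>))" using g unfolding I(1) by auto
    have "(\<lambda>t. g (x(j := t))) \<in> borel_measurable \<rho>"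
      using measurable_comp[OF measurable_component_update gm, OF x I(3)] unfolding comp_def .
    then have [measurable]: "(\<lambda>t. g (x(j := t))) \<in> borel_measurable borel"
      by (simp add: measurable_cong_sets[OF sets_rho refl])
    have "(\<integral>t. g (x(j := t)) \<partial>distr \<rho> borel uminus) = (\<integral>t. g (x(j := - t)) \<partial>\<rho>)"
      by (rule integral_distr) simp_all
    then show "(\<integral>t. g ((x(j := t))(j := - (x(j := t)) j)) \<partial>\<rho>) = (\<integral>t. g (x(j := t)) \<partial>\<rho>)"
      unfolding symmetric by simp
  qed
  also have "\<dots> = (\<integral>x. g x \<partial>Row n)"
    using rows.product_integral_insert[OF I(2,3), of g] g I(1) by simp
  finally show ?thesis .
qed

text \<open>The norm sees only squares, so the normalized entries, although dependent, inherit the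
  separate sign symmetries of the original ones.\<close>

lemma unit_flip:
  assumes "j < n"
  shows "unit n (x(j := - x j)) k = (if k = j then - unit n x k else unit n x k)"
proof -
  have "sqsum n (x(j := - x j)) = sqsum n x"
    unfolding sqsum_def by (intro sum.cong) auto
  then show ?thesis by (simp add: unit_def)
qed

lemma integrable_unit_prod4:
  assumes "i < n" "j < n" "k < n" "l < n"
  shows "integrable (Row n) (\<lambda>x. unit n x i * unit n x j * (unit n x k * unit n x l))"
proof (rule Row.integrable_const_bound[where B=1])
  show "AE x in Row n. norm (unit n x i * unit n x j * (unit n x k * unit n x l)) \<le> 1"
    using assms by (intro AE_I2) (auto simp: abs_mult intro!: mult_le_one abs_unit_le_1)
qed (use assms in measurable)

lemma integrable_unit_prod2:
  assumes "i < n" "j < n"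
  shows "integrable (Row n) (\<lambda>x. unit n x i * unit n x j)"
proof (rule Row.integrable_const_bound[where B=1])
  show "AE x in Row n. norm (unit n x i * unit n x j) \<le> 1"
    using assms by (intro AE_I2) (auto simp: abs_mult intro!: mult_le_one abs_unit_le_1)
qed (use assms in measurable)

lemma mean_odd_eq_0:
  assumes j: "j < n" and g: "integrable (Row n) g" and odd: "\<And>x. g (x(j := - x j)) = - g x"
  shows "(\<integral>x. g x \<partial>Row n) = (0::real)"
proof -
  have "integrable (Row n) (\<lambda>x. g (x(j := - x j)))" using g unfolding odd by simp
  from distr_Row_flip[OF j g this] show ?thesis unfolding odd by simp
qed

lemma mean_unit_prod2:
  assumes "i < n" "j < n" "i \<noteq> j"
  shows "(\<integral>x. unit n x i * unit n x j \<partial>Row n) = 0"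
  using assms by (intro mean_odd_eq_0[of i] integrable_unit_prod2) (auto simp: unit_flip)

text \<open>Two different two-element sets leave an index that occurs in only one of them; the
  product is odd in that coordinate.\<close>

lemma mean_unit_prod4:
  assumes "i < n" "j < n" "k < n" "l < n" "i \<noteq> j" "k \<noteq> l" "{i, j} \<noteq> {k, l}"
  shows "(\<integral>x. unit n x i * unit n x j * (unit n x k * unit n x l) \<partial>Row n) = 0"
proof -
  consider "i \<notin> {k, l}" | "j \<notin> {k, l}" using assms by auto
  then show ?thesis
  proof cases
    case 1 then show ?thesis
      using assms by (intro mean_odd_eq_0[of i] integrable_unit_prod4) (auto simp: unit_flip)
  next
    case 2 then show ?thesis
      using assms by (intro mean_odd_eq_0[of j] integrable_unit_prod4) (auto simp: unit_flip)
  qed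
qed

end

section \<open>Moments of a share under a regularly varying tail\<close>

locale tail_law = row_law \<rho> for \<rho> :: "real measure" +
  fixes a :: real
  assumes tail: "regular_tail (\<lambda>v. measure \<rho> {t. v < t\<^sup>2}) a"
begin

definition G :: "real \<Rightarrow> real" where "G v = measure \<rho> {t. v < t\<^sup>2}"

sublocale regular_tail G a
  using tail by (simp add: G_def[abs_def])

lemma space_rho: "space \<rho> = UNIV"
  using sets_eq_imp_space_eq[OF sets_rho] by simp

lemma measurable_rho: "f \<in> borel_measurable borel \<Longrightarrow> f \<in> borel_measurable \<rho>"
  by (simp add: measurable_cong_sets[OF sets_rho refl])

lemma emeasure_tail: "emeasure \<rho> {t. v < t\<^sup>2} = ennreal (G v)"
  by (simp add: G_def emeasure_eq_measure)

text \<open>The mean of \<open>(V / (V + y)) ^ k\<close> for \<open>V = t\<^sup>2\<close>: the conditional \<open>k\<close>-th moment of a share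
  given that the other columns contribute \<open>y\<close>.\<close>
definition H :: "nat \<Rightarrow> real \<Rightarrow> real" where
  "H k y = (\<integral>t. (t\<^sup>2 / (t\<^sup>2 + y)) ^ k \<partial>\<rho>)"

lemma frac_bounds: "0 \<le> y \<Longrightarrow> 0 \<le> t\<^sup>2 / (t\<^sup>2 + y) \<and> t\<^sup>2 / (t\<^sup>2 + y) \<le> (1::real)"
proof -
  assume y: "0 \<le> y"
  show ?thesis
  proof (cases "t\<^sup>2 + y = 0")
    case False
    then have "0 < t\<^sup>2 + y" using zero_le_power2[of t] y by linarith
    then show ?thesis using y by (simp add: divide_le_eq)
  qed simp
qed

lemma H_integrable: "0 \<le> y \<Longrightarrow> integrable \<rho> (\<lambda>t. (t\<^sup>2 / (t\<^sup>2 + y)) ^ k)"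
  by (rule integrable_const_bound[where B=1])
    (auto intro!: AE_I2 power_le_one measurable_rho simp: power_abs abs_mult frac_bounds)

lemma H_nonneg: "0 \<le> y \<Longrightarrow> 0 \<le> H k y"
  unfolding H_def by (intro integral_nonneg_AE AE_I2 zero_le_power) (simp add: frac_bounds)

lemma H_le_1: "0 \<le> y \<Longrightarrow> H k y \<le> 1"
  unfolding H_def using H_integrable
  by (intro integral_le_const) (auto intro!: power_le_one simp: frac_bounds)

lemma H_antimono:
  assumes "0 < y" "y \<le> z" shows "H k z \<le> H k y"
  unfolding H_def
proof (intro integral_mono H_integrable power_mono)
  show "t\<^sup>2 / (t\<^sup>2 + z) \<le> t\<^sup>2 / (t\<^sup>2 + y)" for t :: real
    using assms zero_le_power2[of t] by (intro frac_le) linarith+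
qed (use assms frac_bounds in auto)

text \<open>Write a \<open>k\<close>-th power as the integral of \<open>k * x ^ (k - 1)\<close> and
  exchange the integrals. For \<open>x\<close> in the unit interval,
  \<open>x < t\<^sup>2 / (t\<^sup>2 + y)\<close> means that \<open>t\<^sup>2\<close> exceeds
  \<open>y * (x / (1 - x))\<close>, which is a tail event measured by \<open>G\<close>.\<close>

lemma H_layer:
  assumes y: "0 < y" and k: "1 \<le> k"
  shows "H k y = (LBINT x:{0<..<1}. real k * x ^ (k - 1) * G (y * (x / (1 - x))))"
proof -
  interpret P: pair_sigma_finite \<rho> lborel
    by (rule pair_sigma_finite.intro[OF prob_space_imp_sigma_finite[OF prob_space_axioms] sigma_finite_lborel])
  define w where "w t = t\<^sup>2 / (t\<^sup>2 + y)" for t :: real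
  have w: "0 \<le> w t" "w t < 1" for t
    using y by (auto simp: w_def divide_less_eq_1 add_nonneg_pos)
  have [measurable]: "w \<in> borel_measurable borel" unfolding w_def[abs_def] by measurable
  have [measurable]: "w \<in> borel_measurable \<rho>" by (rule measurable_rho) simp
  define f where "f x = indicator {0<..<1} x * (real k * x ^ (k - 1))" for x :: real
  have [measurable]: "f \<in> borel_measurable borel" unfolding f_def[abs_def] by measurable
  have f0: "0 \<le> f x" for x by (auto simp: f_def indicator_def)
  have inner: "(\<integral>\<^sup>+x. ennreal (f x) * indicator {x. x < w t} x \<partial>lborel) = ennreal (w t ^ k)" for t
  proof -
    have "(\<integral>\<^sup>+x. ennreal (f x) * indicator {x. x < w t} x \<partial>lborel) =
      (\<integral>\<^sup>+x. ennreal (real k * x ^ (k - 1)) * indicator {0..w t} x \<partial>lborel)"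
    proof (rule nn_integral_cong_AE)
      show "AE x in lborel. ennreal (f x) * indicator {x. x < w t} x = ennreal (real k * x ^ (k - 1)) * indicator {0..w t} x"
        using AE_lborel_singleton[of 0] AE_lborel_singleton[of "w t"]
        by eventually_elim (use w[of t] in \<open>auto simp: f_def indicator_def\<close>)
    qed
    also have "\<dots> = ennreal (w t ^ k - 0 ^ k)"
      by (rule nn_integral_FTC_Icc) (use w[of t] in \<open>auto intro!: derivative_eq_intros\<close>)
    finally show ?thesis using k by (simp add: zero_power)
  qed
  have iff: "x < w t \<longleftrightarrow> y * (x / (1 - x)) < t\<^sup>2" if "0 < x" "x < 1" for x t
  proof -
    have p: "0 < t\<^sup>2 + y" using y by (simp add: add_nonneg_pos)
    have "x < w t \<longleftrightarrow> x * (t\<^sup>2 + y) < t\<^sup>2" unfolding w_def using p by (simp add: pos_less_divide_eq)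
    also have "\<dots> \<longleftrightarrow> y * x < t\<^sup>2 * (1 - x)" by (simp add: algebra_simps)
    also have "\<dots> \<longleftrightarrow> y * (x / (1 - x)) < t\<^sup>2" using that by (simp add: pos_divide_less_eq)
    finally show ?thesis .
  qed
  have "(\<integral>\<^sup>+t. ennreal (w t ^ k) \<partial>\<rho>) = (\<integral>\<^sup>+t. (\<integral>\<^sup>+x. ennreal (f x) * indicator {x. x < w t} x \<partial>lborel) \<partial>\<rho>)"
    unfolding inner ..
  also have "\<dots> = (\<integral>\<^sup>+x. (\<integral>\<^sup>+t. ennreal (f x) * indicator {x. x < w t} x \<partial>\<rho>) \<partial>lborel)"
    by (rule P.Fubini'[symmetric]) measurable
  also have "\<dots> = (\<integral>\<^sup>+x. ennreal (f x * G (y * (x / (1 - x)))) \<partial>lborel)"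
  proof (rule nn_integral_cong)
    fix x :: real
    show "(\<integral>\<^sup>+t. ennreal (f x) * indicator {x. x < w t} x \<partial>\<rho>) = ennreal (f x * G (y * (x / (1 - x))))"
    proof (cases "0 < x \<and> x < 1")
      case True
      have s: "{t. y * (x / (1 - x)) < t\<^sup>2} \<in> sets \<rho>" unfolding sets_rho by measurable
      have "(\<integral>\<^sup>+t. ennreal (f x) * indicator {x. x < w t} x \<partial>\<rho>) =
          (\<integral>\<^sup>+t. ennreal (f x) * indicator {t. y * (x / (1 - x)) < t\<^sup>2} t \<partial>\<rho>)"
        by (rule nn_integral_cong) (use iff[of x] True in \<open>simp add: indicator_def\<close>)
      also have "\<dots> = ennreal (f x) * ennreal (G (y * (x / (1 - x))))"
        unfolding emeasure_tail[symmetric] using s by (rule nn_integral_cmult_indicator)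
      finally show ?thesis using f0[of x] G_pos[of "y * (x / (1 - x))"] by (simp add: ennreal_mult)
    qed (auto simp: f_def)
  qed
  finally have nn: "(\<integral>\<^sup>+t. ennreal (w t ^ k) \<partial>\<rho>) = (\<integral>\<^sup>+x. ennreal (f x * G (y * (x / (1 - x)))) \<partial>lborel)" .
  have "H k y = enn2real (\<integral>\<^sup>+t. ennreal (w t ^ k) \<partial>\<rho>)"
    unfolding H_def w_def[symmetric] using w by (intro integral_eq_nn_integral) auto
  also have "\<dots> = (\<integral>x. f x * G (y * (x / (1 - x))) \<partial>lborel)"
    unfolding nn using f0 less_imp_le[OF G_pos] by (intro integral_eq_nn_integral[symmetric]) auto
  also have "\<dots> = (LBINT x:{0<..<1}. real k * x ^ (k - 1) * G (y * (x / (1 - x))))"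
    unfolding set_lebesgue_integral_def f_def by (simp add: mult.assoc)
  finally show ?thesis .
qed

text \<open>The constant \<open>k * Beta (k - a) (1 + a)\<close> of the Abelian theorem after
  \<open>k\<close> is cancelled against \<open>Gamma (k + 1)\<close>.\<close>

definition hlim :: "nat \<Rightarrow> real" where
  "hlim k = Gamma (real k - a) * Gamma (1 + a) / Gamma (real k)"

lemma hlim_pos: "a < real k \<Longrightarrow> 0 < hlim k"
  unfolding hlim_def using a_pos by (intro divide_pos_pos mult_pos_pos Gamma_real_pos) auto

lemma H_asymp:
  assumes k: "a < real k"
  shows "((\<lambda>y. H k y / G y) \<longlongrightarrow> hlim k) at_top"
proof -
  have k1: "1 \<le> k" using k a_pos by (cases k) auto
  have "real k * Beta (real k - a) (1 + a) = hlim k"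
  proof -
    have "Gamma (real k + 1) = real k * Gamma (real k)" using k1 by (intro Gamma_plus1) auto
    then show ?thesis using k1 by (simp add: hlim_def Beta_def add.commute)
  qed
  with abelian[OF k] have "((\<lambda>y. (LBINT x:{0<..<1}. real k * x ^ (k - 1) * G (y * (x / (1 - x)))) / G y) \<longlongrightarrow> hlim k) at_top"
    by simp
  then show ?thesis
  proof (rule Lim_transform_eventually)
    show "\<forall>\<^sub>F y in at_top. (LBINT x:{0<..<1}. real k * x ^ (k - 1) * G (y * (x / (1 - x)))) / G y = H k y / G y"
      using eventually_gt_at_top[of 0] by eventually_elim (simp add: H_layer[OF _ k1])
  qed
qed

lemma H_measurable: "(\<lambda>x. H k (sqsum m x)) \<in> borel_measurable (Row m)"
  unfolding H_def by (intro borel_measurable_lebesgue_integral) measurable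

lemma H_sqsum_integrable: "integrable (Row m) (\<lambda>x. H k (sqsum m x))"
  by (rule Row.integrable_const_bound[where B=1])
    (auto intro!: AE_I2 H_measurable simp: H_le_1 H_nonneg sqsum_nonneg)

text \<open>Conditioning on the first \<open>m\<close> columns: the last column is independent of
  them, and they enter only through \<open>sqsum m\<close>. Hence the shift by one in the later
  asymptotics.\<close>

lemma share_moment_Suc: "share_moment (Suc m) k = (\<integral>x. H k (sqsum m x) \<partial>Row m)"
proof -
  have I: "{..<Suc m} = insert m {..<m}" by auto
  have sh: "share (Suc m) (x(m := t)) m = t\<^sup>2 / (t\<^sup>2 + sqsum m x)" for x t
  proof -
    have "sqsum m (x(m := t)) = sqsum m x" unfolding sqsum_def by (intro sum.cong) auto
    then show ?thesis by (simp add: share_def sqsum_Suc add.commute)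
  qed
  have "share_moment (Suc m) k = (\<integral>x. share (Suc m) x m ^ k \<partial>PiM (insert m {..<m}) (\<lambda>_. \<rho>))"
    unfolding I[symmetric] by (rule share_moment_eq) simp
  also have "\<dots> = (\<integral>x. (\<integral>t. share (Suc m) (x(m := t)) m ^ k \<partial>\<rho>) \<partial>Row m)"
    using integrable_share_power[of m "Suc m" k] unfolding I
    by (intro rows.product_integral_insert) auto
  finally show ?thesis unfolding sh H_def .
qed

definition lap :: "real \<Rightarrow> real" where "lap s = (\<integral>t. exp (- (s * t\<^sup>2)) \<partial>\<rho>)"

lemma lap_integrable: "0 \<le> s \<Longrightarrow> integrable \<rho> (\<lambda>t. exp (- (s * t\<^sup>2)))"
  by (rule integrable_const_bound[where B=1]) (auto intro!: measurable_rho)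

lemma lap_nonneg: "0 \<le> lap s"
  unfolding lap_def by simp

text \<open>The exponential Markov inequality for the lower tail. It covers infinite variance as
  well, since the Laplace transform of a nonnegative variable always exists.\<close>

lemma chernoff:
  assumes s: "0 \<le> s"
  shows "Row.prob m {x \<in> space (Row m). sqsum m x < K} \<le> exp (s * K) * lap s ^ m"
proof -
  have i: "integrable (Row m) (\<lambda>x. \<Prod>k<m. exp (- (s * (x k)\<^sup>2)))"
    by (rule rows.product_integrable_prod) (auto intro: lap_integrable s)
  have "Row.prob m {x \<in> space (Row m). sqsum m x < K} = (\<integral>x. indicator {x \<in> space (Row m). sqsum m x < K} x \<partial>Row m)"
    by simp
  also have "\<dots> \<le> (\<integral>x. exp (s * K) * (\<Prod>k<m. exp (- (s * (x k)\<^sup>2))) \<partial>Row m)"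
  proof (rule integral_mono)
    show "integrable (Row m) (indicat_real {x \<in> space (Row m). sqsum m x < K})"
      by (intro integrable_real_indicator) (auto simp: Row.emeasure_eq_measure)
    show "integrable (Row m) (\<lambda>x. exp (s * K) * (\<Prod>k<m. exp (- (s * (x k)\<^sup>2))))"
      using i by (rule integrable_mult_right)
    fix x assume "x \<in> space (Row m)"
    have "(\<Prod>k<m. exp (- (s * (x k)\<^sup>2))) = exp (- (s * sqsum m x))"
      by (simp add: exp_sum[symmetric] sqsum_def sum_distrib_left sum_negf)
    then have e: "exp (s * K) * (\<Prod>k<m. exp (- (s * (x k)\<^sup>2))) = exp (s * (K - sqsum m x))"
      by (simp add: exp_add[symmetric] algebra_simps)
    show "indicat_real {x \<in> space (Row m). sqsum m x < K} x \<le> exp (s * K) * (\<Prod>k<m. exp (- (s * (x k)\<^sup>2)))"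
      unfolding e using s by (auto simp: indicator_def)
  qed
  also have "\<dots> = exp (s * K) * (\<integral>x. (\<Prod>k<m. exp (- (s * (x k)\<^sup>2))) \<partial>Row m)"
    by (rule integral_mult_right_zero)
  also have "(\<integral>x. (\<Prod>k<m. exp (- (s * (x k)\<^sup>2))) \<partial>Row m) = lap s ^ m"
    by (subst rows.product_integral_prod) (auto intro: lap_integrable s simp: lap_def)
  finally show ?thesis .
qed

text \<open>Squared entries exceed 1 with positive probability, by \<open>G_pos\<close>. With
  \<open>chernoff\<close> this makes bounded row sums exponentially unlikely.\<close>

lemma lap_1_less: "lap 1 < 1"
proof -
  have s: "{t. 1 < t\<^sup>2} \<in> sets \<rho>" unfolding sets_rho by measurable
  have "lap 1 \<le> (\<integral>t. 1 - (1 - exp (- 1)) * indicator {t. 1 < t\<^sup>2} t \<partial>\<rho>)"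
    unfolding lap_def
  proof (rule integral_mono)
    show "integrable \<rho> (\<lambda>t. exp (- (1 * t\<^sup>2)))" by (rule lap_integrable) simp
    show "integrable \<rho> (\<lambda>t. 1 - (1 - exp (- 1)) * indicat_real {t. 1 < t\<^sup>2} t)"
      using s by (intro Bochner_Integration.integrable_diff integrable_mult_right integrable_real_indicator)
        (auto simp: emeasure_eq_measure)
    fix t :: real
    show "exp (- (1 * t\<^sup>2)) \<le> 1 - (1 - exp (- 1)) * indicat_real {t. 1 < t\<^sup>2} t"
      by (auto simp: indicator_def)
  qed
  also have "\<dots> = 1 - (1 - exp (- 1)) * G 1"
    using s by (subst Bochner_Integration.integral_diff)
      (auto simp: prob_space[unfolded space_rho] G_def emeasure_eq_measure space_rho)
  also have "\<dots> < 1" using G_pos[of 1] by simp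
  finally show ?thesis .
qed

lemma n_share_moment_1: "(\<lambda>n. n * share_moment n 1) \<longlonglongrightarrow> 1"
proof -
  have "(\<lambda>n. Row.prob n {x \<in> space (Row n). sqsum n x = 0}) \<longlonglongrightarrow> 0"
  proof (rule Lim_null_comparison)
    show "\<forall>\<^sub>F n in sequentially. norm (Row.prob n {x \<in> space (Row n). sqsum n x = 0}) \<le> exp (1 * 1) * lap 1 ^ n"
    proof (rule always_eventually, rule allI)
      fix n
      have "Row.prob n {x \<in> space (Row n). sqsum n x = 0} \<le> Row.prob n {x \<in> space (Row n). sqsum n x < 1}"
        by (intro Row.finite_measure_mono) auto
      also have "\<dots> \<le> exp (1 * 1) * lap 1 ^ n" by (rule chernoff) simp
      finally show "norm (Row.prob n {x \<in> space (Row n). sqsum n x = 0}) \<le> exp (1 * 1) * lap 1 ^ n" by simp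
    qed
    show "(\<lambda>n. exp (1 * 1) * lap 1 ^ n) \<longlonglongrightarrow> 0"
      using lap_1_less lap_nonneg[of 1] by (intro tendsto_mult_right_zero LIMSEQ_realpow_zero) auto
  qed
  from tendsto_diff[OF tendsto_const[of 1] this] show ?thesis unfolding share_moment_1 by simp
qed

text \<open>With infinite variance \<open>sqsum\<close> obeys no law of large numbers, so
  \<open>H k\<close> cannot be evaluated at a known point. But \<open>H k\<close> and
  \<open>H 1\<close> are both of the order of \<open>G\<close>, hence their quotient tends to
  \<open>hlim k / hlim 1\<close> wherever the sum lies, as long as it is large, and
  \<open>n * share_moment n 1\<close> is known to tend to 1.\<close>

lemma share_moment_light:
  assumes a: "a < 1" and k: "1 \<le> k"
  shows "(\<lambda>n. n * share_moment n k) \<longlonglongrightarrow> Gamma (real k - a) / (Gamma (real k) * Gamma (1 - a))"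
proof -
  define r where "r = hlim k / hlim 1"
  have h1: "0 < hlim 1" using a by (intro hlim_pos) simp
  have hk: "0 < hlim k" using a k by (intro hlim_pos) simp
  have r0: "0 < r" using h1 hk by (simp add: r_def)
  have r: "r = Gamma (real k - a) / (Gamma (real k) * Gamma (1 - a))"
    using a_pos a by (simp add: r_def hlim_def Gamma_real_pos less_imp_neq[symmetric])
  have ratio: "((\<lambda>y. (H k y / G y) / (H 1 y / G y)) \<longlongrightarrow> r) at_top"
    unfolding r_def using a k h1 by (intro tendsto_divide H_asymp) auto
  have "(\<lambda>n. n * share_moment n k - r * (n * share_moment n 1)) \<longlonglongrightarrow> 0"
  proof (rule LIMSEQ_I)
    fix \<epsilon> :: real assume \<epsilon>: "0 < \<epsilon>"
    define \<delta> where "\<delta> = \<epsilon> / 2"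
    have "eventually (\<lambda>y. \<bar>(H k y / G y) / (H 1 y / G y) - r\<bar> < \<delta>) at_top"
      using tendstoD[OF ratio, of \<delta>] \<epsilon> by (simp add: \<delta>_def dist_real_def)
    moreover have "eventually (\<lambda>y. 0 < H 1 y / G y) at_top"
      using order_tendstoD(1)[OF H_asymp[of 1] h1] a by simp
    ultimately have "eventually (\<lambda>y. \<bar>H k y - r * H 1 y\<bar> \<le> \<delta> * H 1 y) at_top"
    proof eventually_elim
      case (elim y)
      then have p: "0 < H 1 y" using G_pos[of y] by (simp add: zero_less_divide_iff)
      have "(H k y / G y) / (H 1 y / G y) = H k y / H 1 y" using G_pos[of y] p by simp
      then have "\<bar>H k y / H 1 y - r\<bar> * H 1 y \<le> \<delta> * H 1 y" using elim p by (intro mult_right_mono) auto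
      moreover have "\<bar>H k y / H 1 y - r\<bar> * H 1 y = \<bar>(H k y / H 1 y - r) * H 1 y\<bar>" using p by (simp add: abs_mult)
      ultimately show ?case using p by (simp add: left_diff_distrib)
    qed
    then obtain K where K: "\<And>y. K \<le> y \<Longrightarrow> \<bar>H k y - r * H 1 y\<bar> \<le> \<delta> * H 1 y"
      by (auto simp: eventually_at_top_linorder)
    \<comment> \<open>Above \<open>K\<close> the two conditional moments are proportional up to
      \<delta>. The event \<open>sqsum m x < K\<close>, where only the trivial bound is used, has a
      probability so small that even the factor \<open>Suc m\<close> does not matter.\<close>
    have est: "\<bar>Suc m * share_moment (Suc m) k - r * (Suc m * share_moment (Suc m) 1)\<bar> \<le>
        \<delta> + (1 + r) * exp (1 * K) * (Suc m * lap 1 ^ m)" for m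
    proof -
      let ?B = "{x \<in> space (Row m). sqsum m x < K}"
      have "\<bar>share_moment (Suc m) k - r * share_moment (Suc m) 1\<bar> =
          \<bar>\<integral>x. H k (sqsum m x) - r * H 1 (sqsum m x) \<partial>Row m\<bar>"
        unfolding share_moment_Suc using H_sqsum_integrable by simp
      also have "\<dots> \<le> (\<integral>x. \<bar>H k (sqsum m x) - r * H 1 (sqsum m x)\<bar> \<partial>Row m)"
        by (rule integral_abs_bound)
      also have "\<dots> \<le> (\<integral>x. \<delta> * H 1 (sqsum m x) + (1 + r) * indicator ?B x \<partial>Row m)"
      proof (rule integral_mono)
        show "integrable (Row m) (\<lambda>x. \<bar>H k (sqsum m x) - r * H 1 (sqsum m x)\<bar>)"
          by (intro integrable_abs Bochner_Integration.integrable_diff integrable_mult_right H_sqsum_integrable)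
        show "integrable (Row m) (\<lambda>x. \<delta> * H 1 (sqsum m x) + (1 + r) * indicator ?B x)"
          by (intro Bochner_Integration.integrable_add integrable_mult_right H_sqsum_integrable integrable_real_indicator)
            (auto simp: Row.emeasure_eq_measure)
        fix x assume x: "x \<in> space (Row m)"
        have b: "0 \<le> H 1 (sqsum m x)" "H 1 (sqsum m x) \<le> 1" "0 \<le> H k (sqsum m x)" "H k (sqsum m x) \<le> 1"
          by (simp_all add: H_nonneg H_le_1 sqsum_nonneg)
        show "\<bar>H k (sqsum m x) - r * H 1 (sqsum m x)\<bar> \<le> \<delta> * H 1 (sqsum m x) + (1 + r) * indicator ?B x"
        proof (cases "sqsum m x < K")
          case True
          have "\<bar>H k (sqsum m x) - r * H 1 (sqsum m x)\<bar> \<le> 1 + r * 1"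
            using b r0 by (intro order_trans[OF abs_triangle_ineq4] add_mono) (auto simp: abs_mult)
          moreover have "0 \<le> \<delta> * H 1 (sqsum m x)" using b \<epsilon> by (simp add: \<delta>_def)
          ultimately show ?thesis using True x by (simp add: indicator_def)
        next
          case False
          then show ?thesis using K[of "sqsum m x"] by (simp add: indicator_def)
        qed
      qed
      also have "\<dots> = \<delta> * share_moment (Suc m) 1 + (1 + r) * Row.prob m ?B"
        unfolding share_moment_Suc using H_sqsum_integrable
        by (subst Bochner_Integration.integral_add) (auto intro!: integrable_real_indicator simp: Row.emeasure_eq_measure)
      also have "\<dots> \<le> \<delta> * (1 / Suc m) + (1 + r) * (exp (1 * K) * lap 1 ^ m)"
        using \<epsilon> r0 share_moment_1_le[of "Suc m"] by (intro add_mono mult_left_mono chernoff) (auto simp: \<delta>_def)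
      finally have "Suc m * \<bar>share_moment (Suc m) k - r * share_moment (Suc m) 1\<bar> \<le>
          Suc m * (\<delta> * (1 / Suc m) + (1 + r) * (exp (1 * K) * lap 1 ^ m))"
        by (rule mult_left_mono) simp
      also have "\<dots> = \<delta> + (1 + r) * exp (1 * K) * (Suc m * lap 1 ^ m)"
        by (simp add: distrib_left del: of_nat_Suc)
      also have "Suc m * \<bar>share_moment (Suc m) k - r * share_moment (Suc m) 1\<bar> =
          \<bar>Suc m * share_moment (Suc m) k - r * (Suc m * share_moment (Suc m) 1)\<bar>"
      proof -
        have "Suc m * share_moment (Suc m) k - r * (Suc m * share_moment (Suc m) 1) =
            Suc m * (share_moment (Suc m) k - r * share_moment (Suc m) 1)"
          by (simp only: right_diff_distrib mult.left_commute)
        then show ?thesis by (simp only: abs_mult abs_of_nat)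
      qed
      finally show ?thesis .
    qed
    have "(\<lambda>m. Suc m * lap 1 ^ m) \<longlonglongrightarrow> 0"
    proof -
      have "(\<lambda>m. of_nat m * lap 1 ^ m + lap 1 ^ m) \<longlonglongrightarrow> 0 + 0"
        using lap_1_less lap_nonneg[of 1] by (intro tendsto_add powser_times_n_limit_0 LIMSEQ_realpow_zero) auto
      then show ?thesis by (simp add: algebra_simps)
    qed
    then have "(\<lambda>m. (1 + r) * exp (1 * K) * (Suc m * lap 1 ^ m)) \<longlonglongrightarrow> 0"
      by (rule tendsto_mult_right_zero)
    then have "eventually (\<lambda>m. (1 + r) * exp (1 * K) * (Suc m * lap 1 ^ m) < \<delta>) sequentially"
      using \<epsilon> by (intro order_tendstoD(2)) (auto simp: \<delta>_def)
    then obtain M where M: "\<And>m. M \<le> m \<Longrightarrow> (1 + r) * exp (1 * K) * (Suc m * lap 1 ^ m) < \<delta>"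
      by (auto simp: eventually_sequentially)
    show "\<exists>no. \<forall>n\<ge>no. norm (n * share_moment n k - r * (n * share_moment n 1) - 0) < \<epsilon>"
    proof (intro exI allI impI)
      fix n assume "Suc M \<le> n"
      then obtain m where m: "n = Suc m" "M \<le> m" by (cases n) auto
      have "\<bar>Suc m * share_moment (Suc m) k - r * (Suc m * share_moment (Suc m) 1)\<bar> < \<delta> + \<delta>"
        using est[of m] M[OF m(2)] by linarith
      then show "norm (n * share_moment n k - r * (n * share_moment n 1) - 0) < \<epsilon>"
        unfolding m(1) by (simp add: \<delta>_def del: of_nat_Suc)
    qed
  qed
  from tendsto_add[OF this tendsto_mult[OF tendsto_const[of r] n_share_moment_1]]
  have "(\<lambda>n. n * share_moment n k) \<longlonglongrightarrow> r" by simp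
  then show ?thesis unfolding r .
qed

text \<open>By the layer-cake formula the second moment is the integral of \<open>G\<close> over the
  half-line, and \<open>G\<close> has a power majorant with an exponent above 1.\<close>

lemma moment_integrable:
  assumes a: "1 < a" shows "integrable \<rho> (\<lambda>t. t\<^sup>2)"
proof -
  interpret P: pair_sigma_finite \<rho> lborel
    by (rule pair_sigma_finite.intro[OF prob_space_imp_sigma_finite[OF prob_space_axioms] sigma_finite_lborel])
  obtain b where b: "1 < b" "b < a" using dense[OF a] by blast
  obtain K x0 where K: "0 < K" "0 < x0" "\<And>y. x0 \<le> y \<Longrightarrow> G y \<le> K * y powr - b"
    using upper_bound[of b] b by auto
  have [measurable]: "(\<lambda>t. t\<^sup>2) \<in> borel_measurable \<rho>" by (rule measurable_rho) measurable
  have inner: "(\<integral>\<^sup>+v. indicator {0..} v * indicator {v. v < t\<^sup>2} v \<partial>lborel) = ennreal (t\<^sup>2)" for t :: real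
  proof -
    have "(\<integral>\<^sup>+v. indicator {0..} v * indicator {v. v < t\<^sup>2} v \<partial>lborel) = (\<integral>\<^sup>+v. indicator {0..<t\<^sup>2} v \<partial>lborel)"
      by (intro nn_integral_cong) (auto simp: indicator_def)
    then show ?thesis by simp
  qed
  have "(\<integral>\<^sup>+t. ennreal (t\<^sup>2) \<partial>\<rho>) = (\<integral>\<^sup>+t. (\<integral>\<^sup>+v. indicator {0..} v * indicator {v. v < t\<^sup>2} v \<partial>lborel) \<partial>\<rho>)"
    unfolding inner ..
  also have "\<dots> = (\<integral>\<^sup>+v. (\<integral>\<^sup>+t. indicator {0..} v * indicator {v. v < t\<^sup>2} v \<partial>\<rho>) \<partial>lborel)"
    by (rule P.Fubini'[symmetric]) measurable
  also have "\<dots> \<le> (\<integral>\<^sup>+v. indicator {0..x0} v + ennreal (K * v powr - b) * indicator {x0..} v \<partial>lborel)"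
  proof (rule nn_integral_mono)
    fix v :: real
    have s: "{t. v < t\<^sup>2} \<in> sets \<rho>" unfolding sets_rho by measurable
    have "(\<integral>\<^sup>+t. indicator {0..} v * indicator {v. v < t\<^sup>2} v \<partial>\<rho>) =
        (\<integral>\<^sup>+t. indicator {0..} v * indicator {t. v < t\<^sup>2} t \<partial>\<rho>)"
      by (rule nn_integral_cong) (simp add: indicator_def)
    also have "\<dots> = indicator {0..} v * ennreal (G v)"
      unfolding emeasure_tail[symmetric] using s by (rule nn_integral_cmult_indicator)
    also have "\<dots> \<le> indicator {0..x0} v + ennreal (K * v powr - b) * indicator {x0..} v"
    proof -
      consider "v < 0" | "0 \<le> v" "v < x0" | "x0 \<le> v" "0 \<le> v" using K(2) by linarith
      then show ?thesis
      proof cases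
        case 2
        have "ennreal (G v) \<le> ennreal 1" using G_le_1 by (rule ennreal_leI)
        then show ?thesis using 2 by (simp add: indicator_def)
      next
        case 3
        have "ennreal (G v) \<le> ennreal (K * v powr - b)" using K(3)[OF 3(1)] by (rule ennreal_leI)
        then show ?thesis using 3 by (simp add: indicator_def add_increasing)
      qed simp
    qed
    finally show "(\<integral>\<^sup>+t. indicator {0..} v * indicator {v. v < t\<^sup>2} v \<partial>\<rho>) \<le>
      indicator {0..x0} v + ennreal (K * v powr - b) * indicator {x0..} v" .
  qed
  also have "\<dots> = (\<integral>\<^sup>+v. indicator {0..x0} v \<partial>lborel) + (\<integral>\<^sup>+v. ennreal (K * v powr - b) * indicator {x0..} v \<partial>lborel)"
    by (rule nn_integral_add) auto
  also have "(\<integral>\<^sup>+v. ennreal (K * v powr - b) * indicator {x0..} v \<partial>lborel) =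
      ennreal (0 - (- (K / (b - 1)) * x0 powr (1 - b)))"
  proof (rule nn_integral_FTC_atLeast)
    fix v assume v: "x0 \<le> v"
    have "((\<lambda>v. - (K / (b - 1)) * v powr (1 - b)) has_real_derivative - (K / (b - 1)) * ((1 - b) * v powr (1 - b - 1))) (at v)"
      using K v b by (auto intro!: derivative_eq_intros)
    moreover have "- (K / (b - 1)) * ((1 - b) * v powr (1 - b - 1)) = K * v powr - b"
      using b by (simp add: field_simps)
    ultimately show "((\<lambda>v. - (K / (b - 1)) * v powr (1 - b)) has_real_derivative K * v powr - b) (at v)" by simp
    show "0 \<le> K * v powr - b" using K by simp
  next
    have "((\<lambda>v::real. v powr (1 - b)) \<longlongrightarrow> 0) at_top"
      using b by (intro tendsto_neg_powr filterlim_ident) auto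
    then show "((\<lambda>v. - (K / (b - 1)) * v powr (1 - b)) \<longlongrightarrow> 0) at_top" by (rule tendsto_mult_right_zero)
  qed simp
  finally have "(\<integral>\<^sup>+t. ennreal (t\<^sup>2) \<partial>\<rho>) < \<infinity>"
    by (rule le_less_trans) (use K in \<open>simp add: less_top[symmetric]\<close>)
  then show ?thesis by (intro integrableI_nonneg) auto
qed

text \<open>Only a finite mean is available, so the lower tail of \<open>sqsum\<close> is controlled through
  \<open>(1 - exp (- s V)) / s \<rightarrow> V\<close> and no law of large numbers is needed.\<close>
lemma lap_slope:
  assumes i: "integrable \<rho> (\<lambda>t. t\<^sup>2)" and mean: "(\<integral>t. t\<^sup>2 \<partial>\<rho>) = 1" and \<theta>: "\<theta> < 1"
  obtains s where "0 < s" "exp (s * \<theta>) * lap s < 1"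
proof -
  \<comment> \<open>For a suitable small \<open>s\<close> the transform lies below
    \<open>1 - \<theta>' * s\<close>, because its slope at 0 is minus the mean;
    \<open>1 - x \<le> exp (- x)\<close> then converts this into a Chernoff factor below 1.\<close>
  obtain \<theta>' where \<theta>': "\<theta> < \<theta>'" "\<theta>' < 1" using dense[OF \<theta>] by blast
  define f where "f m t = (1 - exp (- (1 / real (Suc m) * t\<^sup>2))) * real (Suc m)" for m and t :: real
  have fm: "f m \<in> borel_measurable \<rho>" for m unfolding f_def[abs_def] by (rule measurable_rho) measurable
  have "(\<lambda>m. \<integral>t. f m t \<partial>\<rho>) \<longlonglongrightarrow> (\<integral>t. t\<^sup>2 \<partial>\<rho>)"
  proof (rule integral_dominated_convergence[OF _ fm i])
    show "(\<lambda>t. t\<^sup>2) \<in> borel_measurable \<rho>" by (rule measurable_rho) measurable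
    show "AE t in \<rho>. (\<lambda>m. f m t) \<longlonglongrightarrow> t\<^sup>2"
    proof (rule AE_I2)
      fix t :: real
      have "(\<lambda>m. (1 - exp (- (1 / real (Suc m) * t\<^sup>2))) * real (Suc m)) \<longlonglongrightarrow> t\<^sup>2" by real_asymp
      then show "(\<lambda>m. f m t) \<longlonglongrightarrow> t\<^sup>2" unfolding f_def .
    qed
    show "AE t in \<rho>. norm (f m t) \<le> t\<^sup>2" for m
    proof (rule AE_I2)
      fix t :: real
      define u where "u = 1 / real (Suc m) * t\<^sup>2"
      have "0 \<le> 1 - exp (- u)" "1 - exp (- u) \<le> u"
        using exp_ge_add_one_self[of "- u"] by (auto simp: u_def)
      then have "\<bar>1 - exp (- u)\<bar> * real (Suc m) \<le> u * real (Suc m)" by (intro mult_right_mono) auto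
      also have "\<dots> = t\<^sup>2" by (simp add: u_def del: of_nat_Suc)
      finally show "norm (f m t) \<le> t\<^sup>2" unfolding f_def u_def[symmetric] by (simp add: abs_mult)
    qed
  qed
  then have "eventually (\<lambda>m. \<theta>' < (\<integral>t. f m t \<partial>\<rho>)) sequentially"
    unfolding mean using \<theta>' by (intro order_tendstoD(1)) auto
  then obtain m where m: "\<theta>' < (\<integral>t. f m t \<partial>\<rho>)" by (auto simp: eventually_sequentially)
  define s where "s = 1 / real (Suc m)"
  have s: "0 < s" by (simp add: s_def)
  have "(\<integral>t. f m t \<partial>\<rho>) = (1 - lap s) * real (Suc m)"
    using lap_integrable[of s] s unfolding f_def lap_def s_def[symmetric]
    by (simp add: prob_space[unfolded space_rho] space_rho del: of_nat_Suc)
  then have "\<theta>' * s < 1 - lap s" using m by (simp add: s_def pos_divide_less_eq del: of_nat_Suc)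
  then have "lap s < 1 - \<theta>' * s" by simp
  also have "\<dots> \<le> exp (- (\<theta>' * s))" using exp_ge_add_one_self[of "- (\<theta>' * s)"] by simp
  finally have "exp (s * \<theta>) * lap s < exp (s * \<theta>) * exp (- (\<theta>' * s))" by simp
  also have "\<dots> = exp (s * (\<theta> - \<theta>'))" by (simp add: exp_add[symmetric] algebra_simps)
  also have "\<dots> \<le> 1" using s \<theta>' by (simp add: mult_nonneg_nonpos)
  finally show ?thesis using s that by blast
qed

text \<open>By \<open>lower_bound\<close> the tail decays at most polynomially, hence more slowly
  than any geometric sequence.\<close>

lemma geometric_over_tail:
  assumes "0 \<le> x" "x < 1"
  shows "(\<lambda>m. x ^ m / G (real (Suc m))) \<longlonglongrightarrow> 0"
proof (cases "x = 0")
  case True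
  then show ?thesis by (intro tendsto_eventually eventually_mono[OF eventually_gt_at_top[of 0]]) auto
next
  case False
  obtain K x0 where K: "0 < K" "0 < x0" "\<And>y. x0 \<le> y \<Longrightarrow> K * y powr - (a + 1) \<le> G y"
    using lower_bound[OF less_add_one] by blast
  define c where "c = - ln x"
  define b where "b = a + 1"
  have c: "0 < c" "x = exp (- c)" using assms False by (auto simp: c_def)
  have b: "0 < b" using a_pos by (simp add: b_def)
  show ?thesis
  proof (rule Lim_null_comparison)
    show "\<forall>\<^sub>F m in sequentially. norm (x ^ m / G (real (Suc m))) \<le> 1 / K * (exp (- c * real m) * real (Suc m) powr b)"
      using eventually_ge_at_top[of "nat \<lceil>x0\<rceil>"]
    proof eventually_elim
      case (elim m)
      then have "x0 \<le> real (Suc m)" by linarith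
      from K(3)[OF this] have le: "K * real (Suc m) powr - b \<le> G (real (Suc m))" by (simp add: b_def)
      have p: "0 < K * real (Suc m) powr - b" using K by simp
      have "norm (x ^ m / G (real (Suc m))) = x ^ m / G (real (Suc m))"
        using assms G_pos[of "real (Suc m)"] by (simp add: abs_of_pos[OF G_pos])
      also have "\<dots> \<le> x ^ m / (K * real (Suc m) powr - b)"
        using assms le p K(1) by (intro divide_left_mono mult_pos_pos G_pos) auto
      also have "\<dots> = 1 / K * (exp (- c * real m) * real (Suc m) powr b)"
        unfolding c(2) by (simp add: exp_of_nat_mult[symmetric] powr_minus field_simps)
      finally show ?case .
    qed
    have "(\<lambda>m. exp (- c * real m) * real (Suc m) powr b) \<longlonglongrightarrow> 0"
      using c(1) b by real_asymp
    then show "(\<lambda>m. 1 / K * (exp (- c * real m) * real (Suc m) powr b)) \<longlonglongrightarrow> 0"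
      by (rule tendsto_mult_right_zero)
  qed
qed

text \<open>The row sum is close to its mean \<open>m\<close>, so the share moment should be close
  to \<open>H k m\<close>. The lower estimate is Jensen's inequality, as \<open>H k\<close> is
  convex and the sum has mean exactly \<open>m\<close>. The upper one uses monotonicity of
  \<open>H k\<close> above a level \<open>\<theta> * (m + 1)\<close>, a Chernoff bound below it, and
  \<open>\<theta>\<close> close to 1. Both work with the finite mean of the squared entries.\<close>

lemma share_moment_heavy:
  assumes a: "1 < a" and mean: "(\<integral>t. t\<^sup>2 \<partial>\<rho>) = 1" and k: "a < real k"
  shows "(\<lambda>m. share_moment (Suc m) k / G (real (Suc m))) \<longlonglongrightarrow> hlim k"
proof -
  have i2: "integrable \<rho> (\<lambda>t. t\<^sup>2)" by (rule moment_integrable[OF a])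
  have real_top: "filterlim (\<lambda>m. real (Suc m)) at_top sequentially" by real_asymp
  have lower: "H k (real m) \<le> share_moment (Suc m) k" if m: "1 \<le> m" for m
  proof -
    define q where "q t = (t\<^sup>2 / (t\<^sup>2 + m)) ^ k" for t :: real
    define c where "c = (\<integral>t. q t * (k / (t\<^sup>2 + m)) \<partial>\<rho>)"
    have pos: "0 < t\<^sup>2 + real m" for t :: real using m by (simp add: add_nonneg_pos)
    have q01: "0 \<le> q t" "q t \<le> 1" for t
      using frac_bounds[of "real m" t] by (auto simp: q_def intro!: power_le_one)
    have iq: "integrable \<rho> q" unfolding q_def[abs_def] by (rule H_integrable) simp
    have ic: "integrable \<rho> (\<lambda>t. q t * (k / (t\<^sup>2 + m)))"
    proof (rule integrable_const_bound[where B="real k"])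
      show "AE t in \<rho>. norm (q t * (k / (t\<^sup>2 + m))) \<le> real k"
      proof (rule AE_I2)
        fix t
        have "1 \<le> t\<^sup>2 + real m" using m by (simp add: add_increasing)
        then have "real k / (t\<^sup>2 + m) \<le> real k / 1" by (intro divide_left_mono) auto
        then have "q t * (k / (t\<^sup>2 + m)) \<le> 1 * (real k / 1)" using q01[of t] pos[of t]
          by (intro mult_mono) (auto intro: less_imp_le)
        then show "norm (q t * (k / (t\<^sup>2 + m))) \<le> real k" using q01[of t] pos[of t] by simp
      qed
      show "(\<lambda>t. q t * (k / (t\<^sup>2 + m))) \<in> borel_measurable \<rho>"
        unfolding q_def by (rule measurable_rho) measurable
    qed
    \<comment> \<open>The tangent line at \<open>m\<close> of a convex function of \<open>y\<close>.
      With \<open>z = (t\<^sup>2 + m) / (t\<^sup>2 + y)\<close> the value on the right is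
      \<open>q t * z ^ k\<close>; Bernoulli's inequality and \<open>2 - 1 / z \<le> z\<close> give
      the line.\<close>
    have tangent: "q t - (y - m) * (q t * (k / (t\<^sup>2 + m))) \<le> (t\<^sup>2 / (t\<^sup>2 + y)) ^ k" if y: "0 \<le> y" for t y :: real
    proof (cases "t = 0")
      case True
      then show ?thesis using k a by (cases k) (auto simp: q_def)
    next
      case False
      then have p: "0 < t\<^sup>2 + y" using y by (simp add: add_pos_nonneg)
      define z where "z = (t\<^sup>2 + m) / (t\<^sup>2 + y)"
      have z: "0 < z" using p pos[of t] by (simp add: z_def)
      have "1 - k * ((y - m) / (t\<^sup>2 + m)) \<le> 1 + k * (z - 1)"
      proof -
        have "1 / z - 1 = (y - m) / (t\<^sup>2 + m)" using p pos[of t] by (simp add: z_def field_simps)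
        moreover have "1 - (1 / z - 1) \<le> 1 + (z - 1)"
        proof -
          have "0 \<le> (z - 1)\<^sup>2 / z" using z by simp
          also have "(z - 1)\<^sup>2 / z = z - 2 + 1 / z" using z by (simp add: power2_eq_square field_simps)
          finally show ?thesis by linarith
        qed
        ultimately have "- ((y - m) / (t\<^sup>2 + m)) \<le> z - 1" by linarith
        then have "real k * (- ((y - m) / (t\<^sup>2 + m))) \<le> real k * (z - 1)" by (intro mult_left_mono) auto
        then show ?thesis by simp
      qed
      also have "\<dots> \<le> (1 + (z - 1)) ^ k" using z by (intro Bernoulli_inequality) simp
      finally have "q t * (1 - k * ((y - m) / (t\<^sup>2 + m))) \<le> q t * z ^ k"
        using q01[of t] by (intro mult_left_mono) auto
      also have "q t * z ^ k = (t\<^sup>2 / (t\<^sup>2 + y)) ^ k"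
        unfolding q_def z_def power_mult_distrib[symmetric] using pos[of t] by simp
      finally show ?thesis by (simp add: algebra_simps)
    qed
    have HS: "H k (real m) - (y - m) * c \<le> H k y" if "0 \<le> y" for y :: real
    proof -
      have "H k (real m) - (y - m) * c = (\<integral>t. q t - (y - m) * (q t * (k / (t\<^sup>2 + m))) \<partial>\<rho>)"
        unfolding H_def c_def q_def[symmetric]
        by (simp only: Bochner_Integration.integral_diff[OF iq integrable_mult_right[OF ic]] integral_mult_right_zero)
      also have "\<dots> \<le> H k y" unfolding H_def
        by (intro integral_mono H_integrable that Bochner_Integration.integrable_diff integrable_mult_right iq ic tangent)
      finally show ?thesis .
    qed
    have comp: "integrable (Row m) (\<lambda>x. (x j)\<^sup>2) \<and> (\<integral>x. (x j)\<^sup>2 \<partial>Row m) = 1" if j: "j < m" for j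
    proof -
      have d: "distr (Row m) \<rho> (\<lambda>x. x j) = \<rho>"
        using distr_PiM_component[of "{..<m}" "\<lambda>_. \<rho>" j] j prob_space_axioms by simp
      have [measurable]: "(\<lambda>t. t\<^sup>2) \<in> borel_measurable \<rho>" by (rule measurable_rho) measurable
      have m: "(\<lambda>x. x j) \<in> Row m \<rightarrow>\<^sub>M \<rho>" using j by (intro measurable_component_singleton) auto
      have "integrable (distr (Row m) \<rho> (\<lambda>x. x j)) (\<lambda>t. t\<^sup>2)" unfolding d by (rule i2)
      moreover have "(\<integral>t. t\<^sup>2 \<partial>distr (Row m) \<rho> (\<lambda>x. x j)) = 1" unfolding d by (rule mean)
      ultimately show ?thesis using m by (simp add: integrable_distr_eq integral_distr)
    qed
    have iS: "integrable (Row m) (sqsum m)" and eS: "(\<integral>x. sqsum m x \<partial>Row m) = m"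
      unfolding sqsum_def[abs_def] using comp by (auto intro!: Bochner_Integration.integrable_sum)
    have "H k (real m) = (\<integral>x. H k (real m) - (sqsum m x - m) * c \<partial>Row m)"
      using iS eS by (simp add: Row.prob_space)
    also have "\<dots> \<le> share_moment (Suc m) k"
      unfolding share_moment_Suc using iS HS
      by (intro integral_mono H_sqsum_integrable Bochner_Integration.integrable_diff integrable_mult_left)
        (auto simp: sqsum_nonneg)
    finally show ?thesis .
  qed
  have upper: "share_moment (Suc m) k \<le> H k y + Row.prob m {x \<in> space (Row m). sqsum m x < y}" if y: "0 < y" for m y
  proof -
    let ?B = "{x \<in> space (Row m). sqsum m x < y}"
    have "share_moment (Suc m) k \<le> (\<integral>x. H k y + indicator ?B x \<partial>Row m)"
      unfolding share_moment_Suc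
    proof (rule integral_mono[OF H_sqsum_integrable])
      show "integrable (Row m) (\<lambda>x. H k y + indicator ?B x)"
        by (intro Bochner_Integration.integrable_add integrable_real_indicator) (auto simp: Row.emeasure_eq_measure)
      fix x assume x: "x \<in> space (Row m)"
      show "H k (sqsum m x) \<le> H k y + indicator ?B x"
      proof (cases "sqsum m x < y")
        case True
        then show ?thesis using x y H_le_1[of "sqsum m x" k] H_nonneg[of y k] sqsum_nonneg[of m x] by simp
      next
        case False
        then show ?thesis using H_antimono[OF y, of "sqsum m x" k] by simp
      qed
    qed
    also have "\<dots> = H k y + Row.prob m ?B"
      by (subst Bochner_Integration.integral_add)
        (auto simp: Row.prob_space Row.emeasure_eq_measure intro!: integrable_real_indicator)
    finally show ?thesis .
  qed
  show ?thesis
  proof (rule order_tendstoI)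
    fix l assume "l < hlim k"
    then have "eventually (\<lambda>y. l < H k y / G y) at_top" by (intro order_tendstoD(1)[OF H_asymp[OF k]])
    then have "eventually (\<lambda>m. l < H k (real m) / G (real m)) sequentially"
      by (rule eventually_compose_filterlim[OF _ filterlim_real_sequentially])
    then show "\<forall>\<^sub>F m in sequentially. l < share_moment (Suc m) k / G (real (Suc m))"
      using eventually_ge_at_top[of 1]
    proof eventually_elim
      case (elim m)
      have "H k (real m) / G (real m) \<le> share_moment (Suc m) k / G (real m)"
        using lower[OF elim(2)] G_pos[of "real m"] by (intro divide_right_mono) auto
      also have "\<dots> \<le> share_moment (Suc m) k / G (real (Suc m))"
        by (intro divide_left_mono anti share_moment_nonneg mult_pos_pos G_pos) simp
      finally show ?case using elim by simp
    qed
  next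
    fix u assume u: "hlim k < u"
    \<comment> \<open>Lowering the level by the factor \<open>\<theta>\<close> raises the tail by
      \<open>\<theta> powr - a\<close> in the limit, so \<open>\<theta>\<close> is taken close
      enough to 1 to stay below \<open>u\<close>.\<close>
    have "((\<lambda>\<theta>. hlim k * \<theta> powr - a) \<longlongrightarrow> hlim k * 1 powr - a) (at_left 1)"
      by (intro tendsto_intros) auto
    then have "eventually (\<lambda>\<theta>. hlim k * \<theta> powr - a < u) (at_left 1)"
      using u by (intro order_tendstoD(2)) auto
    moreover have "eventually (\<lambda>\<theta>. \<theta> \<in> {0<..<1}) (at_left (1::real))"
      by (rule eventually_at_leftI[of 0]) auto
    ultimately have "eventually (\<lambda>\<theta>. hlim k * \<theta> powr - a < u \<and> \<theta> \<in> {0<..<1}) (at_left 1)"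
      by (rule eventually_conj)
    then obtain \<theta> where \<theta>: "hlim k * \<theta> powr - a < u" "0 < \<theta>" "\<theta> < 1"
      using eventually_happens[of _ "at_left (1::real)"] by (force simp: trivial_limit_at_left_real)
    \<comment> \<open>A second level, so that \<open>\<theta> * (m + 1) \<le> \<theta>' * m\<close>
      for large \<open>m\<close>: the sum has \<open>m\<close> terms while the tail is taken at
      \<open>m + 1\<close>.\<close>
    obtain \<theta>' where \<theta>': "\<theta> < \<theta>'" "\<theta>' < 1" using dense[OF \<theta>(3)] by blast
    obtain s where s: "0 < s" "exp (s * \<theta>') * lap s < 1" using lap_slope[OF i2 mean \<theta>'(2)] .
    define x where "x = exp (s * \<theta>') * lap s"
    have x: "0 \<le> x" "x < 1" using s lap_nonneg by (auto simp: x_def)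
    define y where "y m = \<theta> * real (Suc m)" for m
    have ytop: "filterlim y at_top sequentially" unfolding y_def using \<theta>(2) by real_asymp
    have ratio: "(\<lambda>m. G (y m) / G (real (Suc m))) \<longlonglongrightarrow> \<theta> powr - a"
      unfolding y_def by (rule filterlim_compose[OF regular[OF \<theta>(2)] real_top])
    have "(\<lambda>m. (H k (y m) / G (y m)) * (G (y m) / G (real (Suc m))) + x ^ m / G (real (Suc m)))
        \<longlonglongrightarrow> hlim k * \<theta> powr - a + 0"
      by (intro tendsto_add tendsto_mult filterlim_compose[OF H_asymp[OF k] ytop] ratio geometric_over_tail x)
    then have "eventually (\<lambda>m. (H k (y m) / G (y m)) * (G (y m) / G (real (Suc m))) + x ^ m / G (real (Suc m)) < u) sequentially"
      using \<theta>(1) by (intro order_tendstoD(2)) auto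
    moreover have "eventually (\<lambda>m. y m \<le> \<theta>' * real m) sequentially"
      unfolding y_def using \<theta>(2) \<theta>'(1) by real_asymp
    ultimately show "\<forall>\<^sub>F m in sequentially. share_moment (Suc m) k / G (real (Suc m)) < u"
    proof eventually_elim
      case (elim m)
      have y0: "0 < y m" using \<theta>(2) by (simp add: y_def)
      have "Row.prob m {z \<in> space (Row m). sqsum m z < y m} \<le> exp (s * y m) * lap s ^ m"
        using s by (intro chernoff) auto
      also have "\<dots> \<le> exp (s * (\<theta>' * real m)) * lap s ^ m"
        using elim(2) s lap_nonneg by (intro mult_right_mono) auto
      also have "\<dots> = x ^ m"
        unfolding x_def power_mult_distrib by (simp add: exp_of_nat_mult[symmetric] algebra_simps)
      finally have "share_moment (Suc m) k \<le> H k (y m) + x ^ m" using upper[OF y0, of m] by linarith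
      then have "share_moment (Suc m) k / G (real (Suc m)) \<le> (H k (y m) + x ^ m) / G (real (Suc m))"
        using G_pos[of "real (Suc m)"] by (intro divide_right_mono) auto
      also have "\<dots> = (H k (y m) / G (y m)) * (G (y m) / G (real (Suc m))) + x ^ m / G (real (Suc m))"
        using G_pos[of "y m"] by (simp add: add_divide_distrib)
      finally show ?case using elim(1) by linarith
    qed
  qed
qed

end

section \<open>Overlaps of two rows\<close>

lemma integral_pair_product:
  fixes f :: "'a \<Rightarrow> real" and g :: "'b \<Rightarrow> real"
  assumes "prob_space M1" "prob_space M2"
    and [measurable]: "f \<in> borel_measurable M1" "g \<in> borel_measurable M2"
    and bd: "\<And>x. \<bar>f x\<bar> \<le> A" "\<And>y. \<bar>g y\<bar> \<le> B"
  shows "(\<integral>(x, y). f x * g y \<partial>(M1 \<Otimes>\<^sub>M M2)) = (\<integral>x. f x \<partial>M1) * (\<integral>y. g y \<partial>M2)"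
    and "integrable (M1 \<Otimes>\<^sub>M M2) (\<lambda>(x, y). f x * g y)"
proof -
  interpret M1: prob_space M1 by fact
  interpret M2: prob_space M2 by fact
  interpret P: pair_prob_space M1 M2 ..
  have A: "0 \<le> A" using bd(1) abs_ge_zero order_trans by blast
  show i: "integrable (M1 \<Otimes>\<^sub>M M2) (\<lambda>(x, y). f x * g y)"
  proof (rule P.integrable_const_bound[where B="A * B"])
    show "AE z in M1 \<Otimes>\<^sub>M M2. norm (case z of (x, y) \<Rightarrow> f x * g y) \<le> A * B"
      using bd A by (intro AE_I2) (auto simp: abs_mult split: prod.split intro!: mult_mono)
  qed measurable
  show "(\<integral>(x, y). f x * g y \<partial>(M1 \<Otimes>\<^sub>M M2)) = (\<integral>x. f x \<partial>M1) * (\<integral>y. g y \<partial>M2)"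
    using P.integral_fst'[OF i] by simp
qed

lemma sum_four_squares: "(a + b + c + d)\<^sup>2 \<le> 4 * (a\<^sup>2 + b\<^sup>2 + c\<^sup>2 + d\<^sup>2 :: real)"
proof -
  have "4 * (a\<^sup>2 + b\<^sup>2 + c\<^sup>2 + d\<^sup>2) - (a + b + c + d)\<^sup>2 =
      (a - b)\<^sup>2 + (a - c)\<^sup>2 + (a - d)\<^sup>2 + (b - c)\<^sup>2 + (b - d)\<^sup>2 + (c - d)\<^sup>2"
    by (simp add: power2_eq_square algebra_simps)
  also have "\<dots> \<ge> 0" by simp
  finally show ?thesis by linarith
qed

text \<open>Appending a term adds to the error only the product of two increments, at most
  \<open>t\<^sup>2\<close> times the old sum times the new term. So up to products of distinct terms
  the exponential acts on each term separately.\<close>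

lemma iexp_sum_approx:
  fixes f :: "nat \<Rightarrow> real"
  assumes "\<And>j. 0 \<le> f j"
  shows "norm (iexp (t * (\<Sum>j<n. f j)) - 1 - (\<Sum>j<n. iexp (t * f j) - 1))
    \<le> t\<^sup>2 * (\<Sum>j<n. \<Sum>l\<in>{..<n} - {j}. f j * f l)"
proof (induction n)
  case (Suc n)
  define s where "s = (\<Sum>j<n. f j)"
  have lin: "norm (iexp (t * y) - 1) \<le> \<bar>t\<bar> * y" if "0 \<le> y" for y
    using iexp_approx1[of "t * y" 0] that by (simp add: abs_mult)
  have s0: "0 \<le> s" unfolding s_def using assms by (intro sum_nonneg) auto
  have "iexp (t * (s + f n)) = iexp (t * s) * iexp (t * f n)"
    by (simp add: exp_add[symmetric] algebra_simps)
  then have "iexp (t * (\<Sum>j<Suc n. f j)) - 1 - (\<Sum>j<Suc n. iexp (t * f j) - 1) =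
      (iexp (t * s) - 1 - (\<Sum>j<n. iexp (t * f j) - 1)) + (iexp (t * s) - 1) * (iexp (t * f n) - 1)"
    by (simp add: s_def[symmetric] algebra_simps)
  also have "norm \<dots> \<le> norm (iexp (t * s) - 1 - (\<Sum>j<n. iexp (t * f j) - 1)) +
      norm (iexp (t * s) - 1) * norm (iexp (t * f n) - 1)"
    unfolding norm_mult[symmetric] by (rule norm_triangle_ineq)
  also have "\<dots> \<le> t\<^sup>2 * (\<Sum>j<n. \<Sum>l\<in>{..<n} - {j}. f j * f l) + (\<bar>t\<bar> * s) * (\<bar>t\<bar> * f n)"
    using Suc s0 assms by (intro add_mono mult_mono lin) (auto simp: s_def)
  also have "(\<bar>t\<bar> * s) * (\<bar>t\<bar> * f n) = t\<^sup>2 * (\<Sum>j<n. f j * f n)"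
  proof -
    have "(\<bar>t\<bar> * s) * (\<bar>t\<bar> * f n) = (\<bar>t\<bar> * \<bar>t\<bar>) * (s * f n)" by (simp only: mult_ac)
    also have "\<dots> = t\<^sup>2 * (s * f n)" by (simp only: abs_mult_self_eq power2_eq_square)
    also have "s * f n = (\<Sum>j<n. f j * f n)" unfolding s_def by (rule sum_distrib_right)
    finally show ?thesis .
  qed
  also have "t\<^sup>2 * (\<Sum>j<n. \<Sum>l\<in>{..<n} - {j}. f j * f l) + t\<^sup>2 * (\<Sum>j<n. f j * f n) =
      t\<^sup>2 * (\<Sum>j<n. \<Sum>l\<in>{..<Suc n} - {j}. f j * f l)"
  proof -
    have "(\<Sum>l\<in>{..<Suc n} - {j}. f j * f l) = (\<Sum>l\<in>{..<n} - {j}. f j * f l) + f j * f n" if "j < n" for j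
    proof -
      have "{..<Suc n} - {j} = insert n ({..<n} - {j})" using that by auto
      then show ?thesis by simp
    qed
    then show ?thesis by (simp add: distrib_left[symmetric] sum.distrib[symmetric])
  qed
  also have "\<dots> \<le> t\<^sup>2 * (\<Sum>j<Suc n. \<Sum>l\<in>{..<Suc n} - {j}. f j * f l)"
    using assms by (intro mult_left_mono) (auto intro!: sum_nonneg)
  finally show ?case .
qed simp

lemma integral_double_sum:
  fixes f :: "nat \<Rightarrow> nat \<Rightarrow> 'a \<Rightarrow> real"
  assumes i: "\<And>j l. j < n \<Longrightarrow> l < n \<Longrightarrow> integrable M (f j l)"
  shows "integrable M (\<lambda>x. \<Sum>j<n. \<Sum>l<n. f j l x)"
    and "(\<integral>x. (\<Sum>j<n. \<Sum>l<n. f j l x) \<partial>M) = (\<Sum>j<n. \<Sum>l<n. \<integral>x. f j l x \<partial>M)"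
proof -
  have i': "j < n \<Longrightarrow> integrable M (\<lambda>x. \<Sum>l<n. f j l x)" for j
    by (intro Bochner_Integration.integrable_sum i) auto
  show "integrable M (\<lambda>x. \<Sum>j<n. \<Sum>l<n. f j l x)"
    by (intro Bochner_Integration.integrable_sum i') auto
  have "(\<integral>x. (\<Sum>j<n. \<Sum>l<n. f j l x) \<partial>M) = (\<Sum>j<n. \<integral>x. (\<Sum>l<n. f j l x) \<partial>M)"
    by (intro Bochner_Integration.integral_sum i') auto
  also have "\<dots> = (\<Sum>j<n. \<Sum>l<n. \<integral>x. f j l x \<partial>M)"
    by (intro sum.cong refl Bochner_Integration.integral_sum i) auto
  finally show "(\<integral>x. (\<Sum>j<n. \<Sum>l<n. f j l x) \<partial>M) = (\<Sum>j<n. \<Sum>l<n. \<integral>x. f j l x \<partial>M)" .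
qed

section \<open>Overlaps of two independent rows\<close>

context row_law
begin

sublocale RR: pair_prob_space "Row n" "Row n" for n ..

definition overlap :: "nat \<Rightarrow> (nat \<Rightarrow> real) \<Rightarrow> (nat \<Rightarrow> real) \<Rightarrow> nat \<Rightarrow> real" where
  "overlap n x y j = 2 * share n x j * share n y j"

lemma overlap_nonneg: "0 \<le> overlap n x y j"
  by (simp add: overlap_def share_nonneg)

lemma overlap_le: "j < n \<Longrightarrow> overlap n x y j \<le> 2 * share n x j"
  using mult_left_mono[OF share_le_1[of j n y] share_nonneg[of n x j]] by (simp add: overlap_def)

lemma overlap_le_2: "j < n \<Longrightarrow> overlap n x y j \<le> 2"
  using overlap_le[of j n x y] share_le_1[of j n x] by linarith

lemma sum_overlap_le: "(\<Sum>j<n. overlap n x y j) \<le> 2"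
proof -
  have "(\<Sum>j<n. overlap n x y j) \<le> (\<Sum>j<n. 2 * share n x j)"
    by (intro sum_mono overlap_le) simp
  also have "\<dots> \<le> 2" using sum_share_le_1[of n x] by (simp add: sum_distrib_left[symmetric])
  finally show ?thesis .
qed

lemma overlap_measurable [measurable]:
  "j < n \<Longrightarrow> (\<lambda>z. overlap n (fst z) (snd z) j) \<in> borel_measurable (Row n \<Otimes>\<^sub>M Row n)"
  unfolding overlap_def
  by (intro borel_measurable_times borel_measurable_const
      measurable_compose[OF measurable_fst share_measurable] measurable_compose[OF measurable_snd share_measurable])

text \<open>Written without reference to a column; by exchangeability it is the law of every single
  overlap.\<close>

definition overlap_law :: "nat \<Rightarrow> real measure" where
  "overlap_law n = distr (share_law n \<Otimes>\<^sub>M share_law n) borel (\<lambda>(u, v). 2 * u * v)"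

lemma sets_overlap_law [simp, measurable_cong]: "sets (overlap_law n) = sets borel"
  by (simp add: overlap_law_def)

lemma distr_overlap:
  assumes j: "j < n"
  shows "distr (Row n \<Otimes>\<^sub>M Row n) borel (\<lambda>z. overlap n (fst z) (snd z) j) = overlap_law n"
proof -
  let ?s = "\<lambda>x. share n x j"
  have [measurable]: "?s \<in> borel_measurable (Row n)" using j by (rule share_measurable)
  have sf: "sigma_finite_measure (distr (Row n) borel ?s)"
    by (intro prob_space_imp_sigma_finite Row.prob_space_distr) simp
  have "overlap_law n = distr (distr (Row n) borel ?s \<Otimes>\<^sub>M distr (Row n) borel ?s) borel (\<lambda>(u, v). 2 * u * v)"
    unfolding overlap_law_def distr_share[OF j] ..
  also have "distr (Row n) borel ?s \<Otimes>\<^sub>M distr (Row n) borel ?s =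
      distr (Row n \<Otimes>\<^sub>M Row n) (borel \<Otimes>\<^sub>M borel) (\<lambda>(x, y). (?s x, ?s y))"
    by (intro pair_measure_distr sf) simp_all
  also have "distr \<dots> borel (\<lambda>(u, v). 2 * u * v) =
      distr (Row n \<Otimes>\<^sub>M Row n) borel ((\<lambda>(u, v). 2 * u * v) \<circ> (\<lambda>(x, y). (?s x, ?s y)))"
    by (intro distr_distr) measurable
  also have "(\<lambda>(u, v). 2 * u * v) \<circ> (\<lambda>(x, y). (?s x, ?s y)) = (\<lambda>z. overlap n (fst z) (snd z) j)"
    by (auto simp: overlap_def fun_eq_iff)
  finally show ?thesis ..
qed

lemma integral_overlap:
  fixes \<phi> :: "real \<Rightarrow> 'e::{banach, second_countable_topology}"
  assumes "j < n" and [measurable]: "\<phi> \<in> borel_measurable borel"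
  shows "(\<integral>z. \<phi> (overlap n (fst z) (snd z) j) \<partial>(Row n \<Otimes>\<^sub>M Row n)) = (\<integral>w. \<phi> w \<partial>overlap_law n)"
  unfolding distr_overlap[OF assms(1), symmetric]
  by (rule integral_distr[symmetric]) (use overlap_measurable[OF assms(1)] in auto)

lemma prob_space_overlap_law:
  assumes "1 \<le> n" shows "prob_space (overlap_law n)"
proof -
  have n: "0 < n" using assms by simp
  show ?thesis
    unfolding distr_overlap[OF n, symmetric] by (rule RR.prob_space_distr[OF overlap_measurable[OF n]])
qed

lemma AE_overlap_law:
  assumes "1 \<le> n" shows "AE w in overlap_law n. 0 \<le> w \<and> w \<le> 2"
proof -
  have n: "0 < n" using assms by simp
  have "AE z in Row n \<Otimes>\<^sub>M Row n. 0 \<le> overlap n (fst z) (snd z) 0 \<and> overlap n (fst z) (snd z) 0 \<le> 2"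
    by (intro AE_I2 conjI overlap_nonneg overlap_le_2 n)
  then show ?thesis
    unfolding distr_overlap[OF n, symmetric] by (subst AE_distr_iff[OF overlap_measurable[OF n]]) simp_all
qed

lemma overlap_moment:
  assumes j: "j < n"
  shows "(\<integral>z. overlap n (fst z) (snd z) j ^ k \<partial>(Row n \<Otimes>\<^sub>M Row n)) = 2 ^ k * (share_moment n k)\<^sup>2"
proof -
  have m: "(\<lambda>x. share n x j ^ k) \<in> borel_measurable (Row n)" using j by measurable
  have b: "\<bar>share n x j ^ k\<bar> \<le> 1" for x
    using j by (auto simp: share_nonneg intro!: power_le_one share_le_1)
  have "(\<integral>z. overlap n (fst z) (snd z) j ^ k \<partial>(Row n \<Otimes>\<^sub>M Row n)) =
      (\<integral>z. 2 ^ k * (case z of (x, y) \<Rightarrow> share n x j ^ k * share n y j ^ k) \<partial>(Row n \<Otimes>\<^sub>M Row n))"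
    by (intro Bochner_Integration.integral_cong) (auto simp: overlap_def power_mult_distrib)
  also have "\<dots> = 2 ^ k * (\<integral>(x, y). share n x j ^ k * share n y j ^ k \<partial>(Row n \<Otimes>\<^sub>M Row n))"
    by (rule integral_mult_right_zero)
  also have "(\<integral>(x, y). share n x j ^ k * share n y j ^ k \<partial>(Row n \<Otimes>\<^sub>M Row n)) = share_moment n k * share_moment n k"
    unfolding share_moment_eq[OF j, of k]
    by (rule integral_pair_product(1)[OF prob_space_Row prob_space_Row m m b b])
  finally show ?thesis by (simp add: power2_eq_square)
qed

lemma integral_overlap_prod:
  assumes j: "j < n" "l < n"
  shows "(\<integral>z. overlap n (fst z) (snd z) j * overlap n (fst z) (snd z) l \<partial>(Row n \<Otimes>\<^sub>M Row n)) =
    4 * (\<integral>x. share n x j * share n x l \<partial>Row n)\<^sup>2"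
proof -
  have m: "(\<lambda>x. share n x j * share n x l) \<in> borel_measurable (Row n)" using j by measurable
  have b: "\<bar>share n x j * share n x l\<bar> \<le> 1" for x
    using j by (auto simp: abs_mult share_nonneg intro!: mult_le_one share_le_1)
  have "(\<integral>z. overlap n (fst z) (snd z) j * overlap n (fst z) (snd z) l \<partial>(Row n \<Otimes>\<^sub>M Row n)) =
      (\<integral>z. 4 * (case z of (x, y) \<Rightarrow> (share n x j * share n x l) * (share n y j * share n y l)) \<partial>(Row n \<Otimes>\<^sub>M Row n))"
    by (intro Bochner_Integration.integral_cong) (auto simp: overlap_def)
  also have "\<dots> = 4 * (\<integral>(x, y). (share n x j * share n x l) * (share n y j * share n y l) \<partial>(Row n \<Otimes>\<^sub>M Row n))"
    by (rule integral_mult_right_zero)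
  also have "(\<integral>(x, y). (share n x j * share n x l) * (share n y j * share n y l) \<partial>(Row n \<Otimes>\<^sub>M Row n)) =
      (\<integral>x. share n x j * share n x l \<partial>Row n) * (\<integral>x. share n x j * share n x l \<partial>Row n)"
    by (rule integral_pair_product(1)[OF prob_space_Row prob_space_Row m m b b])
  finally show ?thesis by (simp add: power2_eq_square)
qed

lemma integral_overlap_prod_le:
  assumes "j < n" "l < n" "j \<noteq> l"
  shows "(\<integral>z. overlap n (fst z) (snd z) j * overlap n (fst z) (snd z) l \<partial>(Row n \<Otimes>\<^sub>M Row n)) \<le>
    4 / (real n * (real n - 1))\<^sup>2"
proof -
  have "(\<integral>x. share n x j * share n x l \<partial>Row n)\<^sup>2 \<le> (1 / (real n * (real n - 1)))\<^sup>2"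
    using assms by (intro power_mono mean_share_prod_le integral_nonneg_AE) (auto simp: share_nonneg)
  then show ?thesis using assms by (simp add: integral_overlap_prod power_divide)
qed

lemma integrable_overlap:
  fixes f :: "real \<Rightarrow> real"
  assumes "j < n" "f \<in> borel_measurable borel" "\<And>w. 0 \<le> w \<Longrightarrow> w \<le> 2 \<Longrightarrow> \<bar>f w\<bar> \<le> B"
  shows "integrable (Row n \<Otimes>\<^sub>M Row n) (\<lambda>z. f (overlap n (fst z) (snd z) j))"
proof (rule RR.integrable_const_bound[where B=B])
  show "AE z in Row n \<Otimes>\<^sub>M Row n. norm (f (overlap n (fst z) (snd z) j)) \<le> B"
    unfolding real_norm_def by (intro AE_I2 assms(3) overlap_nonneg overlap_le_2 assms(1))
qed (rule measurable_compose[OF overlap_measurable[OF assms(1)] assms(2)])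

lemma integrable_overlap_prod:
  fixes f g :: "real \<Rightarrow> real"
  assumes "j < n" "l < n" "f \<in> borel_measurable borel" "g \<in> borel_measurable borel"
    "\<And>w. 0 \<le> w \<Longrightarrow> w \<le> 2 \<Longrightarrow> \<bar>f w\<bar> \<le> 2" "\<And>w. 0 \<le> w \<Longrightarrow> w \<le> 2 \<Longrightarrow> \<bar>g w\<bar> \<le> 2"
  shows "integrable (Row n \<Otimes>\<^sub>M Row n) (\<lambda>z. f (overlap n (fst z) (snd z) j) * g (overlap n (fst z) (snd z) l))"
proof (rule RR.integrable_const_bound[where B="2 * 2"])
  show "AE z in Row n \<Otimes>\<^sub>M Row n. norm (f (overlap n (fst z) (snd z) j) * g (overlap n (fst z) (snd z) l)) \<le> 2 * 2"
    unfolding real_norm_def abs_mult using assms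
    by (intro AE_I2 mult_mono) (auto simp: overlap_nonneg overlap_le_2)
  show "(\<lambda>z. f (overlap n (fst z) (snd z) j) * g (overlap n (fst z) (snd z) l)) \<in> borel_measurable (Row n \<Otimes>\<^sub>M Row n)"
    using assms by (intro borel_measurable_times measurable_compose[OF overlap_measurable]) auto
qed

text \<open>A soft threshold: \<open>w\<close> splits continuously into
  \<open>excess \<epsilon> w\<close> and \<open>min w \<epsilon>\<close>. Continuity matters because
  convergence of the overlap laws is established for continuous test functions.\<close>

definition excess :: "real \<Rightarrow> real \<Rightarrow> real" where "excess \<epsilon> w = max 0 (w - \<epsilon>)"

lemma excess_measurable [measurable]: "excess \<epsilon> \<in> borel_measurable borel"
  unfolding excess_def[abs_def] by measurable

lemma excess_nonneg: "0 \<le> excess \<epsilon> w" by (simp add: excess_def)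

lemma excess_le: "0 \<le> \<epsilon> \<Longrightarrow> 0 \<le> w \<Longrightarrow> excess \<epsilon> w \<le> w" by (simp add: excess_def)

lemma excess_bound: "0 \<le> \<epsilon> \<Longrightarrow> 0 \<le> w \<Longrightarrow> w \<le> 2 \<Longrightarrow> \<bar>excess \<epsilon> w\<bar> \<le> 2" by (simp add: excess_def)

text \<open>Above the threshold \<open>w / \<epsilon>\<close> exceeds 1, so one more factor of
  \<open>w\<close> can be introduced. Estimates of large overlaps thus reduce to second moments of
  shares.\<close>

lemma excess_le_square:
  assumes "0 < \<epsilon>" "0 \<le> w" shows "excess \<epsilon> w \<le> w\<^sup>2 / \<epsilon>"
proof (cases "w \<le> \<epsilon>")
  case False
  then have "w * \<epsilon> \<le> w * w" using assms by (intro mult_left_mono) auto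
  then have "w \<le> w\<^sup>2 / \<epsilon>" using assms by (simp add: pos_le_divide_eq power2_eq_square)
  then show ?thesis using excess_le[of \<epsilon> w] assms by simp
qed (use assms in \<open>simp add: excess_def\<close>)

lemma excess_neq_0:
  assumes "0 < \<epsilon>" shows "of_bool (excess \<epsilon> w \<noteq> 0) \<le> w\<^sup>2 / \<epsilon>\<^sup>2"
proof (cases "w \<le> \<epsilon>")
  case False
  then have "\<epsilon>\<^sup>2 \<le> w\<^sup>2" using assms by (intro power_mono) auto
  then show ?thesis using assms by simp
qed (simp add: excess_def)

definition hker :: "real \<Rightarrow> nat \<Rightarrow> (nat \<Rightarrow> real) \<Rightarrow> (nat \<Rightarrow> real) \<Rightarrow> real" where
  "hker \<epsilon> n x y = (\<Sum>j<n. excess \<epsilon> (overlap n x y j))"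

lemma hker_sym: "hker \<epsilon> n x y = hker \<epsilon> n y x"
  by (simp add: hker_def overlap_def mult_ac)

lemma hker_measurable [measurable]: "case_prod (hker \<epsilon> n) \<in> borel_measurable (Row n \<Otimes>\<^sub>M Row n)"
proof -
  have "case_prod (hker \<epsilon> n) = (\<lambda>z. \<Sum>j<n. excess \<epsilon> (overlap n (fst z) (snd z) j))"
    by (auto simp: hker_def fun_eq_iff)
  then show ?thesis
    by (auto intro!: borel_measurable_sum measurable_compose[OF overlap_measurable excess_measurable])
qed

lemma hker_bounds: "0 \<le> \<epsilon> \<Longrightarrow> 0 \<le> hker \<epsilon> n x y \<and> hker \<epsilon> n x y \<le> 2"
proof -
  assume e: "0 \<le> \<epsilon>"
  have "hker \<epsilon> n x y \<le> (\<Sum>j<n. overlap n x y j)"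
    unfolding hker_def using e by (intro sum_mono excess_le overlap_nonneg)
  also have "\<dots> \<le> 2" by (rule sum_overlap_le)
  finally show ?thesis by (simp add: hker_def sum_nonneg excess_nonneg)
qed

lemma hker_mean:
  assumes e: "0 \<le> \<epsilon>"
  shows "(\<integral>z. case_prod (hker \<epsilon> n) z \<partial>(Row n \<Otimes>\<^sub>M Row n)) = n * (\<integral>w. excess \<epsilon> w \<partial>overlap_law n)"
proof -
  have "(\<integral>z. case_prod (hker \<epsilon> n) z \<partial>(Row n \<Otimes>\<^sub>M Row n)) =
      (\<integral>z. (\<Sum>j<n. excess \<epsilon> (overlap n (fst z) (snd z) j)) \<partial>(Row n \<Otimes>\<^sub>M Row n))"
    by (intro Bochner_Integration.integral_cong) (auto simp: hker_def)
  also have "\<dots> = (\<Sum>j<n. \<integral>z. excess \<epsilon> (overlap n (fst z) (snd z) j) \<partial>(Row n \<Otimes>\<^sub>M Row n))"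
    using excess_bound[OF e] by (intro Bochner_Integration.integral_sum integrable_overlap) auto
  also have "\<dots> = (\<Sum>j<n. \<integral>w. excess \<epsilon> w \<partial>overlap_law n)"
    by (intro sum.cong integral_overlap) auto
  finally show ?thesis by simp
qed

lemma hker_mean_le:
  assumes e: "0 \<le> \<epsilon>" and n: "1 \<le> n"
  shows "0 \<le> (\<integral>z. case_prod (hker \<epsilon> n) z \<partial>(Row n \<Otimes>\<^sub>M Row n))"
    "(\<integral>z. case_prod (hker \<epsilon> n) z \<partial>(Row n \<Otimes>\<^sub>M Row n)) \<le> 2 / n"
proof -
  show "0 \<le> (\<integral>z. case_prod (hker \<epsilon> n) z \<partial>(Row n \<Otimes>\<^sub>M Row n))"
    using hker_bounds[OF e] by (intro integral_nonneg_AE AE_I2) (auto split: prod.split)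
  have "(\<integral>z. case_prod (hker \<epsilon> n) z \<partial>(Row n \<Otimes>\<^sub>M Row n)) \<le>
      (\<integral>z. (\<Sum>j<n. overlap n (fst z) (snd z) j ^ 1) \<partial>(Row n \<Otimes>\<^sub>M Row n))"
  proof (rule integral_mono)
    show "integrable (Row n \<Otimes>\<^sub>M Row n) (case_prod (hker \<epsilon> n))"
      using hker_bounds[OF e] by (intro RR.integrable_const_bound[where B=2]) (auto intro!: AE_I2)
    show "integrable (Row n \<Otimes>\<^sub>M Row n) (\<lambda>z. \<Sum>j<n. overlap n (fst z) (snd z) j ^ 1)"
      by (intro Bochner_Integration.integrable_sum integrable_overlap[where B=2]) auto
    show "case_prod (hker \<epsilon> n) z \<le> (\<Sum>j<n. overlap n (fst z) (snd z) j ^ 1)" for z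
      by (cases z) (auto simp: hker_def intro!: sum_mono excess_le overlap_nonneg e)
  qed
  also have "\<dots> = (\<Sum>j<n. \<integral>z. overlap n (fst z) (snd z) j ^ 1 \<partial>(Row n \<Otimes>\<^sub>M Row n))"
    by (intro Bochner_Integration.integral_sum integrable_overlap[where B=2]) auto
  also have "\<dots> = (\<Sum>j<n. 2 ^ 1 * (share_moment n 1)\<^sup>2)"
    by (intro sum.cong overlap_moment) auto
  also have "\<dots> = n * (2 * (share_moment n 1)\<^sup>2)"
    by (simp only: sum_constant card_lessThan power_one_right)
  also have "\<dots> \<le> n * (2 * (1 / n)\<^sup>2)"
    by (intro mult_left_mono power_mono share_moment_1_le[OF n] share_moment_nonneg) auto
  also have "\<dots> = 2 / n" by (simp add: power2_eq_square)
  finally show "(\<integral>z. case_prod (hker \<epsilon> n) z \<partial>(Row n \<Otimes>\<^sub>M Row n)) \<le> 2 / n" .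
qed

text \<open>A union bound over the columns combined with Chebyshev's inequality; the second moment
  of one overlap is \<open>4 * (share_moment n 2)\<^sup>2\<close>.\<close>

lemma hker_support:
  assumes e: "0 < \<epsilon>"
  shows "(\<integral>(x, y). of_bool (hker \<epsilon> n x y \<noteq> 0) \<partial>(Row n \<Otimes>\<^sub>M Row n)) \<le> 4 * n * (share_moment n 2)\<^sup>2 / \<epsilon>\<^sup>2"
proof -
  have iw: "integrable (Row n \<Otimes>\<^sub>M Row n) (\<lambda>z. overlap n (fst z) (snd z) j ^ 2 / \<epsilon>\<^sup>2)" if "j < n" for j
  proof (rule integrable_overlap[where f="\<lambda>w. w ^ 2 / \<epsilon>\<^sup>2" and B="2\<^sup>2 / \<epsilon>\<^sup>2", OF that])
    fix w :: real assume "0 \<le> w" "w \<le> 2"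
    then have "w\<^sup>2 / \<epsilon>\<^sup>2 \<le> 2\<^sup>2 / \<epsilon>\<^sup>2" by (intro divide_right_mono power_mono zero_le_power2)
    moreover have "\<bar>w\<^sup>2 / \<epsilon>\<^sup>2\<bar> = w\<^sup>2 / \<epsilon>\<^sup>2" by (rule abs_of_nonneg) simp
    ultimately show "\<bar>w\<^sup>2 / \<epsilon>\<^sup>2\<bar> \<le> 2\<^sup>2 / \<epsilon>\<^sup>2" by linarith
  qed measurable
  have "(\<integral>(x, y). of_bool (hker \<epsilon> n x y \<noteq> 0) \<partial>(Row n \<Otimes>\<^sub>M Row n)) \<le>
      (\<integral>z. (\<Sum>j<n. overlap n (fst z) (snd z) j ^ 2 / \<epsilon>\<^sup>2) \<partial>(Row n \<Otimes>\<^sub>M Row n))"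
  proof (rule integral_mono)
    show "integrable (Row n \<Otimes>\<^sub>M Row n) (\<lambda>(x, y). of_bool (hker \<epsilon> n x y \<noteq> 0) :: real)"
      by (intro RR.integrable_const_bound[where B=1]) auto
    show "integrable (Row n \<Otimes>\<^sub>M Row n) (\<lambda>z. \<Sum>j<n. overlap n (fst z) (snd z) j ^ 2 / \<epsilon>\<^sup>2)"
      by (intro Bochner_Integration.integrable_sum iw) auto
    fix z :: "(nat \<Rightarrow> real) \<times> (nat \<Rightarrow> real)"
    obtain x y where z: "z = (x, y)" by (cases z)
    have "of_bool (hker \<epsilon> n x y \<noteq> 0) \<le> (\<Sum>j<n. of_bool (excess \<epsilon> (overlap n x y j) \<noteq> 0) :: real)"
    proof (cases "hker \<epsilon> n x y = 0")
      case False
      then obtain j where "j < n" "excess \<epsilon> (overlap n x y j) \<noteq> 0"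
        unfolding hker_def by (meson lessThan_iff sum.neutral)
      then have "of_bool (excess \<epsilon> (overlap n x y j) \<noteq> 0) \<le> (\<Sum>j<n. of_bool (excess \<epsilon> (overlap n x y j) \<noteq> 0) :: real)"
        by (intro member_le_sum) auto
      then show ?thesis using False \<open>excess \<epsilon> (overlap n x y j) \<noteq> 0\<close> by simp
    qed (simp add: sum_nonneg)
    also have "\<dots> \<le> (\<Sum>j<n. overlap n x y j ^ 2 / \<epsilon>\<^sup>2)" by (intro sum_mono excess_neq_0 e)
    finally show "(case z of (x, y) \<Rightarrow> of_bool (hker \<epsilon> n x y \<noteq> 0)) \<le> (\<Sum>j<n. overlap n (fst z) (snd z) j ^ 2 / \<epsilon>\<^sup>2)"
      unfolding z by simp
  qed
  also have "\<dots> = (\<Sum>j<n. (\<integral>z. overlap n (fst z) (snd z) j ^ 2 / \<epsilon>\<^sup>2 \<partial>(Row n \<Otimes>\<^sub>M Row n)))"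
    by (intro Bochner_Integration.integral_sum iw) auto
  also have "\<dots> = (\<Sum>j<n. 2 ^ 2 * (share_moment n 2)\<^sup>2 / \<epsilon>\<^sup>2)"
  proof (rule sum.cong[OF refl])
    fix j assume "j \<in> {..<n}"
    then have j: "j < n" by simp
    show "(\<integral>z. overlap n (fst z) (snd z) j ^ 2 / \<epsilon>\<^sup>2 \<partial>(Row n \<Otimes>\<^sub>M Row n)) = 2 ^ 2 * (share_moment n 2)\<^sup>2 / \<epsilon>\<^sup>2"
      unfolding integral_divide_zero overlap_moment[OF j] ..
  qed
  also have "\<dots> = 4 * real n * (share_moment n 2)\<^sup>2 / \<epsilon>\<^sup>2" by simp
  finally show ?thesis .
qed

text \<open>The squared shares of a row sum to at most 1, since the shares are at most 1 and sum to
  at most 1. This keeps the double sum over columns of the order of a single one.\<close>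

lemma square_shares: "(\<Sum>j<n. \<Sum>l<n. (\<integral>x. (share n x j)\<^sup>2 * (share n x l)\<^sup>2 \<partial>Row n)) \<le> n * share_moment n 2"
proof -
  have i: "integrable (Row n) (\<lambda>x. (share n x j)\<^sup>2 * (share n x l)\<^sup>2)" if "j < n" "l < n" for j l
  proof (rule Row.integrable_const_bound[where B=1])
    show "AE x in Row n. norm ((share n x j)\<^sup>2 * (share n x l)\<^sup>2) \<le> 1"
      using that by (intro AE_I2) (auto simp: abs_mult share_nonneg intro!: mult_le_one power_le_one share_le_1)
  qed (use that in measurable)
  have "(\<Sum>j<n. \<Sum>l<n. (\<integral>x. (share n x j)\<^sup>2 * (share n x l)\<^sup>2 \<partial>Row n)) =
      (\<integral>x. (\<Sum>j<n. \<Sum>l<n. (share n x j)\<^sup>2 * (share n x l)\<^sup>2) \<partial>Row n)"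
    by (rule integral_double_sum(2)[OF i, symmetric])
  also have "\<dots> \<le> (\<integral>x. (\<Sum>j<n. (share n x j)\<^sup>2) \<partial>Row n)"
  proof (rule integral_mono)
    show "integrable (Row n) (\<lambda>x. \<Sum>j<n. \<Sum>l<n. (share n x j)\<^sup>2 * (share n x l)\<^sup>2)"
      by (rule integral_double_sum(1)[OF i])
    show "integrable (Row n) (\<lambda>x. \<Sum>j<n. (share n x j)\<^sup>2)"
      by (intro Bochner_Integration.integrable_sum integrable_share_power) auto
    fix x
    have "(\<Sum>l<n. (share n x l)\<^sup>2) \<le> (\<Sum>l<n. share n x l)"
    proof (rule sum_mono)
      fix l assume "l \<in> {..<n}"
      then show "(share n x l)\<^sup>2 \<le> share n x l"
        using mult_left_mono[OF share_le_1[of l n x] share_nonneg[of n x l]] by (simp add: power2_eq_square)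
    qed
    also have "\<dots> \<le> 1" by (rule sum_share_le_1)
    finally have "(\<Sum>l<n. (share n x l)\<^sup>2) \<le> 1" .
    then have "(\<Sum>j<n. (share n x j)\<^sup>2) * (\<Sum>l<n. (share n x l)\<^sup>2) \<le> (\<Sum>j<n. (share n x j)\<^sup>2) * 1"
      by (intro mult_left_mono) (auto simp: sum_nonneg)
    then show "(\<Sum>j<n. \<Sum>l<n. (share n x j)\<^sup>2 * (share n x l)\<^sup>2) \<le> (\<Sum>j<n. (share n x j)\<^sup>2)"
      by (simp add: sum_product)
  qed
  also have "\<dots> = (\<Sum>j<n. (\<integral>x. (share n x j)\<^sup>2 \<partial>Row n))"
    by (intro Bochner_Integration.integral_sum integrable_share_power) auto
  also have "\<dots> = n * share_moment n 2"
    by (simp add: share_moment_eq[symmetric])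
  finally show ?thesis .
qed

text \<open>Two overlaps that share a row are both of order one only if that row has a large share
  twice, which costs an extra factor \<open>share_moment n 2\<close>.\<close>
lemma triple_bound:
  fixes F :: "(nat \<Rightarrow> real) \<times> (nat \<Rightarrow> real) \<times> (nat \<Rightarrow> real) \<Rightarrow> real"
  assumes F: "F \<in> borel_measurable (Row n \<Otimes>\<^sub>M (Row n \<Otimes>\<^sub>M Row n))"
    and C: "0 \<le> C"
    and bd: "\<And>x y z. \<bar>F (x, y, z)\<bar> \<le> C * (\<Sum>j<n. \<Sum>l<n. (overlap n x y j)\<^sup>2 * (overlap n x z l)\<^sup>2)"
    and bd': "\<And>w. \<bar>F w\<bar> \<le> B"
  shows "(\<integral>w. F w \<partial>(Row n \<Otimes>\<^sub>M (Row n \<Otimes>\<^sub>M Row n))) \<le> 16 * C * n * share_moment n 2 ^ 3"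
proof -
  interpret T: pair_prob_space "Row n" "Row n \<Otimes>\<^sub>M Row n" ..
  let ?T = "Row n \<Otimes>\<^sub>M (Row n \<Otimes>\<^sub>M Row n)"
  \<comment> \<open>The product separates by rows: the common row carries both columns, the other
    two rows one each. The factor 16 comes from the 2 in each of the two squared overlaps.\<close>
  define g where "g j l = (\<lambda>(x, w). ((share n x j)\<^sup>2 * (share n x l)\<^sup>2) * (case w of (y, z) \<Rightarrow> (share n y j)\<^sup>2 * (share n z l)\<^sup>2))" for j l
  have m2: "(\<lambda>x. (share n x j)\<^sup>2) \<in> borel_measurable (Row n)" if "j < n" for j using that by measurable
  have b2: "\<bar>(share n x j)\<^sup>2\<bar> \<le> 1" if "j < n" for j x
    using that by (auto simp: share_nonneg intro!: power_le_one share_le_1)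
  have m4: "(\<lambda>x. (share n x j)\<^sup>2 * (share n x l)\<^sup>2) \<in> borel_measurable (Row n)" if "j < n" "l < n" for j l
    using that by measurable
  have b4: "\<bar>(share n x j)\<^sup>2 * (share n y l)\<^sup>2\<bar> \<le> 1" if "j < n" "l < n" for j l x y
    unfolding abs_mult using b2 that by (intro mult_le_one) auto
  have m5: "(\<lambda>w. case w of (y, z) \<Rightarrow> (share n y j)\<^sup>2 * (share n z l)\<^sup>2) \<in> borel_measurable (Row n \<Otimes>\<^sub>M Row n)" if "j < n" "l < n" for j l
    using that by measurable
  have b5: "\<bar>case w of (y, z) \<Rightarrow> (share n y j)\<^sup>2 * (share n z l)\<^sup>2\<bar> \<le> 1" if "j < n" "l < n" for j l w
    using b4[OF that] by (cases w) simp
  have ig: "integrable ?T (g j l)" if "j < n" "l < n" for j l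
    unfolding g_def
    by (rule integral_pair_product(2)[OF prob_space_Row RR.prob_space_axioms m4[OF that] m5[OF that] b4[OF that] b5[OF that]])
  have eg: "(\<integral>w. g j l w \<partial>?T) = (\<integral>x. (share n x j)\<^sup>2 * (share n x l)\<^sup>2 \<partial>Row n) * (share_moment n 2 * share_moment n 2)"
    if jl: "j < n" "l < n" for j l
  proof -
    have e1: "(\<integral>w. g j l w \<partial>?T) = (\<integral>x. (share n x j)\<^sup>2 * (share n x l)\<^sup>2 \<partial>Row n) *
        (\<integral>w. (case w of (y, z) \<Rightarrow> (share n y j)\<^sup>2 * (share n z l)\<^sup>2) \<partial>(Row n \<Otimes>\<^sub>M Row n))"
      unfolding g_def
      by (rule integral_pair_product(1)[OF prob_space_Row RR.prob_space_axioms m4[OF jl] m5[OF jl] b4[OF jl] b5[OF jl]])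
    have e2: "(\<integral>w. (case w of (y, z) \<Rightarrow> (share n y j)\<^sup>2 * (share n z l)\<^sup>2) \<partial>(Row n \<Otimes>\<^sub>M Row n)) =
        (\<integral>x. (share n x j)\<^sup>2 \<partial>Row n) * (\<integral>x. (share n x l)\<^sup>2 \<partial>Row n)"
      by (rule integral_pair_product(1)[OF prob_space_Row prob_space_Row m2[OF jl(1)] m2[OF jl(2)] b2[OF jl(1)] b2[OF jl(2)]])
    show ?thesis unfolding e1 e2 share_moment_eq[OF jl(1), of 2, symmetric] share_moment_eq[OF jl(2), of 2, symmetric] ..
  qed
  have "(\<integral>w. F w \<partial>?T) \<le> (\<integral>w. 16 * C * (\<Sum>j<n. \<Sum>l<n. g j l w) \<partial>?T)"
  proof (rule integral_mono)
    show "integrable ?T F" using F bd' by (intro T.integrable_const_bound[where B=B]) auto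
    show "integrable ?T (\<lambda>w. 16 * C * (\<Sum>j<n. \<Sum>l<n. g j l w))"
      by (intro integrable_mult_right integral_double_sum(1) ig)
    fix w :: "(nat \<Rightarrow> real) \<times> (nat \<Rightarrow> real) \<times> (nat \<Rightarrow> real)"
    obtain x y z where w: "w = (x, y, z)" by (metis surj_pair)
    have "C * (\<Sum>j<n. \<Sum>l<n. (overlap n x y j)\<^sup>2 * (overlap n x z l)\<^sup>2) = 16 * C * (\<Sum>j<n. \<Sum>l<n. g j l w)"
      unfolding w g_def sum_distrib_left by (intro sum.cong refl) (simp add: overlap_def power_mult_distrib)
    moreover have "F w \<le> C * (\<Sum>j<n. \<Sum>l<n. (overlap n x y j)\<^sup>2 * (overlap n x z l)\<^sup>2)"
      unfolding w by (rule order_trans[OF abs_ge_self bd])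
    ultimately show "F w \<le> 16 * C * (\<Sum>j<n. \<Sum>l<n. g j l w)" by (simp only:)
  qed
  also have "\<dots> = 16 * C * (\<Sum>j<n. \<Sum>l<n. (\<integral>w. g j l w \<partial>?T))"
    unfolding integral_mult_right_zero by (simp only: integral_double_sum(2)[OF ig])
  also have "\<dots> = 16 * C * ((\<Sum>j<n. \<Sum>l<n. (\<integral>x. (share n x j)\<^sup>2 * (share n x l)\<^sup>2 \<partial>Row n)) * (share_moment n 2 * share_moment n 2))"
    unfolding sum_distrib_right by (intro arg_cong2[where f="(*)"] sum.cong refl eg) auto
  also have "\<dots> \<le> 16 * C * ((n * share_moment n 2) * (share_moment n 2 * share_moment n 2))"
    using C share_moment_nonneg[of n 2] by (intro mult_left_mono mult_right_mono square_shares) auto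
  also have "\<dots> = 16 * C * n * share_moment n 2 ^ 3" by (simp add: power3_eq_cube)
  finally show ?thesis .
qed

end

section \<open>The degenerate kernel and its remainder after the removal of large overlaps\<close>

definition corr :: "nat \<Rightarrow> (nat \<Rightarrow> real) \<Rightarrow> (nat \<Rightarrow> real) \<Rightarrow> real" where
  "corr n x y = (\<Sum>j<n. unit n x j * unit n y j)"

text \<open>The squared correlation, compensated so that it is exactly degenerate:
  its mean over either argument vanishes.\<close>
definition kap :: "nat \<Rightarrow> (nat \<Rightarrow> real) \<Rightarrow> (nat \<Rightarrow> real) \<Rightarrow> real" where
  "kap n x y = 2 * (corr n x y)\<^sup>2 - 2 / n * ((\<Sum>j<n. share n x j) * (\<Sum>j<n. share n y j))"

context row_law
begin

lemma hker_triple_measurable [measurable]: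
  "(\<lambda>(x, y, z). hker \<epsilon> n x y * hker \<epsilon> n x z) \<in> borel_measurable (Row n \<Otimes>\<^sub>M (Row n \<Otimes>\<^sub>M Row n))"
  by measurable

lemma hker_triple_support:
  assumes e: "0 < \<epsilon>"
  shows "(\<integral>(x, y, z). of_bool (hker \<epsilon> n x y \<noteq> 0 \<and> hker \<epsilon> n x z \<noteq> 0) \<partial>(Row n \<Otimes>\<^sub>M (Row n \<Otimes>\<^sub>M Row n)))
    \<le> 16 * (1 / \<epsilon> ^ 4) * n * share_moment n 2 ^ 3"
proof (rule triple_bound[where B=1])
  fix x y z
  have b: "of_bool (hker \<epsilon> n x y \<noteq> 0) \<le> (\<Sum>j<n. (overlap n x y j)\<^sup>2 / \<epsilon>\<^sup>2)" for y
  proof (cases "hker \<epsilon> n x y = 0")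
    case False
    then obtain j where j: "j < n" "excess \<epsilon> (overlap n x y j) \<noteq> 0"
      unfolding hker_def by (meson lessThan_iff sum.neutral)
    have "1 \<le> (overlap n x y j)\<^sup>2 / \<epsilon>\<^sup>2" using excess_neq_0[OF e, of "overlap n x y j"] j(2) by simp
    also have "\<dots> \<le> (\<Sum>j<n. (overlap n x y j)\<^sup>2 / \<epsilon>\<^sup>2)" using j(1) by (intro member_le_sum) auto
    finally show ?thesis using False by simp
  qed (simp add: sum_nonneg)
  have "of_bool (hker \<epsilon> n x y \<noteq> 0 \<and> hker \<epsilon> n x z \<noteq> 0) =
      (of_bool (hker \<epsilon> n x y \<noteq> 0) * of_bool (hker \<epsilon> n x z \<noteq> 0) :: real)"
    by (simp only: of_bool_conj)
  also have "\<dots> \<le> (\<Sum>j<n. (overlap n x y j)\<^sup>2 / \<epsilon>\<^sup>2) * (\<Sum>l<n. (overlap n x z l)\<^sup>2 / \<epsilon>\<^sup>2)"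
    by (intro mult_mono b sum_nonneg) auto
  also have "\<dots> = 1 / \<epsilon> ^ 4 * (\<Sum>j<n. \<Sum>l<n. (overlap n x y j)\<^sup>2 * (overlap n x z l)\<^sup>2)"
  proof -
    have "a / \<epsilon>\<^sup>2 * (b / \<epsilon>\<^sup>2) = 1 / \<epsilon> ^ 4 * (a * b)" for a b
      by (simp add: power2_eq_square power4_eq_xxxx)
    then show ?thesis unfolding sum_divide_distrib[symmetric] sum_product[symmetric] .
  qed
  finally show "\<bar>case (x, y, z) of (x, y, z) \<Rightarrow> of_bool (hker \<epsilon> n x y \<noteq> 0 \<and> hker \<epsilon> n x z \<noteq> 0)\<bar>
    \<le> 1 / \<epsilon> ^ 4 * (\<Sum>j<n. \<Sum>l<n. (overlap n x y j)\<^sup>2 * (overlap n x z l)\<^sup>2)"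
    unfolding prod.case abs_of_nonneg[OF zero_less_eq_of_bool] .
qed (use e in \<open>auto split: prod.split\<close>)

lemma hker_triple_product:
  assumes e: "0 < \<epsilon>"
  shows "(\<integral>(x, y, z). hker \<epsilon> n x y * hker \<epsilon> n x z \<partial>(Row n \<Otimes>\<^sub>M (Row n \<Otimes>\<^sub>M Row n)))
    \<le> 16 * (1 / \<epsilon>\<^sup>2) * n * share_moment n 2 ^ 3"
proof (rule triple_bound[where B="2 * 2", OF hker_triple_measurable])
  have e0: "0 \<le> \<epsilon>" using e by simp
  fix x y z :: "nat \<Rightarrow> real"
  have b: "hker \<epsilon> n x y \<le> (\<Sum>j<n. (overlap n x y j)\<^sup>2 / \<epsilon>)" for y
    unfolding hker_def by (intro sum_mono excess_le_square e overlap_nonneg)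
  have "\<bar>hker \<epsilon> n x y * hker \<epsilon> n x z\<bar> = hker \<epsilon> n x y * hker \<epsilon> n x z"
    using hker_bounds[OF e0] by (intro abs_of_nonneg mult_nonneg_nonneg) auto
  also have "\<dots> \<le> (\<Sum>j<n. (overlap n x y j)\<^sup>2 / \<epsilon>) * (\<Sum>l<n. (overlap n x z l)\<^sup>2 / \<epsilon>)"
    using hker_bounds[OF e0] e0 by (intro mult_mono b sum_nonneg) auto
  also have "\<dots> = 1 / \<epsilon>\<^sup>2 * (\<Sum>j<n. \<Sum>l<n. (overlap n x y j)\<^sup>2 * (overlap n x z l)\<^sup>2)"
  proof -
    have "a / \<epsilon> * (b / \<epsilon>) = 1 / \<epsilon>\<^sup>2 * (a * b)" for a b
      by (simp add: power2_eq_square)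
    then show ?thesis unfolding sum_divide_distrib[symmetric] sum_product[symmetric] .
  qed
  finally show "\<bar>case (x, y, z) of (x, y, z) \<Rightarrow> hker \<epsilon> n x y * hker \<epsilon> n x z\<bar>
    \<le> 1 / \<epsilon>\<^sup>2 * (\<Sum>j<n. \<Sum>l<n. (overlap n x y j)\<^sup>2 * (overlap n x z l)\<^sup>2)"
    unfolding prod.case .
next
  have e0: "0 \<le> \<epsilon>" using e by simp
  fix w :: "(nat \<Rightarrow> real) \<times> (nat \<Rightarrow> real) \<times> (nat \<Rightarrow> real)"
  obtain x y z where w: "w = (x, y, z)" by (metis surj_pair)
  show "\<bar>case w of (x, y, z) \<Rightarrow> hker \<epsilon> n x y * hker \<epsilon> n x z\<bar> \<le> 2 * 2"
    unfolding w prod.case abs_mult using hker_bounds[OF e0] by (intro mult_mono) auto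
qed simp

definition cross :: "nat \<Rightarrow> (nat \<Rightarrow> real) \<Rightarrow> (nat \<Rightarrow> real) \<Rightarrow> real" where
  "cross n x y = (\<Sum>(j, l)\<in>{(j, l). j < n \<and> l < n \<and> j \<noteq> l}. (unit n x j * unit n x l) * (unit n y j * unit n y l))"

lemma corr_measurable [measurable]: "case_prod (corr n) \<in> borel_measurable (Row n \<Otimes>\<^sub>M Row n)"
proof -
  have "case_prod (corr n) = (\<lambda>z. \<Sum>j<n. unit n (fst z) j * unit n (snd z) j)"
    by (auto simp: corr_def fun_eq_iff)
  then show ?thesis
    by (auto intro!: borel_measurable_sum borel_measurable_times measurable_compose[OF measurable_fst unit_measurable]
      measurable_compose[OF measurable_snd unit_measurable])
qed

lemma kap_measurable [measurable]: "case_prod (kap n) \<in> borel_measurable (Row n \<Otimes>\<^sub>M Row n)"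
proof -
  have "case_prod (kap n) = (\<lambda>z. 2 * (case_prod (corr n) z)\<^sup>2 - 2 / n * ((\<Sum>j<n. share n (fst z) j) * (\<Sum>j<n. share n (snd z) j)))"
    by (auto simp: kap_def fun_eq_iff)
  then show ?thesis
    by (auto intro!: borel_measurable_diff borel_measurable_times borel_measurable_power borel_measurable_sum
      measurable_compose[OF measurable_fst share_measurable] measurable_compose[OF measurable_snd share_measurable])
qed

lemma kap_sym: "kap n x y = kap n y x"
  by (simp add: kap_def corr_def mult_ac)

lemma abs_corr_le: "\<bar>corr n x y\<bar> \<le> n"
proof -
  have "\<bar>corr n x y\<bar> \<le> (\<Sum>j<n. \<bar>unit n x j * unit n y j\<bar>)" unfolding corr_def by (rule sum_abs)
  also have "\<dots> \<le> (\<Sum>j<n. 1)"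
    by (intro sum_mono) (auto simp: abs_mult intro!: mult_le_one abs_unit_le_1)
  finally show ?thesis by simp
qed

lemma abs_kap_le: "\<bar>kap n x y\<bar> \<le> 2 * (real n)\<^sup>2 + 2"
proof -
  define s where "s = (\<Sum>j<n. share n x j) * (\<Sum>j<n. share n y j)"
  have s: "0 \<le> s" "s \<le> 1" unfolding s_def sum_share by auto
  have "(corr n x y)\<^sup>2 \<le> (real n)\<^sup>2" using abs_corr_le[of n x y] by (simp add: abs_le_square_iff[symmetric])
  moreover have "0 \<le> 2 / n * s" "2 / n * s \<le> 2"
  proof -
    show "0 \<le> 2 / n * s" using s by simp
    have "2 / real n \<le> 2" by (cases n) (auto simp: divide_le_eq)
    then have "2 / n * s \<le> 2 * 1" using s by (intro mult_mono) auto
    then show "2 / n * s \<le> 2" by simp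
  qed
  ultimately show ?thesis unfolding kap_def s_def[symmetric] abs_le_iff using zero_le_power2[of "corr n x y"] by linarith
qed

lemma finite_offdiag [simp]: "finite {(j :: nat, l :: nat). j < n \<and> l < n \<and> j \<noteq> l}"
  by (rule finite_subset[of _ "{..<n} \<times> {..<n}"]) auto

lemma card_offdiag: "card {(j :: nat, l :: nat). j < n \<and> l < n \<and> j \<noteq> l} = n * (n - 1)"
proof -
  have e: "{(j, l). j < n \<and> l < n \<and> j \<noteq> l} = Sigma {..<n} (\<lambda>j. {..<n} - {j})" by auto
  show ?thesis unfolding e by (subst card_SigmaI) auto
qed

lemma corr_square: "2 * (corr n x y)\<^sup>2 = (\<Sum>j<n. overlap n x y j) + 2 * cross n x y"
proof -
  let ?f = "\<lambda>j l. (unit n x j * unit n y j) * (unit n x l * unit n y l)"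
  have "(corr n x y)\<^sup>2 = (\<Sum>(j, l)\<in>{..<n} \<times> {..<n}. ?f j l)"
    unfolding corr_def power2_eq_square sum_product sum.cartesian_product ..
  also have "{..<n} \<times> {..<n} = (\<lambda>j. (j, j)) ` {..<n} \<union> {(j, l). j < n \<and> l < n \<and> j \<noteq> l}" by auto
  also have "(\<Sum>(j, l)\<in>\<dots>. ?f j l) = (\<Sum>(j, l)\<in>(\<lambda>j. (j, j)) ` {..<n}. ?f j l) + (\<Sum>(j, l)\<in>{(j, l). j < n \<and> l < n \<and> j \<noteq> l}. ?f j l)"
    by (rule sum.union_disjoint) auto
  also have "(\<Sum>(j, l)\<in>(\<lambda>j. (j, j)) ` {..<n}. ?f j l) = (\<Sum>j<n. share n x j * share n y j)"
    by (subst sum.reindex) (auto simp: inj_on_def unit_square[symmetric] power2_eq_square mult_ac)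
  also have "(\<Sum>(j, l)\<in>{(j, l). j < n \<and> l < n \<and> j \<noteq> l}. ?f j l) = cross n x y"
    unfolding cross_def by (intro sum.cong) (auto simp: mult_ac)
  finally show ?thesis by (simp add: overlap_def sum_distrib_left algebra_simps)
qed

text \<open>The off-diagonal terms are odd in a single coordinate and have mean 0. The diagonal
  terms have mean \<open>2 * e\<close> times the sum of the shares of \<open>x\<close>, where
  \<open>e\<close> is the mean share, and so has the compensator, in which \<open>n\<close> shares
  of \<open>y\<close> are divided by \<open>n\<close>. Because \<open>kap\<close> subtracts share
  sums and not the constant \<open>2 / n\<close>, the identity is exact even if rows can
  vanish.\<close>

lemma kap_degenerate: "(\<integral>y. kap n x y \<partial>Row n) = 0"
proof (cases "n = 0")
  case False
  define s where "s = (\<Sum>j<n. share n x j)"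
  define e where "e = share_moment n 1"
  have ish: "integrable (Row n) (\<lambda>y. share n y j)" if "j < n" for j
    using integrable_share_power[OF that, of 1] by simp
  have esh: "(\<integral>y. share n y j \<partial>Row n) = e" if "j < n" for j
    unfolding e_def share_moment_eq[OF that, of 1] by simp
  have "kap n x y = (\<Sum>j<n. 2 * share n x j * share n y j) +
      2 * (\<Sum>(j, l)\<in>{(j, l). j < n \<and> l < n \<and> j \<noteq> l}. (unit n x j * unit n x l) * (unit n y j * unit n y l))
      - 2 / n * s * (\<Sum>j<n. share n y j)" for y
    unfolding kap_def corr_square s_def overlap_def cross_def by simp
  then have "(\<integral>y. kap n x y \<partial>Row n) = (\<integral>y. (\<Sum>j<n. 2 * share n x j * share n y j) +
      2 * (\<Sum>(j, l)\<in>{(j, l). j < n \<and> l < n \<and> j \<noteq> l}. (unit n x j * unit n x l) * (unit n y j * unit n y l))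
      - 2 / n * s * (\<Sum>j<n. share n y j) \<partial>Row n)" by (simp only:)
  also have "\<dots> = (\<integral>y. (\<Sum>j<n. 2 * share n x j * share n y j) \<partial>Row n) +
      (\<integral>y. 2 * (\<Sum>(j, l)\<in>{(j, l). j < n \<and> l < n \<and> j \<noteq> l}. (unit n x j * unit n x l) * (unit n y j * unit n y l)) \<partial>Row n)
      - (\<integral>y. 2 / n * s * (\<Sum>j<n. share n y j) \<partial>Row n)"
  proof -
    have 1: "integrable (Row n) (\<lambda>y. \<Sum>j<n. 2 * share n x j * share n y j)"
      by (intro Bochner_Integration.integrable_sum integrable_mult_right ish) auto
    have 2: "integrable (Row n) (\<lambda>y. 2 * (\<Sum>(j, l)\<in>{(j, l). j < n \<and> l < n \<and> j \<noteq> l}. (unit n x j * unit n x l) * (unit n y j * unit n y l)))"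
      by (intro integrable_mult_right Bochner_Integration.integrable_sum)
        (auto intro!: integrable_mult_right integrable_unit_prod2)
    have 3: "integrable (Row n) (\<lambda>y. 2 / n * s * (\<Sum>j<n. share n y j))"
      by (intro Bochner_Integration.integrable_sum integrable_mult_right ish) auto
    show ?thesis
      by (simp only: Bochner_Integration.integral_diff[OF Bochner_Integration.integrable_add[OF 1 2] 3]
        Bochner_Integration.integral_add[OF 1 2])
  qed
  also have "(\<integral>y. (\<Sum>j<n. 2 * share n x j * share n y j) \<partial>Row n) = (\<Sum>j<n. 2 * share n x j * e)"
  proof -
    have "(\<integral>y. (\<Sum>j<n. 2 * share n x j * share n y j) \<partial>Row n) = (\<Sum>j<n. (\<integral>y. 2 * share n x j * share n y j \<partial>Row n))"
      by (intro Bochner_Integration.integral_sum integrable_mult_right ish) auto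
    also have "\<dots> = (\<Sum>j<n. 2 * share n x j * e)"
      unfolding integral_mult_right_zero by (intro sum.cong refl) (simp add: esh)
    finally show ?thesis .
  qed
  also have "\<dots> = 2 * s * e" unfolding s_def by (simp add: sum_distrib_left sum_distrib_right)
  also have "(\<integral>y. 2 * (\<Sum>(j, l)\<in>{(j, l). j < n \<and> l < n \<and> j \<noteq> l}. (unit n x j * unit n x l) * (unit n y j * unit n y l)) \<partial>Row n) = 0"
  proof -
    have "(\<integral>y. (\<Sum>(j, l)\<in>{(j, l). j < n \<and> l < n \<and> j \<noteq> l}. (unit n x j * unit n x l) * (unit n y j * unit n y l)) \<partial>Row n) =
      (\<Sum>z\<in>{(j, l). j < n \<and> l < n \<and> j \<noteq> l}. (\<integral>y. (case z of (j, l) \<Rightarrow> (unit n x j * unit n x l) * (unit n y j * unit n y l)) \<partial>Row n))"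
      by (intro Bochner_Integration.integral_sum) (auto intro!: integrable_mult_right integrable_unit_prod2)
    also have "\<dots> = 0"
    proof (rule sum.neutral, safe)
      fix j l assume jl: "j < n" "l < n" "j \<noteq> l"
      show "(\<integral>y. (unit n x j * unit n x l) * (unit n y j * unit n y l) \<partial>Row n) = 0"
        unfolding integral_mult_right_zero mean_unit_prod2[OF jl] by (rule mult_zero_right)
    qed
    finally show ?thesis unfolding integral_mult_right_zero by (simp only: mult_zero_right)
  qed
  also have "(\<integral>y. 2 / n * s * (\<Sum>j<n. share n y j) \<partial>Row n) = 2 / n * s * (n * e)"
  proof -
    have "(\<integral>y. (\<Sum>j<n. share n y j) \<partial>Row n) = (\<Sum>j<n. e)"
      using esh by (subst Bochner_Integration.integral_sum) (auto intro: ish)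
    then show ?thesis unfolding integral_mult_right_zero by simp
  qed
  finally show ?thesis using False by simp
qed (simp add: kap_def corr_def)

lemma kap_mean: "(\<integral>z. case_prod (kap n) z \<partial>(Row n \<Otimes>\<^sub>M Row n)) = 0"
proof -
  have i: "integrable (Row n \<Otimes>\<^sub>M Row n) (case_prod (kap n))"
    by (rule RR.integrable_const_bound[where B="2 * (real n)\<^sup>2 + 2"]) (auto intro!: AE_I2 simp: abs_kap_le)
  have "(\<integral>x. (\<integral>y. case_prod (kap n) (x, y) \<partial>Row n) \<partial>Row n) = (\<integral>z. case_prod (kap n) z \<partial>(Row n \<Otimes>\<^sub>M Row n))"
    by (rule RR.integral_fst'[OF i])
  then show ?thesis by (simp add: kap_degenerate)
qed

text \<open>Given the shared row the other two are independent with the same law, so the inner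
  integral is a square.\<close>

lemma integral_triple:
  fixes k :: "(nat \<Rightarrow> real) \<Rightarrow> (nat \<Rightarrow> real) \<Rightarrow> real"
  assumes [measurable]: "case_prod k \<in> borel_measurable (Row n \<Otimes>\<^sub>M Row n)" and bd: "\<And>x y. \<bar>k x y\<bar> \<le> B"
  shows "(\<integral>(x, y, z). k x y * k x z \<partial>(Row n \<Otimes>\<^sub>M (Row n \<Otimes>\<^sub>M Row n))) = (\<integral>x. (\<integral>y. k x y \<partial>Row n)\<^sup>2 \<partial>Row n)"
proof -
  interpret T: pair_prob_space "Row n" "Row n \<Otimes>\<^sub>M Row n" ..
  have B: "0 \<le> B" using bd abs_ge_zero order_trans by blast
  have i: "integrable (Row n \<Otimes>\<^sub>M (Row n \<Otimes>\<^sub>M Row n)) (\<lambda>(x, y, z). k x y * k x z)"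
  proof (rule T.integrable_const_bound[where B="B * B"])
    show "AE w in Row n \<Otimes>\<^sub>M (Row n \<Otimes>\<^sub>M Row n). norm (case w of (x, y, z) \<Rightarrow> k x y * k x z) \<le> B * B"
    proof (rule AE_I2)
      fix w :: "(nat \<Rightarrow> real) \<times> (nat \<Rightarrow> real) \<times> (nat \<Rightarrow> real)"
      obtain x y z where w: "w = (x, y, z)" by (metis surj_pair)
      show "norm (case w of (x, y, z) \<Rightarrow> k x y * k x z) \<le> B * B"
        unfolding w prod.case real_norm_def abs_mult using bd B by (intro mult_mono) auto
    qed
  qed measurable
  have "(\<integral>(x, y, z). k x y * k x z \<partial>(Row n \<Otimes>\<^sub>M (Row n \<Otimes>\<^sub>M Row n))) =
      (\<integral>x. (\<integral>w. (case (x, w) of (x, y, z) \<Rightarrow> k x y * k x z) \<partial>(Row n \<Otimes>\<^sub>M Row n)) \<partial>Row n)"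
    by (rule T.integral_fst'[OF i, symmetric])
  also have "\<dots> = (\<integral>x. (\<integral>y. k x y \<partial>Row n)\<^sup>2 \<partial>Row n)"
  proof (rule Bochner_Integration.integral_cong[OF refl])
    fix x assume x: "x \<in> space (Row n)"
    have m: "(\<lambda>y. k x y) \<in> borel_measurable (Row n)"
      using measurable_Pair2[OF assms(1) x] by simp
    have "(\<integral>(y, z). k x y * k x z \<partial>(Row n \<Otimes>\<^sub>M Row n)) = (\<integral>y. k x y \<partial>Row n) * (\<integral>z. k x z \<partial>Row n)"
      by (rule integral_pair_product(1)[OF prob_space_Row prob_space_Row m m bd bd])
    then show "(\<integral>w. (case (x, w) of (x, y, z) \<Rightarrow> k x y * k x z) \<partial>(Row n \<Otimes>\<^sub>M Row n)) = (\<integral>y. k x y \<partial>Row n)\<^sup>2"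
      by (simp only: prod.case power2_eq_square)
  qed
  finally show ?thesis .
qed

definition hmean :: "real \<Rightarrow> nat \<Rightarrow> real" where
  "hmean \<epsilon> n = (\<integral>z. case_prod (hker \<epsilon> n) z \<partial>(Row n \<Otimes>\<^sub>M Row n))"

text \<open>What is left of \<open>kap\<close> once large overlaps are removed; \<open>hmean\<close>
  restores the centring. In contrast to \<open>kap\<close> the result is centred but in general not
  degenerate.\<close>

definition rem_ker :: "real \<Rightarrow> nat \<Rightarrow> (nat \<Rightarrow> real) \<Rightarrow> (nat \<Rightarrow> real) \<Rightarrow> real" where
  "rem_ker \<epsilon> n x y = kap n x y - hker \<epsilon> n x y + hmean \<epsilon> n"

lemma rem_ker_sym: "rem_ker \<epsilon> n x y = rem_ker \<epsilon> n y x"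
  by (simp add: rem_ker_def kap_sym[of n x y] hker_sym[of \<epsilon> n x y])

lemma rem_ker_measurable [measurable]: "case_prod (rem_ker \<epsilon> n) \<in> borel_measurable (Row n \<Otimes>\<^sub>M Row n)"
proof -
  have "case_prod (rem_ker \<epsilon> n) = (\<lambda>z. case_prod (kap n) z - case_prod (hker \<epsilon> n) z + hmean \<epsilon> n)"
    by (auto simp: rem_ker_def fun_eq_iff)
  then show ?thesis by simp
qed

lemma abs_rem_ker_le:
  assumes "0 \<le> \<epsilon>" "1 \<le> n" shows "\<bar>rem_ker \<epsilon> n x y\<bar> \<le> 2 * (real n)\<^sup>2 + 6"
proof -
  have "0 \<le> hmean \<epsilon> n" "hmean \<epsilon> n \<le> 2 / n" unfolding hmean_def by (rule hker_mean_le[OF assms])+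
  moreover have "2 / real n \<le> 2" using assms by (simp add: divide_le_eq)
  ultimately show ?thesis
    using abs_kap_le[of n x y] hker_bounds[OF assms(1), of n x y] unfolding rem_ker_def by linarith
qed

lemma integrable_hker: "0 \<le> \<epsilon> \<Longrightarrow> integrable (Row n \<Otimes>\<^sub>M Row n) (case_prod (hker \<epsilon> n))"
  by (rule RR.integrable_const_bound[where B=2]) (auto intro!: AE_I2 simp: hker_bounds)

lemma integrable_kap: "integrable (Row n \<Otimes>\<^sub>M Row n) (case_prod (kap n))"
  by (rule RR.integrable_const_bound[where B="2 * (real n)\<^sup>2 + 2"]) (auto intro!: AE_I2 simp: abs_kap_le)

lemma rem_ker_mean:
  assumes "0 \<le> \<epsilon>"
  shows "(\<integral>z. case_prod (rem_ker \<epsilon> n) z \<partial>(Row n \<Otimes>\<^sub>M Row n)) = 0"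
proof -
  have "case_prod (rem_ker \<epsilon> n) = (\<lambda>z. case_prod (kap n) z - case_prod (hker \<epsilon> n) z + hmean \<epsilon> n)"
    by (auto simp: rem_ker_def fun_eq_iff)
  then have "(\<integral>z. case_prod (rem_ker \<epsilon> n) z \<partial>(Row n \<Otimes>\<^sub>M Row n)) =
      (\<integral>z. case_prod (kap n) z - case_prod (hker \<epsilon> n) z + hmean \<epsilon> n \<partial>(Row n \<Otimes>\<^sub>M Row n))" by (simp only:)
  also have "\<dots> = (\<integral>z. case_prod (kap n) z \<partial>(Row n \<Otimes>\<^sub>M Row n)) - (\<integral>z. case_prod (hker \<epsilon> n) z \<partial>(Row n \<Otimes>\<^sub>M Row n))
      + (\<integral>z. hmean \<epsilon> n \<partial>(Row n \<Otimes>\<^sub>M Row n))"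
    by (simp only: Bochner_Integration.integral_add[OF Bochner_Integration.integrable_diff[OF integrable_kap integrable_hker[OF assms]] RR.integrable_const]
      Bochner_Integration.integral_diff[OF integrable_kap integrable_hker[OF assms]])
  also have "\<dots> = 0" unfolding kap_mean hmean_def[symmetric] by (simp add: RR.prob_space)
  finally show ?thesis .
qed

text \<open>As \<open>kap\<close> is degenerate, the conditional mean of the remainder given one row
  is that of \<open>hker\<close> up to sign and centring. The triple integral is thus a variance,
  bounded by the second moment of the conditional mean of \<open>hker\<close>, that is by the triple
  integral of \<open>hker\<close>.\<close>

lemma rem_ker_triple:
  assumes e: "0 < \<epsilon>" and n: "1 \<le> n"
  shows "\<bar>\<integral>(x, y, z). rem_ker \<epsilon> n x y * rem_ker \<epsilon> n x z \<partial>(Row n \<Otimes>\<^sub>M (Row n \<Otimes>\<^sub>M Row n))\<bar>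
    \<le> 16 * (1 / \<epsilon>\<^sup>2) * n * share_moment n 2 ^ 3"
proof -
  have e0: "0 \<le> \<epsilon>" using e by simp
  define hb where "hb x = (\<integral>y. hker \<epsilon> n x y \<partial>Row n)" for x
  have hm: "(\<lambda>y. hker \<epsilon> n x y) \<in> borel_measurable (Row n)" if "x \<in> space (Row n)" for x
    using measurable_Pair2[OF hker_measurable that] by simp
  have km: "(\<lambda>y. kap n x y) \<in> borel_measurable (Row n)" if "x \<in> space (Row n)" for x
    using measurable_Pair2[OF kap_measurable that] by simp
  have hb01: "0 \<le> hb x" "hb x \<le> 2" if "x \<in> space (Row n)" for x
  proof -
    show "0 \<le> hb x" unfolding hb_def using hker_bounds[OF e0] by (intro integral_nonneg_AE AE_I2) auto
    have "integrable (Row n) (\<lambda>y. hker \<epsilon> n x y)"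
      using hker_bounds[OF e0] by (intro Row.integrable_const_bound[where B=2] hm that) (auto intro!: AE_I2)
    then show "hb x \<le> 2" unfolding hb_def using hker_bounds[OF e0] by (intro Row.integral_le_const) (auto intro!: AE_I2)
  qed
  have hbm [measurable]: "hb \<in> borel_measurable (Row n)"
    unfolding hb_def[abs_def] by (rule Row.borel_measurable_lebesgue_integral[OF hker_measurable])
  have ihb: "integrable (Row n) hb"
    using hb01 by (intro Row.integrable_const_bound[where B=2]) (auto intro!: AE_I2)
  have ihb2: "integrable (Row n) (\<lambda>x. (hb x)\<^sup>2)"
  proof (rule Row.integrable_const_bound[where B="2\<^sup>2"])
    show "AE x in Row n. norm ((hb x)\<^sup>2) \<le> 2\<^sup>2"
    proof (rule AE_I2)
      fix x assume x: "x \<in> space (Row n)"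
      then have "(hb x)\<^sup>2 \<le> 2\<^sup>2" using hb01[OF x] by (intro power_mono) auto
      then show "norm ((hb x)\<^sup>2) \<le> 2\<^sup>2" by simp
    qed
  qed measurable
  have rem: "(\<integral>y. rem_ker \<epsilon> n x y \<partial>Row n) = hmean \<epsilon> n - hb x" if x: "x \<in> space (Row n)" for x
  proof -
    have ik: "integrable (Row n) (\<lambda>y. kap n x y)"
      by (intro Row.integrable_const_bound[where B="2 * (real n)\<^sup>2 + 2"] km x) (auto intro!: AE_I2 simp: abs_kap_le)
    have ih: "integrable (Row n) (\<lambda>y. hker \<epsilon> n x y)"
      using hker_bounds[OF e0] by (intro Row.integrable_const_bound[where B=2] hm x) (auto intro!: AE_I2)
    have "(\<integral>y. rem_ker \<epsilon> n x y \<partial>Row n) = (\<integral>y. kap n x y \<partial>Row n) - hb x + hmean \<epsilon> n"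
      unfolding rem_ker_def hb_def using ik ih by (simp add: Row.prob_space)
    then show ?thesis unfolding kap_degenerate by simp
  qed
  have mhb: "(\<integral>x. hb x \<partial>Row n) = hmean \<epsilon> n"
    unfolding hb_def hmean_def using RR.integral_fst'[OF integrable_hker[OF e0, of n]] by simp
  have eq: "(\<integral>(x, y, z). rem_ker \<epsilon> n x y * rem_ker \<epsilon> n x z \<partial>(Row n \<Otimes>\<^sub>M (Row n \<Otimes>\<^sub>M Row n))) =
      (\<integral>x. (hmean \<epsilon> n - hb x)\<^sup>2 \<partial>Row n)"
    unfolding integral_triple[OF rem_ker_measurable abs_rem_ker_le[OF e0 n]]
    by (intro Bochner_Integration.integral_cong) (auto simp: rem)
  have "(\<integral>x. (hmean \<epsilon> n - hb x)\<^sup>2 \<partial>Row n) = (\<integral>x. (hmean \<epsilon> n)\<^sup>2 - 2 * hmean \<epsilon> n * hb x + (hb x)\<^sup>2 \<partial>Row n)"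
    by (intro Bochner_Integration.integral_cong) (auto simp: power2_eq_square algebra_simps)
  also have "\<dots> = (hmean \<epsilon> n)\<^sup>2 - 2 * hmean \<epsilon> n * hmean \<epsilon> n + (\<integral>x. (hb x)\<^sup>2 \<partial>Row n)"
    using ihb ihb2 by (simp add: Row.prob_space mhb)
  also have "\<dots> \<le> (\<integral>x. (hb x)\<^sup>2 \<partial>Row n)" by (simp add: power2_eq_square)
  also have "\<dots> = (\<integral>(x, y, z). hker \<epsilon> n x y * hker \<epsilon> n x z \<partial>(Row n \<Otimes>\<^sub>M (Row n \<Otimes>\<^sub>M Row n)))"
    unfolding hb_def using hker_bounds[OF e0] by (intro integral_triple[symmetric, where B=2]) auto
  also have "\<dots> \<le> 16 * (1 / \<epsilon>\<^sup>2) * n * share_moment n 2 ^ 3" by (rule hker_triple_product[OF e])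
  finally have "(\<integral>x. (hmean \<epsilon> n - hb x)\<^sup>2 \<partial>Row n) \<le> 16 * (1 / \<epsilon>\<^sup>2) * n * share_moment n 2 ^ 3" .
  moreover have "0 \<le> (\<integral>x. (hmean \<epsilon> n - hb x)\<^sup>2 \<partial>Row n)" by simp
  ultimately show ?thesis unfolding eq by linarith
qed

text \<open>By sign symmetry two index pairs correlate only if they are equal or swapped. So each of
  the \<open>n * (n - 1)\<close> ordered pairs has two partners, and each of these contributes the
  squared mean of a product of two shares.\<close>

lemma second_moment_cross:
  assumes n: "2 \<le> n"
  shows "integrable (Row n \<Otimes>\<^sub>M Row n) (\<lambda>z. (case_prod (cross n) z)\<^sup>2)"
    and "(\<integral>z. (case_prod (cross n) z)\<^sup>2 \<partial>(Row n \<Otimes>\<^sub>M Row n)) \<le> 2 / (real n * (real n - 1))"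
proof -
  let ?O = "{(j :: nat, l :: nat). j < n \<and> l < n \<and> j \<noteq> l}"
  define u where "u q x = unit n x (fst q) * unit n x (snd q)" for q x
  define e where "e = 1 / (real n * (real n - 1))"
  have e0: "0 \<le> e" using n by (simp add: e_def)
  have um: "u q \<in> borel_measurable (Row n)" if "q \<in> ?O" for q
    using that unfolding u_def[abs_def] by (cases q) auto
  have u1: "\<bar>u q x\<bar> \<le> 1" if "q \<in> ?O" for q x
    using that unfolding u_def by (cases q) (auto simp: abs_mult intro!: mult_le_one abs_unit_le_1)
  have uum: "(\<lambda>x. u q x * u q' x) \<in> borel_measurable (Row n)" if "q \<in> ?O" "q' \<in> ?O" for q q'
    using um that by (intro borel_measurable_times) auto
  have uu1: "\<bar>u q x * u q' x\<bar> \<le> 1" if "q \<in> ?O" "q' \<in> ?O" for q q' x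
    using u1 that by (auto simp: abs_mult intro!: mult_le_one)
  define d where "d q q' = (\<lambda>(x, y). (u q x * u q' x) * (u q y * u q' y))" for q q'
  have id: "integrable (Row n \<Otimes>\<^sub>M Row n) (d q q')" if "q \<in> ?O" "q' \<in> ?O" for q q'
    unfolding d_def by (rule integral_pair_product(2)[OF prob_space_Row prob_space_Row uum[OF that] uum[OF that] uu1[OF that] uu1[OF that]])
  have ed: "(\<integral>z. d q q' z \<partial>(Row n \<Otimes>\<^sub>M Row n)) = (\<integral>x. u q x * u q' x \<partial>Row n)\<^sup>2" if "q \<in> ?O" "q' \<in> ?O" for q q'
    unfolding d_def power2_eq_square
    by (rule integral_pair_product(1)[OF prob_space_Row prob_space_Row uum[OF that] uum[OF that] uu1[OF that] uu1[OF that]])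
  have sq: "(\<lambda>z. (case_prod (cross n) z)\<^sup>2) = (\<lambda>z. \<Sum>q\<in>?O. \<Sum>q'\<in>?O. d q q' z)"
  proof
    fix z :: "(nat \<Rightarrow> real) \<times> (nat \<Rightarrow> real)"
    obtain x y where z: "z = (x, y)" by (cases z)
    have "cross n x y = (\<Sum>q\<in>?O. u q x * u q y)"
      unfolding cross_def u_def by (intro sum.cong) auto
    then show "(case_prod (cross n) z)\<^sup>2 = (\<Sum>q\<in>?O. \<Sum>q'\<in>?O. d q q' z)"
      unfolding z d_def power2_eq_square by (simp only: prod.case sum_product) (intro sum.cong refl, simp only: mult_ac)
  qed
  have iq: "integrable (Row n \<Otimes>\<^sub>M Row n) (\<lambda>z. \<Sum>q'\<in>?O. d q q' z)" if "q \<in> ?O" for q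
    by (intro Bochner_Integration.integrable_sum id that)
  show "integrable (Row n \<Otimes>\<^sub>M Row n) (\<lambda>z. (case_prod (cross n) z)\<^sup>2)"
    unfolding sq by (intro Bochner_Integration.integrable_sum iq)
  have le: "(\<integral>x. u q x * u q' x \<partial>Row n)\<^sup>2 \<le> (if q' = q \<or> q' = prod.swap q then e\<^sup>2 else 0)"
    if "q \<in> ?O" "q' \<in> ?O" for q q'
  proof -
    obtain i j k l where q: "q = (i, j)" "q' = (k, l)" by (metis surj_pair)
    have ij: "i < n" "j < n" "i \<noteq> j" "k < n" "l < n" "k \<noteq> l" using that q by auto
    show ?thesis
    proof (cases "{i, j} = {k, l}")
      case True
      then have c: "q' = q \<or> q' = prod.swap q" unfolding q by (auto simp: doubleton_eq_iff)
      have "u q x * u q' x = share n x i * share n x j" for x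
        using c by (auto simp: u_def q unit_square[symmetric] power2_eq_square)
      then have "(\<integral>x. u q x * u q' x \<partial>Row n) = (\<integral>x. share n x i * share n x j \<partial>Row n)" by (simp only:)
      moreover have "0 \<le> (\<integral>x. share n x i * share n x j \<partial>Row n)"
        by (intro integral_nonneg_AE) (auto simp: share_nonneg)
      ultimately have "(\<integral>x. u q x * u q' x \<partial>Row n)\<^sup>2 \<le> e\<^sup>2"
        using mean_share_prod_le[OF ij(1-3)] unfolding e_def by (intro power_mono) auto
      then show ?thesis using c by simp
    next
      case False
      have "(\<integral>x. u q x * u q' x \<partial>Row n) = 0"
        unfolding u_def q fst_conv snd_conv by (rule mean_unit_prod4[OF ij(1,2,4,5,3,6) False])
      then show ?thesis by simp
    qed
  qed
  have "(\<integral>z. (case_prod (cross n) z)\<^sup>2 \<partial>(Row n \<Otimes>\<^sub>M Row n)) = (\<Sum>q\<in>?O. \<Sum>q'\<in>?O. (\<integral>x. u q x * u q' x \<partial>Row n)\<^sup>2)"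
  proof -
    have "(\<integral>z. (case_prod (cross n) z)\<^sup>2 \<partial>(Row n \<Otimes>\<^sub>M Row n)) = (\<Sum>q\<in>?O. \<integral>z. (\<Sum>q'\<in>?O. d q q' z) \<partial>(Row n \<Otimes>\<^sub>M Row n))"
      unfolding sq by (intro Bochner_Integration.integral_sum iq)
    also have "\<dots> = (\<Sum>q\<in>?O. \<Sum>q'\<in>?O. \<integral>z. d q q' z \<partial>(Row n \<Otimes>\<^sub>M Row n))"
      by (intro sum.cong refl Bochner_Integration.integral_sum id)
    also have "\<dots> = (\<Sum>q\<in>?O. \<Sum>q'\<in>?O. (\<integral>x. u q x * u q' x \<partial>Row n)\<^sup>2)"
      by (intro sum.cong refl ed)
    finally show ?thesis .
  qed
  also have "\<dots> \<le> (\<Sum>q\<in>?O. 2 * e\<^sup>2)"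
  proof (rule sum_mono)
    fix q assume q: "q \<in> ?O"
    have "(\<Sum>q'\<in>?O. (\<integral>x. u q x * u q' x \<partial>Row n)\<^sup>2) \<le> (\<Sum>q'\<in>?O. (if q' = q then e\<^sup>2 else 0) + (if q' = prod.swap q then e\<^sup>2 else 0))"
    proof (rule sum_mono)
      fix q' assume "q' \<in> ?O"
      from le[OF q this] show "(\<integral>x. u q x * u q' x \<partial>Row n)\<^sup>2 \<le> (if q' = q then e\<^sup>2 else 0) + (if q' = prod.swap q then e\<^sup>2 else 0)"
        by (rule order_trans) simp
    qed
    also have "\<dots> \<le> e\<^sup>2 + e\<^sup>2"
      unfolding sum.distrib by (intro add_mono) (auto simp: sum.delta)
    finally show "(\<Sum>q'\<in>?O. (\<integral>x. u q x * u q' x \<partial>Row n)\<^sup>2) \<le> 2 * e\<^sup>2" by simp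
  qed
  also have "\<dots> = real (n * (n - 1)) * (2 * e\<^sup>2)" by (simp only: sum_constant card_offdiag)
  also have "\<dots> = 2 / (real n * (real n - 1))"
  proof -
    have "real (n * (n - 1)) = real n * (real n - 1)" using n by (simp add: of_nat_diff)
    then show ?thesis using n by (simp add: e_def power2_eq_square)
  qed
  finally show "(\<integral>z. (case_prod (cross n) z)\<^sup>2 \<partial>(Row n \<Otimes>\<^sub>M Row n)) \<le> 2 / (real n * (real n - 1))" .
qed

text \<open>The diagonal gives the integral of \<open>(min w \<epsilon>)\<^sup>2\<close>, the part
  that survives multiplication by the number of pairs. Distinct columns contribute at most
  \<open>4 / (n * (n - 1))\<^sup>2\<close> each, which is negligible when \<open>p / n\<close> tends
  to 0.\<close>

lemma second_moment_small_overlaps: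
  assumes n: "2 \<le> n" and e: "0 < \<epsilon>"
  shows "integrable (Row n \<Otimes>\<^sub>M Row n) (\<lambda>z. (\<Sum>j<n. min (overlap n (fst z) (snd z) j) \<epsilon>)\<^sup>2)"
    and "(\<integral>z. (\<Sum>j<n. min (overlap n (fst z) (snd z) j) \<epsilon>)\<^sup>2 \<partial>(Row n \<Otimes>\<^sub>M Row n))
      \<le> n * (\<integral>w. (min w \<epsilon>)\<^sup>2 \<partial>overlap_law n) + 4 / (real n * (real n - 1))"
proof -
  define f where "f = (\<lambda>w. min w \<epsilon> :: real)"
  define g where "g j z = f (overlap n (fst z) (snd z) j)" for j z
  have fb: "\<bar>f w\<bar> \<le> 2" "0 \<le> f w" "f w \<le> w" if "0 \<le> w" "w \<le> 2" for w
    using that e by (auto simp: f_def)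
  have [measurable]: "f \<in> borel_measurable borel" unfolding f_def by measurable
  have sq: "(\<lambda>z. (\<Sum>j<n. min (overlap n (fst z) (snd z) j) \<epsilon>)\<^sup>2) = (\<lambda>z. \<Sum>j<n. \<Sum>l<n. g j z * g l z)"
    unfolding g_def f_def power2_eq_square sum_product ..
  have i: "integrable (Row n \<Otimes>\<^sub>M Row n) (\<lambda>z. g j z * g l z)" if "j < n" "l < n" for j l
    unfolding g_def by (intro integrable_overlap_prod that fb) auto
  show "integrable (Row n \<Otimes>\<^sub>M Row n) (\<lambda>z. (\<Sum>j<n. min (overlap n (fst z) (snd z) j) \<epsilon>)\<^sup>2)"
    unfolding sq by (rule integral_double_sum(1)[OF i])
  define d where "d = (\<integral>w. (f w)\<^sup>2 \<partial>overlap_law n)"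
  define b where "b = 4 / (real n * (real n - 1))\<^sup>2"
  have b0: "0 \<le> b" by (simp add: b_def)
  have le: "(\<integral>z. g j z * g l z \<partial>(Row n \<Otimes>\<^sub>M Row n)) \<le> (if l = j then d else b)" if jl: "j < n" "l < n" for j l
  proof (cases "l = j")
    case True
    have "(\<integral>z. g j z * g l z \<partial>(Row n \<Otimes>\<^sub>M Row n)) = (\<integral>w. f w * f w \<partial>overlap_law n)"
      unfolding True g_def by (rule integral_overlap[where \<phi>="\<lambda>w. f w * f w", OF jl(1)]) measurable
    then show ?thesis using True by (simp add: d_def power2_eq_square)
  next
    case False
    have "(\<integral>z. g j z * g l z \<partial>(Row n \<Otimes>\<^sub>M Row n)) \<le>
        (\<integral>z. overlap n (fst z) (snd z) j * overlap n (fst z) (snd z) l \<partial>(Row n \<Otimes>\<^sub>M Row n))"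
    proof (rule integral_mono[OF i[OF jl]])
      show "integrable (Row n \<Otimes>\<^sub>M Row n) (\<lambda>z. overlap n (fst z) (snd z) j * overlap n (fst z) (snd z) l)"
        using integrable_overlap_prod[OF jl, of "\<lambda>w. w" "\<lambda>w. w"] by simp
      fix z
      show "g j z * g l z \<le> overlap n (fst z) (snd z) j * overlap n (fst z) (snd z) l"
        unfolding g_def using jl by (intro mult_mono fb overlap_nonneg overlap_le_2)
    qed
    also have "\<dots> \<le> b" unfolding b_def using jl False by (intro integral_overlap_prod_le) auto
    finally show ?thesis using False by simp
  qed
  have "(\<integral>z. (\<Sum>j<n. min (overlap n (fst z) (snd z) j) \<epsilon>)\<^sup>2 \<partial>(Row n \<Otimes>\<^sub>M Row n)) =
      (\<Sum>j<n. \<Sum>l<n. \<integral>z. g j z * g l z \<partial>(Row n \<Otimes>\<^sub>M Row n))"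
    unfolding sq by (rule integral_double_sum(2)[OF i])
  also have "\<dots> \<le> (\<Sum>j<n. d + (real n - 1) * b)"
  proof (rule sum_mono)
    fix j assume j: "j \<in> {..<n}"
    have "(\<Sum>l<n. \<integral>z. g j z * g l z \<partial>(Row n \<Otimes>\<^sub>M Row n)) \<le> (\<Sum>l<n. if l = j then d else b)"
      using j by (intro sum_mono le) auto
    also have "\<dots> = d + (\<Sum>l\<in>{..<n} - {j}. b)"
      using j by (subst sum.remove[of _ j]) auto
    also have "(\<Sum>l\<in>{..<n} - {j}. b) = (real n - 1) * b" using j n by (simp add: of_nat_diff)
    finally show "(\<Sum>l<n. \<integral>z. g j z * g l z \<partial>(Row n \<Otimes>\<^sub>M Row n)) \<le> d + (real n - 1) * b" .
  qed
  also have "\<dots> = n * d + (real n * (real n - 1)) * b" by (simp add: distrib_left)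
  also have "(real n * (real n - 1)) * b = 4 / (real n * (real n - 1))"
    using n by (simp add: b_def power2_eq_square)
  finally show "(\<integral>z. (\<Sum>j<n. min (overlap n (fst z) (snd z) j) \<epsilon>)\<^sup>2 \<partial>(Row n \<Otimes>\<^sub>M Row n))
      \<le> n * (\<integral>w. (min w \<epsilon>)\<^sup>2 \<partial>overlap_law n) + 4 / (real n * (real n - 1))"
    by (simp only: d_def f_def)
qed

lemma rem_ker_second_moment:
  assumes n: "2 \<le> n" and e: "0 < \<epsilon>"
  shows "(\<integral>(x, y). (rem_ker \<epsilon> n x y)\<^sup>2 \<partial>(Row n \<Otimes>\<^sub>M Row n))
    \<le> 4 * n * (\<integral>w. (min w \<epsilon>)\<^sup>2 \<partial>overlap_law n) + 80 / (real n * (real n - 1))"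
proof -
  have e0: "0 \<le> \<epsilon>" using e by simp
  have n1: "1 \<le> n" using n by simp
  define f where "f z = (\<Sum>j<n. min (overlap n (fst z) (snd z) j) \<epsilon>)" for z
  define m where "m = hmean \<epsilon> n"
  define D where "D = real n * (real n - 1)"
  have D: "0 < D" using n by (simp add: D_def)
  have D2: "D \<le> (real n)\<^sup>2" by (simp add: D_def power2_eq_square algebra_simps)
  have m: "0 \<le> m" "m \<le> 2 / n" unfolding m_def hmean_def by (rule hker_mean_le[OF e0 n1])+
  have four: "4 / (real n)\<^sup>2 \<le> 4 / D" using D D2 n by (intro divide_left_mono mult_pos_pos) auto
  have m2: "m\<^sup>2 \<le> 4 / D"
    using power_mono[OF m(2) m(1), of 2] four by (simp add: power_divide)
  have bound: "(rem_ker \<epsilon> n (fst z) (snd z))\<^sup>2 \<le> 4 * ((f z)\<^sup>2 + 4 * (case_prod (cross n) z)\<^sup>2 + 4 / D + 4 / D)" for z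
  proof -
    obtain x y where z: "z = (x, y)" by (cases z)
    define s where "s = (\<Sum>j<n. share n x j) * (\<Sum>j<n. share n y j)"
    have s: "0 \<le> s" "s \<le> 1" unfolding s_def sum_share by auto
    have "w - excess \<epsilon> w = min w \<epsilon>" for w by (simp add: excess_def)
    then have "(\<Sum>j<n. overlap n x y j) - hker \<epsilon> n x y = f z"
      unfolding hker_def f_def z sum_subtractf[symmetric] by simp
    \<comment> \<open>Four parts: small overlaps, cross terms, the compensator of \<open>kap\<close>
      and the recentring. Their bounds contribute 4, 8, 4 and 4 over \<open>D\<close>, and the
      inequality for four squares multiplies by 4, whence the constant 80.\<close>
    then have eq: "rem_ker \<epsilon> n x y = f z + 2 * cross n x y + - (2 / n * s) + m"
      unfolding rem_ker_def kap_def corr_square s_def m_def by simp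
    have "(2 / n * s)\<^sup>2 \<le> (2 / n * 1)\<^sup>2"
      using s by (intro power_mono mult_left_mono) auto
    then have s2: "(- (2 / n * s))\<^sup>2 \<le> 4 / D" using four by (simp add: power_divide)
    have "(rem_ker \<epsilon> n x y)\<^sup>2 \<le> 4 * ((f z)\<^sup>2 + (2 * cross n x y)\<^sup>2 + (- (2 / n * s))\<^sup>2 + m\<^sup>2)"
      unfolding eq by (rule sum_four_squares)
    also have "\<dots> \<le> 4 * ((f z)\<^sup>2 + 4 * (cross n x y)\<^sup>2 + 4 / D + 4 / D)"
      using s2 m2 by (intro mult_left_mono add_mono) (auto simp: power_mult_distrib)
    finally show ?thesis unfolding z by simp
  qed
  note F = second_moment_small_overlaps[OF n e, folded f_def D_def]
  note Q = second_moment_cross[OF n, folded D_def]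
  have "(\<integral>(x, y). (rem_ker \<epsilon> n x y)\<^sup>2 \<partial>(Row n \<Otimes>\<^sub>M Row n)) \<le>
      (\<integral>z. 4 * ((f z)\<^sup>2 + 4 * (case_prod (cross n) z)\<^sup>2 + 4 / D + 4 / D) \<partial>(Row n \<Otimes>\<^sub>M Row n))"
  proof (rule integral_mono)
    show "integrable (Row n \<Otimes>\<^sub>M Row n) (\<lambda>(x, y). (rem_ker \<epsilon> n x y)\<^sup>2)"
    proof (rule RR.integrable_const_bound[where B="(2 * (real n)\<^sup>2 + 6)\<^sup>2"])
      show "AE z in Row n \<Otimes>\<^sub>M Row n. norm (case z of (x, y) \<Rightarrow> (rem_ker \<epsilon> n x y)\<^sup>2) \<le> (2 * (real n)\<^sup>2 + 6)\<^sup>2"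
      proof (rule AE_I2)
        fix z :: "(nat \<Rightarrow> real) \<times> (nat \<Rightarrow> real)"
        obtain x y where z: "z = (x, y)" by (cases z)
        have "\<bar>rem_ker \<epsilon> n x y\<bar>\<^sup>2 \<le> (2 * (real n)\<^sup>2 + 6)\<^sup>2"
          by (intro power_mono abs_rem_ker_le e0 n1) auto
        then show "norm (case z of (x, y) \<Rightarrow> (rem_ker \<epsilon> n x y)\<^sup>2) \<le> (2 * (real n)\<^sup>2 + 6)\<^sup>2"
          unfolding z by simp
      qed
    qed measurable
    show "integrable (Row n \<Otimes>\<^sub>M Row n) (\<lambda>z. 4 * ((f z)\<^sup>2 + 4 * (case_prod (cross n) z)\<^sup>2 + 4 / D + 4 / D))"
      by (intro integrable_mult_right Bochner_Integration.integrable_add F(1) Q(1) RR.integrable_const)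
    fix z
    show "(case z of (x, y) \<Rightarrow> (rem_ker \<epsilon> n x y)\<^sup>2) \<le> 4 * ((f z)\<^sup>2 + 4 * (case_prod (cross n) z)\<^sup>2 + 4 / D + 4 / D)"
      using bound[of z] by (cases z) (simp only: fst_conv snd_conv prod.case)
  qed
  also have "\<dots> = 4 * ((\<integral>z. (f z)\<^sup>2 \<partial>(Row n \<Otimes>\<^sub>M Row n)) + 4 * (\<integral>z. (case_prod (cross n) z)\<^sup>2 \<partial>(Row n \<Otimes>\<^sub>M Row n)) + 4 / D + 4 / D)"
  proof -
    have c: "(\<integral>z. 4 / D \<partial>(Row n \<Otimes>\<^sub>M Row n)) = 4 / D" by (simp add: RR.prob_space)
    show ?thesis
      by (simp only: integral_mult_right_zero c
        Bochner_Integration.integral_add[OF Bochner_Integration.integrable_add[OF Bochner_Integration.integrable_add[OF F(1) integrable_mult_right[OF Q(1)]] RR.integrable_const] RR.integrable_const]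
        Bochner_Integration.integral_add[OF Bochner_Integration.integrable_add[OF F(1) integrable_mult_right[OF Q(1)]] RR.integrable_const]
        Bochner_Integration.integral_add[OF F(1) integrable_mult_right[OF Q(1)]])
  qed
  also have "\<dots> \<le> 4 * ((n * (\<integral>w. (min w \<epsilon>)\<^sup>2 \<partial>overlap_law n) + 4 / D) + 4 * (2 / D) + 4 / D + 4 / D)"
    using F(2) Q(2) by (intro mult_left_mono add_mono) auto
  also have "\<dots> = 4 * real n * (\<integral>w. (min w \<epsilon>)\<^sup>2 \<partial>overlap_law n) + 80 / D"
    by (simp add: distrib_left add_divide_distrib[symmetric])
  finally show ?thesis unfolding D_def .
qed

text \<open>To first order the columns act separately. The error consists of mean products of
  overlaps in two distinct columns, each at most \<open>4 / (n * (n - 1))\<^sup>2\<close>, over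
  \<open>n * (n - 1)\<close> ordered pairs of columns.\<close>

lemma hker_char:
  assumes n: "2 \<le> n" and e: "0 \<le> \<epsilon>"
  shows "norm ((CLINT z|(Row n \<Otimes>\<^sub>M Row n). iexp (t * case_prod (hker \<epsilon> n) z)) - 1
      - n * (CLINT w|overlap_law n. iexp (t * excess \<epsilon> w) - 1)) \<le> 4 * t\<^sup>2 / (real n * (real n - 1))"
proof -
  define g where "g j z = excess \<epsilon> (overlap n (fst z) (snd z) j)" for j z
  have gm: "j < n \<Longrightarrow> g j \<in> borel_measurable (Row n \<Otimes>\<^sub>M Row n)" for j
    unfolding g_def[abs_def] by (rule measurable_compose[OF overlap_measurable excess_measurable])
  have h: "case_prod (hker \<epsilon> n) z = (\<Sum>j<n. g j z)" for z
    by (cases z) (simp add: hker_def g_def)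
  have i1: "integrable (Row n \<Otimes>\<^sub>M Row n) (\<lambda>z. iexp (t * (\<Sum>j<n. g j z)))"
    using gm by (intro RR.integrable_const_bound[where B=1]) (auto intro!: borel_measurable_sum)
  have i2: "integrable (Row n \<Otimes>\<^sub>M Row n) (\<lambda>z. iexp (t * g j z) - 1)" if "j < n" for j
    using gm[OF that] by (intro Bochner_Integration.integrable_diff RR.integrable_const_bound[where B=1]) auto
  have b: "j < n \<Longrightarrow> l < n \<Longrightarrow> l \<noteq> j \<Longrightarrow> (\<integral>z. g j z * g l z \<partial>(Row n \<Otimes>\<^sub>M Row n)) \<le> 4 / (real n * (real n - 1))\<^sup>2" for j l
  proof -
    assume jl: "j < n" "l < n" "l \<noteq> j"
    have "(\<integral>z. g j z * g l z \<partial>(Row n \<Otimes>\<^sub>M Row n)) \<le>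
        (\<integral>z. overlap n (fst z) (snd z) j * overlap n (fst z) (snd z) l \<partial>(Row n \<Otimes>\<^sub>M Row n))"
    proof (rule integral_mono)
      show "integrable (Row n \<Otimes>\<^sub>M Row n) (\<lambda>z. g j z * g l z)"
        unfolding g_def by (intro integrable_overlap_prod jl excess_bound e) auto
      show "integrable (Row n \<Otimes>\<^sub>M Row n) (\<lambda>z. overlap n (fst z) (snd z) j * overlap n (fst z) (snd z) l)"
        using integrable_overlap_prod[OF jl(1,2), of "\<lambda>w. w" "\<lambda>w. w"] by simp
      fix z show "g j z * g l z \<le> overlap n (fst z) (snd z) j * overlap n (fst z) (snd z) l"
        unfolding g_def by (intro mult_mono excess_le e overlap_nonneg excess_nonneg)
    qed
    also have "\<dots> \<le> 4 / (real n * (real n - 1))\<^sup>2" using jl by (intro integral_overlap_prod_le) auto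
    finally show ?thesis .
  qed
  have ig: "integrable (Row n \<Otimes>\<^sub>M Row n) (\<lambda>z. g j z * g l z)" if "j < n" "l < n" for j l
    unfolding g_def by (intro integrable_overlap_prod that excess_bound e) auto
  have isum: "integrable (Row n \<Otimes>\<^sub>M Row n) (\<lambda>z. \<Sum>j<n. iexp (t * g j z) - 1)"
    by (intro Bochner_Integration.integrable_sum i2) auto
  have e1: "(CLINT z|(Row n \<Otimes>\<^sub>M Row n). (\<Sum>j<n. iexp (t * g j z) - 1)) = n * (CLINT w|overlap_law n. iexp (t * excess \<epsilon> w) - 1)"
  proof -
    have "(CLINT z|(Row n \<Otimes>\<^sub>M Row n). (\<Sum>j<n. iexp (t * g j z) - 1)) = (\<Sum>j<n. CLINT z|(Row n \<Otimes>\<^sub>M Row n). iexp (t * g j z) - 1)"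
      by (intro Bochner_Integration.integral_sum i2) auto
    also have "\<dots> = (\<Sum>j<n. CLINT w|overlap_law n. iexp (t * excess \<epsilon> w) - 1)"
      unfolding g_def by (intro sum.cong refl integral_overlap[where \<phi>="\<lambda>w. iexp (t * excess \<epsilon> w) - 1"]) auto
    finally show ?thesis by simp
  qed
  have "(CLINT z|(Row n \<Otimes>\<^sub>M Row n). iexp (t * case_prod (hker \<epsilon> n) z)) - 1 - n * (CLINT w|overlap_law n. iexp (t * excess \<epsilon> w) - 1) =
      (CLINT z|(Row n \<Otimes>\<^sub>M Row n). iexp (t * (\<Sum>j<n. g j z)) - 1 - (\<Sum>j<n. iexp (t * g j z) - 1))"
  proof -
    have c: "(CLINT z|(Row n \<Otimes>\<^sub>M Row n). 1) = (1 :: complex)" by (simp add: RR.prob_space)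
    show ?thesis
      unfolding e1[symmetric] h
      by (simp only: c Bochner_Integration.integral_diff[OF Bochner_Integration.integrable_diff[OF i1 RR.integrable_const] isum]
        Bochner_Integration.integral_diff[OF i1 RR.integrable_const])
  qed
  also have "norm \<dots> \<le> (\<integral>z. norm (iexp (t * (\<Sum>j<n. g j z)) - 1 - (\<Sum>j<n. iexp (t * g j z) - 1)) \<partial>(Row n \<Otimes>\<^sub>M Row n))"
    by (rule integral_norm_bound)
  also have "\<dots> \<le> (\<integral>z. t\<^sup>2 * (\<Sum>j<n. \<Sum>l\<in>{..<n} - {j}. g j z * g l z) \<partial>(Row n \<Otimes>\<^sub>M Row n))"
  proof (rule integral_mono)
    show "integrable (Row n \<Otimes>\<^sub>M Row n) (\<lambda>z. norm (iexp (t * (\<Sum>j<n. g j z)) - 1 - (\<Sum>j<n. iexp (t * g j z) - 1)))"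
      by (intro integrable_norm Bochner_Integration.integrable_diff i1 isum RR.integrable_const)
    show "integrable (Row n \<Otimes>\<^sub>M Row n) (\<lambda>z. t\<^sup>2 * (\<Sum>j<n. \<Sum>l\<in>{..<n} - {j}. g j z * g l z))"
      by (intro integrable_mult_right Bochner_Integration.integrable_sum ig) auto
    show "norm (iexp (t * (\<Sum>j<n. g j z)) - 1 - (\<Sum>j<n. iexp (t * g j z) - 1)) \<le> t\<^sup>2 * (\<Sum>j<n. \<Sum>l\<in>{..<n} - {j}. g j z * g l z)" for z
      by (rule iexp_sum_approx) (simp add: g_def excess_nonneg)
  qed
  also have "\<dots> = t\<^sup>2 * (\<Sum>j<n. \<Sum>l\<in>{..<n} - {j}. (\<integral>z. g j z * g l z \<partial>(Row n \<Otimes>\<^sub>M Row n)))"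
  proof -
    have "(\<integral>z. (\<Sum>j<n. \<Sum>l\<in>{..<n} - {j}. g j z * g l z) \<partial>(Row n \<Otimes>\<^sub>M Row n)) =
        (\<Sum>j<n. \<integral>z. (\<Sum>l\<in>{..<n} - {j}. g j z * g l z) \<partial>(Row n \<Otimes>\<^sub>M Row n))"
      by (intro Bochner_Integration.integral_sum Bochner_Integration.integrable_sum ig) auto
    also have "\<dots> = (\<Sum>j<n. \<Sum>l\<in>{..<n} - {j}. (\<integral>z. g j z * g l z \<partial>(Row n \<Otimes>\<^sub>M Row n)))"
      by (intro sum.cong refl Bochner_Integration.integral_sum ig) auto
    finally show ?thesis by (simp only: integral_mult_right_zero)
  qed
  also have "\<dots> \<le> t\<^sup>2 * (\<Sum>j<n. \<Sum>l\<in>{..<n} - {j}. 4 / (real n * (real n - 1))\<^sup>2)"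
    by (intro mult_left_mono sum_mono b) auto
  also have "\<dots> = t\<^sup>2 * (real n * ((real n - 1) * (4 / (real n * (real n - 1))\<^sup>2)))"
  proof -
    have "(\<Sum>l\<in>{..<n} - {j}. 4 / (real n * (real n - 1))\<^sup>2) = (real n - 1) * (4 / (real n * (real n - 1))\<^sup>2)" if "j < n" for j
      using that n by (simp add: of_nat_diff)
    then show ?thesis by simp
  qed
  also have "\<dots> = 4 * t\<^sup>2 / (real n * (real n - 1))"
  proof -
    have "x * (y * (4 / (x * y)\<^sup>2)) = 4 / (x * y)" if "x \<noteq> 0" "y \<noteq> 0" for x y :: real
      using that by (simp add: power2_eq_square)
    from this[of "real n" "real n - 1"] n show ?thesis by simp
  qed
  finally show ?thesis .
qed

end

text \<open>The derivative of \<open>exp\<close> is bounded by 1 on the convex half-plane of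
  nonpositive real parts. The exponents of compound Poisson laws lie there, so an error in the
  exponent bounds the error of the characteristic function.\<close>

lemma norm_exp_diff_le:
  assumes "Re a \<le> 0" "Re b \<le> 0" shows "norm (exp a - exp b) \<le> norm (a - b)"
proof -
  have "norm (exp a - exp b) \<le> 1 * norm (a - b)"
  proof (rule field_differentiable_bound[where S="{z. Re z \<le> 0}"])
    show "convex {z. Re z \<le> 0}" by (rule convex_halfspace_Re_le)
    show "(exp has_field_derivative exp z) (at z within {z. Re z \<le> 0})" for z :: complex
      by (rule has_field_derivative_at_within[OF DERIV_exp])
    show "norm (exp z) \<le> 1" if "z \<in> {z. Re z \<le> 0}" for z
      using that by (simp add: norm_exp_eq_Re)
  qed (use assms in auto)
  then show ?thesis by simp
qed

lemma norm_iexp_diff_le: "norm (iexp x - iexp y) \<le> \<bar>x - y\<bar>"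
proof -
  have "norm (iexp x - iexp y) \<le> norm (\<i> * of_real x - \<i> * of_real y)"
    by (rule norm_exp_diff_le) auto
  also have "\<i> * of_real x - \<i> * of_real y = \<i> * of_real (x - y)" by (simp add: algebra_simps)
  finally show ?thesis by (simp only: norm_mult norm_ii norm_of_real mult_1)
qed

lemma (in prob_space) mean_abs_le_sqrt:
  assumes i: "integrable M X" and i2: "integrable M (\<lambda>\<omega>. (X \<omega>)\<^sup>2)" and V: "expectation (\<lambda>\<omega>. (X \<omega>)\<^sup>2) \<le> V"
  shows "expectation (\<lambda>\<omega>. \<bar>X \<omega>\<bar>) \<le> sqrt V"
proof -
  define m where "m = expectation (\<lambda>\<omega>. \<bar>X \<omega>\<bar>)"
  have ia: "integrable M (\<lambda>\<omega>. \<bar>X \<omega>\<bar>)" using i by (rule integrable_abs)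
  have "0 \<le> expectation (\<lambda>\<omega>. (\<bar>X \<omega>\<bar> - m)\<^sup>2)" by simp
  also have "(\<lambda>\<omega>. (\<bar>X \<omega>\<bar> - m)\<^sup>2) = (\<lambda>\<omega>. (X \<omega>)\<^sup>2 - 2 * m * \<bar>X \<omega>\<bar> + m\<^sup>2)"
    by (simp add: fun_eq_iff power2_diff algebra_simps)
  also have "expectation (\<lambda>\<omega>. (X \<omega>)\<^sup>2 - 2 * m * \<bar>X \<omega>\<bar> + m\<^sup>2) = expectation (\<lambda>\<omega>. (X \<omega>)\<^sup>2) - 2 * m * m + m\<^sup>2"
    using i2 ia by (simp add: prob_space m_def[symmetric])
  finally have "m\<^sup>2 \<le> V" using V by (simp add: power2_eq_square)
  then show ?thesis unfolding m_def[symmetric] by (rule real_le_rsqrt)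
qed

lemma (in prob_space) char_diff_le:
  assumes i: "integrable M X" "integrable M Y"
    and i2: "integrable M (\<lambda>\<omega>. (X \<omega> - Y \<omega>)\<^sup>2)" and V: "expectation (\<lambda>\<omega>. (X \<omega> - Y \<omega>)\<^sup>2) \<le> V"
  shows "norm ((CLINT \<omega>|M. iexp (t * X \<omega>)) - (CLINT \<omega>|M. iexp (t * Y \<omega>))) \<le> \<bar>t\<bar> * sqrt V"
proof -
  have m [measurable]: "X \<in> borel_measurable M" "Y \<in> borel_measurable M" using i by auto
  have c: "integrable M (\<lambda>\<omega>. iexp (t * X \<omega>))" "integrable M (\<lambda>\<omega>. iexp (t * Y \<omega>))"
    by (rule integrable_const_bound[where B=1]; simp)+
  have d: "integrable M (\<lambda>\<omega>. X \<omega> - Y \<omega>)" using i by simp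
  have "norm ((CLINT \<omega>|M. iexp (t * X \<omega>)) - (CLINT \<omega>|M. iexp (t * Y \<omega>))) = norm (CLINT \<omega>|M. iexp (t * X \<omega>) - iexp (t * Y \<omega>))"
    by (simp only: Bochner_Integration.integral_diff[OF c])
  also have "\<dots> \<le> expectation (\<lambda>\<omega>. norm (iexp (t * X \<omega>) - iexp (t * Y \<omega>)))" by (rule integral_norm_bound)
  also have "\<dots> \<le> expectation (\<lambda>\<omega>. \<bar>t\<bar> * \<bar>X \<omega> - Y \<omega>\<bar>)"
  proof (rule integral_mono)
    show "integrable M (\<lambda>\<omega>. norm (iexp (t * X \<omega>) - iexp (t * Y \<omega>)))"
      by (intro integrable_norm Bochner_Integration.integrable_diff c)
    show "integrable M (\<lambda>\<omega>. \<bar>t\<bar> * \<bar>X \<omega> - Y \<omega>\<bar>)" by (intro integrable_mult_right integrable_abs d)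
    fix \<omega>
    show "norm (iexp (t * X \<omega>) - iexp (t * Y \<omega>)) \<le> \<bar>t\<bar> * \<bar>X \<omega> - Y \<omega>\<bar>"
      using norm_iexp_diff_le[of "t * X \<omega>" "t * Y \<omega>"] by (simp only: abs_mult[symmetric] right_diff_distrib)
  qed
  also have "\<dots> = \<bar>t\<bar> * expectation (\<lambda>\<omega>. \<bar>X \<omega> - Y \<omega>\<bar>)" by (rule integral_mult_right_zero)
  also have "\<dots> \<le> \<bar>t\<bar> * sqrt V" by (intro mult_left_mono mean_abs_le_sqrt d i2 V) auto
  finally show ?thesis .
qed

context row_law
begin

text \<open>The bound of \<open>second_moment_pair_sum\<close> for the kernel
  \<open>rem_ker\<close>, with the estimates of its second moment and of its triple integral
  inserted.\<close>

definition var_bound :: "real \<Rightarrow> nat \<Rightarrow> nat \<Rightarrow> real" where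
  "var_bound \<epsilon> n p = (real p)\<^sup>2 / 2 * (4 * n * (\<integral>w. (min w \<epsilon>)\<^sup>2 \<partial>overlap_law n) + 80 / (real n * (real n - 1)))
    + real p ^ 3 * (16 * (1 / \<epsilon>\<^sup>2) * n * share_moment n 2 ^ 3)"

context
  fixes M :: "'m measure" and n p :: nat and \<zeta> :: "nat \<Rightarrow> 'm \<Rightarrow> nat \<Rightarrow> real"
  assumes iid: "iid_family M (Row n) \<zeta> p" and n: "2 \<le> n"
begin

interpretation I: iid_family M "Row n" \<zeta> p by (rule iid)

definition pair_sum :: "((nat \<Rightarrow> real) \<Rightarrow> (nat \<Rightarrow> real) \<Rightarrow> real) \<Rightarrow> 'm \<Rightarrow> real" where
  "pair_sum h \<omega> = (\<Sum>P\<in>pairs p. h (\<zeta> (fst P) \<omega>) (\<zeta> (snd P) \<omega>))"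

lemma pair_sum_eq: "pair_sum h \<omega> = (\<Sum>P\<in>pairs p. I.at_pair h P \<omega>)"
  by (simp add: pair_sum_def I.at_pair_def)

lemma pair_sum_measurable:
  assumes "case_prod h \<in> borel_measurable (Row n \<Otimes>\<^sub>M Row n)"
  shows "pair_sum h \<in> borel_measurable M"
  unfolding pair_sum_eq[abs_def] by (intro borel_measurable_sum I.at_pair_measurable assms)

lemma pair_sum_bounded:
  assumes "\<And>x y. \<bar>h x y\<bar> \<le> B" shows "\<bar>pair_sum h \<omega>\<bar> \<le> real (card (pairs p)) * B"
  unfolding pair_sum_def using assms
  by (intro order_trans[OF sum_abs] sum_bounded_above) auto

lemma pair_sum_integrable:
  assumes "case_prod h \<in> borel_measurable (Row n \<Otimes>\<^sub>M Row n)" "\<And>x y. \<bar>h x y\<bar> \<le> B"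
  shows "integrable M (pair_sum h)" "integrable M (\<lambda>\<omega>. (pair_sum h \<omega>)\<^sup>2)"
proof -
  show "integrable M (pair_sum h)"
    using pair_sum_bounded[of h B] assms
    by (intro I.integrable_const_bound[where B="real (card (pairs p)) * B"] pair_sum_measurable) auto
  show "integrable M (\<lambda>\<omega>. (pair_sum h \<omega>)\<^sup>2)"
  proof (rule I.integrable_const_bound[where B="(real (card (pairs p)) * B)\<^sup>2"])
    have "\<bar>pair_sum h \<omega>\<bar>\<^sup>2 \<le> (real (card (pairs p)) * B)\<^sup>2" for \<omega>
      by (intro power_mono pair_sum_bounded assms) auto
    then show "AE \<omega> in M. norm ((pair_sum h \<omega>)\<^sup>2) \<le> (real (card (pairs p)) * B)\<^sup>2" by simp
    show "(\<lambda>\<omega>. (pair_sum h \<omega>)\<^sup>2) \<in> borel_measurable M"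
      by (intro borel_measurable_power pair_sum_measurable assms)
  qed
qed

lemma second_moment_rem:
  assumes e: "0 < \<epsilon>"
  shows "(\<integral>\<omega>. (pair_sum (rem_ker \<epsilon> n) \<omega>)\<^sup>2 \<partial>M) \<le> var_bound \<epsilon> n p"
proof -
  have e0: "0 \<le> \<epsilon>" and n1: "1 \<le> n" using e n by auto
  have "(\<integral>\<omega>. (pair_sum (rem_ker \<epsilon> n) \<omega>)\<^sup>2 \<partial>M) \<le>
    (real p)\<^sup>2 / 2 * (\<integral>(x, y). (rem_ker \<epsilon> n x y)\<^sup>2 \<partial>(Row n \<Otimes>\<^sub>M Row n)) +
    real p ^ 3 * \<bar>\<integral>(x, y, z). rem_ker \<epsilon> n x y * rem_ker \<epsilon> n x z \<partial>(Row n \<Otimes>\<^sub>M (Row n \<Otimes>\<^sub>M Row n))\<bar>"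
    unfolding pair_sum_eq
    by (rule I.second_moment_pair_sum[OF rem_ker_measurable rem_ker_sym abs_rem_ker_le[OF e0 n1] rem_ker_mean[OF e0]])
  also have "\<dots> \<le> var_bound \<epsilon> n p"
    unfolding var_bound_def by (intro add_mono mult_left_mono rem_ker_second_moment rem_ker_triple e n n1) auto
  finally show ?thesis .
qed

text \<open>Overlaps never exceed 2, so at threshold 2 nothing is removed.\<close>
lemma rem_ker_2: "rem_ker 2 n x y = kap n x y"
proof -
  have h: "hker 2 n x y = 0" for x y
    unfolding hker_def excess_def using overlap_le_2[of _ n x y] by (intro sum.neutral) auto
  then have "hmean 2 n = 0" unfolding hmean_def by (simp add: case_prod_beta')
  with h show ?thesis by (simp add: rem_ker_def)
qed

lemma second_moment_kap: "(\<integral>\<omega>. (pair_sum (kap n) \<omega>)\<^sup>2 \<partial>M) \<le> var_bound 2 n p"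
  using second_moment_rem[of 2] by (simp add: rem_ker_2[abs_def] pair_sum_def)

text \<open>Three errors add up: passing in mean square from \<open>kap\<close> to the centred large
  overlaps, replacing their sum over pairs by a compound Poisson law, and treating the columns of
  one pair separately. The centring turns the compound Poisson exponent into a compensated
  one.\<close>

lemma char_kap:
  fixes q \<gamma> N :: real
  assumes e: "0 < \<epsilon>"
  defines "q \<equiv> 4 * real n * (share_moment n 2)\<^sup>2 / \<epsilon>\<^sup>2"
    and "\<gamma> \<equiv> 16 * (1 / \<epsilon> ^ 4) * n * share_moment n 2 ^ 3"
    and "N \<equiv> real (card (pairs p))"
  shows "norm ((CLINT \<omega>|M. iexp (t * pair_sum (kap n) \<omega>)) -
      exp (N * n * (CLINT w|overlap_law n. levy_exponent t (excess \<epsilon> w))))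
    \<le> \<bar>t\<bar> * sqrt (var_bound \<epsilon> n p) + \<bar>t\<bar> * (2 * real p ^ 3 * (2 * \<gamma> + 3 * q\<^sup>2) * exp ((real p)\<^sup>2 * q))
      + N * (4 * t\<^sup>2 / (real n * (real n - 1)))"
proof -
  have e0: "0 \<le> \<epsilon>" and n1: "1 \<le> n" using e n by auto
  interpret O: prob_space "overlap_law n" by (rule prob_space_overlap_law[OF n1])
  define m where "m = hmean \<epsilon> n"
  define h where "h = pair_sum (hker \<epsilon> n)"
  define \<Psi> where "\<Psi> = (CLINT z|(Row n \<Otimes>\<^sub>M Row n). iexp (t * case_prod (hker \<epsilon> n) z))"
  define E where "E = (CLINT w|overlap_law n. iexp (t * excess \<epsilon> w) - 1)"
  define J where "J = (\<integral>w. excess \<epsilon> w \<partial>overlap_law n)"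
  have hb: "\<bar>hker \<epsilon> n x y\<bar> \<le> 2" for x y using hker_bounds[OF e0, of n x y] by simp
  have sum_rem: "pair_sum (kap n) \<omega> - (h \<omega> - N * m) = pair_sum (rem_ker \<epsilon> n) \<omega>" for \<omega>
    unfolding h_def pair_sum_def rem_ker_def sum.distrib sum_subtractf N_def m_def by simp
  have ik: "integrable M (pair_sum (kap n))" by (rule pair_sum_integrable(1)[OF kap_measurable abs_kap_le])
  have ih: "integrable M h" unfolding h_def by (rule pair_sum_integrable(1)[OF hker_measurable hb])
  have ihm: "integrable M (\<lambda>\<omega>. h \<omega> - N * m)" using ih by simp
  have step1: "norm ((CLINT \<omega>|M. iexp (t * pair_sum (kap n) \<omega>)) - (CLINT \<omega>|M. iexp (t * (h \<omega> - N * m)))) \<le> \<bar>t\<bar> * sqrt (var_bound \<epsilon> n p)"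
  proof (rule I.char_diff_le[OF ik ihm])
    show "integrable M (\<lambda>\<omega>. (pair_sum (kap n) \<omega> - (h \<omega> - N * m))\<^sup>2)"
      unfolding sum_rem by (rule pair_sum_integrable(2)[OF rem_ker_measurable abs_rem_ker_le[OF e0 n1]])
    show "(\<integral>\<omega>. (pair_sum (kap n) \<omega> - (h \<omega> - N * m))\<^sup>2 \<partial>M) \<le> var_bound \<epsilon> n p"
      unfolding sum_rem by (rule second_moment_rem[OF e])
  qed
  have shift: "(CLINT \<omega>|M. iexp (t * (h \<omega> - N * m))) = exp (- (\<i> * of_real (t * (N * m)))) * (CLINT \<omega>|M. iexp (t * h \<omega>))"
  proof -
    have "\<i> * of_real (t * (s - N * m)) = - (\<i> * of_real (t * (N * m))) + \<i> * of_real (t * s)" for s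
      by (simp add: algebra_simps)
    then show ?thesis by (simp only: exp_add integral_mult_right_zero)
  qed
  have n_unit: "norm (exp (- (\<i> * of_real (t * (N * m))))) = 1" by (simp add: norm_exp_eq_Re)
  define q' where "q' = (\<integral>(x, y). of_bool (hker \<epsilon> n x y \<noteq> 0) \<partial>(Row n \<Otimes>\<^sub>M Row n) :: real)"
  define \<gamma>' where "\<gamma>' = (\<integral>(x, y, z). of_bool (hker \<epsilon> n x y \<noteq> 0 \<and> hker \<epsilon> n x z \<noteq> 0) \<partial>(Row n \<Otimes>\<^sub>M (Row n \<Otimes>\<^sub>M Row n)) :: real)"
  have q': "0 \<le> q'" "q' \<le> q" "\<gamma>' \<le> \<gamma>"
  proof -
    show "0 \<le> q'" unfolding q'_def by (intro integral_nonneg_AE) auto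
    show "q' \<le> q" unfolding q'_def q_def by (rule hker_support[OF e])
    show "\<gamma>' \<le> \<gamma>" unfolding \<gamma>'_def \<gamma>_def by (rule hker_triple_support[OF e])
  qed
  have g0: "0 \<le> \<gamma>" unfolding \<gamma>_def using share_moment_nonneg[of n 2] e by simp
  have step2: "norm ((CLINT \<omega>|M. iexp (t * h \<omega>)) - exp (of_nat (card (pairs p)) * (\<Psi> - 1)))
      \<le> \<bar>t\<bar> * (2 * real p ^ 3 * (2 * \<gamma> + 3 * q\<^sup>2) * exp ((real p)\<^sup>2 * q))"
  proof -
    have "norm ((CLINT \<omega>|M. iexp (t * h \<omega>)) - exp (of_nat (card (pairs p)) * (\<Psi> - 1)))
      \<le> \<bar>t\<bar> * (2 * real p ^ 3 * (2 * \<gamma>' + 3 * q'\<^sup>2) * exp ((real p)\<^sup>2 * q'))"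
      unfolding h_def pair_sum_eq \<Psi>_def
      by (rule I.char_pair_sum[OF hker_measurable hker_sym hb _ q'_def[symmetric] \<gamma>'_def[symmetric]]) simp
    also have "\<dots> \<le> \<bar>t\<bar> * (2 * real p ^ 3 * (2 * \<gamma> + 3 * q\<^sup>2) * exp ((real p)\<^sup>2 * q))"
    proof (rule mult_left_mono)
      have "2 * \<gamma>' + 3 * q'\<^sup>2 \<le> 2 * \<gamma> + 3 * q\<^sup>2"
        using q' by (intro add_mono mult_left_mono power_mono) auto
      then have "2 * real p ^ 3 * (2 * \<gamma>' + 3 * q'\<^sup>2) \<le> 2 * real p ^ 3 * (2 * \<gamma> + 3 * q\<^sup>2)"
        by (intro mult_left_mono) auto
      moreover have "exp ((real p)\<^sup>2 * q') \<le> exp ((real p)\<^sup>2 * q)" using q' by (simp add: mult_left_mono)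
      ultimately show "2 * real p ^ 3 * (2 * \<gamma>' + 3 * q'\<^sup>2) * exp ((real p)\<^sup>2 * q')
          \<le> 2 * real p ^ 3 * (2 * \<gamma> + 3 * q\<^sup>2) * exp ((real p)\<^sup>2 * q)"
        by (rule mult_mono) (use g0 in auto)
    qed simp
    finally show ?thesis .
  qed
  have iexc: "integrable (overlap_law n) (excess \<epsilon>)"
    by (rule O.integrable_const_bound[where B=2])
      (auto intro!: eventually_mono[OF AE_overlap_law[OF n1]] excess_bound[OF e0])
  have ichar: "integrable (overlap_law n) (\<lambda>w. iexp (t * excess \<epsilon> w) - 1)"
    by (intro Bochner_Integration.integrable_diff O.integrable_const_bound[where B=1]) auto
  have levy: "(CLINT w|overlap_law n. levy_exponent t (excess \<epsilon> w)) = E - \<i> * of_real t * of_real J"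
  proof -
    have ie: "integrable (overlap_law n) (\<lambda>w. \<i> * of_real t * complex_of_real (excess \<epsilon> w))"
      by (intro integrable_mult_right integrable_of_real iexc)
    have "(CLINT w|overlap_law n. levy_exponent t (excess \<epsilon> w)) =
        (CLINT w|overlap_law n. (iexp (t * excess \<epsilon> w) - 1) - \<i> * of_real t * complex_of_real (excess \<epsilon> w))"
      by (intro Bochner_Integration.integral_cong) (auto simp: levy_exponent_def)
    also have "\<dots> = E - (CLINT w|overlap_law n. \<i> * of_real t * complex_of_real (excess \<epsilon> w))"
      unfolding E_def by (rule Bochner_Integration.integral_diff[OF ichar ie])
    also have "(CLINT w|overlap_law n. \<i> * of_real t * complex_of_real (excess \<epsilon> w)) = \<i> * of_real t * of_real J"
      unfolding J_def by (simp only: integral_mult_right_zero integral_complex_of_real)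
    finally show ?thesis .
  qed
  have mJ: "m = n * J" unfolding m_def hmean_def J_def by (rule hker_mean[OF e0])
  \<comment> \<open>The phase of the centring joins the compound Poisson exponent. By
    \<open>mJ\<close> it is exactly the linear term of \<open>levy_exponent\<close>, so
    \<open>A\<close> and \<open>B\<close> differ only by the error of \<open>hker_char\<close> times
    the number of pairs.\<close>
  define A where "A = - (\<i> * of_real (t * (N * m))) + of_nat (card (pairs p)) * (\<Psi> - 1)"
  define B where "B = N * n * (CLINT w|overlap_law n. levy_exponent t (excess \<epsilon> w))"
  have AB: "A - B = N * (\<Psi> - 1 - n * E)"
    unfolding A_def B_def levy mJ N_def by (simp add: algebra_simps)
  have "norm \<Psi> \<le> 1"
    unfolding \<Psi>_def by (intro order_trans[OF integral_norm_bound]) (simp add: RR.prob_space)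
  then have "Re \<Psi> \<le> 1" using complex_Re_le_cmod[of \<Psi>] by linarith
  then have ReA: "Re A \<le> 0" unfolding A_def by (simp add: mult_nonneg_nonpos)
  have "norm (CLINT w|overlap_law n. iexp (t * excess \<epsilon> w)) \<le> 1"
    by (intro order_trans[OF integral_norm_bound]) (simp add: O.prob_space)
  then have R1: "Re (CLINT w|overlap_law n. iexp (t * excess \<epsilon> w)) \<le> 1"
    using complex_Re_le_cmod[of "CLINT w|overlap_law n. iexp (t * excess \<epsilon> w)"] by linarith
  have "E = (CLINT w|overlap_law n. iexp (t * excess \<epsilon> w)) - 1"
    unfolding E_def by (subst Bochner_Integration.integral_diff)
      (auto simp: O.prob_space intro!: O.integrable_const_bound[where B=1])
  then have "Re E \<le> 0" using R1 by simp
  then have ReB: "Re B \<le> 0" unfolding B_def levy N_def by (simp add: mult_nonneg_nonpos)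
  have step3: "norm (exp A - exp B) \<le> N * (4 * t\<^sup>2 / (real n * (real n - 1)))"
  proof -
    have "norm (exp A - exp B) \<le> norm (A - B)" by (rule norm_exp_diff_le[OF ReA ReB])
    also have "\<dots> = N * norm (\<Psi> - 1 - n * E)" unfolding AB norm_mult N_def by simp
    also have "\<dots> \<le> N * (4 * t\<^sup>2 / (real n * (real n - 1)))"
      unfolding \<Psi>_def E_def N_def by (intro mult_left_mono hker_char n e0) auto
    finally show ?thesis .
  qed
  have expA: "exp A = exp (- (\<i> * of_real (t * (N * m)))) * exp (of_nat (card (pairs p)) * (\<Psi> - 1))"
    unfolding A_def by (rule exp_add)
  define a where "a = (CLINT \<omega>|M. iexp (t * pair_sum (kap n) \<omega>))"
  define b where "b = (CLINT \<omega>|M. iexp (t * (h \<omega> - N * m)))"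
  have bA: "norm (b - exp A) \<le> \<bar>t\<bar> * (2 * real p ^ 3 * (2 * \<gamma> + 3 * q\<^sup>2) * exp ((real p)\<^sup>2 * q))"
    unfolding b_def shift expA right_diff_distrib[symmetric] norm_mult n_unit mult_1 by (rule step2)
  have "norm (a - exp B) = norm ((a - b) + (b - exp A) + (exp A - exp B))" by simp
  also have "\<dots> \<le> norm (a - b) + norm (b - exp A) + norm (exp A - exp B)"
    by (meson norm_triangle_ineq norm_triangle_le order_trans add_mono order_refl)
  also have "\<dots> \<le> \<bar>t\<bar> * sqrt (var_bound \<epsilon> n p) + \<bar>t\<bar> * (2 * real p ^ 3 * (2 * \<gamma> + 3 * q\<^sup>2) * exp ((real p)\<^sup>2 * q))
      + N * (4 * t\<^sup>2 / (real n * (real n - 1)))"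
    using step1 unfolding a_def[symmetric] b_def[symmetric] by (intro add_mono bA step3)
  finally show ?thesis unfolding a_def B_def .
qed

end
end

section \<open>The limit law\<close>

text \<open>The approximating sequence and its limit may depend on the accuracy \<eta>. This serves
  both the polynomial approximation and the choice of the threshold.\<close>

lemma real_squeeze_approx:
  fixes x :: "nat \<Rightarrow> 'e::real_normed_vector"
  assumes "\<And>\<eta>. 0 < \<eta> \<Longrightarrow> \<exists>y l. y \<longlonglongrightarrow> l \<and> norm (l - L) \<le> \<eta> \<and> (\<forall>\<^sub>F n in sequentially. norm (x n - y n) \<le> \<eta>)"
  shows "x \<longlonglongrightarrow> L"
proof (rule tendstoI)
  fix e :: real assume "0 < e"
  then obtain y l where y: "y \<longlonglongrightarrow> l" "norm (l - L) \<le> e / 4" "\<forall>\<^sub>F n in sequentially. norm (x n - y n) \<le> e / 4"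
    using assms[of "e / 4"] by auto
  have "\<forall>\<^sub>F n in sequentially. dist (y n) l < e / 4" using tendstoD[OF y(1), of "e / 4"] \<open>0 < e\<close> by simp
  with y(3) show "\<forall>\<^sub>F n in sequentially. dist (x n) L < e"
  proof eventually_elim
    case (elim n)
    have "norm (x n - L) = norm ((x n - y n) + (y n - l) + (l - L))" by simp
    also have "\<dots> \<le> norm (x n - y n) + norm (y n - l) + norm (l - L)"
      using norm_triangle_ineq[of "x n - y n + (y n - l)" "l - L"] norm_triangle_ineq[of "x n - y n" "y n - l"] by linarith
    finally show ?case using elim y(2) \<open>0 < e\<close> by (simp add: dist_norm)
  qed
qed

text \<open>All that the limit theorem takes from the tail and from the growth of \<open>p\<close>.
  Both ranges of \<alpha> lead to the same two asymptotic conditions, after which the probabilistic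
  argument is common to them.\<close>

locale scaled_rows = row_law \<rho> for \<rho> :: "real measure" +
  fixes p :: "nat \<Rightarrow> nat" and \<alpha> c :: real
  assumes alpha: "\<alpha> \<in> {0<..<3} - {2}"
    and c: "0 < c"
    and moments: "2 \<le> k \<Longrightarrow> (\<lambda>n. p n * sqrt n * share_moment n k) \<longlonglongrightarrow> c * limit_moment \<alpha> k"
    and sparse: "(\<lambda>n. p n / n) \<longlonglongrightarrow> 0"
begin

abbreviation "\<nu> \<equiv> nu \<alpha> c"

text \<open>The number of pairs times the number of columns, with
  \<open>(real p)\<^sup>2 / 2\<close> in place of \<open>p * (p - 1) / 2\<close> so that the moment
  asymptotics apply directly; \<open>limit_levy_pairs\<close> makes the correction.\<close>

definition weight :: "nat \<Rightarrow> real" where "weight n = (real (p n))\<^sup>2 / 2 * n"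

lemma weight_nonneg: "0 \<le> weight n" by (simp add: weight_def)

lemma nu_square_integrable: "integrable \<nu> (\<lambda>x. x\<^sup>2)"
  using nu_power(1)[OF alpha, of 2] by simp

lemma overlap_power:
  assumes "1 \<le> n" shows "(\<integral>w. w ^ k \<partial>overlap_law n) = 2 ^ k * (share_moment n k)\<^sup>2"
    and "integrable (overlap_law n) (\<lambda>w. w ^ k)"
proof -
  have n: "0 < n" using assms by simp
  have "(\<integral>z. overlap n (fst z) (snd z) 0 ^ k \<partial>(Row n \<Otimes>\<^sub>M Row n)) = (\<integral>w. w ^ k \<partial>overlap_law n)"
    by (rule integral_overlap[where \<phi>="\<lambda>w. w ^ k", OF n]) measurable
  then show "(\<integral>w. w ^ k \<partial>overlap_law n) = 2 ^ k * (share_moment n k)\<^sup>2"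
    unfolding overlap_moment[OF n] ..
  interpret O: prob_space "overlap_law n" by (rule prob_space_overlap_law[OF assms])
  show "integrable (overlap_law n) (\<lambda>w. w ^ k)"
  proof (rule O.integrable_const_bound[where B="2 ^ k"])
    show "AE w in overlap_law n. norm (w ^ k) \<le> 2 ^ k"
      using AE_overlap_law[OF assms] by eventually_elim (auto simp: power_abs intro!: power_mono)
  qed measurable
qed

text \<open>An overlap is twice a product of two independent shares, so its weighted moment is
  \<open>2 ^ (k - 1)\<close> times the square of
  \<open>p n * sqrt n * share_moment n k\<close>.\<close>

lemma limit_power:
  assumes k: "2 \<le> k"
  shows "(\<lambda>n. weight n * (\<integral>w. w ^ k \<partial>overlap_law n)) \<longlonglongrightarrow> (\<integral>x. x ^ k \<partial>\<nu>)"
proof -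
  have "(\<lambda>n. 2 ^ (k - 1) * (p n * sqrt n * share_moment n k)\<^sup>2) \<longlonglongrightarrow> 2 ^ (k - 1) * (c * limit_moment \<alpha> k)\<^sup>2"
    by (intro tendsto_intros moments k)
  also have "2 ^ (k - 1) * (c * limit_moment \<alpha> k)\<^sup>2 = (\<integral>x. x ^ k \<partial>\<nu>)"
    using nu_power(2)[OF alpha, of k c] k by (simp add: power_mult_distrib)
  finally show ?thesis
  proof (rule Lim_transform_eventually)
    show "\<forall>\<^sub>F n in sequentially. 2 ^ (k - 1) * (p n * sqrt n * share_moment n k)\<^sup>2 = weight n * (\<integral>w. w ^ k \<partial>overlap_law n)"
      using eventually_ge_at_top[of 1]
    proof eventually_elim
      case (elim n)
      have "(2::real) ^ k = 2 * 2 ^ (k - 1)" using k by (cases k) auto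
      then show ?case unfolding overlap_power(1)[OF elim] weight_def by (simp add: power_mult_distrib)
    qed
  qed
qed

lemma overlap_integrable_real:
  fixes G :: "real \<Rightarrow> real"
  assumes n: "1 \<le> n" and [measurable]: "G \<in> borel_measurable borel" and b: "\<And>x. x \<in> {0..2} \<Longrightarrow> \<bar>G x\<bar> \<le> B"
  shows "integrable (overlap_law n) (\<lambda>w. w\<^sup>2 * G w)"
proof (rule Bochner_Integration.integrable_bound)
  show "integrable (overlap_law n) (\<lambda>w. B * w\<^sup>2)" using overlap_power(2)[OF n, of 2] by simp
  show "AE w in overlap_law n. norm (w\<^sup>2 * G w) \<le> norm (B * w\<^sup>2)"
    using AE_overlap_law[OF n]
  proof eventually_elim
    case (elim w)
    then have "\<bar>G w\<bar> \<le> B" using b by simp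
    then have "\<bar>G w\<bar> * w\<^sup>2 \<le> \<bar>B\<bar> * w\<^sup>2" by (intro mult_right_mono) auto
    then show ?case by (simp add: abs_mult mult.commute)
  qed
qed measurable

lemma nu_integrable_real:
  fixes G :: "real \<Rightarrow> real"
  assumes [measurable]: "G \<in> borel_measurable borel" and b: "\<And>x. x \<in> {0..2} \<Longrightarrow> \<bar>G x\<bar> \<le> B"
  shows "integrable \<nu> (\<lambda>w. w\<^sup>2 * G w)"
proof (rule Bochner_Integration.integrable_bound)
  show "integrable \<nu> (\<lambda>w. B * w\<^sup>2)" using nu_square_integrable by simp
  show "AE w in \<nu>. norm (w\<^sup>2 * G w) \<le> norm (B * w\<^sup>2)"
  proof (rule AE_I2)
    fix w assume "w \<in> space \<nu>"
    then have "\<bar>G w\<bar> \<le> B" using b by (simp add: space_nu)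
    then have "\<bar>G w\<bar> * w\<^sup>2 \<le> \<bar>B\<bar> * w\<^sup>2" by (intro mult_right_mono) auto
    then show "norm (w\<^sup>2 * G w) \<le> norm (B * w\<^sup>2)" by (simp add: abs_mult mult.commute)
  qed
qed measurable

lemma limit_polynomial:
  "(\<lambda>n. weight n * (\<integral>w. w\<^sup>2 * (\<Sum>i\<le>d. a i * w ^ i) \<partial>overlap_law n)) \<longlonglongrightarrow> (\<integral>x. x\<^sup>2 * (\<Sum>i\<le>d. a i * x ^ i) \<partial>\<nu>)"
proof -
  have e: "w\<^sup>2 * (\<Sum>i\<le>d. a i * w ^ i) = (\<Sum>i\<le>d. a i * w ^ (i + 2))" for w :: real
    unfolding sum_distrib_left by (intro sum.cong refl) (simp only: power_add mult_ac)
  have nu: "(\<integral>x. (\<Sum>i\<le>d. a i * x ^ (i + 2)) \<partial>\<nu>) = (\<Sum>i\<le>d. a i * (\<integral>x. x ^ (i + 2) \<partial>\<nu>))"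
  proof -
    have "(\<integral>x. (\<Sum>i\<le>d. a i * x ^ (i + 2)) \<partial>\<nu>) = (\<Sum>i\<le>d. (\<integral>x. a i * x ^ (i + 2) \<partial>\<nu>))"
      by (intro Bochner_Integration.integral_sum integrable_mult_right nu_power(1)[OF alpha]) auto
    then show ?thesis by (simp only: integral_mult_right_zero)
  qed
  have ov: "weight n * (\<integral>w. (\<Sum>i\<le>d. a i * w ^ (i + 2)) \<partial>overlap_law n) = (\<Sum>i\<le>d. a i * (weight n * (\<integral>w. w ^ (i + 2) \<partial>overlap_law n)))"
    if "1 \<le> n" for n
  proof -
    have "(\<integral>w. (\<Sum>i\<le>d. a i * w ^ (i + 2)) \<partial>overlap_law n) = (\<Sum>i\<le>d. (\<integral>w. a i * w ^ (i + 2) \<partial>overlap_law n))"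
      by (intro Bochner_Integration.integral_sum integrable_mult_right overlap_power(2) that)
    then show ?thesis by (simp only: integral_mult_right_zero sum_distrib_left mult.left_commute)
  qed
  have "(\<lambda>n. \<Sum>i\<le>d. a i * (weight n * (\<integral>w. w ^ (i + 2) \<partial>overlap_law n))) \<longlonglongrightarrow> (\<Sum>i\<le>d. a i * (\<integral>x. x ^ (i + 2) \<partial>\<nu>))"
    by (intro tendsto_sum tendsto_mult tendsto_const limit_power) simp
  then show ?thesis unfolding e nu
    by (rule Lim_transform_eventually) (use ov in \<open>auto intro!: eventually_mono[OF eventually_ge_at_top[of 1]]\<close>)
qed

text \<open>Moments of order at least 2 converge and \<open>x\<^sup>2 \<nu>(dx)\<close> is a finite
  measure on a compact interval, so the Weierstrass theorem carries the convergence from polynomials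
  to continuous functions. The factor \<open>w\<^sup>2\<close> is essential because
  \<open>nu\<close> is infinite near 0.\<close>

lemma limit_continuous_real:
  fixes G :: "real \<Rightarrow> real"
  assumes cont: "continuous_on {0..2} G" and Gm [measurable]: "G \<in> borel_measurable borel"
  shows "(\<lambda>n. weight n * (\<integral>w. w\<^sup>2 * G w \<partial>overlap_law n)) \<longlonglongrightarrow> (\<integral>x. x\<^sup>2 * G x \<partial>\<nu>)"
proof (rule real_squeeze_approx)
  fix \<eta> :: real assume \<eta>: "0 < \<eta>"
  define I where "I = (\<integral>x. x\<^sup>2 \<partial>\<nu>)"
  have I0: "0 \<le> I" by (simp add: I_def)
  \<comment> \<open>\<open>I\<close> is the mass of \<open>x\<^sup>2 \<nu>(dx)\<close>, and the
    weighted second moments of the overlap laws are eventually below \<open>I + 1\<close>; so a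
    uniform error \<delta> costs at most \<eta> on either side.\<close>
  define \<delta> where "\<delta> = \<eta> / (I + 1)"
  have \<delta>: "0 < \<delta>" "\<delta> * (I + 1) = \<eta>" using \<eta> I0 by (auto simp: \<delta>_def)
  obtain g where g: "real_polynomial_function g" "\<And>x. x \<in> {0..2} \<Longrightarrow> \<bar>G x - g x\<bar> < \<delta>"
    using Stone_Weierstrass_real_polynomial_function[OF compact_Icc cont \<delta>(1)] by blast
  obtain a d where ad: "g = (\<lambda>x. \<Sum>i\<le>d. a i * x ^ i)"
    using g(1) by (auto simp: real_polynomial_function_iff_sum)
  have [measurable]: "g \<in> borel_measurable borel" unfolding ad by measurable
  have bounded: "\<exists>B. \<forall>x\<in>{0..2}. \<bar>f x\<bar> \<le> B" if "continuous_on {0..2} f" for f :: "real \<Rightarrow> real"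
    using compact_imp_bounded[OF compact_continuous_image[OF that compact_Icc]] by (auto simp: bounded_iff)
  obtain B1 where B1: "\<And>x. x \<in> {0..2} \<Longrightarrow> \<bar>G x\<bar> \<le> B1" using bounded[OF cont] by blast
  have "continuous_on {0..2} g" unfolding ad by (intro continuous_intros)
  then obtain B2 where B2: "\<And>x. x \<in> {0..2} \<Longrightarrow> \<bar>g x\<bar> \<le> B2" using bounded by blast
  have dnu: "\<bar>(\<integral>x. x\<^sup>2 * g x \<partial>\<nu>) - (\<integral>x. x\<^sup>2 * G x \<partial>\<nu>)\<bar> \<le> \<delta> * I"
  proof -
    have i: "integrable \<nu> (\<lambda>x. x\<^sup>2 * g x)" "integrable \<nu> (\<lambda>x. x\<^sup>2 * G x)"
      using nu_integrable_real[OF _ B2] nu_integrable_real[OF _ B1] by auto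
    have "\<bar>(\<integral>x. x\<^sup>2 * g x \<partial>\<nu>) - (\<integral>x. x\<^sup>2 * G x \<partial>\<nu>)\<bar> = \<bar>\<integral>x. x\<^sup>2 * g x - x\<^sup>2 * G x \<partial>\<nu>\<bar>"
      by (simp only: Bochner_Integration.integral_diff[OF i])
    also have "\<dots> \<le> (\<integral>x. \<bar>x\<^sup>2 * g x - x\<^sup>2 * G x\<bar> \<partial>\<nu>)" by (rule integral_abs_bound)
    also have "\<dots> \<le> (\<integral>x. \<delta> * x\<^sup>2 \<partial>\<nu>)"
    proof (rule integral_mono)
      show "integrable \<nu> (\<lambda>x. \<bar>x\<^sup>2 * g x - x\<^sup>2 * G x\<bar>)" by (intro integrable_abs Bochner_Integration.integrable_diff i)
      show "integrable \<nu> (\<lambda>x. \<delta> * x\<^sup>2)" by (intro integrable_mult_right nu_square_integrable)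
      fix x assume "x \<in> space \<nu>"
      then have "\<bar>g x - G x\<bar> \<le> \<delta>" using g(2)[of x] by (simp add: space_nu abs_minus_commute)
      then have "x\<^sup>2 * \<bar>g x - G x\<bar> \<le> x\<^sup>2 * \<delta>" by (intro mult_left_mono) auto
      then show "\<bar>x\<^sup>2 * g x - x\<^sup>2 * G x\<bar> \<le> \<delta> * x\<^sup>2" unfolding right_diff_distrib[symmetric] abs_mult by (simp add: mult.commute)
    qed
    finally show ?thesis by (simp add: I_def)
  qed
  have dov: "\<bar>(\<integral>x. x\<^sup>2 * G x \<partial>overlap_law n) - (\<integral>x. x\<^sup>2 * g x \<partial>overlap_law n)\<bar> \<le> \<delta> * (\<integral>x. x\<^sup>2 \<partial>overlap_law n)"
    if n: "1 \<le> n" for n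
  proof -
    have i: "integrable (overlap_law n) (\<lambda>x. x\<^sup>2 * G x)" "integrable (overlap_law n) (\<lambda>x. x\<^sup>2 * g x)"
      using overlap_integrable_real[OF n _ B2] overlap_integrable_real[OF n _ B1] by auto
    have "\<bar>(\<integral>x. x\<^sup>2 * G x \<partial>overlap_law n) - (\<integral>x. x\<^sup>2 * g x \<partial>overlap_law n)\<bar> = \<bar>\<integral>x. x\<^sup>2 * G x - x\<^sup>2 * g x \<partial>overlap_law n\<bar>"
      by (simp only: Bochner_Integration.integral_diff[OF i])
    also have "\<dots> \<le> (\<integral>x. \<bar>x\<^sup>2 * G x - x\<^sup>2 * g x\<bar> \<partial>overlap_law n)" by (rule integral_abs_bound)
    also have "\<dots> \<le> (\<integral>x. \<delta> * x\<^sup>2 \<partial>overlap_law n)"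
    proof (rule integral_mono_AE)
      show "integrable (overlap_law n) (\<lambda>x. \<bar>x\<^sup>2 * G x - x\<^sup>2 * g x\<bar>)" by (intro integrable_abs Bochner_Integration.integrable_diff i)
      show "integrable (overlap_law n) (\<lambda>x. \<delta> * x\<^sup>2)" by (intro integrable_mult_right overlap_power(2) n)
      show "AE x in overlap_law n. \<bar>x\<^sup>2 * G x - x\<^sup>2 * g x\<bar> \<le> \<delta> * x\<^sup>2"
        using AE_overlap_law[OF n]
      proof eventually_elim
        case (elim x)
        then have "\<bar>G x - g x\<bar> \<le> \<delta>" using g(2)[of x] by simp
        then have "x\<^sup>2 * \<bar>G x - g x\<bar> \<le> x\<^sup>2 * \<delta>" by (intro mult_left_mono) auto
        then show "\<bar>x\<^sup>2 * G x - x\<^sup>2 * g x\<bar> \<le> \<delta> * x\<^sup>2" unfolding right_diff_distrib[symmetric] abs_mult by (simp add: mult.commute)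
      qed
    qed
    finally show ?thesis by simp
  qed
  have "(\<lambda>n. weight n * (\<integral>w. w ^ 2 \<partial>overlap_law n)) \<longlonglongrightarrow> I" unfolding I_def by (rule limit_power) simp
  then have "\<forall>\<^sub>F n in sequentially. weight n * (\<integral>w. w ^ 2 \<partial>overlap_law n) < I + 1"
    by (rule order_tendstoD(2)) simp
  then have ev: "\<forall>\<^sub>F n in sequentially. norm (weight n * (\<integral>w. w\<^sup>2 * G w \<partial>overlap_law n) - weight n * (\<integral>w. w\<^sup>2 * g w \<partial>overlap_law n)) \<le> \<eta>"
    using eventually_ge_at_top[of 1]
  proof eventually_elim
    case (elim n)
    have "norm (weight n * (\<integral>w. w\<^sup>2 * G w \<partial>overlap_law n) - weight n * (\<integral>w. w\<^sup>2 * g w \<partial>overlap_law n)) =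
        weight n * \<bar>(\<integral>x. x\<^sup>2 * G x \<partial>overlap_law n) - (\<integral>x. x\<^sup>2 * g x \<partial>overlap_law n)\<bar>"
      unfolding right_diff_distrib[symmetric] real_norm_def abs_mult abs_of_nonneg[OF weight_nonneg] ..
    also have "\<dots> \<le> weight n * (\<delta> * (\<integral>x. x\<^sup>2 \<partial>overlap_law n))"
      by (intro mult_left_mono dov elim weight_nonneg)
    also have "\<dots> = \<delta> * (weight n * (\<integral>x. x\<^sup>2 \<partial>overlap_law n))" by (simp only: mult.left_commute)
    also have "\<dots> \<le> \<delta> * (I + 1)" using elim \<delta> by (intro mult_left_mono) auto
    finally show ?case using \<delta> by simp
  qed
  show "\<exists>y l. y \<longlonglongrightarrow> l \<and> norm (l - (\<integral>x. x\<^sup>2 * G x \<partial>\<nu>)) \<le> \<eta> \<and>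
      (\<forall>\<^sub>F n in sequentially. norm (weight n * (\<integral>w. w\<^sup>2 * G w \<partial>overlap_law n) - y n) \<le> \<eta>)"
  proof (intro exI conjI)
    show "(\<lambda>n. weight n * (\<integral>w. w\<^sup>2 * g w \<partial>overlap_law n)) \<longlonglongrightarrow> (\<integral>x. x\<^sup>2 * g x \<partial>\<nu>)"
      unfolding ad by (rule limit_polynomial)
    have "\<delta> * I \<le> \<delta> * (I + 1)" by (intro mult_left_mono) (use \<delta>(1) in auto)
    then show "norm ((\<integral>x. x\<^sup>2 * g x \<partial>\<nu>) - (\<integral>x. x\<^sup>2 * G x \<partial>\<nu>)) \<le> \<eta>" using dnu \<delta>(2) by simp
    show "\<forall>\<^sub>F n in sequentially. norm (weight n * (\<integral>w. w\<^sup>2 * G w \<partial>overlap_law n) - weight n * (\<integral>w. w\<^sup>2 * g w \<partial>overlap_law n)) \<le> \<eta>"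
      by (rule ev)
  qed
qed

text \<open>Shares are at most 1, so the second moment is at most the first, which is at most
  \<open>1 / n\<close>.\<close>

lemma sqrt_share_moment_2: "(\<lambda>n. sqrt n * share_moment n 2) \<longlonglongrightarrow> 0"
proof (rule Lim_null_comparison)
  show "\<forall>\<^sub>F n in sequentially. norm (sqrt n * share_moment n 2) \<le> 1 / sqrt n"
    using eventually_ge_at_top[of 1]
  proof eventually_elim
    case (elim n)
    have n0: "0 < n" using elim by simp
    have "share_moment n 2 \<le> share_moment n 1"
      unfolding share_moment_eq[OF n0]
      using elim by (intro integral_mono integrable_share_power power_decreasing) (auto simp: share_nonneg share_le_1)
    also have "\<dots> \<le> 1 / n" by (rule share_moment_1_le[OF elim])
    finally have "sqrt n * share_moment n 2 \<le> sqrt n * (1 / n)" by (intro mult_left_mono) auto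
    also have "\<dots> = 1 / sqrt n" using elim by (simp add: real_div_sqrt field_simps)
    finally show ?case using share_moment_nonneg[of n 2] by simp
  qed
  show "(\<lambda>n. 1 / sqrt (real n)) \<longlonglongrightarrow> 0" by real_asymp
qed

text \<open>The three bounds on triples and repeated columns are all powers of
  \<open>p n * sqrt n * share_moment n 2\<close> times a null sequence.\<close>
lemma triple_null: "(\<lambda>n. real (p n) ^ 3 * (n * share_moment n 2 ^ 3)) \<longlonglongrightarrow> 0"
proof -
  have "(\<lambda>n. (p n * sqrt n * share_moment n 2) ^ 3 * (1 / sqrt n)) \<longlonglongrightarrow> (c * limit_moment \<alpha> 2) ^ 3 * 0"
    by (intro tendsto_mult tendsto_power moments) (simp, real_asymp)
  then have "(\<lambda>n. (p n * sqrt n * share_moment n 2) ^ 3 * (1 / sqrt n)) \<longlonglongrightarrow> 0" by simp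
  then show ?thesis
  proof (rule Lim_transform_eventually)
    show "\<forall>\<^sub>F n in sequentially. (p n * sqrt n * share_moment n 2) ^ 3 * (1 / sqrt n) = real (p n) ^ 3 * (n * share_moment n 2 ^ 3)"
      using eventually_ge_at_top[of 1]
    proof eventually_elim
      case (elim n)
      then have s: "0 < sqrt n" by simp
      have "sqrt n ^ 3 = n * sqrt n" by (simp add: power3_eq_cube)
      then have "(p n * sqrt n * share_moment n 2) ^ 3 * (1 / sqrt n) = real (p n) ^ 3 * (n * sqrt n) * share_moment n 2 ^ 3 * (1 / sqrt n)"
        by (simp only: power_mult_distrib)
      then show ?case using s by simp
    qed
  qed
qed

lemma quadruple_null: "(\<lambda>n. real (p n) ^ 3 * (n * (share_moment n 2)\<^sup>2)\<^sup>2) \<longlonglongrightarrow> 0"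
proof -
  have "(\<lambda>n. (p n * sqrt n * share_moment n 2) ^ 3 * (sqrt n * share_moment n 2)) \<longlonglongrightarrow> (c * limit_moment \<alpha> 2) ^ 3 * 0"
    by (intro tendsto_mult tendsto_power moments sqrt_share_moment_2) simp
  moreover have "(p n * sqrt n * share_moment n 2) ^ 3 * (sqrt n * share_moment n 2) = real (p n) ^ 3 * (n * (share_moment n 2)\<^sup>2)\<^sup>2" for n
  proof -
    have "sqrt n ^ 4 = (n :: real)\<^sup>2" by (simp add: power4_eq_xxxx power2_eq_square)
    then have "real (p n) ^ 3 * sqrt n ^ 4 * share_moment n 2 ^ 4 = real (p n) ^ 3 * (n * (share_moment n 2)\<^sup>2)\<^sup>2"
      by (simp add: power_mult_distrib)
    moreover have "(x * y * z) ^ 3 * (y * z) = x ^ 3 * y ^ 4 * z ^ 4" for x y z :: real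
      by (simp add: power3_eq_cube power4_eq_xxxx)
    ultimately show ?thesis by simp
  qed
  ultimately show ?thesis by simp
qed

lemma pairs_null: "(\<lambda>n. (real (p n))\<^sup>2 / (real n * (real n - 1))) \<longlonglongrightarrow> 0"
proof -
  have "(\<lambda>n. (p n / n)\<^sup>2 * (n / (real n - 1))) \<longlonglongrightarrow> 0\<^sup>2 * 1"
    by (intro tendsto_mult tendsto_power sparse) real_asymp
  then have "(\<lambda>n. (p n / n)\<^sup>2 * (n / (real n - 1))) \<longlonglongrightarrow> 0" by simp
  moreover have "(p n / n)\<^sup>2 * (n / (real n - 1)) = (real (p n))\<^sup>2 / (real n * (real n - 1))" for n
    by (cases "n = 0") (simp_all add: power2_eq_square)
  ultimately show ?thesis by simp
qed

lemma var_bound_limit: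
  assumes e: "0 < \<epsilon>"
  shows "(\<lambda>n. var_bound \<epsilon> n (p n)) \<longlonglongrightarrow> 4 * (\<integral>x. (min x \<epsilon>)\<^sup>2 \<partial>\<nu>)"
proof -
  \<comment> \<open>The quotient of \<open>(min x \<epsilon>)\<^sup>2\<close> by
    \<open>x\<^sup>2\<close>, written with a denominator bounded away from 0 so that it is
    continuous on the closed interval.\<close>
  define G where "G x = (min 1 (\<epsilon> / max x \<epsilon>))\<^sup>2" for x :: real
  have G: "x\<^sup>2 * G x = (min x \<epsilon>)\<^sup>2" if "0 \<le> x" for x
    using that e unfolding G_def power_mult_distrib[symmetric] by (auto simp: min_def max_def)
  have cont: "continuous_on {0..2} G" unfolding G_def[abs_def] using e by (intro continuous_intros) auto
  have [measurable]: "G \<in> borel_measurable borel" unfolding G_def[abs_def] by measurable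
  have "(\<lambda>n. 4 * (weight n * (\<integral>w. w\<^sup>2 * G w \<partial>overlap_law n)) + 40 * ((real (p n))\<^sup>2 / (real n * (real n - 1)))
      + 16 * (1 / \<epsilon>\<^sup>2) * (real (p n) ^ 3 * (n * share_moment n 2 ^ 3)))
    \<longlonglongrightarrow> 4 * (\<integral>x. x\<^sup>2 * G x \<partial>\<nu>) + 40 * 0 + 16 * (1 / \<epsilon>\<^sup>2) * 0"
    by (intro tendsto_add tendsto_mult tendsto_const limit_continuous_real cont pairs_null triple_null) measurable
  moreover have "(\<integral>x. x\<^sup>2 * G x \<partial>\<nu>) = (\<integral>x. (min x \<epsilon>)\<^sup>2 \<partial>\<nu>)"
    by (intro Bochner_Integration.integral_cong G) (auto simp: space_nu)
  ultimately have "(\<lambda>n. 4 * (weight n * (\<integral>w. w\<^sup>2 * G w \<partial>overlap_law n)) + 40 * ((real (p n))\<^sup>2 / (real n * (real n - 1)))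
      + 16 * (1 / \<epsilon>\<^sup>2) * (real (p n) ^ 3 * (n * share_moment n 2 ^ 3))) \<longlonglongrightarrow> 4 * (\<integral>x. (min x \<epsilon>)\<^sup>2 \<partial>\<nu>)" by simp
  then show ?thesis
  proof (rule Lim_transform_eventually)
    show "\<forall>\<^sub>F n in sequentially. 4 * (weight n * (\<integral>w. w\<^sup>2 * G w \<partial>overlap_law n)) + 40 * ((real (p n))\<^sup>2 / (real n * (real n - 1)))
      + 16 * (1 / \<epsilon>\<^sup>2) * (real (p n) ^ 3 * (n * share_moment n 2 ^ 3)) = var_bound \<epsilon> n (p n)"
      using eventually_ge_at_top[of 1]
    proof eventually_elim
      case (elim n)
      have "(\<integral>w. w\<^sup>2 * G w \<partial>overlap_law n) = (\<integral>w. (min w \<epsilon>)\<^sup>2 \<partial>overlap_law n)"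
        using AE_overlap_law[OF elim] by (intro integral_cong_AE) (auto elim!: eventually_mono simp: G)
      then show ?case unfolding var_bound_def weight_def by (simp add: algebra_simps)
    qed
  qed
qed

lemma excess_levy_bound:
  assumes "0 \<le> \<epsilon>" "0 \<le> w" shows "norm (levy_exponent t (excess \<epsilon> w)) \<le> t\<^sup>2 / 2 * w\<^sup>2"
proof -
  have "(excess \<epsilon> w)\<^sup>2 \<le> w\<^sup>2" by (intro power_mono excess_le excess_nonneg assms)
  then have "t\<^sup>2 / 2 * (excess \<epsilon> w)\<^sup>2 \<le> t\<^sup>2 / 2 * w\<^sup>2" by (intro mult_left_mono) auto
  with levy_exponent_bound show ?thesis by (rule order_trans)
qed

lemma excess_levy_integrable:
  assumes e: "0 \<le> \<epsilon>"
  shows "integrable \<nu> (\<lambda>x. levy_exponent t (excess \<epsilon> x))"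
    and "1 \<le> n \<Longrightarrow> integrable (overlap_law n) (\<lambda>x. levy_exponent t (excess \<epsilon> x))"
proof -
  show "integrable \<nu> (\<lambda>x. levy_exponent t (excess \<epsilon> x))"
  proof (rule Bochner_Integration.integrable_bound)
    show "integrable \<nu> (\<lambda>x. t\<^sup>2 / 2 * x\<^sup>2)" by (intro integrable_mult_right nu_square_integrable)
    show "AE x in \<nu>. norm (levy_exponent t (excess \<epsilon> x)) \<le> norm (t\<^sup>2 / 2 * x\<^sup>2)"
      using excess_levy_bound[OF e] by (intro AE_I2) (auto simp: space_nu abs_mult)
  qed measurable
  assume n: "1 \<le> n"
  show "integrable (overlap_law n) (\<lambda>x. levy_exponent t (excess \<epsilon> x))"
  proof (rule Bochner_Integration.integrable_bound)
    show "integrable (overlap_law n) (\<lambda>x. t\<^sup>2 / 2 * x\<^sup>2)" by (intro integrable_mult_right overlap_power(2) n)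
    show "AE x in overlap_law n. norm (levy_exponent t (excess \<epsilon> x)) \<le> norm (t\<^sup>2 / 2 * x\<^sup>2)"
      using AE_overlap_law[OF n] by eventually_elim (use excess_levy_bound[OF e] in \<open>auto simp: abs_mult\<close>)
  qed measurable
qed

lemma limit_levy_weight:
  assumes e: "0 < \<epsilon>"
  shows "(\<lambda>n. weight n * (CLINT w|overlap_law n. levy_exponent t (excess \<epsilon> w)))
    \<longlonglongrightarrow> (CLINT x|\<nu>. levy_exponent t (excess \<epsilon> x))"
proof -
  have e0: "0 \<le> \<epsilon>" using e by simp
  \<comment> \<open>Division by \<open>x\<^sup>2\<close> in disguise: the numerator vanishes for
    \<open>x \<le> \<epsilon>\<close>, so the denominator may be kept away from 0 and the quotient
    is continuous at 0.\<close>
  define G where "G x = levy_exponent t (excess \<epsilon> x) / of_real ((max x \<epsilon>)\<^sup>2)" for x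
  have G: "of_real (x\<^sup>2) * G x = levy_exponent t (excess \<epsilon> x)" if "0 \<le> x" for x
  proof (cases "x \<le> \<epsilon>")
    case True
    then show ?thesis by (simp add: G_def excess_def levy_exponent_def)
  next
    case False
    then show ?thesis using e by (simp add: G_def max_def)
  qed
  have cG: "continuous_on {0..2} G"
    unfolding G_def[abs_def] levy_exponent_def excess_def using e by (intro continuous_intros) auto
  have [measurable]: "G \<in> borel_measurable borel" unfolding G_def[abs_def] by measurable
  have re: "(\<lambda>n. weight n * (\<integral>w. w\<^sup>2 * Re (G w) \<partial>overlap_law n)) \<longlonglongrightarrow> (\<integral>x. x\<^sup>2 * Re (G x) \<partial>\<nu>)"
    by (intro limit_continuous_real continuous_on_Re cG) measurable
  have im: "(\<lambda>n. weight n * (\<integral>w. w\<^sup>2 * Im (G w) \<partial>overlap_law n)) \<longlonglongrightarrow> (\<integral>x. x\<^sup>2 * Im (G x) \<partial>\<nu>)"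
    by (intro limit_continuous_real continuous_on_Im cG) measurable
  have R: "Re (levy_exponent t (excess \<epsilon> x)) = x\<^sup>2 * Re (G x)" "Im (levy_exponent t (excess \<epsilon> x)) = x\<^sup>2 * Im (G x)" if "0 \<le> x" for x
    unfolding G[OF that, symmetric] by (simp_all add: Re_divide Im_divide)
  have ren: "Re (CLINT x|\<nu>. levy_exponent t (excess \<epsilon> x)) = (\<integral>x. x\<^sup>2 * Re (G x) \<partial>\<nu>)"
    "Im (CLINT x|\<nu>. levy_exponent t (excess \<epsilon> x)) = (\<integral>x. x\<^sup>2 * Im (G x) \<partial>\<nu>)"
    unfolding integral_Re[OF excess_levy_integrable(1)[OF e0], symmetric] integral_Im[OF excess_levy_integrable(1)[OF e0], symmetric]
    by (auto intro!: Bochner_Integration.integral_cong R simp: space_nu)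
  have reo: "Re (weight n * (CLINT x|overlap_law n. levy_exponent t (excess \<epsilon> x))) = weight n * (\<integral>x. x\<^sup>2 * Re (G x) \<partial>overlap_law n)"
    "Im (weight n * (CLINT x|overlap_law n. levy_exponent t (excess \<epsilon> x))) = weight n * (\<integral>x. x\<^sup>2 * Im (G x) \<partial>overlap_law n)"
    if n: "1 \<le> n" for n
  proof -
    have "(\<integral>x. Re (levy_exponent t (excess \<epsilon> x)) \<partial>overlap_law n) = (\<integral>x. x\<^sup>2 * Re (G x) \<partial>overlap_law n)"
      using AE_overlap_law[OF n] by (intro integral_cong_AE) (auto elim!: eventually_mono simp: R)
    moreover have "(\<integral>x. Im (levy_exponent t (excess \<epsilon> x)) \<partial>overlap_law n) = (\<integral>x. x\<^sup>2 * Im (G x) \<partial>overlap_law n)"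
      using AE_overlap_law[OF n] by (intro integral_cong_AE) (auto elim!: eventually_mono simp: R)
    ultimately show "Re (weight n * (CLINT x|overlap_law n. levy_exponent t (excess \<epsilon> x))) = weight n * (\<integral>x. x\<^sup>2 * Re (G x) \<partial>overlap_law n)"
      "Im (weight n * (CLINT x|overlap_law n. levy_exponent t (excess \<epsilon> x))) = weight n * (\<integral>x. x\<^sup>2 * Im (G x) \<partial>overlap_law n)"
      using integral_Re[OF excess_levy_integrable(2)[OF e0 n]] integral_Im[OF excess_levy_integrable(2)[OF e0 n]] by auto
  qed
  show ?thesis unfolding tendsto_complex_iff ren
  proof
    show "(\<lambda>n. Re (weight n * (CLINT w|overlap_law n. levy_exponent t (excess \<epsilon> w)))) \<longlonglongrightarrow> (\<integral>x. x\<^sup>2 * Re (G x) \<partial>\<nu>)"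
      by (rule Lim_transform_eventually[OF re eventually_mono[OF eventually_ge_at_top]]) (rule reo(1)[symmetric])
    show "(\<lambda>n. Im (weight n * (CLINT w|overlap_law n. levy_exponent t (excess \<epsilon> w)))) \<longlonglongrightarrow> (\<integral>x. x\<^sup>2 * Im (G x) \<partial>\<nu>)"
      by (rule Lim_transform_eventually[OF im eventually_mono[OF eventually_ge_at_top]]) (rule reo(2)[symmetric])
  qed
qed

text \<open>The true number of pairs falls short of \<open>(real p)\<^sup>2 / 2\<close> by
  \<open>p / 2\<close>. The integral is of order at most \<open>(share_moment n 2)\<^sup>2\<close>,
  so the correction is a bounded quantity times \<open>sqrt n * share_moment n 2\<close>, which
  tends to 0.\<close>

lemma limit_levy_pairs:
  assumes e: "0 < \<epsilon>"
  shows "(\<lambda>n. real (card (pairs (p n))) * n * (CLINT w|overlap_law n. levy_exponent t (excess \<epsilon> w)))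
    \<longlonglongrightarrow> (CLINT x|\<nu>. levy_exponent t (excess \<epsilon> x))"
proof -
  have e0: "0 \<le> \<epsilon>" using e by simp
  define L where "L n = (CLINT w|overlap_law n. levy_exponent t (excess \<epsilon> w))" for n
  have L: "norm (L n) \<le> 2 * t\<^sup>2 * (share_moment n 2)\<^sup>2" if n: "1 \<le> n" for n
  proof -
    have "norm (L n) \<le> (\<integral>w. norm (levy_exponent t (excess \<epsilon> w)) \<partial>overlap_law n)"
      unfolding L_def by (rule integral_norm_bound)
    also have "\<dots> \<le> (\<integral>w. t\<^sup>2 / 2 * w\<^sup>2 \<partial>overlap_law n)"
    proof (rule integral_mono_AE)
      show "integrable (overlap_law n) (\<lambda>w. norm (levy_exponent t (excess \<epsilon> w)))"
        by (intro integrable_norm excess_levy_integrable e0 n)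
      show "integrable (overlap_law n) (\<lambda>x. t\<^sup>2 / 2 * x\<^sup>2)" by (intro integrable_mult_right overlap_power(2) n)
      show "AE x in overlap_law n. norm (levy_exponent t (excess \<epsilon> x)) \<le> t\<^sup>2 / 2 * x\<^sup>2"
        using AE_overlap_law[OF n] by eventually_elim (use excess_levy_bound[OF e0] in auto)
    qed
    also have "\<dots> = t\<^sup>2 / 2 * (2 ^ 2 * (share_moment n 2)\<^sup>2)"
      unfolding integral_mult_right_zero overlap_power(1)[OF n] ..
    finally show ?thesis by simp
  qed
  have "(\<lambda>n. of_real (real (p n) / 2 * n) * L n) \<longlonglongrightarrow> 0"
  proof (rule Lim_null_comparison)
    show "\<forall>\<^sub>F n in sequentially. norm (of_real (real (p n) / 2 * n) * L n) \<le> t\<^sup>2 * ((p n * sqrt n * share_moment n 2) * (sqrt n * share_moment n 2))"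
      using eventually_ge_at_top[of 1]
    proof eventually_elim
      case (elim n)
      have "norm (of_real (real (p n) / 2 * n) * L n) = real (p n) / 2 * n * norm (L n)"
        unfolding norm_mult norm_of_real by simp
      also have "\<dots> \<le> real (p n) / 2 * n * (2 * t\<^sup>2 * (share_moment n 2)\<^sup>2)"
        by (intro mult_left_mono L elim) auto
      also have "\<dots> = t\<^sup>2 * (p n * (sqrt n)\<^sup>2 * (share_moment n 2)\<^sup>2)" by simp
      also have "p n * (sqrt n)\<^sup>2 * (share_moment n 2)\<^sup>2 = (p n * sqrt n * share_moment n 2) * (sqrt n * share_moment n 2)"
        by (simp only: power2_eq_square mult_ac)
      finally show ?case .
    qed
    have "(\<lambda>n. t\<^sup>2 * ((p n * sqrt n * share_moment n 2) * (sqrt n * share_moment n 2))) \<longlonglongrightarrow> t\<^sup>2 * ((c * limit_moment \<alpha> 2) * 0)"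
      by (intro tendsto_mult tendsto_const moments sqrt_share_moment_2) simp
    then show "(\<lambda>n. t\<^sup>2 * ((p n * sqrt n * share_moment n 2) * (sqrt n * share_moment n 2))) \<longlonglongrightarrow> 0" by simp
  qed
  from tendsto_diff[OF limit_levy_weight[OF e] this[unfolded L_def]]
  have "(\<lambda>n. weight n * (CLINT w|overlap_law n. levy_exponent t (excess \<epsilon> w)) -
      of_real (real (p n) / 2 * n) * (CLINT w|overlap_law n. levy_exponent t (excess \<epsilon> w)))
    \<longlonglongrightarrow> (CLINT x|\<nu>. levy_exponent t (excess \<epsilon> x))" by simp
  moreover have "weight n * x - of_real (real (p n) / 2 * n) * x = real (card (pairs (p n))) * n * x" for n and x :: complex
  proof -
    have "weight n - real (p n) / 2 * n = real (card (pairs (p n))) * n"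
      unfolding weight_def card_pairs by (simp add: power2_eq_square algebra_simps)
    then have "of_real (weight n - real (p n) / 2 * n) * x = of_real (real (card (pairs (p n))) * n) * x" by (simp only:)
    then show ?thesis by (simp add: left_diff_distrib)
  qed
  ultimately show ?thesis by simp
qed

text \<open>The prefactor of the exponential is a combination of the null sequences of
  \<open>triple_null\<close> and \<open>quadruple_null\<close>, while the exponent itself converges.
  So the compound Poisson error vanishes although the bound on the mean number of large overlaps
  does not.\<close>

lemma char_error_null:
  assumes e: "0 < \<epsilon>"
  shows "(\<lambda>n. \<bar>t\<bar> * (2 * real (p n) ^ 3 * (2 * (16 * (1 / \<epsilon> ^ 4) * n * share_moment n 2 ^ 3) + 3 * (4 * real n * (share_moment n 2)\<^sup>2 / \<epsilon>\<^sup>2)\<^sup>2)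
      * exp ((real (p n))\<^sup>2 * (4 * real n * (share_moment n 2)\<^sup>2 / \<epsilon>\<^sup>2)))
    + real (card (pairs (p n))) * (4 * t\<^sup>2 / (real n * (real n - 1)))) \<longlonglongrightarrow> 0"
proof -
  have X: "(\<lambda>n. 64 * (1 / \<epsilon> ^ 4) * (real (p n) ^ 3 * (n * share_moment n 2 ^ 3)) + 96 / \<epsilon> ^ 4 * (real (p n) ^ 3 * (n * (share_moment n 2)\<^sup>2)\<^sup>2))
      \<longlonglongrightarrow> 64 * (1 / \<epsilon> ^ 4) * 0 + 96 / \<epsilon> ^ 4 * 0"
    by (intro tendsto_intros triple_null quadruple_null)
  have Y: "(\<lambda>n. exp (4 / \<epsilon>\<^sup>2 * (p n * sqrt n * share_moment n 2)\<^sup>2)) \<longlonglongrightarrow> exp (4 / \<epsilon>\<^sup>2 * (c * limit_moment \<alpha> 2)\<^sup>2)"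
    by (intro tendsto_intros moments) simp
  have Z: "(\<lambda>n. real (card (pairs (p n))) * (4 * t\<^sup>2 / (real n * (real n - 1)))) \<longlonglongrightarrow> 0"
  proof (rule Lim_null_comparison)
    show "\<forall>\<^sub>F n in sequentially. norm (real (card (pairs (p n))) * (4 * t\<^sup>2 / (real n * (real n - 1)))) \<le> 2 * t\<^sup>2 * ((real (p n))\<^sup>2 / (real n * (real n - 1)))"
      using eventually_ge_at_top[of 1]
    proof eventually_elim
      case (elim n)
      then have d: "0 \<le> real n * (real n - 1)" by simp
      have "real (card (pairs (p n))) * (4 * t\<^sup>2 / (real n * (real n - 1))) \<le> (real (p n))\<^sup>2 / 2 * (4 * t\<^sup>2 / (real n * (real n - 1)))"
        using d by (intro mult_right_mono card_pairs_le divide_nonneg_nonneg) auto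
      moreover have nn: "0 \<le> real (card (pairs (p n))) * (4 * t\<^sup>2 / (real n * (real n - 1)))"
        by (rule mult_nonneg_nonneg[OF _ divide_nonneg_nonneg[OF _ d]]) auto
      ultimately show ?case unfolding real_norm_def abs_of_nonneg[OF nn] by (simp add: mult.assoc)
    qed
    have "(\<lambda>n. 2 * t\<^sup>2 * ((real (p n))\<^sup>2 / (real n * (real n - 1)))) \<longlonglongrightarrow> 2 * t\<^sup>2 * 0"
      by (intro tendsto_mult tendsto_const pairs_null)
    then show "(\<lambda>n. 2 * t\<^sup>2 * ((real (p n))\<^sup>2 / (real n * (real n - 1)))) \<longlonglongrightarrow> 0" by simp
  qed
  have "(\<lambda>n. \<bar>t\<bar> * ((64 * (1 / \<epsilon> ^ 4) * (real (p n) ^ 3 * (n * share_moment n 2 ^ 3)) + 96 / \<epsilon> ^ 4 * (real (p n) ^ 3 * (n * (share_moment n 2)\<^sup>2)\<^sup>2))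
      * exp (4 / \<epsilon>\<^sup>2 * (p n * sqrt n * share_moment n 2)\<^sup>2)) + real (card (pairs (p n))) * (4 * t\<^sup>2 / (real n * (real n - 1))))
    \<longlonglongrightarrow> \<bar>t\<bar> * ((64 * (1 / \<epsilon> ^ 4) * 0 + 96 / \<epsilon> ^ 4 * 0) * exp (4 / \<epsilon>\<^sup>2 * (c * limit_moment \<alpha> 2)\<^sup>2)) + 0"
    by (intro tendsto_add tendsto_mult[OF tendsto_const] tendsto_mult[OF X Y] Z)
  moreover have "2 * P * (2 * (16 * (1 / \<epsilon> ^ 4) * n * b ^ 3) + 3 * (4 * real n * b\<^sup>2 / \<epsilon>\<^sup>2)\<^sup>2) =
      64 * (1 / \<epsilon> ^ 4) * (P * (n * b ^ 3)) + 96 / \<epsilon> ^ 4 * (P * (n * b\<^sup>2)\<^sup>2)" for P b :: real and n :: nat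
    using e by (simp add: power2_eq_square power4_eq_xxxx field_simps)
  moreover have "(real (p n))\<^sup>2 * (4 * real n * b\<^sup>2 / \<epsilon>\<^sup>2) = 4 / \<epsilon>\<^sup>2 * (p n * sqrt n * b)\<^sup>2" for b :: real and n :: nat
    by (simp add: power_mult_distrib)
  ultimately show ?thesis by (simp only: mult_zero_right mult_zero_left add_0_right)
qed

text \<open>First \<open>n\<close> tends to infinity for a fixed threshold, then the threshold to 0.
  The one error of \<open>char_kap\<close> that survives the first limit comes from the mean square
  of the small overlaps; it is controlled by the integral of
  \<open>(min x \<epsilon>)\<^sup>2\<close> against \<open>nu\<close> and vanishes with
  \<epsilon>.\<close>

theorem char_pair_sum_limit:
  assumes iid: "\<And>n. iid_family (M n) (Row n) (\<zeta> n) (p n)"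
  shows "(\<lambda>n. CLINT \<omega>|M n. iexp (t * pair_sum (p n) (\<zeta> n) (kap n) \<omega>)) \<longlonglongrightarrow> exp (CLINT x|\<nu>. levy_exponent t x)"
proof (rule real_squeeze_approx)
  fix \<eta> :: real assume \<eta>: "0 < \<eta>"
  define \<epsilon> where "\<epsilon> m = 1 / real (Suc m)" for m
  have \<epsilon>: "0 < \<epsilon> m" "0 \<le> \<epsilon> m" for m by (auto simp: \<epsilon>_def)
  have \<epsilon>0: "\<epsilon> \<longlonglongrightarrow> 0" unfolding \<epsilon>_def by (rule lim_1_over_n[THEN LIMSEQ_Suc])
  have 1: "(\<lambda>m. \<integral>x. (min x (\<epsilon> m))\<^sup>2 \<partial>\<nu>) \<longlonglongrightarrow> (\<integral>x. 0 \<partial>\<nu>)"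
  proof (rule integral_dominated_convergence[OF _ _ nu_square_integrable])
    show "AE x in \<nu>. (\<lambda>m. (min x (\<epsilon> m))\<^sup>2) \<longlonglongrightarrow> 0"
    proof (rule AE_I2)
      fix x assume x: "x \<in> space \<nu>"
      have "(\<lambda>m. (min x (\<epsilon> m))\<^sup>2) \<longlonglongrightarrow> (min x 0)\<^sup>2" by (intro tendsto_intros \<epsilon>0)
      then show "(\<lambda>m. (min x (\<epsilon> m))\<^sup>2) \<longlonglongrightarrow> 0" using x by (simp add: space_nu)
    qed
    show "AE x in \<nu>. norm ((min x (\<epsilon> m))\<^sup>2) \<le> x\<^sup>2" for m
    proof (rule AE_I2)
      fix x assume "x \<in> space \<nu>"
      then have "(min x (\<epsilon> m))\<^sup>2 \<le> x\<^sup>2" using \<epsilon>[of m] by (intro power_mono) (auto simp: space_nu)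
      then show "norm ((min x (\<epsilon> m))\<^sup>2) \<le> x\<^sup>2" by simp
    qed
  qed measurable
  have 2: "(\<lambda>m. CLINT x|\<nu>. levy_exponent t (excess (\<epsilon> m) x)) \<longlonglongrightarrow> (CLINT x|\<nu>. levy_exponent t x)"
  proof (rule integral_dominated_convergence)
    show "integrable \<nu> (\<lambda>x. t\<^sup>2 / 2 * x\<^sup>2)" by (intro integrable_mult_right nu_square_integrable)
    show "AE x in \<nu>. (\<lambda>m. levy_exponent t (excess (\<epsilon> m) x)) \<longlonglongrightarrow> levy_exponent t x"
    proof (rule AE_I2)
      fix x assume x: "x \<in> space \<nu>"
      have "(\<lambda>m. levy_exponent t (excess (\<epsilon> m) x)) \<longlonglongrightarrow> levy_exponent t (excess 0 x)"
        unfolding levy_exponent_def excess_def by (intro tendsto_intros \<epsilon>0)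
      then show "(\<lambda>m. levy_exponent t (excess (\<epsilon> m) x)) \<longlonglongrightarrow> levy_exponent t x"
        using x by (simp add: space_nu excess_def)
    qed
    show "AE x in \<nu>. norm (levy_exponent t (excess (\<epsilon> m) x)) \<le> t\<^sup>2 / 2 * x\<^sup>2" for m
      using excess_levy_bound[OF \<epsilon>(2)] by (intro AE_I2) (auto simp: space_nu)
  qed measurable
  have "(\<lambda>m. \<bar>t\<bar> * sqrt (4 * (\<integral>x. (min x (\<epsilon> m))\<^sup>2 \<partial>\<nu>))) \<longlonglongrightarrow> \<bar>t\<bar> * sqrt (4 * (\<integral>x. 0 \<partial>\<nu>))"
    by (intro tendsto_intros 1)
  then have "\<forall>\<^sub>F m in sequentially. \<bar>t\<bar> * sqrt (4 * (\<integral>x. (min x (\<epsilon> m))\<^sup>2 \<partial>\<nu>)) < \<eta>"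
    using \<eta> by (intro order_tendstoD(2)) auto
  moreover have "\<forall>\<^sub>F m in sequentially. dist (exp (CLINT x|\<nu>. levy_exponent t (excess (\<epsilon> m) x))) (exp (CLINT x|\<nu>. levy_exponent t x)) < \<eta>"
    by (rule tendstoD[OF tendsto_exp[OF 2] \<eta>])
  ultimately have "\<forall>\<^sub>F m in sequentially. \<bar>t\<bar> * sqrt (4 * (\<integral>x. (min x (\<epsilon> m))\<^sup>2 \<partial>\<nu>)) < \<eta> \<and>
      dist (exp (CLINT x|\<nu>. levy_exponent t (excess (\<epsilon> m) x))) (exp (CLINT x|\<nu>. levy_exponent t x)) < \<eta>"
    by (rule eventually_conj)
  then obtain m where m: "\<bar>t\<bar> * sqrt (4 * (\<integral>x. (min x (\<epsilon> m))\<^sup>2 \<partial>\<nu>)) < \<eta>"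
      "dist (exp (CLINT x|\<nu>. levy_exponent t (excess (\<epsilon> m) x))) (exp (CLINT x|\<nu>. levy_exponent t x)) < \<eta>"
    by (auto simp: eventually_sequentially)
  define err where "err n = \<bar>t\<bar> * (2 * real (p n) ^ 3 * (2 * (16 * (1 / \<epsilon> m ^ 4) * n * share_moment n 2 ^ 3) + 3 * (4 * real n * (share_moment n 2)\<^sup>2 / (\<epsilon> m)\<^sup>2)\<^sup>2)
      * exp ((real (p n))\<^sup>2 * (4 * real n * (share_moment n 2)\<^sup>2 / (\<epsilon> m)\<^sup>2)))
    + real (card (pairs (p n))) * (4 * t\<^sup>2 / (real n * (real n - 1)))" for n
  have "(\<lambda>n. \<bar>t\<bar> * sqrt (var_bound (\<epsilon> m) n (p n)) + err n) \<longlonglongrightarrow> \<bar>t\<bar> * sqrt (4 * (\<integral>x. (min x (\<epsilon> m))\<^sup>2 \<partial>\<nu>)) + 0"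
    unfolding err_def by (intro tendsto_add tendsto_mult tendsto_const tendsto_real_sqrt var_bound_limit char_error_null \<epsilon>)
  then have "\<forall>\<^sub>F n in sequentially. \<bar>t\<bar> * sqrt (var_bound (\<epsilon> m) n (p n)) + err n < \<eta>"
    using m(1) by (intro order_tendstoD(2)) auto
  then have close: "\<forall>\<^sub>F n in sequentially. norm ((CLINT \<omega>|M n. iexp (t * pair_sum (p n) (\<zeta> n) (kap n) \<omega>)) -
      exp (real (card (pairs (p n))) * n * (CLINT w|overlap_law n. levy_exponent t (excess (\<epsilon> m) w)))) \<le> \<eta>"
    using eventually_ge_at_top[of 2]
  proof eventually_elim
    case (elim n)
    show ?case using char_kap[OF iid elim(2) \<epsilon>(1)[of m], of t] elim(1) unfolding err_def by linarith
  qed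
  show "\<exists>y l. y \<longlonglongrightarrow> l \<and> norm (l - exp (CLINT x|\<nu>. levy_exponent t x)) \<le> \<eta> \<and>
      (\<forall>\<^sub>F n in sequentially. norm ((CLINT \<omega>|M n. iexp (t * pair_sum (p n) (\<zeta> n) (kap n) \<omega>)) - y n) \<le> \<eta>)"
  proof (intro exI conjI)
    show "(\<lambda>n. exp (real (card (pairs (p n))) * n * (CLINT w|overlap_law n. levy_exponent t (excess (\<epsilon> m) w))))
      \<longlonglongrightarrow> exp (CLINT x|\<nu>. levy_exponent t (excess (\<epsilon> m) x))"
      by (intro tendsto_exp limit_levy_pairs \<epsilon>)
    show "norm (exp (CLINT x|\<nu>. levy_exponent t (excess (\<epsilon> m) x)) - exp (CLINT x|\<nu>. levy_exponent t x)) \<le> \<eta>"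
      using m(2) by (simp add: dist_norm)
  qed (rule close)
qed

lemma second_moment_bounded:
  assumes iid: "\<And>n. iid_family (M n) (Row n) (\<zeta> n) (p n)"
  obtains B where "\<forall>\<^sub>F n in sequentially. (\<integral>\<omega>. (pair_sum (p n) (\<zeta> n) (kap n) \<omega>)\<^sup>2 \<partial>M n) \<le> B"
proof -
  have "\<forall>\<^sub>F n in sequentially. var_bound 2 n (p n) < 4 * (\<integral>x. (min x 2)\<^sup>2 \<partial>\<nu>) + 1"
    by (rule order_tendstoD(2)[OF var_bound_limit]) auto
  then have "\<forall>\<^sub>F n in sequentially. (\<integral>\<omega>. (pair_sum (p n) (\<zeta> n) (kap n) \<omega>)\<^sup>2 \<partial>M n) \<le> 4 * (\<integral>x. (min x 2)\<^sup>2 \<partial>\<nu>) + 1"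
    using eventually_ge_at_top[of 2]
  proof eventually_elim
    case (elim n)
    show ?case using second_moment_kap[OF iid elim(2)] elim(1) by linarith
  qed
  then show ?thesis by (rule that)
qed

end

section \<open>The correlation matrix\<close>

text \<open>Squaring halves the exponent and replaces \<open>L\<close> by \<open>L (sqrt v)\<close>,
  which is again slowly varying. \<open>L\<close> is assumed positive only far out, but a decreasing
  tail that is positive far out is positive everywhere.\<close>

lemma slowly_varying_regular_tail:
  fixes \<rho> :: "real measure"
  assumes rho: "prob_space \<rho>" "sets \<rho> = sets borel" and \<alpha>: "0 < \<alpha>"
    and tail: "\<And>x. 0 < x \<Longrightarrow> measure \<rho> {t. x < \<bar>t\<bar>} = x powr (- \<alpha>) * L x"
    and L: "slowly_varying L"
  shows "0 < v \<Longrightarrow> measure \<rho> {t. v < t\<^sup>2} = v powr (- (\<alpha> / 2)) * L (sqrt v)"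
    and "regular_tail (\<lambda>v. measure \<rho> {t. v < t\<^sup>2}) (\<alpha> / 2)"
proof -
  interpret prob_space \<rho> by (rule rho(1))
  define G where "G v = measure \<rho> {t. v < t\<^sup>2}" for v
  have s: "{t. v < t\<^sup>2} \<in> sets \<rho>" for v :: real unfolding rho(2) by measurable
  have G: "G v = v powr (- (\<alpha> / 2)) * L (sqrt v)" if "0 < v" for v
  proof -
    have "{t. v < t\<^sup>2} = {t. sqrt v < \<bar>t\<bar>}"
      by (intro Collect_cong) (metis real_sqrt_abs real_sqrt_less_iff)
    moreover have "sqrt v powr (- \<alpha>) = v powr (- (\<alpha> / 2))"
      using that by (simp add: powr_half_sqrt[symmetric] powr_powr)
    ultimately show ?thesis using tail[of "sqrt v"] that by (simp add: G_def)
  qed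
  then show "0 < v \<Longrightarrow> measure \<rho> {t. v < t\<^sup>2} = v powr (- (\<alpha> / 2)) * L (sqrt v)" by (simp add: G_def)
  obtain A where A: "\<And>x. A \<le> x \<Longrightarrow> 0 < L x" using L by (auto simp: slowly_varying_def)
  have anti: "G y \<le> G x" if "x \<le> y" for x y
    unfolding G_def using that by (intro finite_measure_mono s) auto
  have "regular_tail G (\<alpha> / 2)"
  proof
    show "0 < \<alpha> / 2" using \<alpha> by simp
    show "G y \<le> G x" if "x \<le> y" for x y by (rule anti[OF that])
    show "G x \<le> 1" for x by (simp add: G_def)
    show "0 < G v" for v
    proof -
      \<comment> \<open>A point to the right of \<open>v\<close> whose square root lies in the range
        where \<open>L\<close> is positive.\<close>
      define w where "w = max v ((max 1 A)\<^sup>2)"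
      have "1\<^sup>2 \<le> (max 1 A)\<^sup>2" by (rule power_mono) auto
      then have w: "0 < w" by (auto simp: w_def less_max_iff_disj)
      have "sqrt ((max 1 A)\<^sup>2) \<le> sqrt w" unfolding real_sqrt_le_iff w_def by simp
      then have "A \<le> sqrt w" by simp
      then have "0 < G w" unfolding G[OF w] using A w by simp
      also have "G w \<le> G v" by (rule anti) (simp add: w_def)
      finally show ?thesis .
    qed
    show "((\<lambda>y. G (t * y) / G y) \<longlongrightarrow> t powr - (\<alpha> / 2)) at_top" if t: "0 < t" for t
    proof -
      have "((\<lambda>x. L (sqrt t * x) / L x) \<longlongrightarrow> 1) at_top"
        using L t by (simp add: slowly_varying_def)
      from filterlim_compose[OF this sqrt_at_top]
      have "((\<lambda>y. t powr - (\<alpha> / 2) * (L (sqrt t * sqrt y) / L (sqrt y))) \<longlongrightarrow> t powr - (\<alpha> / 2) * 1) at_top"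
        by (rule tendsto_mult_left)
      then have "((\<lambda>y. t powr - (\<alpha> / 2) * (L (sqrt t * sqrt y) / L (sqrt y))) \<longlongrightarrow> t powr - (\<alpha> / 2)) at_top"
        by simp
      then show ?thesis
      proof (rule Lim_transform_eventually)
        show "\<forall>\<^sub>F y in at_top. t powr - (\<alpha> / 2) * (L (sqrt t * sqrt y) / L (sqrt y)) = G (t * y) / G y"
          using eventually_gt_at_top[of 0]
        proof eventually_elim
          case (elim y)
          then show ?case using t G[of y] G[of "t * y"] by (simp add: real_sqrt_mult powr_mult)
        qed
      qed
    qed
  qed
  then show "regular_tail (\<lambda>v. measure \<rho> {t. v < t\<^sup>2}) (\<alpha> / 2)" by (simp add: G_def[abs_def])
qed

context tail_law
begin

text \<open>Here \<open>n * share_moment n k\<close> converges, so \<open>p\<close> of order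
  \<open>sqrt n\<close> is the growth at which \<open>p n * sqrt n * share_moment n k\<close> has a
  finite positive limit.\<close>

lemma scaled_rows_light:
  assumes \<alpha>: "\<alpha> \<in> {0<..<2}" "a = \<alpha> / 2" and c: "0 < c"
    and p: "(\<lambda>n. real (p n) / (c * real n powr (1 / 2))) \<longlonglongrightarrow> 1"
  shows "scaled_rows \<rho> p \<alpha> c"
proof (intro scaled_rows.intro scaled_rows_axioms.intro row_law_axioms)
  have "(\<lambda>n. c * (real (p n) / (c * real n powr (1 / 2)))) \<longlonglongrightarrow> c * 1"
    by (intro tendsto_mult tendsto_const p)
  moreover have "c * (real (p n) / (c * real n powr (1 / 2))) = p n / sqrt n" for n
    using c by (simp add: powr_half_sqrt)
  ultimately have q: "(\<lambda>n. p n / sqrt n) \<longlonglongrightarrow> c" by simp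
  show "(\<lambda>n. p n * sqrt n * share_moment n k) \<longlonglongrightarrow> c * limit_moment \<alpha> k" if k: "2 \<le> k" for k
  proof -
    have "(\<lambda>n. (p n / sqrt n) * (n * share_moment n k)) \<longlonglongrightarrow> c * (Gamma (real k - a) / (Gamma (real k) * Gamma (1 - a)))"
      by (intro tendsto_mult q share_moment_light) (use \<alpha> k in auto)
    moreover have "(p n / sqrt n) * (n * share_moment n k) = p n * sqrt n * share_moment n k" for n
    proof -
      have "(p n / sqrt n) * (n * share_moment n k) = p n * (real n / sqrt n) * share_moment n k" by simp
      then show ?thesis by (simp only: real_div_sqrt of_nat_0_le_iff)
    qed
    ultimately show ?thesis using \<alpha> by (simp add: limit_moment_def)
  qed
  have "(\<lambda>n. (p n / sqrt n) * (1 / sqrt n)) \<longlonglongrightarrow> c * 0"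
    by (intro tendsto_mult q) real_asymp
  then show "(\<lambda>n. p n / n) \<longlonglongrightarrow> 0" by simp
qed (use \<alpha> c in auto)

text \<open>The growth condition says that \<open>p n * sqrt n * G n\<close> tends to
  \<open>c\<close>. The bound \<alpha> < 3 enters through \<open>p n / n\<close>, which is this
  convergent quantity times \<open>n powr - (3 / 2) / G n\<close>: the tail index
  \<open>\<alpha> / 2\<close> is below 3/2, so the last quotient tends to 0.\<close>

lemma scaled_rows_heavy:
  assumes \<alpha>: "\<alpha> \<in> {2<..<3}" "a = \<alpha> / 2" and c: "0 < c" and mean: "(\<integral>t. t\<^sup>2 \<partial>\<rho>) = 1"
    and G: "\<And>v. 0 < v \<Longrightarrow> G v = v powr - (\<alpha> / 2) * L (sqrt v)"
    and p: "(\<lambda>n. real (p n) / (c * real n powr ((\<alpha> - 1) / 2) * (1 / L (real n powr (1 / 2))))) \<longlonglongrightarrow> 1"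
  shows "scaled_rows \<rho> p \<alpha> c"
proof (intro scaled_rows.intro scaled_rows_axioms.intro row_law_axioms)
  have a: "1 < a" "a < 3 / 2" using \<alpha> by auto
  have "(\<lambda>n. c * (real (p n) / (c * real n powr ((\<alpha> - 1) / 2) * (1 / L (real n powr (1 / 2)))))) \<longlonglongrightarrow> c * 1"
    by (intro tendsto_mult tendsto_const p)
  then have q: "(\<lambda>n. p n * sqrt n * G n) \<longlonglongrightarrow> c * 1"
  proof (rule Lim_transform_eventually)
    show "\<forall>\<^sub>F n in sequentially. c * (real (p n) / (c * real n powr ((\<alpha> - 1) / 2) * (1 / L (real n powr (1 / 2))))) = p n * sqrt n * G n"
      using eventually_gt_at_top[of 0]
    proof eventually_elim
      case (elim n)
      then have n: "0 < real n" by simp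
      have "sqrt n * n powr - (\<alpha> / 2) = n powr - ((\<alpha> - 1) / 2)"
        using n by (simp add: powr_half_sqrt[symmetric] powr_add[symmetric] diff_divide_distrib)
      also have "\<dots> = 1 / n powr ((\<alpha> - 1) / 2)" by (simp add: powr_minus_divide)
      finally have eq: "sqrt n * n powr - (\<alpha> / 2) = 1 / n powr ((\<alpha> - 1) / 2)" .
      have "p n * sqrt n * G n = p n * (sqrt n * n powr - (\<alpha> / 2)) * L (sqrt n)"
        unfolding G[OF n] by simp
      then show ?case unfolding eq using c n by (simp add: powr_half_sqrt)
    qed
  qed
  show "(\<lambda>n. p n * sqrt n * share_moment n k) \<longlonglongrightarrow> c * limit_moment \<alpha> k" if k: "2 \<le> k" for k
  proof -
    have "(\<lambda>m. share_moment (Suc m) k / G (real (Suc m))) \<longlonglongrightarrow> hlim k"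
      using a k by (intro share_moment_heavy mean) auto
    then have "(\<lambda>n. share_moment n k / G (real n)) \<longlonglongrightarrow> hlim k" by (rule LIMSEQ_imp_Suc)
    from tendsto_mult[OF q this] have "(\<lambda>n. (p n * sqrt n * G n) * (share_moment n k / G n)) \<longlonglongrightarrow> c * hlim k" by simp
    moreover have "(p n * sqrt n * G n) * (share_moment n k / G n) = p n * sqrt n * share_moment n k" for n
      using G_pos[of n] by simp
    moreover have "hlim k = limit_moment \<alpha> k" unfolding hlim_def limit_moment_def unfolding \<alpha>(2) using \<alpha>(1) by (simp add: mult.commute)
    ultimately show ?thesis by simp
  qed
  define b where "b = (a + 3 / 2) / 2"
  have b: "a < b" "b < 3 / 2" using a by (auto simp: b_def)
  obtain K x0 where K: "0 < K" "0 < x0" "\<And>y. x0 \<le> y \<Longrightarrow> K * y powr - b \<le> G y"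
    using lower_bound[OF b(1)] by blast
  show "(\<lambda>n. p n / n) \<longlonglongrightarrow> 0"
  proof (rule Lim_null_comparison)
    show "\<forall>\<^sub>F n in sequentially. norm (p n / n) \<le> (p n * sqrt n * G n) * (1 / K * n powr (b - 3 / 2))"
      using eventually_gt_at_top[of "nat \<lceil>x0\<rceil>"]
    proof eventually_elim
      case (elim n)
      then have n: "x0 \<le> real n" "0 < real n" using K(2) by linarith+
      have "K * n powr - b \<le> G n" by (rule K(3)[OF n(1)])
      then have "n powr - b \<le> G n * (1 / K)" using K(1) by (simp add: field_simps)
      then have "(p n * sqrt n) * (n powr - b * n powr (b - 3 / 2)) \<le> (p n * sqrt n) * ((G n * (1 / K)) * n powr (b - 3 / 2))"
        by (intro mult_left_mono mult_right_mono) auto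
      moreover have "(p n * sqrt n) * (n powr - b * n powr (b - 3 / 2)) = p n / n"
      proof -
        have "sqrt n * (n powr - b * n powr (b - 3 / 2)) = n powr (1 / 2 + (- b + (b - 3 / 2)))"
          using n by (simp only: powr_add powr_half_sqrt of_nat_0_le_iff)
        also have "\<dots> = n powr - 1" by simp
        also have "\<dots> = 1 / n" using n by (simp add: powr_minus_divide)
        finally show ?thesis by (simp only: mult.assoc times_divide_eq_right mult_1_right)
      qed
      ultimately show ?case by (simp add: mult.assoc)
    qed
    have "((\<lambda>x::real. x powr (b - 3 / 2)) \<longlongrightarrow> 0) at_top" using b by (intro tendsto_neg_powr filterlim_ident) auto
    from filterlim_compose[OF this filterlim_real_sequentially]
    have "(\<lambda>n. (p n * sqrt n * G n) * (1 / K * n powr (b - 3 / 2))) \<longlonglongrightarrow> (c * 1) * (1 / K * 0)"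
      by (intro tendsto_mult q tendsto_const)
    then show "(\<lambda>n. (p n * sqrt n * G n) * (1 / K * n powr (b - 3 / 2))) \<longlonglongrightarrow> 0" by simp
  qed
qed (use \<alpha> c in auto)

lemma zero_rows_null:
  assumes "(\<lambda>n. p n / n) \<longlonglongrightarrow> 0"
  shows "(\<lambda>n. real (p n) * Row.prob n {x \<in> space (Row n). sqsum n x = 0}) \<longlonglongrightarrow> 0"
proof (rule Lim_null_comparison)
  have "\<forall>\<^sub>F n in sequentially. p n / n < 1" using assms by (rule order_tendstoD) simp
  then show "\<forall>\<^sub>F n in sequentially. norm (real (p n) * Row.prob n {x \<in> space (Row n). sqsum n x = 0}) \<le> exp 1 * (n * lap 1 ^ n)"
    using eventually_gt_at_top[of 0]
  proof eventually_elim
    case (elim n)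
    have "Row.prob n {x \<in> space (Row n). sqsum n x = 0} \<le> Row.prob n {x \<in> space (Row n). sqsum n x < 1}"
      by (rule Row.finite_measure_mono) auto
    also have "\<dots> \<le> exp (1 * 1) * lap 1 ^ n" by (rule chernoff) simp
    finally have "real (p n) * Row.prob n {x \<in> space (Row n). sqsum n x = 0} \<le> real n * (exp 1 * lap 1 ^ n)"
      using elim by (intro mult_mono) (auto simp: divide_simps)
    then show ?case by (simp add: mult_ac)
  qed
  have "(\<lambda>n. n * lap 1 ^ n) \<longlonglongrightarrow> 0"
    using lap_nonneg[of 1] lap_1_less by (intro powser_times_n_limit_0) auto
  from tendsto_mult[OF tendsto_const[of "exp 1"] this]
  show "(\<lambda>n. exp 1 * (n * lap 1 ^ n)) \<longlonglongrightarrow> 0" by simp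
qed

end

text \<open>Rows are functions of disjoint blocks of the independent array, hence independent. Each
  has the product law because the joint law of the array is a product and projects onto a
  row.\<close>

lemma (in prob_space) iid_family_rows:
  fixes \<rho> :: "real measure" and p n :: nat
  assumes indep: "indep_vars (\<lambda>_. borel) (\<lambda>(i, j). X i j) ({..<p} \<times> {..<n})"
    and copies: "\<And>i j. i < p \<Longrightarrow> j < n \<Longrightarrow> distr M borel (X i j) = \<rho>"
    and rho: "prob_space \<rho>" "sets \<rho> = sets borel"
  shows "iid_family M (PiM {..<n} (\<lambda>_. \<rho>)) (\<lambda>i \<omega>. \<lambda>j\<in>{..<n}. X i j \<omega>) p"
proof -
  let ?R = "PiM {..<n} (\<lambda>_. \<rho>)"
  interpret R: prob_space ?R by (intro prob_space_PiM rho)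
  have sets_R: "sets ?R = sets (PiM {..<n} (\<lambda>_. borel))" by (intro sets_PiM_cong refl rho)
  have X [measurable]: "X i j \<in> borel_measurable M" if "i < p" "j < n" for i j
    using indep that by (auto simp: indep_vars_def)
  have Z: "(\<lambda>\<omega>. \<lambda>j\<in>{..<n}. X i j \<omega>) \<in> M \<rightarrow>\<^sub>M PiM {..<n} (\<lambda>_. borel)" if "i < p" for i
    using that by (intro measurable_restrict X) auto
  have "indep_vars (\<lambda>i. PiM ({i} \<times> {..<n}) (\<lambda>_. borel)) (\<lambda>i \<omega>. \<lambda>k\<in>{i} \<times> {..<n}. (case k of (i, j) \<Rightarrow> X i j) \<omega>) {..<p}"
    by (rule indep_vars_restrict[OF indep]) (auto simp: disjoint_family_on_def)
  then have "indep_vars (\<lambda>i. ?R) (\<lambda>i \<omega>. (\<lambda>x. \<lambda>j\<in>{..<n}. x (i, j)) (\<lambda>k\<in>{i} \<times> {..<n}. (case k of (i, j) \<Rightarrow> X i j) \<omega>)) {..<p}"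
  proof (rule indep_vars_compose2)
    fix i :: nat
    have "(\<lambda>x. \<lambda>j\<in>{..<n}. x (i, j)) \<in> PiM ({i} \<times> {..<n}) (\<lambda>_. borel) \<rightarrow>\<^sub>M PiM {..<n} (\<lambda>_. borel :: real measure)"
      by (intro measurable_restrict measurable_component_singleton) auto
    then show "(\<lambda>x. \<lambda>j\<in>{..<n}. x (i, j)) \<in> PiM ({i} \<times> {..<n}) (\<lambda>_. borel) \<rightarrow>\<^sub>M ?R"
      unfolding measurable_cong_sets[OF refl sets_R] .
  qed
  then have ind: "indep_vars (\<lambda>i. ?R) (\<lambda>i \<omega>. \<lambda>j\<in>{..<n}. X i j \<omega>) {..<p}"
    by (rule indep_vars_cong[THEN iffD1, rotated -1]) (auto simp: fun_eq_iff)
  have law: "distr M ?R (\<lambda>\<omega>. \<lambda>j\<in>{..<n}. X i j \<omega>) = ?R" if i: "i < p" for i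
  proof (cases "n = 0")
    \<comment> \<open>The array has an empty index set here. The space of rows is a single point, on
      which any two probability measures agree.\<close>
    case True
    have [measurable]: "(\<lambda>\<omega>. \<lambda>j\<in>{..<n}. X i j \<omega>) \<in> M \<rightarrow>\<^sub>M ?R"
      using Z[OF i] by (simp only: measurable_cong_sets[OF refl sets_R])
    interpret D: prob_space "distr M ?R (\<lambda>\<omega>. \<lambda>j\<in>{..<n}. X i j \<omega>)" by (rule prob_space_distr) measurable
    show ?thesis
    proof (rule measure_eqI)
      fix A assume "A \<in> sets (distr M ?R (\<lambda>\<omega>. \<lambda>j\<in>{..<n}. X i j \<omega>))"
      then have "A = {} \<or> A = space ?R" using sets.sets_into_space[of A ?R] True by (auto simp: space_PiM)
      then show "emeasure (distr M ?R (\<lambda>\<omega>. \<lambda>j\<in>{..<n}. X i j \<omega>)) A = emeasure ?R A"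
        using D.emeasure_space_1 R.emeasure_space_1 by (auto simp del: space_PiM)
    qed simp
  next
    case False
    let ?I = "{..<p} \<times> {..<n}" and ?row = "\<lambda>x. \<lambda>j\<in>{..<n}. x (i, j)"
    let ?W = "\<lambda>\<omega>. \<lambda>k\<in>?I. (case k of (i, j) \<Rightarrow> X i j) \<omega>"
    have W [measurable]: "?W \<in> M \<rightarrow>\<^sub>M PiM ?I (\<lambda>_. borel)" by (intro measurable_restrict) (auto intro: X)
    have row: "?row \<in> PiM ?I (\<lambda>_. borel) \<rightarrow>\<^sub>M PiM {..<n} (\<lambda>_. borel)"
      using i by (intro measurable_restrict measurable_component_singleton) auto
    have row' [measurable]: "?row \<in> PiM ?I (\<lambda>_. borel) \<rightarrow>\<^sub>M ?R"
      using row unfolding measurable_cong_sets[OF refl sets_R] .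
    have "distr M (PiM ?I (\<lambda>_. borel)) ?W = PiM ?I (\<lambda>k. distr M borel (case k of (i, j) \<Rightarrow> X i j))"
      using indep False i by (subst indep_vars_iff_distr_eq_PiM'[symmetric]) (auto intro: X)
    also have "\<dots> = PiM ?I (\<lambda>_. \<rho>)" by (intro PiM_cong refl) (auto intro: copies)
    finally have D: "distr M (PiM ?I (\<lambda>_. borel)) ?W = PiM ?I (\<lambda>_. \<rho>)" .
    have "distr M ?R (\<lambda>\<omega>. \<lambda>j\<in>{..<n}. X i j \<omega>) = distr M ?R (?row \<circ> ?W)"
      using i by (intro distr_cong refl) (auto simp: fun_eq_iff)
    also have "\<dots> = distr (distr M (PiM ?I (\<lambda>_. borel)) ?W) ?R ?row"
      by (rule distr_distr[symmetric]) (rule row' W)+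
    also have "\<dots> = ?R"
      unfolding D by (rule distr_PiM_reindex[of ?I "\<lambda>_. \<rho>"]) (use i rho in \<open>auto simp: inj_on_def\<close>)
    finally show ?thesis .
  qed
  show ?thesis
    by (intro iid_family.intro iid_family_axioms.intro prob_space_axioms R.prob_space_axioms ind law)
qed

section \<open>The trace as a sum over pairs of rows\<close>

lemma sample_correlation_index:
  assumes "i < p" "k < p"
  shows "sample_correlation p n x $$ (i, k) = corr n (x i) (x k)"
  using assms
  by (simp add: sample_correlation_def normalized_matrix_def scalar_prod_def corr_def unit_def sqsum_def lessThan_atLeast0)

lemma corr_commute: "corr n x y = corr n y x"
  by (simp add: corr_def mult.commute)

lemma mat_trace_square:
  "mat_trace (sample_correlation p n x ^\<^sub>m 2) = (\<Sum>i<p. \<Sum>k<p. (corr n (x i) (x k))\<^sup>2)"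
proof -
  define R where "R = sample_correlation p n x"
  have d: "dim_row R = p" "dim_col R = p"
    by (simp_all add: R_def sample_correlation_def normalized_matrix_def)
  have "R ^\<^sub>m 2 = R * R" using d by (simp add: numeral_2_eq_2)
  moreover have "(R * R) $$ (i, i) = (\<Sum>k<p. (corr n (x i) (x k))\<^sup>2)" if "i < p" for i
  proof -
    have "(R * R) $$ (i, i) = (\<Sum>k<p. R $$ (i, k) * R $$ (k, i))"
      using that d by (simp add: scalar_prod_def lessThan_atLeast0)
    also have "\<dots> = (\<Sum>k<p. (corr n (x i) (x k))\<^sup>2)"
      using that by (intro sum.cong refl) (simp add: R_def sample_correlation_index power2_eq_square corr_commute[of _ "x i"])
    finally show ?thesis .
  qed
  ultimately show ?thesis using d by (simp add: mat_trace_def R_def[symmetric])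
qed

lemma sum_symmetric_square:
  fixes f :: "nat \<Rightarrow> nat \<Rightarrow> real"
  assumes sym: "\<And>i k. f i k = f k i"
  shows "(\<Sum>i<p. \<Sum>k<p. f i k) = (\<Sum>i<p. f i i) + 2 * (\<Sum>P\<in>pairs p. f (fst P) (snd P))"
proof (induction p)
  case 0
  then show ?case by (simp add: pairs_def)
next
  case (Suc p)
  have P: "pairs (Suc p) = pairs p \<union> (\<lambda>i. (i, p)) ` {..<p}" by (auto simp: pairs_def less_Suc_eq)
  have "finite (pairs p)" by (rule finite_subset[of _ "{..<p} \<times> {..<p}"]) (auto simp: pairs_def)
  then have "(\<Sum>P\<in>pairs (Suc p). f (fst P) (snd P)) = (\<Sum>P\<in>pairs p. f (fst P) (snd P)) + (\<Sum>i<p. f i p)"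
    unfolding P by (subst sum.union_disjoint) (auto simp: pairs_def sum.reindex inj_on_def)
  moreover have "(\<Sum>k<p. f p k) = (\<Sum>i<p. f i p)" by (intro sum.cong refl sym)
  ultimately show ?case using Suc by (simp add: sum.distrib)
qed

text \<open>For nonzero rows the diagonal entries of the matrix and all share sums in
  \<open>kap\<close> are 1. The diagonal accounts for \<open>p\<close>, and the compensators
  \<open>2 / n\<close> of the \<open>p * (p - 1) / 2\<close> pairs for the rest of
  \<open>mu_trace\<close>.\<close>

lemma trace_eq_pair_sum:
  assumes nz: "\<And>i. i < p \<Longrightarrow> sqsum n (x i) \<noteq> 0"
  shows "mat_trace (sample_correlation p n x ^\<^sub>m 2) - mu_trace p n = (\<Sum>P\<in>pairs p. kap n (x (fst P)) (x (snd P)))"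
proof -
  have "corr n (x i) (x i) = 1" if "i < p" for i
    using sum_share[of n "x i"] nz[OF that] by (simp add: corr_def power2_eq_square[symmetric] unit_square)
  then have diag: "(\<Sum>i<p. (corr n (x i) (x i))\<^sup>2) = p" by simp
  have "(\<Sum>P\<in>pairs p. kap n (x (fst P)) (x (snd P))) = (\<Sum>P\<in>pairs p. 2 * (corr n (x (fst P)) (x (snd P)))\<^sup>2 - 2 / n)"
    using nz by (intro sum.cong refl) (auto simp: kap_def sum_share pairs_def)
  also have "\<dots> = 2 * (\<Sum>P\<in>pairs p. (corr n (x (fst P)) (x (snd P)))\<^sup>2) - real (card (pairs p)) * (2 / n)"
    by (simp add: sum_subtractf sum_distrib_left)
  also have "real (card (pairs p)) * (2 / n) = real p * (real p - 1) / n" by (simp add: card_pairs)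
  finally show ?thesis
    unfolding mat_trace_square mu_trace_def
    using sum_symmetric_square[of "\<lambda>i k. (corr n (x i) (x k))\<^sup>2" p] diag by (simp add: corr_commute)
qed

lemma corr_cong: "(\<And>j. j < n \<Longrightarrow> x j = x' j) \<Longrightarrow> (\<And>j. j < n \<Longrightarrow> y j = y' j) \<Longrightarrow> corr n x y = corr n x' y'"
  by (simp add: corr_def unit_def sqsum_def)

text \<open>As points of the product space rows are functions restricted to \<open>{..<n}\<close>,
  while the matrix is built from unrestricted ones; only the columns below \<open>n\<close> enter
  the kernel.\<close>

lemma kap_restrict: "kap n (restrict x {..<n}) (restrict y {..<n}) = kap n x y"
  by (simp add: kap_def share_def sqsum_def corr_cong[of n "restrict x {..<n}" x "restrict y {..<n}" y])

lemma trace_measurable: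
  assumes [measurable]: "\<And>i j. i < p \<Longrightarrow> j < n \<Longrightarrow> X i j \<in> borel_measurable M"
  shows "(\<lambda>\<omega>. mat_trace (sample_correlation p n (\<lambda>i j. X i j \<omega>) ^\<^sub>m 2)) \<in> borel_measurable M"
  unfolding mat_trace_square corr_def unit_def sqsum_def
  by measurable

text \<open>Bounded second moments make the characteristic functions Lipschitz uniformly in \<open>n\<close>, which allows
  the argument to vary with \<open>n\<close>.\<close>
lemma weak_conv_rescaled:
  fixes T Z :: "nat \<Rightarrow> 'b \<Rightarrow> real" and \<mu> :: "real measure" and \<sigma> :: "nat \<Rightarrow> real"
  assumes M: "\<And>n. prob_space (M n)" and \<mu>: "real_distribution \<mu>"
    and Z: "\<And>n. Z n \<in> borel_measurable (M n)"
    and T: "\<forall>\<^sub>F n in sequentially. T n \<in> borel_measurable (M n) \<and> integrable (M n) (T n)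
        \<and> integrable (M n) (\<lambda>\<omega>. (T n \<omega>)\<^sup>2) \<and> (\<integral>\<omega>. (T n \<omega>)\<^sup>2 \<partial>M n) \<le> B"
    and limit: "\<And>t. (\<lambda>n. CLINT \<omega>|M n. iexp (t * T n \<omega>)) \<longlonglongrightarrow> char \<mu> (t * s)"
    and \<sigma>: "\<sigma> \<longlonglongrightarrow> s" "s \<noteq> 0"
    and close: "\<forall>\<^sub>F n in sequentially. \<exists>E\<in>sets (M n). measure (M n) E \<le> \<delta> n \<and> (\<forall>\<omega>\<in>space (M n) - E. Z n \<omega> = T n \<omega>)"
      "\<delta> \<longlonglongrightarrow> 0"
  shows "weak_conv_m (\<lambda>n. distr (M n) borel (\<lambda>\<omega>. Z n \<omega> / \<sigma> n)) \<mu>"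
proof (rule levy_continuity[OF _ \<mu>])
  interpret prob_space "M n" for n by (rule M)
  have meas [measurable]: "(\<lambda>\<omega>. Z n \<omega> / \<sigma> n) \<in> borel_measurable (M n)" for n using Z by measurable
  show "real_distribution (distr (M n) borel (\<lambda>\<omega>. Z n \<omega> / \<sigma> n))" for n
    by (rule real_distribution_distr) measurable
  fix t
  define u where "u = t / s"
  define v where "v n = t / \<sigma> n" for n
  have v: "v \<longlonglongrightarrow> u" unfolding v_def u_def by (intro tendsto_intros \<sigma>)
  have char_eq: "char (distr (M n) borel (\<lambda>\<omega>. Z n \<omega> / \<sigma> n)) t = (CLINT \<omega>|M n. iexp (v n * Z n \<omega>))" for n
    unfolding char_def v_def by (subst integral_distr) (auto simp: meas)
  have "(\<lambda>n. (CLINT \<omega>|M n. iexp (v n * Z n \<omega>)) - (CLINT \<omega>|M n. iexp (u * T n \<omega>))) \<longlonglongrightarrow> 0"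
  proof (rule Lim_null_comparison)
    show "\<forall>\<^sub>F n in sequentially. norm ((CLINT \<omega>|M n. iexp (v n * Z n \<omega>)) - (CLINT \<omega>|M n. iexp (u * T n \<omega>)))
        \<le> 2 * \<delta> n + \<bar>v n - u\<bar> * sqrt B"
      using T close(1)
    proof eventually_elim
      case (elim n)
      then have [measurable]: "T n \<in> borel_measurable (M n)" by simp
      note [measurable] = Z[of n]
      from elim obtain E where E [measurable]: "E \<in> sets (M n)" and PE: "measure (M n) E \<le> \<delta> n"
        and eq: "\<And>\<omega>. \<omega> \<in> space (M n) \<Longrightarrow> \<omega> \<notin> E \<Longrightarrow> Z n \<omega> = T n \<omega>" by auto
      have i: "integrable (M n) (\<lambda>\<omega>. iexp (r * U \<omega>))" if "U \<in> borel_measurable (M n)" for r U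
        using that by (intro integrable_const_bound[where B=1]) auto
      have "norm ((CLINT \<omega>|M n. iexp (v n * Z n \<omega>)) - (CLINT \<omega>|M n. iexp (v n * T n \<omega>)))
          = norm (CLINT \<omega>|M n. iexp (v n * Z n \<omega>) - iexp (v n * T n \<omega>))"
        by (simp only: Bochner_Integration.integral_diff[OF i i] Z \<open>T n \<in> borel_measurable (M n)\<close>)
      also have "\<dots> \<le> (\<integral>\<omega>. norm (iexp (v n * Z n \<omega>) - iexp (v n * T n \<omega>)) \<partial>M n)" by (rule integral_norm_bound)
      also have "\<dots> \<le> (\<integral>\<omega>. 2 * indicator E \<omega> \<partial>M n)"
      proof (rule integral_mono)
        show "integrable (M n) (\<lambda>\<omega>. norm (iexp (v n * Z n \<omega>) - iexp (v n * T n \<omega>)))"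
          by (intro integrable_norm Bochner_Integration.integrable_diff i) measurable
        show "integrable (M n) (\<lambda>\<omega>. 2 * indicator E \<omega> :: real)"
          by (intro integrable_mult_right integrable_real_indicator) (auto simp: emeasure_eq_measure)
        fix \<omega> assume w: "\<omega> \<in> space (M n)"
        have "norm (iexp (v n * Z n \<omega>) - iexp (v n * T n \<omega>)) \<le> 1 + 1"
          by (rule order_trans[OF norm_triangle_ineq4]) simp
        then show "norm (iexp (v n * Z n \<omega>) - iexp (v n * T n \<omega>)) \<le> 2 * indicator E \<omega>"
          using eq[OF w] by (cases "\<omega> \<in> E") auto
      qed
      also have "\<dots> = 2 * measure (M n) E" by (simp add: Int_absorb2 sets.sets_into_space)
      finally have 1: "norm ((CLINT \<omega>|M n. iexp (v n * Z n \<omega>)) - (CLINT \<omega>|M n. iexp (v n * T n \<omega>))) \<le> 2 * \<delta> n"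
        using PE by simp
      have "norm ((CLINT \<omega>|M n. iexp (1 * (v n * T n \<omega>))) - (CLINT \<omega>|M n. iexp (1 * (u * T n \<omega>)))) \<le> \<bar>1\<bar> * sqrt ((v n - u)\<^sup>2 * B)"
      proof (rule char_diff_le)
        show "integrable (M n) (\<lambda>\<omega>. v n * T n \<omega>)" "integrable (M n) (\<lambda>\<omega>. u * T n \<omega>)"
          using elim by (intro integrable_mult_right; simp)+
        have d: "(\<lambda>\<omega>. (v n * T n \<omega> - u * T n \<omega>)\<^sup>2) = (\<lambda>\<omega>. (v n - u)\<^sup>2 * (T n \<omega>)\<^sup>2)"
          by (simp add: left_diff_distrib[symmetric] power_mult_distrib)
        show "integrable (M n) (\<lambda>\<omega>. (v n * T n \<omega> - u * T n \<omega>)\<^sup>2)"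
          unfolding d using elim by (intro integrable_mult_right) simp
        show "(\<integral>\<omega>. (v n * T n \<omega> - u * T n \<omega>)\<^sup>2 \<partial>M n) \<le> (v n - u)\<^sup>2 * B"
          unfolding d integral_mult_right_zero using elim by (intro mult_left_mono) auto
      qed
      then have 2: "norm ((CLINT \<omega>|M n. iexp (v n * T n \<omega>)) - (CLINT \<omega>|M n. iexp (u * T n \<omega>))) \<le> \<bar>v n - u\<bar> * sqrt B"
        by (simp only: mult_1 abs_one real_sqrt_mult real_sqrt_abs)
      show ?case using norm_triangle_le[OF add_mono[OF 1 2]] by simp
    qed
    have "(\<lambda>n. 2 * \<delta> n + \<bar>v n - u\<bar> * sqrt B) \<longlonglongrightarrow> 2 * 0 + \<bar>u - u\<bar> * sqrt B"
      by (intro tendsto_intros close(2) v)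
    then show "(\<lambda>n. 2 * \<delta> n + \<bar>v n - u\<bar> * sqrt B) \<longlonglongrightarrow> 0" by simp
  qed
  from tendsto_add[OF this limit[of u]]
  show "(\<lambda>n. char (distr (M n) borel (\<lambda>\<omega>. Z n \<omega> / \<sigma> n)) t) \<longlonglongrightarrow> char \<mu> t"
    unfolding char_eq using \<sigma>(2) by (simp add: u_def)
qed

theorem theorem3p10:
  fixes \<alpha> c :: real
    and L :: "real \<Rightarrow> real"
    and M0 :: "'a measure" and X11 :: "'a \<Rightarrow> real"
    and p :: "nat \<Rightarrow> nat"
    and M :: "nat \<Rightarrow> 'b measure" and X :: "nat \<Rightarrow> nat \<Rightarrow> nat \<Rightarrow> 'b \<Rightarrow> real"
    and N :: "'c measure" and \<xi> :: "nat \<Rightarrow> 'c \<Rightarrow> real"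
  assumes alpha: "\<alpha> \<in> {0<..<3} - {2}"
    and c_pos: "0 < c"
    and M0: "prob_space M0" and X11: "X11 \<in> borel_measurable M0"
    and nondegenerate: "\<nexists>a. AE \<omega> in M0. X11 \<omega> = a"
    and symmetric: "distr M0 borel (\<lambda>\<omega>. - X11 \<omega>) = distr M0 borel X11"
    and tail: "\<And>x. x > 0 \<Longrightarrow>
        measure M0 {\<omega> \<in> space M0. \<bar>X11 \<omega>\<bar> > x} = x powr (- \<alpha>) * L x"
    and L: "slowly_varying L"
    and unit_variance: "integrable M0 (\<lambda>\<omega>. (X11 \<omega>)\<^sup>2) \<Longrightarrow> (\<integral>\<omega>. (X11 \<omega>)\<^sup>2 \<partial>M0) = 1"
    and M: "\<And>n. prob_space (M n)"
    and indep: "\<And>n. prob_space.indep_vars (M n) (\<lambda>_. borel) (\<lambda>(i, j). X n i j)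
        ({..<p n} \<times> {..<n})"
    and copies: "\<And>n i j. i < p n \<Longrightarrow> j < n \<Longrightarrow>
        distr (M n) borel (X n i j) = distr M0 borel X11"
    and p_below_2: "\<alpha> < 2 \<Longrightarrow> (\<lambda>n. real (p n) / (c * real n powr (1 / 2))) \<longlonglongrightarrow> 1"
    and p_above_2: "\<alpha> > 2 \<Longrightarrow>
        (\<lambda>n. real (p n) / (c * real n powr ((\<alpha> - 1) / 2) * (1 / L (real n powr (1 / 2)))))
          \<longlonglongrightarrow> 1"
    and poisson: "poisson_atoms N (nu \<alpha> c) \<xi>"
  shows "weak_conv_m
     (\<lambda>n. distr (M n) borel
        (\<lambda>\<omega>. (mat_trace (sample_correlation (p n) n (\<lambda>i j. X n i j \<omega>) ^\<^sub>m 2) - mu_trace (p n) n)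
               / sigma_trace (M n) (p n) n (X n)))
     (distr N borel (\<lambda>\<omega>. centred_atom_sum \<alpha> c \<xi> \<omega> / (sqrt 2 * c * c2 \<alpha>)))"
proof -
  interpret M0: prob_space M0 by (rule M0)
  note X11 [measurable]
  define \<rho> where "\<rho> = distr M0 borel X11"
  have prob_rho: "prob_space \<rho>" unfolding \<rho>_def by (rule M0.prob_space_distr) measurable
  have sets_rho: "sets \<rho> = sets borel" by (simp add: \<rho>_def)
  have \<alpha>_pos: "0 < \<alpha>" using alpha by simp
  have tail_rho: "measure \<rho> {t. x < \<bar>t\<bar>} = x powr (- \<alpha>) * L x" if "0 < x" for x
  proof -
    have "measure \<rho> {t. x < \<bar>t\<bar>} = measure M0 (X11 -` {t. x < \<bar>t\<bar>} \<inter> space M0)"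
      unfolding \<rho>_def by (rule measure_distr) measurable
    also have "X11 -` {t. x < \<bar>t\<bar>} \<inter> space M0 = {\<omega> \<in> space M0. \<bar>X11 \<omega>\<bar> > x}" by auto
    finally show ?thesis using tail[OF that] by simp
  qed
  have tail_G: "measure \<rho> {t. v < t\<^sup>2} = v powr - (\<alpha> / 2) * L (sqrt v)" if "0 < v" for v
    by (rule slowly_varying_regular_tail(1)[OF prob_rho sets_rho \<alpha>_pos _ L that]) (rule tail_rho)
  have "distr \<rho> borel uminus = distr M0 borel (uminus \<circ> X11)"
    unfolding \<rho>_def by (rule distr_distr) measurable
  also have "uminus \<circ> X11 = (\<lambda>\<omega>. - X11 \<omega>)" by (simp add: fun_eq_iff)
  finally have "distr \<rho> borel uminus = \<rho>" unfolding symmetric \<rho>_def .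
  then have "row_law \<rho>" using prob_rho sets_rho by (intro row_law.intro row_law_axioms.intro)
  moreover have "regular_tail (\<lambda>v. measure \<rho> {t. v < t\<^sup>2}) (\<alpha> / 2)"
    by (rule slowly_varying_regular_tail(2)[OF prob_rho sets_rho \<alpha>_pos _ L]) (rule tail_rho)
  ultimately interpret tail_law \<rho> "\<alpha> / 2" by (intro tail_law.intro tail_law_axioms.intro)
  have "scaled_rows \<rho> p \<alpha> c"
  proof (cases "\<alpha> < 2")
    case True
    then show ?thesis using alpha by (intro scaled_rows_light c_pos p_below_2) auto
  next
    case False
    then have \<alpha>: "2 < \<alpha>" using alpha by auto
    \<comment> \<open>Above 2 the tail forces a finite second moment, so the normalization
      hypothesis becomes applicable.\<close>
    have "integrable \<rho> (\<lambda>t. t\<^sup>2)" using \<alpha> by (intro moment_integrable) simp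
    then have "integrable M0 (\<lambda>\<omega>. (X11 \<omega>)\<^sup>2)" unfolding \<rho>_def by (subst (asm) integrable_distr_eq) auto
    then have "(\<integral>\<omega>. (X11 \<omega>)\<^sup>2 \<partial>M0) = 1" by (rule unit_variance)
    then have mean: "(\<integral>t. t\<^sup>2 \<partial>\<rho>) = 1" unfolding \<rho>_def by (subst integral_distr) auto
    show ?thesis
    proof (rule scaled_rows_heavy[OF _ refl c_pos mean])
      show "G v = v powr - (\<alpha> / 2) * L (sqrt v)" if "0 < v" for v
        unfolding G_def by (rule tail_G[OF that])
    qed (use \<alpha> alpha p_above_2 in auto)
  qed
  then interpret S: scaled_rows \<rho> p \<alpha> c .
  have "prob_space N" using poisson by (simp add: poisson_atoms_def)
  then interpret P: nu_process N \<alpha> c \<xi>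
    using poisson alpha by (intro nu_process.intro poisson_process.intro poisson_process_axioms.intro nu_process_axioms.intro)
  define s where "s = sqrt 2 * c * c2 \<alpha>"
  have c2_pos: "0 < c2 \<alpha>" using alpha by (auto simp: c2_def intro!: mult_pos_pos Gamma_real_pos)
  have s: "0 < s" using c_pos c2_pos by (simp add: s_def)
  define \<zeta> where "\<zeta> n i \<omega> = (\<lambda>j\<in>{..<n}. X n i j \<omega>)" for n i \<omega>
  have iid: "iid_family (M n) (Row n) (\<zeta> n) (p n)" for n
    unfolding \<zeta>_def[abs_def] by (rule prob_space.iid_family_rows[OF M indep _ prob_rho sets_rho]) (simp add: copies \<rho>_def)
  have X: "X n i j \<in> borel_measurable (M n)" if "i < p n" "j < n" for n i j
    using indep[of n] that by (auto simp: prob_space.indep_vars_def[OF M])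
  define T where "T n = pair_sum (p n) (\<zeta> n) (kap n)" for n
  define Z where "Z n \<omega> = mat_trace (sample_correlation (p n) n (\<lambda>i j. X n i j \<omega>) ^\<^sub>m 2) - mu_trace (p n) n" for n \<omega>
  define zero where "zero n = Row.prob n {x \<in> space (Row n). sqsum n x = 0}" for n
  obtain B where B: "\<forall>\<^sub>F n in sequentially. (\<integral>\<omega>. (T n \<omega>)\<^sup>2 \<partial>M n) \<le> B"
    unfolding T_def by (rule S.second_moment_bounded[OF iid])
  have m2: "(\<lambda>n. p n * sqrt n * share_moment n 2) \<longlonglongrightarrow> c * c2 \<alpha>"
    using S.moments[of 2] by (simp add: limit_moment_2[OF alpha])
  have \<sigma>: "(\<lambda>n. sigma_trace (M n) (p n) n (X n)) \<longlonglongrightarrow> s"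
  proof -
    \<comment> \<open>Expanding \<open>sigma_trace\<close> leaves
      \<open>2 * (p n * sqrt n * beta4)\<^sup>2 + 4 * (p n / n)\<^sup>2\<close> under the root, and
      the second part tends to 0.\<close>
    have "(\<lambda>n. sqrt (2 * (p n * sqrt n * share_moment n 2)\<^sup>2 + 4 * (p n / n)\<^sup>2)) \<longlonglongrightarrow> sqrt (2 * (c * c2 \<alpha>)\<^sup>2 + 4 * 0\<^sup>2)"
      by (intro tendsto_intros m2 S.sparse)
    also have "sqrt (2 * (c * c2 \<alpha>)\<^sup>2 + 4 * 0\<^sup>2) = s"
      using c_pos c2_pos by (simp add: s_def real_sqrt_mult)
    finally show ?thesis
    proof (rule Lim_transform_eventually)
      \<comment> \<open>Positivity of this quantity forces \<open>0 < p n\<close> and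
        \<open>0 < n\<close>, so that the matrix entry \<open>(0, 0)\<close> read by
        \<open>beta4\<close> exists.\<close>
      have "\<forall>\<^sub>F n in sequentially. 0 < p n * sqrt n * share_moment n 2"
        using c_pos c2_pos by (intro order_tendstoD(1)[OF m2]) simp
      then show "\<forall>\<^sub>F n in sequentially. sqrt (2 * (p n * sqrt n * share_moment n 2)\<^sup>2 + 4 * (p n / n)\<^sup>2) = sigma_trace (M n) (p n) n (X n)"
      proof eventually_elim
        case (elim n)
        then have pn: "0 < p n" "0 < n" by (auto intro: Nat.gr0I)
        interpret I: iid_family "M n" "Row n" "\<zeta> n" "p n" by (rule iid)
        have "beta4 (M n) (p n) n (X n) = (\<integral>\<omega>. share n (\<zeta> n 0 \<omega>) 0 ^ 2 \<partial>M n)"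
        proof -
          have "(x / sqrt y) ^ 4 = (x\<^sup>2 / y) ^ 2" if "0 \<le> y" for x y :: real
          proof -
            have "z ^ 4 = (z\<^sup>2)\<^sup>2" for z :: real by (simp add: power4_eq_xxxx power2_eq_square)
            then show ?thesis using that by (simp only: power_divide real_sqrt_pow2)
          qed
          then show ?thesis unfolding beta4_def
            by (intro Bochner_Integration.integral_cong refl)
              (use pn in \<open>simp add: normalized_matrix_def share_def sqsum_def \<zeta>_def sum_nonneg\<close>)
        qed
        also have "\<dots> = (\<integral>x. share n x 0 ^ 2 \<partial>distr (M n) (Row n) (\<zeta> n 0))"
          using pn by (intro integral_distr[symmetric]) auto
        also have "\<dots> = share_moment n 2"
          unfolding I.law[OF pn(1)] by (rule share_moment_eq[symmetric, OF pn(2)])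
        finally have \<beta>: "beta4 (M n) (p n) n (X n) = share_moment n 2" .
        have "2 * (real (p n) * sqrt n * b)\<^sup>2 + 4 * (p n / n)\<^sup>2 = 2 * (real (p n))\<^sup>2 * n * (b\<^sup>2 + 2 / real n ^ 3)" for b :: real
          using pn(2) by (simp add: power2_eq_square power3_eq_cube field_simps)
        then show ?case by (simp only: sigma_trace_def \<beta>)
      qed
    qed
  qed
  have "weak_conv_m (\<lambda>n. distr (M n) borel (\<lambda>\<omega>. Z n \<omega> / sigma_trace (M n) (p n) n (X n)))
      (distr N borel (\<lambda>\<omega>. centred_atom_sum \<alpha> c \<xi> \<omega> / s))"
  \<comment> \<open>\<open>Z\<close> and \<open>T\<close> agree unless one of the \<open>p n\<close>
    rows vanishes, whence the union bound as \<delta>. The constant \<open>s\<close> is both the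
    limit of the normalizers and the divisor of the limit variable, so it cancels in the
    characteristic functions.\<close>
  proof (rule weak_conv_rescaled[where T=T and s=s and B=B and \<delta>="\<lambda>n. real (p n) * zero n"])
    show "real_distribution (distr N borel (\<lambda>\<omega>. centred_atom_sum \<alpha> c \<xi> \<omega> / s))"
      by (intro P.real_distribution_distr borel_measurable_divide P.measurable_centred_atom_sum borel_measurable_const)
    show "Z n \<in> borel_measurable (M n)" for n
      unfolding Z_def[abs_def] by (intro borel_measurable_diff borel_measurable_const trace_measurable X)
    show "\<forall>\<^sub>F n in sequentially. T n \<in> borel_measurable (M n) \<and> integrable (M n) (T n)
        \<and> integrable (M n) (\<lambda>\<omega>. (T n \<omega>)\<^sup>2) \<and> (\<integral>\<omega>. (T n \<omega>)\<^sup>2 \<partial>M n) \<le> B"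
      using B eventually_ge_at_top[of 2]
    proof eventually_elim
      case (elim n)
      have "integrable (M n) (T n)" "integrable (M n) (\<lambda>\<omega>. (T n \<omega>)\<^sup>2)"
        unfolding T_def by (rule pair_sum_integrable[OF iid elim(2) kap_measurable abs_kap_le])+
      then show ?case using elim(1) by auto
    qed
    show "(\<lambda>n. CLINT \<omega>|M n. iexp (t * T n \<omega>)) \<longlonglongrightarrow> char (distr N borel (\<lambda>\<omega>. centred_atom_sum \<alpha> c \<xi> \<omega> / s)) (t * s)" for t
    proof -
      have "char (distr N borel (\<lambda>\<omega>. centred_atom_sum \<alpha> c \<xi> \<omega> / s)) (t * s)
          = (CLINT \<omega>|N. iexp ((t * s) * (centred_atom_sum \<alpha> c \<xi> \<omega> / s)))"
        unfolding char_def
        by (rule integral_distr) (intro borel_measurable_divide P.measurable_centred_atom_sum borel_measurable_const, measurable)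
      also have "\<dots> = (CLINT \<omega>|N. iexp (t * centred_atom_sum \<alpha> c \<xi> \<omega>))" using s by simp
      also have "\<dots> = exp (CLINT x|nu \<alpha> c. levy_exponent t x)" by (rule P.char_centred_atom_sum)
      finally show ?thesis unfolding T_def using S.char_pair_sum_limit[OF iid, of t] by simp
    qed
    show "\<forall>\<^sub>F n in sequentially. \<exists>E\<in>sets (M n). measure (M n) E \<le> real (p n) * zero n \<and> (\<forall>\<omega>\<in>space (M n) - E. Z n \<omega> = T n \<omega>)"
      using eventually_ge_at_top[of 2]
    proof eventually_elim
      case (elim n)
      interpret I: iid_family "M n" "Row n" "\<zeta> n" "p n" by (rule iid)
      define E where "E i = {\<omega> \<in> space (M n). sqsum n (\<zeta> n i \<omega>) = 0}" for i
      have E: "E i \<in> sets (M n)" "measure (M n) (E i) = zero n" if i: "i < p n" for i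
      proof -
        note [measurable] = I.measurable_row[OF i]
        show "E i \<in> sets (M n)" unfolding E_def by measurable
        have "E i = \<zeta> n i -` {x \<in> space (Row n). sqsum n x = 0} \<inter> space (M n)"
          using measurable_space[OF I.measurable_row[OF i]] by (auto simp: E_def)
        then have "measure (M n) (E i) = measure (distr (M n) (Row n) (\<zeta> n i)) {x \<in> space (Row n). sqsum n x = 0}"
          by (simp only:) (rule measure_distr[symmetric]; measurable)
        then show "measure (M n) (E i) = zero n" unfolding I.law[OF i] zero_def .
      qed
      have sets_E: "(\<Union>i<p n. E i) \<in> sets (M n)" using E by auto
      have "measure (M n) (\<Union>i<p n. E i) \<le> (\<Sum>i<p n. measure (M n) (E i))"
        using E by (intro I.finite_measure_subadditive_finite) auto
      also have "\<dots> = real (p n) * zero n" using E by simp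
      finally have PE: "measure (M n) (\<Union>i<p n. E i) \<le> real (p n) * zero n" .
      have "Z n \<omega> = T n \<omega>" if w: "\<omega> \<in> space (M n) - (\<Union>i<p n. E i)" for \<omega>
      proof -
        have "sqsum n (\<lambda>j. X n i j \<omega>) \<noteq> 0" if "i < p n" for i
          using w that by (auto simp: E_def \<zeta>_def sqsum_def)
        then have "Z n \<omega> = (\<Sum>P\<in>pairs (p n). kap n (\<lambda>j. X n (fst P) j \<omega>) (\<lambda>j. X n (snd P) j \<omega>))"
          unfolding Z_def by (rule trace_eq_pair_sum)
        also have "\<dots> = T n \<omega>"
          unfolding T_def pair_sum_def[OF iid elim] \<zeta>_def kap_restrict ..
        finally show ?thesis .
      qed
      then show ?case using sets_E PE by blast
    qed
    show "(\<lambda>n. real (p n) * zero n) \<longlonglongrightarrow> 0" unfolding zero_def by (rule zero_rows_null[OF S.sparse])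
  qed (use M \<sigma> s in auto)
  then show ?thesis unfolding Z_def s_def .
qed

end
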